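(* Let $\Omega\subset\mathbb{R}^2$ be a bounded polygonal domain and $\mathcal{T}_h$ a shape-regular triangulation of $\Omega$ with shape-regularity constant $\gamma$ and maximum mesh size $h$. There exists $C$ that depends on $\Omega$ and $\gamma$ but is independent of $h$ such that for any $v\in[H^2(\Omega,\mathcal{T}_h)]^2$, $$\|v\|_{H_h^2}^2\le C\Bigl(\|\nabla_h\epsilon_h(v)\|_{L^2}^2+\|\epsilon_h(v)\|_{L^2}^2+\|v\|_{L^2}^2+\sum_{e\in\mathcal{E}_h}h_{e}^{-1}\|[\![\Pi_{e}v]\!]\|_{L^2(e)}^2\Bigr),$$ where $\Pi_{e}:[L^2(e)]^2\to [P_{1,-}(e)]^2$ is the $L^2$ projection and $$[P_{1,-}(e)]^2:=\{v\in [P_1(e)]^2 \mid v\cdot t\in \mathrm{RM}(e)\},$$ with $t$ the tangential vector of the edge $e$ and $\mathrm{RM}(e)$ the infinitesimal rigid motions on $e$.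
   Context: Shape-regular (Ciarlet–Raviart): $h_K/\rho_K\le\gamma$ for all triangles $K\in\mathcal{T}_h$, where $h_K$ is the diameter of $K$ and $\rho_K$ is the diameter of the largest ball inscribed in $K$; $h=\max_K h_K$. $\mathcal{E}_h$ is the set of all edges of $\mathcal{T}_h$, and $h_e$ is the length of $e$. $[H^m(\Omega,\mathcal{T}_h)]^2=\{v\in[L^2(\Omega)]^2: v|_K\in[H^m(K)]^2\ \forall K\in\mathcal{T}_h\}$, with broken norm $\|v\|_{H_h^m}=\|v\|_{L^2}+\sum_{k=1}^m\|\nabla_h^k v\|_{L^2}$, where $(\nabla_h^k v)|_K=\nabla^k(v|_K)$ and $\|\nabla_h^kv\|_{L^2}^2=\sum_{K}\|\nabla^kv\|_{L^2(K)}^2$. $\epsilon_h(v)=(\nabla_hv+[\nabla_hv]^T)/2$ is the piecewise symmetric gradient. $[\![v]\!]$ denotes the jump of $v$ across an edge, by the usual convention the trace itself on a boundary edge. On the one-dimensional edge $e$, $\mathrm{RM}(e)$ consists of the constants, so that elements of $[P_{1,-}(e)]^2$ have affine normal component and constant tangential component. *)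

theory Defs
  imports "HOL-Analysis.Analysis"
begin

type_synonym plane = "real^2"

definition L2 :: "'a measure \<Rightarrow> ('a \<Rightarrow> 'b::euclidean_space) \<Rightarrow> bool" where
  "L2 M f \<longleftrightarrow> f \<in> borel_measurable M \<and> integrable M (\<lambda>x. (norm (f x))\<^sup>2)"

definition norm_L2 :: "'a measure \<Rightarrow> ('a \<Rightarrow> 'b::euclidean_space) \<Rightarrow> real" where
  "norm_L2 M f = sqrt (\<integral>x. (norm (f x))\<^sup>2 \<partial>M)"

definition pdiff :: "2 \<Rightarrow> (plane \<Rightarrow> 'b::euclidean_space) \<Rightarrow> plane \<Rightarrow> 'b" where
  "pdiff i f x = frechet_derivative f (at x) (axis i 1)"

text \<open>A derivative of order \<open>k\<close> is indexed by the list of its \<open>k\<close> directions.\<close>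

primrec pdiffs :: "2 list \<Rightarrow> (plane \<Rightarrow> 'b::euclidean_space) \<Rightarrow> plane \<Rightarrow> 'b" where
  "pdiffs [] f = f"
| "pdiffs (i # \<alpha>) f = pdiff i (pdiffs \<alpha> f)"

primrec C_k :: "nat \<Rightarrow> (plane \<Rightarrow> 'b::euclidean_space) \<Rightarrow> bool" where
  "C_k 0 f \<longleftrightarrow> continuous_on UNIV f"
| "C_k (Suc k) f \<longleftrightarrow> (\<forall>x. f differentiable (at x)) \<and> (\<forall>i. C_k k (pdiff i f))"

definition smooth :: "(plane \<Rightarrow> 'b::euclidean_space) \<Rightarrow> bool" where
  "smooth f \<longleftrightarrow> (\<forall>k. C_k k f)"

definition test_function :: "plane set \<Rightarrow> (plane \<Rightarrow> real) \<Rightarrow> bool" where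
  "test_function U \<phi> \<longleftrightarrow>
     smooth \<phi> \<and> compact (closure {x. \<phi> x \<noteq> 0}) \<and> closure {x. \<phi> x \<noteq> 0} \<subseteq> U"

definition is_weak_deriv ::
    "plane set \<Rightarrow> 2 list \<Rightarrow> (plane \<Rightarrow> 'b::euclidean_space) \<Rightarrow> (plane \<Rightarrow> 'b) \<Rightarrow> bool" where
  "is_weak_deriv U \<alpha> f g \<longleftrightarrow>
     (\<forall>\<phi>. test_function U \<phi> \<longrightarrow>
        (\<integral>x. pdiffs \<alpha> \<phi> x *\<^sub>R f x \<partial>lebesgue_on U)
          = (-1) ^ length \<alpha> *\<^sub>R (\<integral>x. \<phi> x *\<^sub>R g x \<partial>lebesgue_on U))"

definition sobolev :: "nat \<Rightarrow> plane set \<Rightarrow> (plane \<Rightarrow> 'b::euclidean_space) set" where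
  "sobolev m U = {f. L2 (lebesgue_on U) f \<and>
     (\<forall>\<alpha>. length \<alpha> \<le> m \<longrightarrow> (\<exists>g. L2 (lebesgue_on U) g \<and> is_weak_deriv U \<alpha> f g))}"

text \<open>Determined only up to null sets (for \<open>f\<close> in the Sobolev space of order \<open>length \<alpha>\<close>);
  it is used below under integrals over \<open>U\<close> only.\<close>

definition weak_deriv ::
    "plane set \<Rightarrow> 2 list \<Rightarrow> (plane \<Rightarrow> 'b::euclidean_space) \<Rightarrow> plane \<Rightarrow> 'b" where
  "weak_deriv U \<alpha> f = (SOME g. L2 (lebesgue_on U) g \<and> is_weak_deriv U \<alpha> f g)"

text \<open>The L2 norm of the full tensor of derivatives of order \<open>k\<close>, so mixed derivatives
  are counted once per ordering; \<open>norm\<close> on vectors and matrices is Euclidean/Frobenius.\<close>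

definition norm_grad :: "nat \<Rightarrow> plane set \<Rightarrow> (plane \<Rightarrow> 'b::euclidean_space) \<Rightarrow> real" where
  "norm_grad k U f =
     sqrt (\<Sum>\<alpha> | length \<alpha> = k. (norm_L2 (lebesgue_on U) (weak_deriv U \<alpha> f))\<^sup>2)"

definition sobolev_norm :: "nat \<Rightarrow> plane set \<Rightarrow> (plane \<Rightarrow> 'b::euclidean_space) \<Rightarrow> real" where
  "sobolev_norm m U f = norm_L2 (lebesgue_on U) f + (\<Sum>k=1..m. norm_grad k U f)"

text \<open>The last condition says that the domain does not lie on both sides of its boundary
  (no slits). Holes are allowed.\<close>

definition polygonal_domain :: "plane set \<Rightarrow> bool" where
  "polygonal_domain \<Omega> \<longleftrightarrow>
     open \<Omega> \<and> connected \<Omega> \<and> \<Omega> \<noteq> {} \<and> bounded \<Omega> \<and>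
     (\<exists>\<S>. finite \<S> \<and> (\<forall>s\<in>\<S>. \<exists>a b. s = closed_segment a b) \<and> frontier \<Omega> = \<Union>\<S>) \<and>
     interior (closure \<Omega>) = \<Omega>"

text \<open>The elements of \<open>\<T>\<close> are closed non-degenerate triangles; the library's \<open>triangulation\<close>
  provides finiteness and conformity.\<close>

definition triangulation_of :: "plane set \<Rightarrow> plane set set \<Rightarrow> bool" where
  "triangulation_of \<Omega> \<T> \<longleftrightarrow>
     triangulation \<T> \<and> (\<forall>K\<in>\<T>. 2 simplex K) \<and> \<Union>\<T> = closure \<Omega>"

definition inball_diameter :: "plane set \<Rightarrow> real" where
  "inball_diameter K = Sup {diameter (ball x r) | x r. ball x r \<subseteq> K}"

definition shape_regular :: "real \<Rightarrow> plane set set \<Rightarrow> bool" where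
  "shape_regular \<gamma> \<T> \<longleftrightarrow> (\<forall>K\<in>\<T>. diameter K / inball_diameter K \<le> \<gamma>)"

definition edges :: "plane set set \<Rightarrow> plane set set" where
  "edges \<T> = {e. \<exists>K\<in>\<T>. e edge_of K}"

definition broken_sobolev ::
    "nat \<Rightarrow> plane set \<Rightarrow> plane set set \<Rightarrow> (plane \<Rightarrow> 'b::euclidean_space) set" where
  "broken_sobolev m \<Omega> \<T> =
     {v. L2 (lebesgue_on \<Omega>) v \<and> (\<forall>K\<in>\<T>. v \<in> sobolev m (interior K))}"

definition broken_norm_grad ::
    "nat \<Rightarrow> plane set set \<Rightarrow> (plane \<Rightarrow> 'b::euclidean_space) \<Rightarrow> real" where
  "broken_norm_grad k \<T> v = sqrt (\<Sum>K\<in>\<T>. (norm_grad k (interior K) v)\<^sup>2)"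

definition broken_norm ::
    "nat \<Rightarrow> plane set \<Rightarrow> plane set set \<Rightarrow> (plane \<Rightarrow> 'b::euclidean_space) \<Rightarrow> real" where
  "broken_norm m \<Omega> \<T> v =
     norm_L2 (lebesgue_on \<Omega>) v + (\<Sum>k=1..m. broken_norm_grad k \<T> v)"

text \<open>Piecewise derivative: the interiors of the triangles are disjoint, so at most one
  summand is non-zero; on the edges (a null set) the value is 0.\<close>

definition broken_deriv ::
    "plane set set \<Rightarrow> 2 list \<Rightarrow> (plane \<Rightarrow> 'b::euclidean_space) \<Rightarrow> plane \<Rightarrow> 'b" where
  "broken_deriv \<T> \<alpha> v x =
     (\<Sum>K\<in>\<T>. indicator (interior K) x *\<^sub>R weak_deriv (interior K) \<alpha> v x)"

definition eps_h :: "plane set set \<Rightarrow> (plane \<Rightarrow> real^2) \<Rightarrow> plane \<Rightarrow> real^2^2" where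
  "eps_h \<T> v x =
     (\<chi> i j. (broken_deriv \<T> [j] v x $ i + broken_deriv \<T> [i] v x $ j) / 2)"

definition edge_ends :: "plane set \<Rightarrow> plane \<times> plane" where
  "edge_ends e = (SOME p. closed_segment (fst p) (snd p) = e)"

definition tangent :: "plane set \<Rightarrow> plane" where
  "tangent e = sgn (snd (edge_ends e) - fst (edge_ends e))"

text \<open>Arc length on the segment \<open>e\<close>, with underlying space \<open>e\<close>.\<close>

definition edge_measure :: "plane set \<Rightarrow> plane measure" where
  "edge_measure e =
     distr (restrict_space lborel {0..diameter e}) (restrict_space borel e)
       (\<lambda>s. fst (edge_ends e) + s *\<^sub>R tangent e)"

text \<open>The Sobolev trace of \<open>v\<close> from the triangle \<open>K\<close> on its edge \<open>e\<close>: the continuous extension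
  of restriction to \<open>e\<close> from smooth functions to the Sobolev space of order 1 on \<open>K\<close>.\<close>

definition is_trace ::
    "plane set \<Rightarrow> plane set \<Rightarrow> (plane \<Rightarrow> 'b::euclidean_space) \<Rightarrow> (plane \<Rightarrow> 'b) \<Rightarrow> bool" where
  "is_trace K e v w \<longleftrightarrow> L2 (edge_measure e) w \<and>
     (\<exists>\<phi> :: nat \<Rightarrow> plane \<Rightarrow> 'b. (\<forall>n. smooth (\<phi> n)) \<and>
        (\<lambda>n. sobolev_norm 1 (interior K) (\<lambda>x. \<phi> n x - v x)) \<longlonglongrightarrow> 0 \<and>
        (\<lambda>n. norm_L2 (edge_measure e) (\<lambda>x. \<phi> n x - w x)) \<longlonglongrightarrow> 0)"

definition edge_trace ::
    "plane set \<Rightarrow> plane set \<Rightarrow> (plane \<Rightarrow> 'b::euclidean_space) \<Rightarrow> plane \<Rightarrow> 'b" where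
  "edge_trace K e v = (SOME w. is_trace K e v w)"

definition P1 :: "plane set \<Rightarrow> (plane \<Rightarrow> real) set" where
  "P1 e = {p. \<exists>c d. \<forall>x\<in>e. p x = c + d \<bullet> x}"

definition RM_edge :: "plane set \<Rightarrow> (plane \<Rightarrow> real) set" where
  "RM_edge e = {p. \<exists>c. \<forall>x\<in>e. p x = c}"

definition P1_minus :: "plane set \<Rightarrow> (plane \<Rightarrow> real^2) set" where
  "P1_minus e =
     {p. (\<forall>i. (\<lambda>x. p x $ i) \<in> P1 e) \<and> (\<lambda>x. p x \<bullet> tangent e) \<in> RM_edge e}"

definition edge_proj :: "plane set \<Rightarrow> (plane \<Rightarrow> real^2) \<Rightarrow> plane \<Rightarrow> real^2" where
  "edge_proj e f = (SOME p. p \<in> P1_minus e \<and>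
     (\<forall>q\<in>P1_minus e. (\<integral>x. (f x - p x) \<bullet> q x \<partial>edge_measure e) = 0))"

text \<open>The jump across \<open>e\<close> of a family \<open>F\<close> giving, for each triangle \<open>K\<close> adjacent to \<open>e\<close>, the
  one-sided values \<open>F K\<close> on \<open>e\<close>. The order of the two triangles at an interior edge, hence the
  sign, is unspecified. An edge is a boundary edge iff it belongs to exactly one triangle.\<close>

definition jump ::
    "plane set set \<Rightarrow> plane set \<Rightarrow> (plane set \<Rightarrow> plane \<Rightarrow> 'b::euclidean_space) \<Rightarrow> plane \<Rightarrow> 'b" where
  "jump \<T> e F =
     (if \<exists>!K. K \<in> \<T> \<and> e edge_of K
      then F (THE K. K \<in> \<T> \<and> e edge_of K)
      else let p = (SOME p. fst p \<in> \<T> \<and> snd p \<in> \<T> \<and> fst p \<noteq> snd p \<and>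
                            e edge_of fst p \<and> e edge_of snd p)
           in (\<lambda>x. F (fst p) x - F (snd p) x))"

definition jump_proj :: "plane set set \<Rightarrow> plane set \<Rightarrow> (plane \<Rightarrow> real^2) \<Rightarrow> plane \<Rightarrow> real^2" where
  "jump_proj \<T> e v = jump \<T> e (\<lambda>K. edge_proj e (edge_trace K e v))"

end

theory Submission imports Defs begin

(* PART 1 *)

lemma pdiff_eqI:
  assumes "(f has_derivative f') (at x)"
  shows "pdiff i f x = f' (axis i 1)"
  using frechet_derivative_at[OF assms] by (simp add: pdiff_def)

lemma has_derivative_pdiff:
  fixes f :: "plane \<Rightarrow> 'b::euclidean_space"
  assumes "f differentiable (at x)"
  shows "(f has_derivative (\<lambda>h. \<Sum>i\<in>UNIV. h $ i *\<^sub>R pdiff i f x)) (at x)"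
proof -
  have D: "(f has_derivative frechet_derivative f (at x)) (at x)"
    using assms frechet_derivative_works by blast
  have "frechet_derivative f (at x) h = (\<Sum>i\<in>UNIV. h $ i *\<^sub>R pdiff i f x)" for h
  proof -
    have l: "linear (frechet_derivative f (at x))" using D has_derivative_linear by blast
    have "h = (\<Sum>i\<in>UNIV. h $ i *\<^sub>R axis i (1::real))"
      using basis_expansion[of h] by (simp add: scalar_mult_eq_scaleR)
    then have "frechet_derivative f (at x) h = frechet_derivative f (at x) (\<Sum>i\<in>UNIV. h $ i *\<^sub>R axis i 1)"
      by simp
    also have "\<dots> = (\<Sum>i\<in>UNIV. h $ i *\<^sub>R pdiff i f x)"
      by (simp add: linear_sum[OF l] linear_scale[OF l] pdiff_def)
    finally show ?thesis .
  qed
  then have "frechet_derivative f (at x) = (\<lambda>h. \<Sum>i\<in>UNIV. h $ i *\<^sub>R pdiff i f x)" by blast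
  then show ?thesis using D by simp
qed

lemma pdiff_const [simp]: "pdiff i (\<lambda>x. c) = (\<lambda>x. 0)"
  by (rule ext, rule pdiff_eqI[THEN trans]) (auto intro: has_derivative_const)

lemma pdiff_add:
  assumes "f differentiable (at x)" "g differentiable (at x)"
  shows "pdiff i (\<lambda>x. f x + g x) x = pdiff i f x + pdiff i g x"
  using assms unfolding frechet_derivative_works
  by (subst pdiff_eqI[OF has_derivative_add]) (auto simp: pdiff_def)

lemma pdiff_diff:
  assumes "f differentiable (at x)" "g differentiable (at x)"
  shows "pdiff i (\<lambda>x. f x - g x) x = pdiff i f x - pdiff i g x"
  using assms unfolding frechet_derivative_works
  by (subst pdiff_eqI[OF has_derivative_diff]) (auto simp: pdiff_def)

lemma pdiff_linear:
  assumes "bounded_linear L" "f differentiable (at x)"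
  shows "pdiff i (\<lambda>x. L (f x)) x = L (pdiff i f x)"
  using assms(2) unfolding frechet_derivative_works
  by (subst pdiff_eqI[OF bounded_linear.has_derivative[OF assms(1)]]) (auto simp: pdiff_def)

lemma pdiff_scaleR:
  fixes g :: "plane \<Rightarrow> real"
  assumes "g differentiable (at x)" "f differentiable (at x)"
  shows "pdiff i (\<lambda>x. g x *\<^sub>R f x) x = pdiff i g x *\<^sub>R f x + g x *\<^sub>R pdiff i f x"
  using assms unfolding frechet_derivative_works
  by (subst pdiff_eqI[OF has_derivative_scaleR]) (auto simp: pdiff_def)

lemma pdiff_dilate:
  fixes f :: "plane \<Rightarrow> 'b::euclidean_space"
  assumes "f differentiable (at (s *\<^sub>R x + c))"
  shows "pdiff i (\<lambda>x. f (s *\<^sub>R x + c)) x = s *\<^sub>R pdiff i f (s *\<^sub>R x + c)"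
proof -
  let ?D = "frechet_derivative f (at (s *\<^sub>R x + c))"
  have D: "(f has_derivative ?D) (at (s *\<^sub>R x + c))"
    using assms frechet_derivative_works by blast
  have "((\<lambda>x. f (s *\<^sub>R x + c)) has_derivative (\<lambda>h. ?D (s *\<^sub>R h))) (at x)"
    by (rule has_derivative_compose[where g=f and f="\<lambda>x. s *\<^sub>R x + c", OF _ D]) (auto intro!: derivative_eq_intros)
  from pdiff_eqI[OF this] show ?thesis
    using linear_scale[OF has_derivative_linear[OF D]] by (simp add: pdiff_def)
qed

lemma C_k_SucD: "C_k (Suc k) f \<Longrightarrow> C_k k f"
proof (induction k arbitrary: f)
  case 0
  then show ?case
    by (auto intro!: continuous_at_imp_continuous_on differentiable_imp_continuous_within)
qed auto

lemma smooth_differentiable: "smooth f \<Longrightarrow> f differentiable (at x)"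
  unfolding smooth_def by (metis C_k.simps(2))

lemma smooth_pdiff: "smooth f \<Longrightarrow> smooth (pdiff i f)"
  unfolding smooth_def by (metis C_k.simps(2))

lemma smooth_pdiffs: "smooth f \<Longrightarrow> smooth (pdiffs \<alpha> f)"
  by (induction \<alpha>) (auto simp: smooth_pdiff)

lemma smooth_continuous: "smooth f \<Longrightarrow> continuous_on S f"
  unfolding smooth_def by (metis C_k.simps(1) continuous_on_subset top_greatest)

lemma C_k_add: "C_k k f \<Longrightarrow> C_k k g \<Longrightarrow> C_k k (\<lambda>x. f x + g x)"
proof (induction k arbitrary: f g)
  case (Suc k)
  then have "pdiff i (\<lambda>x. f x + g x) = (\<lambda>x. pdiff i f x + pdiff i g x)" for i
    by (intro ext pdiff_add) auto
  then show ?case using Suc by (auto intro!: differentiable_add)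
qed (auto intro: continuous_intros)

lemma C_k_const: "C_k k (\<lambda>x. c)"
  by (induction k arbitrary: c) auto

lemma C_k_linear:
  assumes "bounded_linear L"
  shows "C_k k f \<Longrightarrow> C_k k (\<lambda>x. L (f x))"
proof (induction k arbitrary: f)
  case 0
  then show ?case using assms by (auto intro: bounded_linear.continuous_on)
next
  case (Suc k)
  then have "pdiff i (\<lambda>x. L (f x)) = (\<lambda>x. L (pdiff i f x))" for i
    by (intro ext pdiff_linear assms) auto
  then show ?case using Suc
    by (auto intro!: differentiable_compose[of L]
        bounded_linear_imp_differentiable[OF assms])
qed

lemma C_k_scaleR:
  fixes g :: "plane \<Rightarrow> real"
  shows "C_k k g \<Longrightarrow> C_k k f \<Longrightarrow> C_k k (\<lambda>x. g x *\<^sub>R f x)"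
proof (induction k arbitrary: f g)
  case (Suc k)
  then have *: "pdiff i (\<lambda>x. g x *\<^sub>R f x) = (\<lambda>x. pdiff i g x *\<^sub>R f x + g x *\<^sub>R pdiff i f x)" for i
    by (intro ext pdiff_scaleR) auto
  have "C_k k f" "C_k k g" using Suc.prems C_k_SucD by blast+
  then show ?case using Suc by (auto simp: * intro!: C_k_add differentiable_scaleR)
qed (auto intro: continuous_intros)

lemma C_k_dilate: "C_k k f \<Longrightarrow> C_k k (\<lambda>x. f (s *\<^sub>R x + c))"
proof (induction k arbitrary: f)
  case 0
  then show ?case by (auto intro!: continuous_on_compose2[of UNIV f] continuous_intros)
next
  case (Suc k)
  then have *: "pdiff i (\<lambda>x. f (s *\<^sub>R x + c)) = (\<lambda>x. s *\<^sub>R pdiff i f (s *\<^sub>R x + c))" for i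
    by (intro ext pdiff_dilate) auto
  have "(\<lambda>x. f (s *\<^sub>R x + c)) differentiable at x" for x
    using Suc.prems by (intro differentiable_compose[where f=f and g="\<lambda>x. s *\<^sub>R x + c"])
      (auto intro!: derivative_intros)
  moreover have "C_k k (\<lambda>x. s *\<^sub>R pdiff i f (s *\<^sub>R x + c))" for i
    using Suc by (intro C_k_linear[OF bounded_linear_scaleR_right] Suc.IH) auto
  ultimately show ?case by (auto simp: *)
qed

lemma smooth_const: "smooth (\<lambda>x. c)"
  by (simp add: smooth_def C_k_const)

lemma smooth_add: "smooth f \<Longrightarrow> smooth g \<Longrightarrow> smooth (\<lambda>x. f x + g x)"
  by (simp add: smooth_def C_k_add)

lemma smooth_linear: "bounded_linear L \<Longrightarrow> smooth f \<Longrightarrow> smooth (\<lambda>x. L (f x))"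
  by (simp add: smooth_def C_k_linear)

lemma smooth_scaleR: "smooth g \<Longrightarrow> smooth f \<Longrightarrow> smooth (\<lambda>x. g x *\<^sub>R f x)" for g :: "plane \<Rightarrow> real"
  by (simp add: smooth_def C_k_scaleR)

lemma smooth_dilate: "smooth f \<Longrightarrow> smooth (\<lambda>x. f (s *\<^sub>R x + c))"
  by (simp add: smooth_def C_k_dilate)

lemma smooth_diff: "smooth f \<Longrightarrow> smooth g \<Longrightarrow> smooth (\<lambda>x. f x - g x)"
  using smooth_add[OF _ smooth_linear[OF bounded_linear_minus[OF bounded_linear_ident]], of f g] by simp

lemma smooth_id_linear:
  assumes "bounded_linear L" shows "smooth L"
proof -
  have p: "pdiff i L = (\<lambda>x. L (axis i 1))" for i
    by (rule ext, rule pdiff_eqI, rule bounded_linear_imp_has_derivative[OF assms])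
  have "C_k k L" for k
    using assms by (cases k) (auto simp: p C_k_const linear_continuous_on bounded_linear_imp_differentiable)
  then show ?thesis by (simp add: smooth_def)
qed

section \<open>bump\<close>

definition flat :: "nat \<Rightarrow> real \<Rightarrow> real" where
  "flat n t = (if t \<le> 0 then 0 else exp (- inverse t) * inverse t ^ n)"

lemma flat_has_derivative:
  "(flat n has_real_derivative (flat (n + 2) t - n * flat (n + 1) t)) (at t)"
proof (cases t "0::real" rule: linorder_cases)
  case less
  have "(flat n has_real_derivative 0) (at t)"
    by (rule has_field_derivative_transform_within_open[of "\<lambda>x. 0" _ _ "{..<0}"])
       (use less in \<open>auto simp: flat_def\<close>)
  then show ?thesis using less by (simp add: flat_def)
next
  case greater
  have "((\<lambda>t. exp (- inverse t) * inverse t ^ n) has_real_derivative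
      exp (- inverse t) * inverse t ^ (n + 2) - n * (exp (- inverse t) * inverse t ^ (n + 1))) (at t)"
  proof -
    have i: "(inverse has_real_derivative - (inverse t ^ 2)) (at t)"
      using DERIV_inverse[of t] greater by (simp add: power2_eq_square numeral_2_eq_2)
    have p: "real n * inverse t ^ (n - 1) * inverse t ^ 2 = n * inverse t ^ (n + 1)"
      by (cases n) (auto simp: power2_eq_square)
    show ?thesis
      by (rule DERIV_cong[OF DERIV_mult[OF DERIV_fun_exp[OF DERIV_minus[OF i]] DERIV_power[OF i]]])
         (use p in \<open>auto simp: algebra_simps power2_eq_square\<close>)
  qed
  then have "((\<lambda>t. exp (- inverse t) * inverse t ^ n) has_real_derivative
      (flat (n + 2) t - n * flat (n + 1) t)) (at t)"
    using greater by (simp add: flat_def)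
  then show ?thesis
    by (rule has_field_derivative_transform_within_open[of _ _ _ "{0<..}"])
       (use greater in \<open>auto simp: flat_def\<close>)
next
  case equal
  have "((\<lambda>x. x ^ (n + 1) / exp x) \<longlongrightarrow> (0::real)) at_top"
    by (rule tendsto_power_div_exp_0)
  then have "((\<lambda>h. inverse h ^ (n + 1) / exp (inverse h)) \<longlongrightarrow> (0::real)) (at_right 0)"
    by (rule filterlim_compose[OF _ filterlim_inverse_at_top_right])
  then have r: "((\<lambda>h. exp (- inverse h) * inverse h ^ n / h) \<longlongrightarrow> (0::real)) (at_right 0)"
    by (simp add: exp_minus divide_inverse mult_ac)
  have "((\<lambda>h. flat n h / h) \<longlongrightarrow> 0) (at_right 0)"
    using r by (rule Lim_transform_eventually)
      (auto simp: flat_def eventually_at_right_less eventually_at_filter)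
  moreover have "((\<lambda>h. flat n h / h) \<longlongrightarrow> 0) (at_left 0)"
    by (rule Lim_transform_eventually[of "\<lambda>h. 0"]) (auto simp: flat_def eventually_at_filter)
  ultimately have "((\<lambda>h. flat n h / h) \<longlongrightarrow> 0) (at 0)"
    by (simp add: filterlim_split_at)
  then show ?thesis using equal by (simp add: DERIV_def flat_def)
qed

inductive_set bump_alg :: "real \<Rightarrow> (plane \<Rightarrow> real) set" for \<rho> where
  const: "(\<lambda>x. c) \<in> bump_alg \<rho>"
| coord: "(\<lambda>x. x $ i) \<in> bump_alg \<rho>"
| flat: "(\<lambda>x. flat n (\<rho> - x \<bullet> x)) \<in> bump_alg \<rho>"
| add: "f \<in> bump_alg \<rho> \<Longrightarrow> g \<in> bump_alg \<rho> \<Longrightarrow> (\<lambda>x. f x + g x) \<in> bump_alg \<rho>"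
| mult: "f \<in> bump_alg \<rho> \<Longrightarrow> g \<in> bump_alg \<rho> \<Longrightarrow> (\<lambda>x. f x * g x) \<in> bump_alg \<rho>"

lemma bump_alg_pdiff:
  "f \<in> bump_alg \<rho> \<Longrightarrow> (\<forall>x. f differentiable (at x)) \<and> (\<forall>i. pdiff i f \<in> bump_alg \<rho>)"
proof (induction rule: bump_alg.induct)
  case (const c)
  then show ?case by (auto intro: bump_alg.const)
next
  case (coord j)
  have "pdiff i (\<lambda>x. x $ j) = (\<lambda>x. axis i 1 $ j)" for i
    by (rule ext, rule pdiff_eqI)
       (auto intro: bounded_linear_imp_has_derivative bounded_linear_vec_nth)
  then show ?case
    by (auto intro: bump_alg.const bounded_linear_imp_differentiable bounded_linear_vec_nth)
next
  case (flat n)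
  have D: "((\<lambda>x::plane. flat n (\<rho> - x \<bullet> x)) has_derivative
      (\<lambda>h. (flat (n + 2) (\<rho> - x \<bullet> x) - n * flat (n + 1) (\<rho> - x \<bullet> x)) * (- 2 * (x \<bullet> h)))) (at x)" for x
    by (rule has_derivative_compose[of "\<lambda>x. \<rho> - x \<bullet> x" _ _ _ "flat n", OF _ flat_has_derivative[unfolded has_field_derivative_def]])
       (auto intro!: derivative_eq_intros simp: inner_commute)
  have eq: "pdiff i (\<lambda>x::plane. flat n (\<rho> - x \<bullet> x)) =
      (\<lambda>x. (flat (n + 2) (\<rho> - x \<bullet> x) + (- real n) * flat (n + 1) (\<rho> - x \<bullet> x)) * (- 2 * x $ i))" for i
    by (rule ext, subst pdiff_eqI[OF D]) (simp add: inner_axis)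
  show ?case
  proof (intro conjI allI)
    show "(\<lambda>x::plane. flat n (\<rho> - x \<bullet> x)) differentiable at x" for x
      unfolding differentiable_def using D by blast
    show "pdiff i (\<lambda>x::plane. flat n (\<rho> - x \<bullet> x)) \<in> bump_alg \<rho>" for i
      unfolding eq by (intro bump_alg.intros)
  qed
next
  case (add f g)
  then have "pdiff i (\<lambda>x. f x + g x) = (\<lambda>x. pdiff i f x + pdiff i g x)" for i
    by (intro ext pdiff_add) auto
  then show ?case using add by (auto intro!: differentiable_add bump_alg.add)
next
  case (mult f g)
  then have "pdiff i (\<lambda>x. f x * g x) = (\<lambda>x. pdiff i f x * g x + f x * pdiff i g x)" for i
    using pdiff_scaleR[of f _ g i] by (intro ext) auto
  then show ?case using mult by (auto intro!: differentiable_mult bump_alg.add bump_alg.mult)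
qed

lemma bump_alg_smooth: "f \<in> bump_alg \<rho> \<Longrightarrow> smooth f"
proof -
  have "f \<in> bump_alg \<rho> \<Longrightarrow> C_k k f" for k
  proof (induction k arbitrary: f)
    case 0
    then show ?case using bump_alg_pdiff[OF 0]
      by (auto intro!: continuous_at_imp_continuous_on differentiable_imp_continuous_within)
  next
    case (Suc k)
    then show ?case using bump_alg_pdiff[of f \<rho>] by auto
  qed
  then show "f \<in> bump_alg \<rho> \<Longrightarrow> smooth f" by (simp add: smooth_def)
qed

lemma bump_exists:
  assumes "\<rho> > 0"
  obtains k :: "plane \<Rightarrow> real" where "smooth k" "\<And>x. k x \<ge> 0" "\<And>x. norm x \<ge> \<rho> \<Longrightarrow> k x = 0"
    "integral\<^sup>L lebesgue k = 1" "integrable lebesgue k"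
proof -
  let ?b = "\<lambda>x::plane. flat 0 (\<rho>\<^sup>2 - x \<bullet> x)"
  have sm: "smooth ?b" by (rule bump_alg_smooth[OF bump_alg.flat])
  have nn: "?b x \<ge> 0" for x by (simp add: flat_def)
  have z: "?b x = 0" if "norm x \<ge> \<rho>" for x
    using that assms by (simp add: flat_def power_mono dot_square_norm)
  have z': "?b x > 0" if "norm x < \<rho>" for x
  proof -
    have "(norm x)\<^sup>2 < \<rho>\<^sup>2" using that assms by (intro power_strict_mono) auto
    then show ?thesis by (simp add: flat_def dot_square_norm)
  qed
  have "continuous_on (cball 0 \<rho>) ?b" by (rule smooth_continuous[OF sm])
  then have "integrable lborel (\<lambda>x. indicator (cball 0 \<rho>) x *\<^sub>R ?b x)"
    by (rule borel_integrable_compact[OF compact_cball])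
  then have ab: "integrable lebesgue (\<lambda>x. indicator (cball 0 \<rho>) x *\<^sub>R ?b x)"
    by (subst integrable_completion) auto
  have int: "integrable lebesgue ?b"
  proof -
    have "(\<lambda>x. indicator (cball 0 \<rho>) x *\<^sub>R ?b x) = ?b"
    proof (rule ext)
      fix x show "indicator (cball 0 \<rho>) x *\<^sub>R ?b x = ?b x" using z[of x] by (cases "norm x < \<rho>") (auto simp: indicator_def)
    qed
    then show ?thesis using ab by simp
  qed
  have pos: "integral\<^sup>L lebesgue ?b > 0"
  proof (rule ccontr)
    assume "\<not> ?thesis"
    then have "integral\<^sup>L lebesgue ?b = 0"
      using integral_nonneg_AE[where f="?b" and M=lebesgue] nn by (simp add: antisym_conv)
    then have "AE x in lebesgue. ?b x = 0"
      using integral_nonneg_eq_0_iff_AE[OF int] nn by auto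
    then have "AE x in lebesgue. x \<notin> ball (0::plane) \<rho>"
      by (rule eventually_mono) (use z' in \<open>fastforce simp: less_le\<close>)
    then have "ball (0::plane) \<rho> \<in> null_sets lebesgue"
      by (subst AE_iff_null_sets) auto
    then have "negligible (ball (0::plane) \<rho>)"
      by (simp add: negligible_iff_null_sets)
    then show False using assms open_not_negligible[of "ball (0::plane) \<rho>"] by auto
  qed
  let ?k = "\<lambda>x. ?b x / integral\<^sup>L lebesgue ?b"
  show thesis
  proof (rule that[of ?k])
    show "smooth ?k"
      using smooth_linear[OF bounded_linear_divide sm] .
    show "integral\<^sup>L lebesgue ?k = 1" using pos by simp
    show "integrable lebesgue ?k" using int by simp
  qed (use nn z pos in auto)
qed

(* PART 2 *)

lemma line_has_derivative:
  fixes f :: "plane \<Rightarrow> real"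
  assumes "\<And>x. f differentiable (at x)"
  shows "((\<lambda>t. f (y + t *\<^sub>R axis i 1)) has_real_derivative pdiff i f (y + t *\<^sub>R axis i 1)) (at t)"
proof -
  let ?D = "frechet_derivative f (at (y + t *\<^sub>R axis i 1))"
  have D: "(f has_derivative ?D) (at (y + t *\<^sub>R axis i 1))"
    using assms frechet_derivative_works by blast
  have "((\<lambda>t. f (y + t *\<^sub>R axis i 1)) has_derivative (\<lambda>h. ?D (h *\<^sub>R axis i 1))) (at t)"
    by (rule has_derivative_compose[where g=f and f="\<lambda>t. y + t *\<^sub>R axis i 1", OF _ D])
       (auto intro!: derivative_eq_intros)
  then show ?thesis
    using linear_scale[OF has_derivative_linear[OF D]]
    by (simp add: has_field_derivative_def pdiff_def mult_commute_abs)
qed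

lemma second_difference:
  fixes f :: "plane \<Rightarrow> real"
  assumes f: "smooth f" and h: "h > 0"
  obtains \<xi> where "dist \<xi> x \<le> 2 * h"
    "f (x + h *\<^sub>R axis i 1 + h *\<^sub>R axis j 1) - f (x + h *\<^sub>R axis i 1) - f (x + h *\<^sub>R axis j 1) + f x
       = h * h * pdiff j (pdiff i f) \<xi>"
proof -
  note d1 = smooth_differentiable[OF f] and d2 = smooth_differentiable[OF smooth_pdiff[OF f]]
  let ?u = "\<lambda>s. f ((x + h *\<^sub>R axis j 1) + s *\<^sub>R axis i 1) - f (x + s *\<^sub>R axis i 1)"
  have "\<exists>z>0. z < h \<and> ?u h - ?u 0 = (h - 0) *
      (pdiff i f ((x + h *\<^sub>R axis j 1) + z *\<^sub>R axis i 1) - pdiff i f (x + z *\<^sub>R axis i 1))"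
    by (rule MVT2[OF h]) (intro derivative_intros line_has_derivative d1)
  then obtain z where z: "0 < z" "z < h" and
    u: "?u h - ?u 0 = h * (pdiff i f ((x + h *\<^sub>R axis j 1) + z *\<^sub>R axis i 1) - pdiff i f (x + z *\<^sub>R axis i 1))"
    by auto
  let ?w = "\<lambda>t. pdiff i f ((x + z *\<^sub>R axis i 1) + t *\<^sub>R axis j 1)"
  have "\<exists>y>0. y < h \<and> ?w h - ?w 0 = (h - 0) * pdiff j (pdiff i f) ((x + z *\<^sub>R axis i 1) + y *\<^sub>R axis j 1)"
    by (rule MVT2[OF h]) (intro line_has_derivative d2)
  then obtain y where y: "0 < y" "y < h" and
    w: "?w h - ?w 0 = h * pdiff j (pdiff i f) ((x + z *\<^sub>R axis i 1) + y *\<^sub>R axis j 1)"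
    by auto
  let ?\<xi> = "(x + z *\<^sub>R axis i 1) + y *\<^sub>R axis j 1"
  have "dist ?\<xi> x \<le> norm (z *\<^sub>R axis i (1::real)) + norm (y *\<^sub>R axis j (1::real))"
    using norm_triangle_ineq[of "z *\<^sub>R axis i (1::real)" "y *\<^sub>R axis j 1"]
    by (simp add: dist_norm algebra_simps)
  also have "\<dots> \<le> 2 * h" using y z by simp
  finally have "dist ?\<xi> x \<le> 2 * h" .
  moreover have "f (x + h *\<^sub>R axis i 1 + h *\<^sub>R axis j 1) - f (x + h *\<^sub>R axis i 1) - f (x + h *\<^sub>R axis j 1) + f x
     = ?u h - ?u 0" by (simp add: algebra_simps)
  moreover have "?u h - ?u 0 = h * (?w h - ?w 0)" unfolding u by (simp add: algebra_simps)
  ultimately show thesis using that[of ?\<xi>] w by simp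
qed

lemma pdiff_commute:
  fixes f :: "plane \<Rightarrow> real"
  assumes f: "smooth f"
  shows "pdiff j (pdiff i f) x = pdiff i (pdiff j f) x"
proof -
  have ex: "\<exists>\<xi>. (\<forall>n. dist (\<xi> n) x \<le> 2 * inverse (Suc n)) \<and>
      (\<forall>n. f (x + inverse (Suc n) *\<^sub>R axis i 1 + inverse (Suc n) *\<^sub>R axis j 1) - f (x + inverse (Suc n) *\<^sub>R axis i 1)
        - f (x + inverse (Suc n) *\<^sub>R axis j 1) + f x = inverse (Suc n) * inverse (Suc n) * pdiff j (pdiff i f) (\<xi> n))"
    for i j
  proof -
    have "\<exists>\<xi>. dist \<xi> x \<le> 2 * inverse (real (Suc n)) \<and>
      f (x + inverse (Suc n) *\<^sub>R axis i 1 + inverse (Suc n) *\<^sub>R axis j 1) - f (x + inverse (Suc n) *\<^sub>R axis i 1)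
        - f (x + inverse (Suc n) *\<^sub>R axis j 1) + f x = inverse (Suc n) * inverse (Suc n) * pdiff j (pdiff i f) \<xi>" for n
    proof -
      have "inverse (real (Suc n)) > 0" by simp
      from second_difference[OF f this, of x i j] show ?thesis by (smt (verit, ccfv_threshold))
    qed
    then have "\<forall>n. \<exists>\<xi>. dist \<xi> x \<le> 2 * inverse (real (Suc n)) \<and>
      f (x + inverse (Suc n) *\<^sub>R axis i 1 + inverse (Suc n) *\<^sub>R axis j 1) - f (x + inverse (Suc n) *\<^sub>R axis i 1)
        - f (x + inverse (Suc n) *\<^sub>R axis j 1) + f x = inverse (Suc n) * inverse (Suc n) * pdiff j (pdiff i f) \<xi>" by blast
    from choice[OF this] show ?thesis by blast
  qed
  obtain a where a: "\<forall>n. dist (a n) x \<le> 2 * inverse (Suc n)" and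
    a': "\<forall>n. f (x + inverse (Suc n) *\<^sub>R axis i 1 + inverse (Suc n) *\<^sub>R axis j 1) - f (x + inverse (Suc n) *\<^sub>R axis i 1)
        - f (x + inverse (Suc n) *\<^sub>R axis j 1) + f x = inverse (Suc n) * inverse (Suc n) * pdiff j (pdiff i f) (a n)"
    using ex by blast
  obtain b where b: "\<forall>n. dist (b n) x \<le> 2 * inverse (Suc n)" and
    b': "\<forall>n. f (x + inverse (Suc n) *\<^sub>R axis j 1 + inverse (Suc n) *\<^sub>R axis i 1) - f (x + inverse (Suc n) *\<^sub>R axis j 1)
        - f (x + inverse (Suc n) *\<^sub>R axis i 1) + f x = inverse (Suc n) * inverse (Suc n) * pdiff i (pdiff j f) (b n)"
    using ex by blast
  have eq: "pdiff j (pdiff i f) (a n) = pdiff i (pdiff j f) (b n)" for n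
  proof -
    have "inverse (real (Suc n)) * inverse (Suc n) * pdiff j (pdiff i f) (a n) =
      inverse (Suc n) * inverse (Suc n) * pdiff i (pdiff j f) (b n)"
      unfolding a'[rule_format, symmetric] b'[rule_format, symmetric] by (simp add: algebra_simps)
    then show ?thesis by simp
  qed
  have lim: "c \<longlonglongrightarrow> x" if "\<forall>n. dist (c n) x \<le> 2 * inverse (Suc n)" for c
  proof (rule tendsto_dist_iff[THEN iffD2], rule tendsto_sandwich[of "\<lambda>n. 0" _ _ "\<lambda>n. 2 * inverse (real (Suc n))"])
    show "(\<lambda>n. 2 * inverse (real (Suc n))) \<longlonglongrightarrow> 0"
      using tendsto_mult_right_zero[OF LIMSEQ_inverse_real_of_nat] by simp
  qed (use that in auto)
  have "continuous_on UNIV (pdiff j (pdiff i f))" "continuous_on UNIV (pdiff i (pdiff j f))"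
    by (intro smooth_continuous smooth_pdiff f)+
  then have "(\<lambda>n. pdiff j (pdiff i f) (a n)) \<longlonglongrightarrow> pdiff j (pdiff i f) x"
    "(\<lambda>n. pdiff i (pdiff j f) (b n)) \<longlonglongrightarrow> pdiff i (pdiff j f) x"
    using lim[OF a] lim[OF b]
    by (auto intro: continuous_on_tendsto_compose)
  then show ?thesis unfolding eq using LIMSEQ_unique by blast
qed

subsection \<open>L2 norm\<close>

lemma L2D: "L2 M f \<Longrightarrow> f \<in> borel_measurable M" "L2 M f \<Longrightarrow> integrable M (\<lambda>x. (norm (f x))\<^sup>2)"
  by (auto simp: L2_def)

lemma norm_L2_nonneg [simp]: "norm_L2 M f \<ge> 0"
  by (simp add: norm_L2_def)

lemma norm_L2_sq: "(norm_L2 M f)\<^sup>2 = (\<integral>x. (norm (f x))\<^sup>2 \<partial>M)"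
  by (simp add: norm_L2_def)

lemma sq_add_le: "(a + b)\<^sup>2 \<le> 2 * a\<^sup>2 + 2 * b\<^sup>2" for a b :: real
  using zero_le_power2[of "a - b"] by (simp add: power2_eq_square algebra_simps)

lemma L2_bound:
  assumes "L2 M f" "g \<in> borel_measurable M" "\<And>x. x \<in> space M \<Longrightarrow> norm (g x) \<le> C * norm (f x)" 
  shows "L2 M g"
  unfolding L2_def
proof
  show "integrable M (\<lambda>x. (norm (g x))\<^sup>2)"
  proof (rule Bochner_Integration.integrable_bound[of M "\<lambda>x. C\<^sup>2 * (norm (f x))\<^sup>2"])
    show "AE x in M. norm ((norm (g x))\<^sup>2) \<le> norm (C\<^sup>2 * (norm (f x))\<^sup>2)"
      using assms(3) by (auto intro!: AE_I2 simp: power_mult_distrib[symmetric] power_mono)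
  qed (use assms in \<open>auto simp: L2_def\<close>)
qed (use assms in auto)

lemma L2_add:
  assumes "L2 M f" "L2 M g" shows "L2 M (\<lambda>x. f x + g x)"
  unfolding L2_def
proof
  show "integrable M (\<lambda>x. (norm (f x + g x))\<^sup>2)"
  proof (rule Bochner_Integration.integrable_bound[of M "\<lambda>x. 2 * (norm (f x))\<^sup>2 + 2 * (norm (g x))\<^sup>2"])
    have "(norm (f x + g x))\<^sup>2 \<le> 2 * (norm (f x))\<^sup>2 + 2 * (norm (g x))\<^sup>2" for x
      by (rule order_trans[OF power_mono[OF norm_triangle_ineq[of "f x" "g x"]] sq_add_le]) simp
    then show "AE x in M. norm ((norm (f x + g x))\<^sup>2) \<le> norm (2 * (norm (f x))\<^sup>2 + 2 * (norm (g x))\<^sup>2)"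
      by (auto intro!: AE_I2)
  qed (use assms in \<open>auto simp: L2_def\<close>)
qed (use assms in \<open>auto simp: L2_def\<close>)

lemma L2_linear:
  assumes "bounded_linear T" "L2 M f" shows "L2 M (\<lambda>x. T (f x))"
proof -
  obtain C where C: "\<And>x. norm (T x) \<le> C * norm x"
    using bounded_linear.bounded[OF assms(1)] by (metis mult.commute)
  show ?thesis
  proof (rule L2_bound[OF assms(2)])
    show "(\<lambda>x. T (f x)) \<in> borel_measurable M"
      using assms linear_continuous_on[OF assms(1), of UNIV]
      by (auto simp: L2_def intro: measurable_compose[OF _ borel_measurable_continuous_onI])
  qed (use C in auto)
qed

lemma L2_minus: "L2 M f \<Longrightarrow> L2 M (\<lambda>x. - f x)"
  using L2_linear[OF bounded_linear_minus[OF bounded_linear_ident]] .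

lemma L2_scaleR: "L2 M f \<Longrightarrow> L2 M (\<lambda>x. c *\<^sub>R f x)"
  by (rule L2_linear[OF bounded_linear_scaleR_right])

lemma L2_diff: "L2 M f \<Longrightarrow> L2 M g \<Longrightarrow> L2 M (\<lambda>x. f x - g x)"
  using L2_add[OF _ L2_minus, of M f g] by simp

lemma L2_sum: "finite A \<Longrightarrow> (\<And>i. i \<in> A \<Longrightarrow> L2 M (f i)) \<Longrightarrow> L2 M (\<lambda>x. \<Sum>i\<in>A. f i x)"
  by (induction A rule: finite_induct) (auto intro: L2_add, simp add: L2_def)

lemma L2_mult_integrable:
  assumes "L2 M f" "L2 M g" shows "integrable M (\<lambda>x. norm (f x) * norm (g x))"
proof (rule Bochner_Integration.integrable_bound[of M "\<lambda>x. (norm (f x))\<^sup>2 + (norm (g x))\<^sup>2"])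
  have "norm (f x) * norm (g x) \<le> (norm (f x))\<^sup>2 + (norm (g x))\<^sup>2" for x
  proof -
    have "2 * (norm (f x) * norm (g x)) \<le> (norm (f x))\<^sup>2 + (norm (g x))\<^sup>2"
      using sum_squares_bound[of "norm (f x)" "norm (g x)"] by simp
    moreover have "0 \<le> norm (f x) * norm (g x)" by simp
    ultimately show ?thesis by linarith
  qed
  then show "AE x in M. norm (norm (f x) * norm (g x)) \<le> norm ((norm (f x))\<^sup>2 + (norm (g x))\<^sup>2)"
    by (auto intro!: AE_I2)
qed (use assms in \<open>auto simp: L2_def\<close>)

lemma L2_Cauchy_Schwarz:
  assumes f: "L2 M f" and g: "L2 M g"
  shows "(\<integral>x. norm (f x) * norm (g x) \<partial>M) \<le> norm_L2 M f * norm_L2 M g"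
proof -
  define a b c where "a = (norm_L2 M f)\<^sup>2" and "b = (\<integral>x. norm (f x) * norm (g x) \<partial>M)" and "c = (norm_L2 M g)\<^sup>2"
  have b0: "b \<ge> 0" by (simp add: b_def integral_nonneg)
  have q: "2 * t * b \<le> t\<^sup>2 * a + c" for t
  proof -
    have "2 * t * b = (\<integral>x. 2 * t * (norm (f x) * norm (g x)) \<partial>M)" by (simp add: b_def)
    also have "\<dots> \<le> (\<integral>x. t\<^sup>2 * (norm (f x))\<^sup>2 + (norm (g x))\<^sup>2 \<partial>M)"
    proof (rule integral_mono)
      fix x show "2 * t * (norm (f x) * norm (g x)) \<le> t\<^sup>2 * (norm (f x))\<^sup>2 + (norm (g x))\<^sup>2"
        using zero_le_power2[of "t * norm (f x) - norm (g x)"] by (simp add: power2_eq_square algebra_simps)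
    qed (use L2_mult_integrable[OF f g] L2D(2)[OF f] L2D(2)[OF g] in auto)
    also have "\<dots> = t\<^sup>2 * a + c"
      using L2D(2)[OF f] L2D(2)[OF g] by (simp add: a_def c_def norm_L2_sq)
    finally show ?thesis .
  qed
  have "b\<^sup>2 \<le> a * c"
  proof (cases "a = 0")
    case True
    have "b = 0"
    proof (rule ccontr)
      assume "b \<noteq> 0"
      then have "b > 0" using b0 by simp
      then show False using q[of "(c + 1) / (2 * b)"] True by simp
    qed
    then show ?thesis by (simp add: a_def c_def)
  next
    case False
    then have a: "a > 0" by (simp add: a_def)
    have "2 * (b / a) * b \<le> (b / a)\<^sup>2 * a + c" by (rule q)
    moreover have "(b / a)\<^sup>2 * a = b\<^sup>2 / a" using a by (simp add: power2_eq_square)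
    moreover have "2 * (b / a) * b = 2 * (b\<^sup>2 / a)" by (simp add: power2_eq_square)
    ultimately have "b\<^sup>2 / a \<le> c" by linarith
    then show ?thesis using a by (simp add: field_simps)
  qed
  then have "b\<^sup>2 \<le> (norm_L2 M f * norm_L2 M g)\<^sup>2" by (simp add: a_def c_def power_mult_distrib)
  then show ?thesis using power2_le_imp_le by (fastforce simp: b_def)
qed

lemma norm_L2_triangle:
  assumes f: "L2 M f" and g: "L2 M g"
  shows "norm_L2 M (\<lambda>x. f x + g x) \<le> norm_L2 M f + norm_L2 M g"
proof (rule power2_le_imp_le)
  have "(norm_L2 M (\<lambda>x. f x + g x))\<^sup>2 \<le> (\<integral>x. (norm (f x))\<^sup>2 + 2 * (norm (f x) * norm (g x)) + (norm (g x))\<^sup>2 \<partial>M)"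
    unfolding norm_L2_sq
  proof (rule integral_mono)
    fix x show "(norm (f x + g x))\<^sup>2 \<le> (norm (f x))\<^sup>2 + 2 * (norm (f x) * norm (g x)) + (norm (g x))\<^sup>2"
      using power_mono[OF norm_triangle_ineq[of "f x" "g x"], of 2]
      by (simp add: power2_eq_square algebra_simps)
  qed (use L2_mult_integrable[OF f g] L2D(2)[OF f] L2D(2)[OF g] L2D(2)[OF L2_add[OF f g]] in auto)
  also have "\<dots> = (norm_L2 M f)\<^sup>2 + 2 * (\<integral>x. norm (f x) * norm (g x) \<partial>M) + (norm_L2 M g)\<^sup>2"
    using L2_mult_integrable[OF f g] L2D(2)[OF f] L2D(2)[OF g] by (simp add: norm_L2_sq)
  also have "\<dots> \<le> (norm_L2 M f + norm_L2 M g)\<^sup>2"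
    using L2_Cauchy_Schwarz[OF f g] by (simp add: power2_eq_square algebra_simps)
  finally show "(norm_L2 M (\<lambda>x. f x + g x))\<^sup>2 \<le> (norm_L2 M f + norm_L2 M g)\<^sup>2" .
qed simp

lemma norm_L2_minus [simp]: "norm_L2 M (\<lambda>x. - f x) = norm_L2 M f"
  by (simp add: norm_L2_def)

lemma norm_L2_commute: "norm_L2 M (\<lambda>x. f x - g x) = norm_L2 M (\<lambda>x. g x - f x)"
  by (simp add: norm_L2_def norm_minus_commute)

lemma norm_L2_scaleR: "norm_L2 M (\<lambda>x. c *\<^sub>R f x) = \<bar>c\<bar> * norm_L2 M f"
  by (simp add: norm_L2_def power_mult_distrib real_sqrt_mult)

lemma norm_L2_triangle_diff:
  assumes f: "L2 M f" and g: "L2 M g"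
  shows "norm_L2 M f \<le> norm_L2 M (\<lambda>x. f x - g x) + norm_L2 M g"
  using norm_L2_triangle[OF L2_diff[OF f g] g] by simp

lemma norm_L2_triangle3:
  assumes "L2 M f" "L2 M g" "L2 M h"
  shows "norm_L2 M (\<lambda>x. f x - h x) \<le> norm_L2 M (\<lambda>x. f x - g x) + norm_L2 M (\<lambda>x. g x - h x)"
  using norm_L2_triangle[OF L2_diff[OF assms(1,2)] L2_diff[OF assms(2,3)]] by simp

lemma norm_L2_mono:
  assumes "L2 M g" "f \<in> borel_measurable M" "\<And>x. x \<in> space M \<Longrightarrow> norm (f x) \<le> norm (g x)"
  shows "norm_L2 M f \<le> norm_L2 M g"
proof -
  have "L2 M f" by (rule L2_bound[OF assms(1,2), of 1]) (use assms(3) in auto)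
  then show ?thesis unfolding norm_L2_def
    by (intro real_sqrt_le_mono integral_mono power_mono) (use assms in \<open>auto simp: L2_def\<close>)
qed

lemma norm_L2_cong_AE:
  assumes "f \<in> borel_measurable M" "g \<in> borel_measurable M" "AE x in M. f x = g x"
  shows "norm_L2 M f = norm_L2 M g"
proof -
  have "AE x in M. (norm (f x))\<^sup>2 = (norm (g x))\<^sup>2"
    using assms(3) by (rule AE_mp) auto
  then have "(\<integral>x. (norm (f x))\<^sup>2 \<partial>M) = (\<integral>x. (norm (g x))\<^sup>2 \<partial>M)"
    using assms by (intro integral_cong_AE) auto
  then show ?thesis unfolding norm_L2_def by simp
qed

lemma norm_L2_cong:
  assumes "\<And>x. x \<in> space M \<Longrightarrow> f x = g x"
  shows "norm_L2 M f = norm_L2 M g"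
  unfolding norm_L2_def using assms by (auto cong: Bochner_Integration.integral_cong)

lemma L2_cong:
  assumes "\<And>x. x \<in> space M \<Longrightarrow> f x = g x"
  shows "L2 M f \<longleftrightarrow> L2 M g"
  unfolding L2_def using assms
  by (auto cong: measurable_cong Bochner_Integration.integrable_cong)

lemma norm_L2_tendsto:
  assumes "\<And>n. L2 M (\<phi> n)" "L2 M f" "(\<lambda>n. norm_L2 M (\<lambda>x. \<phi> n x - f x)) \<longlonglongrightarrow> 0"
  shows "(\<lambda>n. norm_L2 M (\<phi> n)) \<longlonglongrightarrow> norm_L2 M f"
proof -
  have "\<bar>norm_L2 M (\<phi> n) - norm_L2 M f\<bar> \<le> norm_L2 M (\<lambda>x. \<phi> n x - f x)" for n
    using norm_L2_triangle_diff[OF assms(1)[of n] assms(2)] norm_L2_triangle_diff[OF assms(2) assms(1)[of n]]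
    by (simp add: norm_L2_commute[of M f])
  then have "(\<lambda>n. norm_L2 M (\<phi> n) - norm_L2 M f) \<longlonglongrightarrow> 0"
    by (intro tendsto_rabs_zero_cancel[OF tendsto_sandwich[of "\<lambda>n. 0", OF _ _ tendsto_const assms(3)]]) auto
  then show ?thesis by (simp add: LIM_zero_iff)
qed

lemma norm_L2_zero_AE:
  assumes "L2 M f" "norm_L2 M f = 0" shows "AE x in M. f x = 0"
proof -
  have "(\<integral>x. (norm (f x))\<^sup>2 \<partial>M) = 0" using assms(2) norm_L2_sq[of M f] by simp
  then have "AE x in M. (norm (f x))\<^sup>2 = 0"
    using L2D(2)[OF assms(1)] by (subst (asm) integral_nonneg_eq_0_iff_AE) auto
  then show ?thesis by simp
qed

subsection \<open>kernels\<close>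

lemma csupp_uniform:
  fixes k :: "plane \<Rightarrow> 'b::euclidean_space"
  assumes k: "continuous_on UNIV k" and R: "\<forall>x. norm x > R \<longrightarrow> k x = 0" and e: "e > 0"
  obtains d where "d > 0" "\<And>x y. norm (x - y) < d \<Longrightarrow> norm (k x - k y) < e"
proof -
  have "uniformly_continuous_on (cball 0 (R + 1)) k"
    by (intro compact_uniformly_continuous compact_cball continuous_on_subset[OF k]) auto
  then obtain d where d: "d > 0" "\<And>x y. x \<in> cball 0 (R+1) \<Longrightarrow> y \<in> cball 0 (R+1) \<Longrightarrow> dist y x < d \<Longrightarrow> dist (k y) (k x) < e"
    using e unfolding uniformly_continuous_on_def by metis
  show thesis
  proof (rule that[of "min d 1"])
    fix x y :: plane assume xy: "norm (x - y) < min d 1"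
    have t: "norm x \<le> norm y + norm (x - y)" "norm y \<le> norm x + norm (x - y)"
      using norm_triangle_ineq[of y "x - y"] norm_triangle_ineq[of x "y - x"] by (auto simp: norm_minus_commute)
    show "norm (k x - k y) < e"
    proof (cases "norm x > R \<and> norm y > R")
      case True then show ?thesis using R e by simp
    next
      case False
      then have "norm x \<le> R + 1" "norm y \<le> R + 1" using t xy by auto
      then show ?thesis using d(2)[of y x] xy by (auto simp: dist_norm)
    qed
  qed (use d in auto)
qed

lemma csupp_bounded:
  fixes k :: "plane \<Rightarrow> 'b::euclidean_space"
  assumes k: "continuous_on UNIV k" and R: "\<forall>x. norm x > R \<longrightarrow> k x = 0"
  obtains B where "B \<ge> 0" "\<And>x. norm (k x) \<le> B"
proof -
  have "bounded (k ` cball 0 R)"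
    by (intro compact_imp_bounded compact_continuous_image continuous_on_subset[OF k]) auto
  then obtain B where B: "\<forall>x\<in>cball 0 R. norm (k x) \<le> B" unfolding bounded_iff by auto
  have "norm (k x) \<le> max B 0" for x
    using B R[rule_format, of x] by (cases "norm x > R") (auto simp: le_max_iff_disj)
  then show thesis using that[of "max B 0"] by auto
qed

lemma csupp_integrable:
  fixes k :: "plane \<Rightarrow> 'b::euclidean_space"
  assumes k: "continuous_on UNIV k" and R: "\<forall>x. norm x > R \<longrightarrow> k x = 0"
  shows "integrable lborel k" "integrable lebesgue k"
proof -
  have "integrable lborel (\<lambda>x. indicator (cball 0 R) x *\<^sub>R k x)"
    by (intro borel_integrable_compact continuous_on_subset[OF k]) auto
  moreover have "(\<lambda>x. indicator (cball 0 R) x *\<^sub>R k x) = k"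
    by (rule ext) (use R in \<open>auto simp: indicator_def not_le\<close>)
  ultimately show *: "integrable lborel k" by simp
  then show "integrable lebesgue k"
    using borel_measurable_continuous_onI[OF k] by (subst integrable_completion) auto
qed

lemma pdiff_zero_open:
  assumes "open S" "x \<in> S" "\<And>y. y \<in> S \<Longrightarrow> f y = 0"
  shows "pdiff i f x = 0"
proof -
  have "(f has_derivative (\<lambda>h. 0)) (at x)"
    by (rule has_derivative_transform_within_open[of "\<lambda>x. 0" _ _ _ S]) (use assms in auto)
  from pdiff_eqI[OF this] show ?thesis .
qed

lemma csupp_pdiff:
  assumes R: "\<forall>x. norm x > R \<longrightarrow> k x = 0" shows "\<forall>x. norm x > R \<longrightarrow> pdiff i k x = 0"
  by (intro allI impI pdiff_zero_open[of "- cball 0 R" _ k]) (use R in auto)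

lemma kernel_integrable:
  fixes k :: "plane \<Rightarrow> real" and f :: "plane \<Rightarrow> 'b::euclidean_space"
  assumes idm: "(\<lambda>x. x) \<in> measurable M borel" and f: "integrable M f"
    and k: "continuous_on UNIV k" and R: "\<forall>x. norm x > R \<longrightarrow> k x = 0"
  shows "integrable M (\<lambda>z. k (z - y) *\<^sub>R f z)"
proof -
  obtain B where B: "B \<ge> 0" "\<And>x. norm (k x) \<le> B" using csupp_bounded[OF k R] by blast
  show ?thesis
  proof (rule Bochner_Integration.integrable_bound[of M "\<lambda>z. B *\<^sub>R f z"])
    have "continuous_on UNIV (\<lambda>z. k (z - y))"
      by (auto intro!: continuous_intros continuous_on_compose2[OF k])
    from measurable_compose[OF idm borel_measurable_continuous_onI[OF this]]
    have [measurable]: "(\<lambda>z. k (z - y)) \<in> borel_measurable M" .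
    show "(\<lambda>z. k (z - y) *\<^sub>R f z) \<in> borel_measurable M" using f by measurable
    show "AE x in M. norm (k (x - y) *\<^sub>R f x) \<le> norm (B *\<^sub>R f x)"
      using B by (auto intro!: AE_I2 mult_right_mono)
  qed (use f in auto)
qed

lemma smooth_uniform_linearization:
  fixes k :: "plane \<Rightarrow> real"
  assumes k: "smooth k" and R: "\<forall>x. norm x > R \<longrightarrow> k x = 0" and e: "e > 0"
  obtains d where "d > 0"
    "\<And>w u. norm u < d \<Longrightarrow> \<bar>k (w + u) - k w - (\<Sum>i\<in>UNIV. u $ i * pdiff i k w)\<bar> \<le> e * norm u"
proof -
  have "\<exists>d>0. \<forall>x y. norm (x - y) < d \<longrightarrow> norm (pdiff i k x - pdiff i k y) < e / 2" for i
  proof -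
    have "e / 2 > 0" using e by simp
    from csupp_uniform[OF smooth_continuous[OF smooth_pdiff[OF k]] csupp_pdiff[OF R] this]
    show ?thesis by metis
  qed
  then obtain d where d: "\<And>i. d i > 0" "\<And>i x y. norm (x - y) < d i \<Longrightarrow> norm (pdiff i k x - pdiff i k y) < e / 2" by metis
  show thesis
  proof (rule that[of "min (d 1) (d 2)"])
    fix w u :: plane assume u: "norm u < min (d 1) (d 2)"
    let ?D = "\<lambda>x h. \<Sum>i\<in>UNIV. h $ i *\<^sub>R pdiff i k x"
    have "norm (k (w + u) - k w - ?D w (w + u - w)) \<le> norm (w + u - w) * e"
    proof (rule differentiable_bound_linearization[of w "w+u" "ball w (min (d 1) (d 2))"])
      fix t :: real assume t: "t \<in> {0..1}"
      have "norm (t *\<^sub>R u) \<le> norm u" using t by (auto intro: mult_left_le_one_le)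
      then show "w + t *\<^sub>R (w + u - w) \<in> ball w (min (d 1) (d 2))" using u by (auto simp: dist_norm)
    next
      fix x assume x: "x \<in> ball w (min (d 1) (d 2))"
      show "(k has_derivative ?D x) (at x within ball w (min (d 1) (d 2)))"
        by (rule has_derivative_at_withinI[OF has_derivative_pdiff[OF smooth_differentiable[OF k]]])
      show "onorm (?D x - ?D w) \<le> e"
      proof (rule onorm_bound)
        fix h :: plane
        have "\<bar>h $ i * (pdiff i k x - pdiff i k w)\<bar> \<le> norm h * (e / 2)" for i
        proof -
          have "norm (x - w) < d i" using x exhaust_2[of i] by (auto simp: dist_norm norm_minus_commute)
          from d(2)[OF this] show ?thesis
            unfolding abs_mult by (intro mult_mono) (auto simp: component_le_norm_cart)
        qed
        from this[of 1] this[of 2] show "norm ((?D x - ?D w) h) \<le> e * norm h"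
          unfolding UNIV_2 by (simp add: algebra_simps abs_if split: if_splits)
      qed (use e in auto)
    qed (use d in auto)
    then show "\<bar>k (w + u) - k w - (\<Sum>i\<in>UNIV. u $ i * pdiff i k w)\<bar> \<le> e * norm u"
      by (simp add: mult.commute)
  qed (use d in auto)
qed

lemma kernel_has_derivative:
  fixes k :: "plane \<Rightarrow> real" and f :: "plane \<Rightarrow> 'b::euclidean_space"
  assumes idm: "(\<lambda>x. x) \<in> measurable M borel" and f: "integrable M f"
    and k: "smooth k" and R: "\<forall>x. norm x > R \<longrightarrow> k x = 0"
  shows "((\<lambda>x. \<integral>z. k (z - (s *\<^sub>R x + c)) *\<^sub>R f z \<partial>M) has_derivative
     (\<lambda>h. \<Sum>i\<in>UNIV. h $ i *\<^sub>R ((- s) *\<^sub>R (\<integral>z. pdiff i k (z - (s *\<^sub>R x + c)) *\<^sub>R f z \<partial>M)))) (at x)"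
    (is "(?F has_derivative ?F') _")
  unfolding has_derivative_within_alt
proof (intro conjI allI impI)
  show "bounded_linear ?F'"
    by (intro bounded_linear_sum bounded_linear_scaleR_const bounded_linear_vec_nth)
  fix e :: real assume e: "e > 0"
  define I where "I = (\<integral>z. norm (f z) \<partial>M)"
  have I: "I \<ge> 0" by (simp add: I_def integral_nonneg)
  define e' where "e' = e / (\<bar>s\<bar> * I + 1)"
  have pos: "\<bar>s\<bar> * I + 1 > 0" using I by (simp add: add_nonneg_pos)
  have e': "e' > 0" using e pos by (simp add: e'_def)
  obtain d where d: "d > 0"
    "\<And>w u. norm u < d \<Longrightarrow> \<bar>k (w + u) - k w - (\<Sum>i\<in>UNIV. u $ i * pdiff i k w)\<bar> \<le> e' * norm u"
    using smooth_uniform_linearization[OF k R e'] by blast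
  show "\<exists>d>0. \<forall>y\<in>UNIV. norm (y - x) < d \<longrightarrow> norm (?F y - ?F x - ?F' (y - x)) \<le> e * norm (y - x)"
  proof (intro exI[of _ "d / (\<bar>s\<bar> + 1)"] conjI ballI impI)
    show "d / (\<bar>s\<bar> + 1) > 0" using d by simp
    fix y assume y: "norm (y - x) < d / (\<bar>s\<bar> + 1)"
    let ?u = "- s *\<^sub>R (y - x)" and ?w = "\<lambda>z. z - (s *\<^sub>R x + c)"
    have "norm ?u \<le> (\<bar>s\<bar> + 1) * norm (y - x)" by (simp add: mult_right_mono)
    also have "\<dots> < d" using y by (simp add: field_simps)
    finally have u: "norm ?u < d" .
    note ki = kernel_integrable[OF idm f smooth_continuous[OF k] R]
    have kpi: "integrable M (\<lambda>z. pdiff i k (z - y) *\<^sub>R f z)" for i y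
      by (rule kernel_integrable[OF idm f smooth_continuous[OF smooth_pdiff[OF k]] csupp_pdiff[OF R]])
    have eq: "?F y - ?F x - ?F' (y - x) =
      (\<integral>z. (k (?w z + ?u) - k (?w z) - (\<Sum>i\<in>UNIV. ?u $ i * pdiff i k (?w z))) *\<^sub>R f z \<partial>M)"
    proof -
      have w: "?w z + ?u = z - (s *\<^sub>R y + c)" for z by (simp add: algebra_simps)
      show ?thesis unfolding w UNIV_2
        using ki[where y= "s *\<^sub>R y + c"] ki[where y= "s *\<^sub>R x + c"] kpi[where y="s *\<^sub>R x + c" and i=1] kpi[where y="s *\<^sub>R x + c" and i=2]
        by (simp add: scaleR_diff_left scaleR_add_left scaleR_scaleR[symmetric] scaleR_left_commute algebra_simps del: scaleR_scaleR)
    qed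
    have "norm (?F y - ?F x - ?F' (y - x)) \<le> (\<integral>z. e' * norm ?u * norm (f z) \<partial>M)"
      unfolding eq
    proof (rule order_trans[OF integral_norm_bound integral_mono], rule integrable_norm)
      show "integrable M (\<lambda>z. (k (?w z + ?u) - k (?w z) - (\<Sum>i\<in>UNIV. ?u $ i * pdiff i k (?w z))) *\<^sub>R f z)"
      proof -
        have w: "?w z + ?u = z - (s *\<^sub>R y + c)" for z by (simp add: algebra_simps)
        show ?thesis unfolding w UNIV_2
          using ki[where y= "s *\<^sub>R y + c"] ki[where y= "s *\<^sub>R x + c"] kpi[where y="s *\<^sub>R x + c" and i=1] kpi[where y="s *\<^sub>R x + c" and i=2]
          by (simp add: scaleR_diff_left scaleR_add_left scaleR_scaleR[symmetric] del: scaleR_scaleR)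
      qed
      fix z show "norm ((k (?w z + ?u) - k (?w z) - (\<Sum>i\<in>UNIV. ?u $ i * pdiff i k (?w z))) *\<^sub>R f z) \<le> e' * norm ?u * norm (f z)"
        by (subst norm_scaleR[of _ "f z"]) (rule mult_right_mono[OF d(2)[OF u]], simp)
    qed (use f in simp)
    also have "\<dots> = (e' * (\<bar>s\<bar> * I)) * norm (y - x)" by (simp add: I_def)
    also have "\<dots> \<le> e * norm (y - x)"
    proof (rule mult_right_mono)
      have "e' * (\<bar>s\<bar> * I) \<le> e' * (\<bar>s\<bar> * I + 1)" using e' by simp
      also have "\<dots> = e" using pos by (simp add: e'_def)
      finally show "e' * (\<bar>s\<bar> * I) \<le> e" .
    qed simp
    finally show "norm (?F y - ?F x - ?F' (y - x)) \<le> e * norm (y - x)" .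
  qed
qed

lemma kernel_pdiff:
  fixes k :: "plane \<Rightarrow> real" and f :: "plane \<Rightarrow> 'b::euclidean_space"
  assumes idm: "(\<lambda>x. x) \<in> measurable M borel" and f: "integrable M f"
    and k: "smooth k" and R: "\<forall>x. norm x > R \<longrightarrow> k x = 0"
  shows "pdiff i (\<lambda>x. \<integral>z. k (z - (s *\<^sub>R x + c)) *\<^sub>R f z \<partial>M) =
    (\<lambda>x. (- s) *\<^sub>R (\<integral>z. pdiff i k (z - (s *\<^sub>R x + c)) *\<^sub>R f z \<partial>M))"
proof (rule ext)
  fix x
  have ax: "(\<Sum>j\<in>UNIV. axis i (1::real) $ j *\<^sub>R g j) = g i" for g :: "2 \<Rightarrow> 'b"
    unfolding UNIV_2 using exhaust_2[of i] by (auto simp: axis_def)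
  show "pdiff i (\<lambda>x. \<integral>z. k (z - (s *\<^sub>R x + c)) *\<^sub>R f z \<partial>M) x =
    (- s) *\<^sub>R (\<integral>z. pdiff i k (z - (s *\<^sub>R x + c)) *\<^sub>R f z \<partial>M)"
    by (subst pdiff_eqI[OF kernel_has_derivative[OF assms]]) (rule ax)
qed

lemma kernel_smooth:
  fixes k :: "plane \<Rightarrow> real" and f :: "plane \<Rightarrow> 'b::euclidean_space"
  assumes idm: "(\<lambda>x. x) \<in> measurable M borel" and f: "integrable M f"
    and k: "smooth k" and R: "\<forall>x. norm x > R \<longrightarrow> k x = 0"
  shows "smooth (\<lambda>x. \<integral>z. k (z - (s *\<^sub>R x + c)) *\<^sub>R f z \<partial>M)"
proof -
  have diff: "(\<lambda>x. \<integral>z. k (z - (s *\<^sub>R x + c)) *\<^sub>R f z \<partial>M) differentiable (at x)"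
    if "smooth k" "\<forall>x. norm x > R \<longrightarrow> k x = 0" for k x
    using kernel_has_derivative[OF idm f that] unfolding differentiable_def by blast
  have "C_k n (\<lambda>x. \<integral>z. k (z - (s *\<^sub>R x + c)) *\<^sub>R f z \<partial>M)" for n
    using k R
  proof (induction n arbitrary: k)
    case 0
    then show ?case
      by (auto intro!: continuous_at_imp_continuous_on differentiable_imp_continuous_within diff)
  next
    case (Suc n)
    have "C_k n (\<lambda>x. (- s) *\<^sub>R (\<integral>z. pdiff i k (z - (s *\<^sub>R x + c)) *\<^sub>R f z \<partial>M))" for i
      by (intro C_k_linear[OF bounded_linear_scaleR_right] Suc.IH smooth_pdiff Suc.prems(1) csupp_pdiff[OF Suc.prems(2)])
    then show ?case
      using diff[OF Suc.prems] by (simp add: kernel_pdiff[OF idm f Suc.prems])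
  qed
  then show ?thesis by (simp add: smooth_def)
qed

subsection \<open>Integration by parts\<close>

lemma integral_pdiff_zero_real:
  fixes F :: "plane \<Rightarrow> real"
  assumes F: "smooth F" and R: "\<forall>x. norm x > R \<longrightarrow> F x = 0"
  shows "integral\<^sup>L lebesgue (pdiff i F) = 0"
proof -
  let ?M = "lebesgue_on (ball (0::plane) (R + 1))"
  have idm: "(\<lambda>x. x) \<in> measurable ?M borel"
    by (intro measurable_restrict_space1) (auto simp: measurable_completion)
  have "finite_measure ?M" by (rule finite_measure_lebesgue_on) auto
  then have f: "integrable ?M (\<lambda>x. 1::real)" by (rule finite_measure.integrable_const)
  have restr: "(\<integral>z. k (z - ((-1) *\<^sub>R x + 0)) *\<^sub>R (1::real) \<partial>?M) = integral\<^sup>L lborel k"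
    if k: "continuous_on UNIV k" and kR: "\<forall>x. norm x > R \<longrightarrow> k x = 0" and x: "norm x < 1"
    for x and k :: "plane \<Rightarrow> real"
  proof -
    have km[measurable]: "k \<in> borel_measurable borel" by (rule borel_measurable_continuous_onI[OF k])
    have z: "indicator (ball 0 (R + 1)) z *\<^sub>R (k (z - ((-1) *\<^sub>R x + 0)) *\<^sub>R 1) = k (z + x)" for z
    proof (cases "norm z < R + 1")
      case False
      have "norm z \<le> norm (z + x) + norm x" using norm_triangle_ineq[of "z + x" "- x"] by simp
      then have "norm (z + x) > R" using False x by auto
      then show ?thesis using kR False by auto
    qed auto
    have "(\<integral>z. k (z - ((-1) *\<^sub>R x + 0)) *\<^sub>R (1::real) \<partial>?M) = (\<integral>z. k (z + x) \<partial>lebesgue)"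
      by (subst integral_restrict_space) (simp_all only: z, auto)
    also have "\<dots> = (\<integral>z. k (z + x) \<partial>lborel)"
      by (rule integral_completion) measurable
    also have "\<dots> = (\<integral>z. k z \<partial>distr lborel borel ((+) x))"
      by (subst integral_distr) (auto simp: add.commute)
    finally show ?thesis by (simp add: lborel_distr_plus)
  qed
  let ?G = "\<lambda>x. \<integral>z. F (z - ((-1) *\<^sub>R x + 0)) *\<^sub>R (1::real) \<partial>?M"
  have "(?G has_derivative (\<lambda>h. 0)) (at 0)"
    by (rule has_derivative_transform_within_open[of "\<lambda>x. integral\<^sup>L lborel F" _ _ _ "ball 0 1"])
       (use restr[OF smooth_continuous[OF F] R] in auto)
  then have "pdiff i ?G 0 = 0" by (rule pdiff_eqI)
  then have "(\<integral>z. pdiff i F (z - ((-1) *\<^sub>R 0 + 0)) *\<^sub>R (1::real) \<partial>?M) = 0"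
    unfolding kernel_pdiff[OF idm f F R] by simp
  then have "integral\<^sup>L lborel (pdiff i F) = 0"
    using restr[OF smooth_continuous[OF smooth_pdiff[OF F]] csupp_pdiff[OF R], where x=0] by simp
  then show ?thesis
    by (subst integral_completion) (auto intro: borel_measurable_continuous_onI smooth_continuous smooth_pdiff F)
qed

lemma integral_pdiff_zero:
  fixes F :: "plane \<Rightarrow> 'b::euclidean_space"
  assumes F: "smooth F" and R: "\<forall>x. norm x > R \<longrightarrow> F x = 0"
  shows "integral\<^sup>L lebesgue (pdiff i F) = 0"
proof (rule euclidean_eqI)
  fix b :: 'b assume "b \<in> Basis"
  have int: "integrable lebesgue (pdiff i F)"
    by (rule csupp_integrable(2)[OF smooth_continuous[OF smooth_pdiff[OF F]] csupp_pdiff[OF R]])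
  have "integral\<^sup>L lebesgue (pdiff i F) \<bullet> b = (\<integral>x. pdiff i F x \<bullet> b \<partial>lebesgue)"
    using int by simp
  also have "(\<lambda>x. pdiff i F x \<bullet> b) = pdiff i (\<lambda>x. F x \<bullet> b)"
    using pdiff_linear[OF bounded_linear_inner_left smooth_differentiable[OF F]] by auto
  also have "integral\<^sup>L lebesgue (pdiff i (\<lambda>x. F x \<bullet> b)) = 0"
    by (rule integral_pdiff_zero_real[OF smooth_linear[OF bounded_linear_inner_left F]]) (use R in auto)
  finally show "integral\<^sup>L lebesgue (pdiff i F) \<bullet> b = 0 \<bullet> b" by simp
qed

lemma test_function_outside:
  assumes "test_function U \<psi>" "x \<notin> U" shows "\<psi> x = 0" "pdiff i \<psi> x = 0"
proof -
  let ?S = "closure {x. \<psi> x \<noteq> 0}"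
  have S: "x \<in> - ?S" using assms unfolding test_function_def by auto
  then show "\<psi> x = 0" using closure_subset[of "{x. \<psi> x \<noteq> 0}"] by auto
  show "pdiff i \<psi> x = 0"
    by (rule pdiff_zero_open[of "- ?S"]) (use S closure_subset[of "{x. \<psi> x \<noteq> 0}"] in auto)
qed

lemma test_function_bounded:
  assumes "test_function U \<psi>" obtains R where "\<forall>x. norm x > R \<longrightarrow> \<psi> x = 0"
proof -
  have "bounded (closure {x. \<psi> x \<noteq> 0})" using assms compact_imp_bounded unfolding test_function_def by blast
  then obtain R where "\<And>x. x \<in> closure {x. \<psi> x \<noteq> 0} \<Longrightarrow> norm x \<le> R" unfolding bounded_iff by auto
  then show thesis using that[of R] closure_subset[of "{x. \<psi> x \<noteq> 0}"] by fastforce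
qed

lemma test_function_pdiff:
  assumes "test_function U \<psi>" shows "test_function U (pdiff i \<psi>)"
proof -
  let ?S = "closure {x. \<psi> x \<noteq> 0}"
  have "{x. pdiff i \<psi> x \<noteq> 0} \<subseteq> ?S"
  proof
    fix x assume x: "x \<in> {x. pdiff i \<psi> x \<noteq> 0}"
    show "x \<in> ?S"
    proof (rule ccontr)
      assume "x \<notin> ?S"
      then have "pdiff i \<psi> x = 0"
        by (intro pdiff_zero_open[of "- ?S"]) (use closure_subset[of "{x. \<psi> x \<noteq> 0}"] in auto)
      then show False using x by simp
    qed
  qed
  then have "closure {x. pdiff i \<psi> x \<noteq> 0} \<subseteq> ?S" by (simp add: closure_minimal)
  then show ?thesis using assms unfolding test_function_def
    using compact_Int_closed[of ?S "closure {x. pdiff i \<psi> x \<noteq> 0}"] smooth_pdiff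
    by (simp add: Int_absorb1) blast
qed

lemma test_function_integrable:
  assumes "test_function U \<psi>" "smooth \<phi>" shows "integrable lebesgue (\<lambda>x. \<psi> x *\<^sub>R \<phi> x)"
proof -
  obtain R where R: "\<forall>x. norm x > R \<longrightarrow> \<psi> x = 0" using test_function_bounded[OF assms(1)] by blast
  show ?thesis
    by (rule csupp_integrable(2)[of _ R])
       (use assms R in \<open>auto simp: test_function_def intro!: smooth_continuous smooth_scaleR\<close>)
qed

lemma integral_lebesgue_on_extend:
  fixes f :: "plane \<Rightarrow> 'b::euclidean_space"
  assumes "U \<in> sets lebesgue" "\<And>x. x \<notin> U \<Longrightarrow> f x = 0"
  shows "integral\<^sup>L (lebesgue_on U) f = integral\<^sup>L lebesgue f"
proof -
  have "(\<lambda>x. indicator U x *\<^sub>R f x) = f" using assms(2) by (auto simp: indicator_def fun_eq_iff)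
  then show ?thesis using assms(1) by (subst integral_restrict_space) auto
qed

lemma smooth_is_weak_deriv:
  fixes \<phi> :: "plane \<Rightarrow> 'b::euclidean_space"
  assumes U: "open U" and \<phi>: "smooth \<phi>"
  shows "is_weak_deriv U [i] \<phi> (pdiff i \<phi>)"
  unfolding is_weak_deriv_def
proof (intro allI impI)
  fix \<psi> :: "plane \<Rightarrow> real" assume \<psi>: "test_function U \<psi>"
  have sm: "smooth \<psi>" using \<psi> by (simp add: test_function_def)
  obtain R where R: "\<forall>x. norm x > R \<longrightarrow> \<psi> x = 0" using test_function_bounded[OF \<psi>] by blast
  have UL: "U \<in> sets lebesgue" using U by auto
  have "integral\<^sup>L lebesgue (pdiff i (\<lambda>x. \<psi> x *\<^sub>R \<phi> x)) = 0"
    by (rule integral_pdiff_zero[of _ R]) (auto intro: smooth_scaleR sm \<phi> simp: R)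
  moreover have "pdiff i (\<lambda>x. \<psi> x *\<^sub>R \<phi> x) = (\<lambda>x. pdiff i \<psi> x *\<^sub>R \<phi> x + \<psi> x *\<^sub>R pdiff i \<phi> x)"
    by (intro ext pdiff_scaleR smooth_differentiable sm \<phi>)
  ultimately have "(\<integral>x. pdiff i \<psi> x *\<^sub>R \<phi> x \<partial>lebesgue) + (\<integral>x. \<psi> x *\<^sub>R pdiff i \<phi> x \<partial>lebesgue) = 0"
    using test_function_integrable[OF test_function_pdiff[OF \<psi>] \<phi>] test_function_integrable[OF \<psi> smooth_pdiff[OF \<phi>]]
    by (simp add: Bochner_Integration.integral_add)
  then show "(\<integral>x. pdiffs [i] \<psi> x *\<^sub>R \<phi> x \<partial>lebesgue_on U) =
      (-1) ^ length [i] *\<^sub>R (\<integral>x. \<psi> x *\<^sub>R pdiff i \<phi> x \<partial>lebesgue_on U)"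
    using test_function_outside[OF \<psi>]
    by (simp add: integral_lebesgue_on_extend[OF UL] eq_neg_iff_add_eq_0)
qed

(* PART 3 *)

lemma norm_L2_dominated:
  fixes h :: "nat \<Rightarrow> 'a \<Rightarrow> 'b::euclidean_space"
  assumes h: "\<And>n. h n \<in> borel_measurable M" and w: "integrable M w"
    and b: "\<And>n. AE x in M. (norm (h n x))\<^sup>2 \<le> w x" and l: "AE x in M. (\<lambda>n. h n x) \<longlonglongrightarrow> 0"
  shows "(\<lambda>n. norm_L2 M (h n)) \<longlonglongrightarrow> 0"
proof -
  have "(\<lambda>n. \<integral>x. (norm (h n x))\<^sup>2 \<partial>M) \<longlonglongrightarrow> (\<integral>x. 0 \<partial>M)"
  proof (rule integral_dominated_convergence[where w=w])
    show "AE x in M. (\<lambda>n. (norm (h n x))\<^sup>2) \<longlonglongrightarrow> 0"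
      using l
    proof (rule eventually_mono)
      fix x assume "(\<lambda>n. h n x) \<longlonglongrightarrow> 0"
      then show "(\<lambda>n. (norm (h n x))\<^sup>2) \<longlonglongrightarrow> 0"
        using tendsto_power[OF tendsto_norm_zero, of "\<lambda>n. h n x" sequentially 2] by simp
    qed
  qed (use h w b in auto)
  then have "(\<lambda>n. sqrt (\<integral>x. (norm (h n x))\<^sup>2 \<partial>M)) \<longlonglongrightarrow> sqrt 0"
    by (intro tendsto_real_sqrt) simp
  then show ?thesis by (simp add: norm_L2_def)
qed

definition cut :: "real \<Rightarrow> 'b::euclidean_space \<Rightarrow> 'b" where
  "cut m v = (m / max m (norm v)) *\<^sub>R v"

lemma cut_continuous: "m > 0 \<Longrightarrow> continuous_on UNIV (cut m)"
  unfolding cut_def by (intro continuous_intros) (auto simp: max_def)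

lemma cut_bound: "m > 0 \<Longrightarrow> norm (cut m v) \<le> m"
  by (auto simp: cut_def max_def field_simps)

lemma cut_eq: "m > 0 \<Longrightarrow> norm v \<le> m \<Longrightarrow> cut m v = v"
  by (auto simp: cut_def max_def)

lemma cut_diff: "m > 0 \<Longrightarrow> norm (v - cut m v) \<le> norm v"
proof -
  assume m: "m > 0"
  define s where "s = m / max m (norm v)"
  have s: "0 \<le> s" "s \<le> 1" using m by (auto simp: s_def max_def divide_le_eq_1)
  have "v - cut m v = (1 - s) *\<^sub>R v" by (simp add: cut_def s_def algebra_simps)
  then have "norm (v - cut m v) = (1 - s) * norm v" using s by simp
  also have "\<dots> \<le> norm v" using s by (simp add: mult_left_le_one_le)
  finally show ?thesis .
qed

lemma idm_lebesgue_on: "(\<lambda>x::plane. x) \<in> measurable (lebesgue_on U) borel"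
  by (intro measurable_restrict_space1) (auto simp: measurable_completion)

lemma continuous_measurable_lebesgue_on:
  fixes g :: "plane \<Rightarrow> 'b::euclidean_space"
  assumes "continuous_on UNIV g" shows "g \<in> borel_measurable (lebesgue_on U)"
  using measurable_compose[OF idm_lebesgue_on borel_measurable_continuous_onI[OF assms]] .

definition kern :: "real \<Rightarrow> plane \<Rightarrow> real" where
  "kern \<delta> = (SOME k. smooth k \<and> (\<forall>x. k x \<ge> 0) \<and> (\<forall>x. norm x > \<delta> \<longrightarrow> k x = 0) \<and>
     integral\<^sup>L lebesgue k = 1 \<and> integrable lebesgue k)"

lemma kern:
  assumes "\<delta> > 0"
  shows "smooth (kern \<delta>)" "kern \<delta> x \<ge> 0" "\<forall>x. norm x > \<delta> \<longrightarrow> kern \<delta> x = 0"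
    "integral\<^sup>L lebesgue (kern \<delta>) = 1" "integrable lebesgue (kern \<delta>)"
proof -
  obtain k :: "plane \<Rightarrow> real" where k: "smooth k" "\<And>x. k x \<ge> 0" "\<And>x. norm x \<ge> \<delta> \<Longrightarrow> k x = 0"
    "integral\<^sup>L lebesgue k = 1" "integrable lebesgue k"
    using bump_exists[OF assms] by blast
  have "smooth k \<and> (\<forall>x. k x \<ge> 0) \<and> (\<forall>x. norm x > \<delta> \<longrightarrow> k x = 0) \<and>
     integral\<^sup>L lebesgue k = 1 \<and> integrable lebesgue k" using k by auto
  from someI[of "\<lambda>k. smooth k \<and> (\<forall>x. k x \<ge> 0) \<and> (\<forall>x. norm x > \<delta> \<longrightarrow> k x = 0) \<and>
     integral\<^sup>L lebesgue k = 1 \<and> integrable lebesgue k", OF this]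
  show "smooth (kern \<delta>)" "kern \<delta> x \<ge> 0" "\<forall>x. norm x > \<delta> \<longrightarrow> kern \<delta> x = 0"
    "integral\<^sup>L lebesgue (kern \<delta>) = 1" "integrable lebesgue (kern \<delta>)"
    unfolding kern_def[symmetric] by auto
qed

lemma nn_integral_dilate:
  fixes F :: "plane \<Rightarrow> ennreal"
  assumes [measurable]: "F \<in> borel_measurable borel" and s: "s \<noteq> 0"
  shows "(\<integral>\<^sup>+x. F (t + s *\<^sub>R x) \<partial>lborel) = ennreal (1 / s\<^sup>2) * (\<integral>\<^sup>+x. F x \<partial>lborel)"
proof -
  have "(\<integral>\<^sup>+x. F x \<partial>lborel) = (\<integral>\<^sup>+x. F x \<partial>density (distr lborel borel (\<lambda>x::plane. t + s *\<^sub>R x)) (\<lambda>_. ennreal (\<bar>s\<bar> ^ DIM(plane))))"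
    using lborel_affine[OF s, of t] by simp
  also have "\<dots> = (\<integral>\<^sup>+x. ennreal (\<bar>s\<bar> ^ DIM(plane)) * F x \<partial>distr lborel borel (\<lambda>x::plane. t + s *\<^sub>R x))"
    by (rule nn_integral_density) measurable
  also have "\<dots> = (\<integral>\<^sup>+x. ennreal (\<bar>s\<bar> ^ DIM(plane)) * F (t + s *\<^sub>R x) \<partial>lborel)"
    by (rule nn_integral_distr) measurable
  also have "\<dots> = ennreal (s\<^sup>2) * (\<integral>\<^sup>+x. F (t + s *\<^sub>R x) \<partial>lborel)"
    by (subst nn_integral_cmult) (simp_all add: DIM_cart)
  finally have "ennreal (1 / s\<^sup>2) * (\<integral>\<^sup>+x. F x \<partial>lborel) =
    (ennreal (1 / s\<^sup>2) * ennreal (s\<^sup>2)) * (\<integral>\<^sup>+x. F (t + s *\<^sub>R x) \<partial>lborel)" by (simp add: mult.assoc)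
  also have "ennreal (1 / s\<^sup>2) * ennreal (s\<^sup>2) = ennreal 1"
    using s by (subst ennreal_mult[symmetric]) auto
  finally show ?thesis by simp
qed

lemma kern_nn_integral:
  assumes "\<delta> > 0" "s \<noteq> 0"
  shows "(\<integral>\<^sup>+x. ennreal (kern \<delta> (t + s *\<^sub>R x)) \<partial>lborel) = ennreal (1 / s\<^sup>2)"
proof -
  have m: "kern \<delta> \<in> borel_measurable borel"
    by (rule borel_measurable_continuous_onI[OF smooth_continuous[OF kern(1)[OF assms(1)]]])
  have "(\<integral>\<^sup>+x. ennreal (kern \<delta> x) \<partial>lebesgue) = 1"
    using kern[OF assms(1)] by (subst nn_integral_eq_integral) auto
  then have "(\<integral>\<^sup>+x. ennreal (kern \<delta> x) \<partial>lborel) = 1"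
    using m by (simp add: nn_integral_completion)
  then show ?thesis
    using nn_integral_dilate[OF _ assms(2), of "\<lambda>x. ennreal (kern \<delta> x)" t] m by simp
qed

locale starlike =
  fixes U :: "plane set" and c :: plane and \<rho> :: real
  assumes U: "open U" "convex U" "bounded U" and \<rho>: "\<rho> > 0" "ball c \<rho> \<subseteq> U"
begin

abbreviation "M \<equiv> lebesgue_on U"

lemma lm: "U \<in> lmeasurable" by (rule lmeasurable_open[OF U(3,1)])

lemma Usets: "U \<in> sets lebesgue" using U by auto

lemma fin: "finite_measure M" by (rule finite_measure_lebesgue_on[OF lm])

lemma L2_integrable:
  fixes f :: "plane \<Rightarrow> 'b::euclidean_space"
  assumes "L2 M f" shows "integrable M f"
proof (rule Bochner_Integration.integrable_bound[of M "\<lambda>x. (norm (f x))\<^sup>2 + 1"])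
  show "integrable M (\<lambda>x. (norm (f x))\<^sup>2 + 1)"
    by (intro Bochner_Integration.integrable_add L2D(2)[OF assms] finite_measure.integrable_const[OF fin])
  have "norm (f x) \<le> (norm (f x))\<^sup>2 + 1" for x
    using sum_squares_bound[of "norm (f x)" 1] by (smt (verit) norm_ge_zero one_power2)
  then show "AE x in M. norm (f x) \<le> norm ((norm (f x))\<^sup>2 + 1)" by auto
qed (rule L2D(1)[OF assms])

lemma L2_bounded:
  fixes g :: "plane \<Rightarrow> 'b::euclidean_space"
  assumes "g \<in> borel_measurable M" "\<And>x. x \<in> U \<Longrightarrow> norm (g x) \<le> B"
  shows "L2 M g" 
  unfolding L2_def
proof
  show "integrable M (\<lambda>x. (norm (g x))\<^sup>2)"
  proof (rule Bochner_Integration.integrable_bound[of M "\<lambda>x. B\<^sup>2"])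
    show "AE x in M. norm ((norm (g x))\<^sup>2) \<le> norm (B\<^sup>2)"
      by (rule AE_I2) (use assms(2) in \<open>auto intro!: power_mono\<close>)
  qed (use assms finite_measure.integrable_const[OF fin] in auto)
qed (rule assms)

lemma L2_continuous:
  fixes g :: "plane \<Rightarrow> 'b::euclidean_space"
  assumes "continuous_on UNIV g" shows "L2 M g"
proof -
  have "bounded (g ` closure U)"
    using U(3) by (intro compact_imp_bounded compact_continuous_image continuous_on_subset[OF assms]) auto
  then obtain B where B: "\<forall>x\<in>closure U. norm (g x) \<le> B" unfolding bounded_iff by auto
  show ?thesis
    by (rule L2_bounded[OF continuous_measurable_lebesgue_on[OF assms], of B]) (use B closure_subset in blast)
qed

lemma L2_smooth: "smooth g \<Longrightarrow> L2 M g"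
  by (rule L2_continuous[OF smooth_continuous])

lemma norm_L2_bounded:
  fixes g :: "plane \<Rightarrow> 'b::euclidean_space"
  assumes "g \<in> borel_measurable M" "\<And>x. x \<in> U \<Longrightarrow> norm (g x) \<le> B" "B \<ge> 0"
  shows "norm_L2 M g \<le> B * sqrt (measure lebesgue U)"
proof -
  have "norm_L2 M g \<le> norm_L2 M (\<lambda>x. B)"
    by (rule norm_L2_mono[OF L2_continuous assms(1)]) (use assms(2,3) in auto)
  also have "\<dots> = B * sqrt (measure lebesgue U)"
    using assms(3) Usets by (simp add: norm_L2_def real_sqrt_mult measure_restrict_space)
  finally show ?thesis .
qed

lemma L2_dense_continuous:
  fixes f :: "plane \<Rightarrow> 'b::euclidean_space"
  assumes f: "L2 M f" and \<eta>: "\<eta> > 0"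
  obtains g where "continuous_on UNIV g" "norm_L2 M (\<lambda>x. f x - g x) < \<eta>"
proof -
  have fm: "f \<in> borel_measurable M" by (rule L2D(1)[OF f])
  then have "f measurable_on U"
    using measurable_on_iff_borel_measurable[OF Usets] by blast
  then obtain N g where N: "negligible N" and g: "\<And>n. continuous_on UNIV (g n)"
    and lim: "\<And>x. x \<notin> N \<Longrightarrow> (\<lambda>n. g n x) \<longlonglongrightarrow> (if x \<in> U then f x else 0)"
    unfolding measurable_on_def by metis
  have cutm: "(\<lambda>x. cut (real (Suc m)) (f x)) \<in> borel_measurable M" for m
    using measurable_compose[OF fm borel_measurable_continuous_onI[OF cut_continuous]] by simp
  have cg: "continuous_on UNIV (\<lambda>x. cut (real (Suc m)) (g n x))" for m n
    by (rule continuous_on_compose2[OF cut_continuous g]) auto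
  have "(\<lambda>m. norm_L2 M (\<lambda>x. f x - cut (real (Suc m)) (f x))) \<longlonglongrightarrow> 0"
  proof (rule norm_L2_dominated[where w="\<lambda>x. (norm (f x))\<^sup>2"])
    fix m show "AE x in M. (norm (f x - cut (real (Suc m)) (f x)))\<^sup>2 \<le> (norm (f x))\<^sup>2"
      by (intro AE_I2 power_mono cut_diff) auto
  next
    show "AE x in M. (\<lambda>m. f x - cut (real (Suc m)) (f x)) \<longlonglongrightarrow> 0"
    proof (rule AE_I2)
      fix x
      obtain m0 :: nat where "norm (f x) \<le> m0" using real_arch_simple by blast
      then have "f x - cut (real (Suc m)) (f x) = 0" if "m \<ge> m0" for m
        using that by (subst cut_eq) auto
      then show "(\<lambda>m. f x - cut (real (Suc m)) (f x)) \<longlonglongrightarrow> 0"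
        by (intro tendsto_eventually eventually_sequentiallyI[of m0]) auto
    qed
  qed (use fm cutm L2D(2)[OF f] in auto)
  then have "\<exists>m. norm_L2 M (\<lambda>x. f x - cut (real (Suc m)) (f x)) < \<eta> / 2"
    using order_tendstoD(2)[of _ 0 sequentially "\<eta> / 2"] \<eta> by (auto simp: eventually_sequentially)
  then obtain m where m: "norm_L2 M (\<lambda>x. f x - cut (real (Suc m)) (f x)) < \<eta> / 2" by blast
  let ?C = "cut (real (Suc m)) :: 'b \<Rightarrow> 'b"
  have "(\<lambda>n. norm_L2 M (\<lambda>x. ?C (f x) - ?C (g n x))) \<longlonglongrightarrow> 0"
  proof (rule norm_L2_dominated[where w="\<lambda>x. (2 * real (Suc m))\<^sup>2"])
    fix n
    have "norm (?C (f x) - ?C (g n x)) \<le> 2 * real (Suc m)" for x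
      using norm_triangle_ineq4[of "?C (f x)" "?C (g n x)"] cut_bound[of "real (Suc m)" "f x"] cut_bound[of "real (Suc m)" "g n x"]
      by (simp add: add_mono)
    then show "AE x in M. (norm (?C (f x) - ?C (g n x)))\<^sup>2 \<le> (2 * real (Suc m))\<^sup>2"
      by (intro AE_I2 power_mono) auto
    show "(\<lambda>x. ?C (f x) - ?C (g n x)) \<in> borel_measurable M"
      using cutm[of m] continuous_measurable_lebesgue_on[OF cg[of m n]] by simp
  next
    have "AE x in lebesgue. x \<notin> N" using N by (simp add: negligible_iff_null_sets AE_not_in)
    then have "AE x in M. x \<notin> N"
      using Usets by (subst AE_restrict_space_iff) auto
    then show "AE x in M. (\<lambda>n. ?C (f x) - ?C (g n x)) \<longlonglongrightarrow> 0"
    proof (rule AE_mp, intro AE_I2 impI)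
      fix x assume x: "x \<in> space M" "x \<notin> N"
      have "isCont ?C (f x)" using cut_continuous[of "real (Suc m)", where ?'a='b] by (simp add: continuous_on_eq_continuous_at)
      then have "(\<lambda>n. ?C (g n x)) \<longlonglongrightarrow> ?C (f x)"
        using isCont_tendsto_compose[OF _ lim[OF x(2)]] x(1) by simp
      then show "(\<lambda>n. ?C (f x) - ?C (g n x)) \<longlonglongrightarrow> 0"
        using tendsto_diff[OF tendsto_const[of "?C (f x)"]] by fastforce
    qed
  qed (use finite_measure.integrable_const[OF fin] in auto)
  then have "\<exists>n. norm_L2 M (\<lambda>x. ?C (f x) - ?C (g n x)) < \<eta> / 2"
    using order_tendstoD(2)[of _ 0 sequentially "\<eta> / 2"] \<eta> by (auto simp: eventually_sequentially)
  then obtain n where n: "norm_L2 M (\<lambda>x. ?C (f x) - ?C (g n x)) < \<eta> / 2" by blast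
  have "L2 M (\<lambda>x. ?C (f x))" by (rule L2_bounded[OF cutm, of _ "real (Suc m)"]) (simp add: cut_bound)
  then have "norm_L2 M (\<lambda>x. f x - ?C (g n x)) < \<eta>"
    using norm_L2_triangle3[OF f _ L2_continuous[OF cg[of m n]]] m n by fastforce
  then show thesis using that[OF cg] by blast
qed

definition ctr :: "real \<Rightarrow> plane \<Rightarrow> plane" where
  "ctr \<epsilon> x = (1 - \<epsilon>) *\<^sub>R x + \<epsilon> *\<^sub>R c"

definition moll :: "real \<Rightarrow> (plane \<Rightarrow> 'b::euclidean_space) \<Rightarrow> plane \<Rightarrow> 'b" where
  "moll \<epsilon> f x = (\<integral>z. kern (\<epsilon> * \<rho> / 2) (z - ctr \<epsilon> x) *\<^sub>R f z \<partial>M)"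

lemma rad: "\<epsilon> > 0 \<Longrightarrow> \<epsilon> * \<rho> / 2 > 0" using \<rho> by simp

lemma kern_smooth_translate: "\<epsilon> > 0 \<Longrightarrow> smooth (\<lambda>z. kern (\<epsilon> * \<rho> / 2) (z - y))"
  using smooth_dilate[OF kern(1)[OF rad], of \<epsilon> 1 "- y"] by simp

lemma ctr_ball:
  assumes x: "x \<in> U" and e: "0 < \<epsilon>" "\<epsilon> < 1"
  shows "cball (ctr \<epsilon> x) (\<epsilon> * \<rho> / 2) \<subseteq> U"
proof
  fix y assume y: "y \<in> cball (ctr \<epsilon> x) (\<epsilon> * \<rho> / 2)"
  let ?w = "(y - ctr \<epsilon> x) /\<^sub>R \<epsilon>"
  have "norm (y - ctr \<epsilon> x) \<le> \<epsilon> * \<rho> / 2" using y by (simp add: dist_norm norm_minus_commute)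
  also have "\<dots> < \<epsilon> * \<rho>" using e \<rho> by simp
  finally have "norm (y - ctr \<epsilon> x) / \<epsilon> < \<rho>" using e by (simp add: field_simps)
  then have "norm ?w < \<rho>" using e by (simp add: divide_inverse mult.commute)
  then have "c + ?w \<in> U" using \<rho>(2) by (auto simp: dist_norm)
  then have "(1 - \<epsilon>) *\<^sub>R x + \<epsilon> *\<^sub>R (c + ?w) \<in> U"
    using U(2) x e by (intro convexD_alt) auto
  also have "(1 - \<epsilon>) *\<^sub>R x + \<epsilon> *\<^sub>R (c + ?w) = y"
    using e by (simp add: ctr_def scaleR_add_right)
  finally show "y \<in> U" .
qed

lemma kern_test:
  assumes x: "x \<in> U" and e: "0 < \<epsilon>" "\<epsilon> < 1"
  shows "test_function U (\<lambda>z. kern (\<epsilon> * \<rho> / 2) (z - ctr \<epsilon> x))"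
proof -
  let ?S = "{z. kern (\<epsilon> * \<rho> / 2) (z - ctr \<epsilon> x) \<noteq> 0}"
  have "?S \<subseteq> cball (ctr \<epsilon> x) (\<epsilon> * \<rho> / 2)"
    using kern(3)[OF rad[OF e(1)]] by (auto simp: dist_norm norm_minus_commute) (metis not_le norm_minus_commute)
  then have "closure ?S \<subseteq> cball (ctr \<epsilon> x) (\<epsilon> * \<rho> / 2)" by (simp add: closure_minimal)
  moreover from this have "compact (closure ?S)"
    using bounded_subset[OF bounded_cball] by (simp add: compact_eq_bounded_closed)
  ultimately show ?thesis
    using ctr_ball[OF assms] kern_smooth_translate[OF e(1)] unfolding test_function_def by auto
qed

lemma kern_mass:
  assumes x: "x \<in> U" and e: "0 < \<epsilon>" "\<epsilon> < 1"
  shows "(\<integral>z. kern (\<epsilon> * \<rho> / 2) (z - ctr \<epsilon> x) \<partial>M) = 1"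
    "integrable M (\<lambda>z. kern (\<epsilon> * \<rho> / 2) (z - ctr \<epsilon> x))"
proof -
  let ?k = "kern (\<epsilon> * \<rho> / 2)"
  note k = kern[OF rad[OF e(1)]]
  have m: "?k \<in> borel_measurable borel" by (rule borel_measurable_continuous_onI[OF smooth_continuous[OF k(1)]])
  have m': "(\<lambda>z. ?k (z - ctr \<epsilon> x)) \<in> borel_measurable borel"
    by (rule borel_measurable_continuous_onI[OF smooth_continuous[OF kern_smooth_translate[OF e(1)]]])
  have "(\<integral>z. ?k (z - ctr \<epsilon> x) \<partial>M) = (\<integral>z. ?k (z - ctr \<epsilon> x) \<partial>lebesgue)"
    by (rule integral_lebesgue_on_extend[OF Usets]) (rule test_function_outside(1)[OF kern_test[OF assms]])
  also have "\<dots> = (\<integral>z. ?k (z - ctr \<epsilon> x) \<partial>lborel)" by (rule integral_completion) (use m' in simp)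
  also have "\<dots> = (\<integral>z. ?k z \<partial>distr lborel borel ((+) (- ctr \<epsilon> x)))"
    using m by (subst integral_distr) (auto simp: add.commute)
  also have "\<dots> = (\<integral>z. ?k z \<partial>lborel)" by (simp add: lborel_distr_plus)
  also have "\<dots> = (\<integral>z. ?k z \<partial>lebesgue)" by (rule integral_completion[symmetric]) (use m in simp)
  finally show "(\<integral>z. ?k (z - ctr \<epsilon> x) \<partial>M) = 1" using k by simp
  show "integrable M (\<lambda>z. ?k (z - ctr \<epsilon> x))"
    by (rule L2_integrable[OF L2_smooth[OF kern_smooth_translate[OF e(1)]]])
qed

lemma moll_integrable:
  fixes f :: "plane \<Rightarrow> 'b::euclidean_space"
  assumes "\<epsilon> > 0" "L2 M f"
  shows "integrable M (\<lambda>z. kern (\<epsilon> * \<rho> / 2) (z - y) *\<^sub>R f z)"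
  by (rule kernel_integrable[OF idm_lebesgue_on L2_integrable[OF assms(2)] smooth_continuous[OF kern(1)] kern(3)])
     (rule rad[OF assms(1)])+

lemma moll_smooth:
  assumes e: "\<epsilon> > 0" and f: "L2 M f"
  shows "smooth (moll \<epsilon> f)"
  unfolding moll_def[abs_def] ctr_def
  by (rule kernel_smooth[OF idm_lebesgue_on L2_integrable[OF f] kern(1) kern(3)]) (rule rad[OF e])+

lemma moll_diff:
  assumes e: "\<epsilon> > 0" and f: "L2 M f" and g: "L2 M g"
  shows "moll \<epsilon> (\<lambda>x. f x - g x) x = moll \<epsilon> f x - moll \<epsilon> g x"
  unfolding moll_def scaleR_diff_right
  by (rule Bochner_Integration.integral_diff) (intro moll_integrable e f g)+

lemma moll_pdiff:
  assumes f: "L2 M f" and g: "is_weak_deriv U [i] f g"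
    and x: "x \<in> U" and e: "0 < \<epsilon>" "\<epsilon> < 1"
  shows "pdiff i (moll \<epsilon> f) x = (1 - \<epsilon>) *\<^sub>R moll \<epsilon> g x"
proof -
  let ?k = "kern (\<epsilon> * \<rho> / 2)"
  note k = kern[OF rad[OF e(1)]]
  have "pdiff i (moll \<epsilon> f) x = (- (1 - \<epsilon>)) *\<^sub>R (\<integral>z. pdiff i ?k (z - ctr \<epsilon> x) *\<^sub>R f z \<partial>M)"
    unfolding moll_def[abs_def] ctr_def
    by (rule fun_cong[OF kernel_pdiff[OF idm_lebesgue_on L2_integrable[OF f] k(1) k(3)]])
  also have "(\<lambda>z. pdiff i ?k (z - ctr \<epsilon> x)) = pdiff i (\<lambda>z. ?k (z - ctr \<epsilon> x))"
    using pdiff_dilate[where f="?k" and s=1 and c="- ctr \<epsilon> x", OF smooth_differentiable[OF k(1)]] by auto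
  then have "(\<integral>z. pdiff i ?k (z - ctr \<epsilon> x) *\<^sub>R f z \<partial>M) = (\<integral>z. pdiffs [i] (\<lambda>z. ?k (z - ctr \<epsilon> x)) z *\<^sub>R f z \<partial>M)"
    by (simp add: fun_eq_iff)
  also have "\<dots> = - (\<integral>z. ?k (z - ctr \<epsilon> x) *\<^sub>R g z \<partial>M)"
    using g kern_test[OF x e] unfolding is_weak_deriv_def by simp
  finally show ?thesis by (simp add: moll_def[of \<epsilon> g x] algebra_simps)
qed

lemma moll_Jensen:
  fixes f :: "plane \<Rightarrow> 'b::euclidean_space"
  assumes f: "L2 M f" and x: "x \<in> U" and e: "0 < \<epsilon>" "\<epsilon> < 1"
  shows "(norm (moll \<epsilon> f x))\<^sup>2 \<le> (\<integral>z. kern (\<epsilon> * \<rho> / 2) (z - ctr \<epsilon> x) * (norm (f z))\<^sup>2 \<partial>M)"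
    "integrable M (\<lambda>z. kern (\<epsilon> * \<rho> / 2) (z - ctr \<epsilon> x) * (norm (f z))\<^sup>2)"
proof -
  let ?k = "\<lambda>z. kern (\<epsilon> * \<rho> / 2) (z - ctr \<epsilon> x)"
  note k0 = kern(2)[OF rad[OF e(1)]]
  show int: "integrable M (\<lambda>z. ?k z * (norm (f z))\<^sup>2)"
    using kernel_integrable[OF idm_lebesgue_on L2D(2)[OF f] smooth_continuous[OF kern(1)[OF rad[OF e(1)]]] kern(3)[OF rad[OF e(1)]], of "ctr \<epsilon> x"]
    by simp
  have km: "?k \<in> borel_measurable M"
    by (rule continuous_measurable_lebesgue_on[OF smooth_continuous[OF kern_smooth_translate[OF e(1)]]])
  have a: "L2 M (\<lambda>z. sqrt (?k z))"
    using kern_mass(2)[OF x e] km k0 by (simp add: L2_def)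
  have b: "L2 M (\<lambda>z. sqrt (?k z) * norm (f z))"
    using int km k0 L2D(1)[OF f] by (simp add: L2_def power_mult_distrib)
  have na: "norm_L2 M (\<lambda>z. sqrt (?k z)) = 1" using kern_mass(1)[OF x e] k0 by (simp add: norm_L2_def)
  have "norm (moll \<epsilon> f x) \<le> (\<integral>z. norm (?k z *\<^sub>R f z) \<partial>M)"
    unfolding moll_def by (rule integral_norm_bound)
  also have "\<dots> = (\<integral>z. norm (sqrt (?k z)) * norm (sqrt (?k z) * norm (f z)) \<partial>M)"
  proof (rule Bochner_Integration.integral_cong[OF refl])
    fix z
    have "sqrt (?k z) * (sqrt (?k z) * norm (f z)) = ?k z * norm (f z)"
      using k0 by (metis mult.assoc real_sqrt_mult_self abs_of_nonneg)
    then show "norm (?k z *\<^sub>R f z) = norm (sqrt (?k z)) * norm (sqrt (?k z) * norm (f z))"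
      using k0 by simp
  qed
  also have "\<dots> \<le> norm_L2 M (\<lambda>z. sqrt (?k z)) * norm_L2 M (\<lambda>z. sqrt (?k z) * norm (f z))"
    by (rule L2_Cauchy_Schwarz[OF a b])
  finally have "norm (moll \<epsilon> f x) \<le> norm_L2 M (\<lambda>z. sqrt (?k z) * norm (f z))" by (simp add: na)
  then have "(norm (moll \<epsilon> f x))\<^sup>2 \<le> (norm_L2 M (\<lambda>z. sqrt (?k z) * norm (f z)))\<^sup>2" by (rule power_mono) simp
  also have "\<dots> = (\<integral>z. ?k z * (norm (f z))\<^sup>2 \<partial>M)"
    using k0 by (simp add: norm_L2_sq power_mult_distrib)
  finally show "(norm (moll \<epsilon> f x))\<^sup>2 \<le> (\<integral>z. ?k z * (norm (f z))\<^sup>2 \<partial>M)" .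
qed

lemma moll_bound:
  fixes f :: "plane \<Rightarrow> 'b::euclidean_space"
  assumes f: "L2 M f" and e: "0 < \<epsilon>" "\<epsilon> \<le> 1 / 2"
  shows "norm_L2 M (moll \<epsilon> f) \<le> 2 * norm_L2 M f"
proof (rule power2_le_imp_le)
  let ?k = "kern (\<epsilon> * \<rho> / 2)"
  note k0 = kern(2)[OF rad[OF e(1)]]
  have e1: "\<epsilon> < 1" using e by simp
  interpret M: finite_measure M by (rule fin)
  interpret MM: pair_sigma_finite M M ..
  have kc: "continuous_on UNIV ?k" by (rule smooth_continuous[OF kern(1)[OF rad[OF e(1)]]])
  have mk: "?k \<in> borel_measurable borel" by (rule borel_measurable_continuous_onI[OF kc])
  have [measurable]: "(\<lambda>p. fst p) \<in> borel_measurable (M \<Otimes>\<^sub>M M)" "(\<lambda>p. snd p) \<in> borel_measurable (M \<Otimes>\<^sub>M M)"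
    using measurable_compose[OF measurable_fst idm_lebesgue_on] measurable_compose[OF measurable_snd idm_lebesgue_on] by auto
  have kk: "(\<lambda>p. ?k (snd p - ctr \<epsilon> (fst p))) \<in> borel_measurable (M \<Otimes>\<^sub>M M)"
    unfolding ctr_def by (rule measurable_compose[OF _ mk]) measurable
  have [measurable]: "f \<in> borel_measurable M" by (rule L2D(1)[OF f])
  have jm: "(\<lambda>p. ennreal (?k (snd p - ctr \<epsilon> (fst p)) * (norm (f (snd p)))\<^sup>2)) \<in> borel_measurable (M \<Otimes>\<^sub>M M)"
    using kk by measurable
  have "ennreal ((norm_L2 M (moll \<epsilon> f))\<^sup>2) = (\<integral>\<^sup>+x. ennreal ((norm (moll \<epsilon> f x))\<^sup>2) \<partial>M)"
    unfolding norm_L2_sq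
    by (rule nn_integral_eq_integral[symmetric]) (use L2D(2)[OF L2_smooth[OF moll_smooth[OF e(1) f]]] in auto)
  also have "\<dots> \<le> (\<integral>\<^sup>+x. (\<integral>\<^sup>+z. ennreal (?k (z - ctr \<epsilon> x) * (norm (f z))\<^sup>2) \<partial>M) \<partial>M)"
  proof (rule nn_integral_mono)
    fix x assume "x \<in> space M"
    then have x: "x \<in> U" by simp
    have "(\<integral>\<^sup>+z. ennreal (?k (z - ctr \<epsilon> x) * (norm (f z))\<^sup>2) \<partial>M) = ennreal (\<integral>z. ?k (z - ctr \<epsilon> x) * (norm (f z))\<^sup>2 \<partial>M)"
      by (rule nn_integral_eq_integral[OF moll_Jensen(2)[OF f x e(1) e1]]) (use k0 in auto)
    then show "ennreal ((norm (moll \<epsilon> f x))\<^sup>2) \<le> (\<integral>\<^sup>+z. ennreal (?k (z - ctr \<epsilon> x) * (norm (f z))\<^sup>2) \<partial>M)"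
      using moll_Jensen(1)[OF f x e(1) e1] by (simp add: ennreal_leI)
  qed
  also have "\<dots> = (\<integral>\<^sup>+z. (\<integral>\<^sup>+x. ennreal (?k (z - ctr \<epsilon> x) * (norm (f z))\<^sup>2) \<partial>M) \<partial>M)"
    using MM.Fubini'[of "\<lambda>x z. ennreal (?k (z - ctr \<epsilon> x) * (norm (f z))\<^sup>2)"] jm by (simp add: case_prod_unfold)
  also have "\<dots> \<le> (\<integral>\<^sup>+z. ennreal (4 * (norm (f z))\<^sup>2) \<partial>M)"
  proof (rule nn_integral_mono)
    fix z
    have m1: "(\<lambda>x. ?k (z - ctr \<epsilon> x)) \<in> borel_measurable borel"
      unfolding ctr_def by (rule borel_measurable_continuous_onI, rule continuous_on_compose2[OF kc]) (auto intro!: continuous_intros)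
    have "(\<integral>\<^sup>+x. ennreal (?k (z - ctr \<epsilon> x)) \<partial>M) \<le> (\<integral>\<^sup>+x. ennreal (?k (z - ctr \<epsilon> x)) \<partial>lebesgue)"
      using Usets by (subst nn_integral_restrict_space) (auto intro!: nn_integral_mono simp: indicator_def)
    also have "\<dots> = (\<integral>\<^sup>+x. ennreal (?k (z - ctr \<epsilon> x)) \<partial>lborel)"
      using m1 by (subst nn_integral_completion) auto
    also have "\<dots> = (\<integral>\<^sup>+x. ennreal (?k ((z - \<epsilon> *\<^sub>R c) + (- (1 - \<epsilon>)) *\<^sub>R x)) \<partial>lborel)"
      by (simp add: ctr_def algebra_simps)
    also have "\<dots> = ennreal (1 / (- (1 - \<epsilon>))\<^sup>2)"
      by (rule kern_nn_integral[OF rad[OF e(1)]]) (use e1 in simp)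
    also have "\<dots> \<le> ennreal 4"
    proof (rule ennreal_leI)
      have "(1 / 2)\<^sup>2 \<le> (1 - \<epsilon>)\<^sup>2" using e by (intro power_mono) auto
      then have "1 / (1 - \<epsilon>)\<^sup>2 \<le> 1 / (1 / 2)\<^sup>2" by (intro divide_left_mono) (use e1 in \<open>auto simp: power2_eq_square\<close>)
      then show "1 / (- (1 - \<epsilon>))\<^sup>2 \<le> 4" by (simp add: power2_eq_square algebra_simps)
    qed
    finally have le: "(\<integral>\<^sup>+x. ennreal (?k (z - ctr \<epsilon> x)) \<partial>M) \<le> ennreal 4" .
    have "(\<integral>\<^sup>+x. ennreal (?k (z - ctr \<epsilon> x) * (norm (f z))\<^sup>2) \<partial>M) = (\<integral>\<^sup>+x. ennreal (?k (z - ctr \<epsilon> x)) * ennreal ((norm (f z))\<^sup>2) \<partial>M)"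
      using k0 by (simp add: ennreal_mult)
    also have "\<dots> = (\<integral>\<^sup>+x. ennreal (?k (z - ctr \<epsilon> x)) \<partial>M) * ennreal ((norm (f z))\<^sup>2)"
      using m1 by (intro nn_integral_multc) (auto intro!: measurable_compose[OF idm_lebesgue_on, of "\<lambda>x. ennreal (?k (z - ctr \<epsilon> x))" borel])
    also have "\<dots> \<le> ennreal 4 * ennreal ((norm (f z))\<^sup>2)" by (rule mult_right_mono[OF le]) simp
    finally show "(\<integral>\<^sup>+x. ennreal (?k (z - ctr \<epsilon> x) * (norm (f z))\<^sup>2) \<partial>M) \<le> ennreal (4 * (norm (f z))\<^sup>2)"
      by (simp add: ennreal_mult)
  qed
  also have "\<dots> = ennreal (\<integral>z. 4 * (norm (f z))\<^sup>2 \<partial>M)"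
    by (rule nn_integral_eq_integral) (use L2D(2)[OF f] in auto)
  also have "(\<integral>z. 4 * (norm (f z))\<^sup>2 \<partial>M) = (2 * norm_L2 M f)\<^sup>2"
    by (simp add: power_mult_distrib norm_L2_sq)
  finally show "(norm_L2 M (moll \<epsilon> f))\<^sup>2 \<le> (2 * norm_L2 M f)\<^sup>2"
    by (subst (asm) ennreal_le_iff) auto
qed simp

lemma moll_uniform:
  fixes g :: "plane \<Rightarrow> 'b::euclidean_space"
  assumes g: "continuous_on UNIV g" and \<eta>: "\<eta> > 0"
  obtains \<epsilon>0 where "\<epsilon>0 > 0" "\<And>\<epsilon> x. 0 < \<epsilon> \<Longrightarrow> \<epsilon> < \<epsilon>0 \<Longrightarrow> \<epsilon> < 1 \<Longrightarrow> x \<in> U \<Longrightarrow> norm (moll \<epsilon> g x - g x) \<le> \<eta>"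
proof -
  obtain B where B: "\<And>x. x \<in> U \<Longrightarrow> norm x \<le> B" using U(3) unfolding bounded_iff by auto
  have cU: "c \<in> U" using \<rho> by auto
  have B0: "B \<ge> 0" using B[OF cU] norm_ge_zero order_trans by blast
  have "uniformly_continuous_on (cball 0 B) g"
    by (intro compact_uniformly_continuous continuous_on_subset[OF g]) auto
  then obtain d where d: "d > 0" "\<And>x y. x \<in> cball 0 B \<Longrightarrow> y \<in> cball 0 B \<Longrightarrow> dist y x < d \<Longrightarrow> dist (g y) (g x) < \<eta>"
    using \<eta> unfolding uniformly_continuous_on_def by metis
  let ?R = "\<rho> + 2 * B"
  have R: "?R > 0" using \<rho> B0 by simp
  show thesis
  proof (rule that[of "d / ?R"])
    show "d / ?R > 0" using d R by simp
    fix \<epsilon> x assume e: "0 < \<epsilon>" "\<epsilon> < d / ?R" "\<epsilon> < 1" and x: "x \<in> U"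
    let ?k = "\<lambda>z. kern (\<epsilon> * \<rho> / 2) (z - ctr \<epsilon> x)"
    note k0 = kern(2)[OF rad[OF e(1)]]
    have gi: "integrable M (\<lambda>z. ?k z *\<^sub>R g z)" by (rule moll_integrable[OF e(1) L2_continuous[OF g]])
    have gx: "integrable M (\<lambda>z. ?k z *\<^sub>R g x)" using kern_mass(2)[OF x e(1,3)] by simp
    have "moll \<epsilon> g x - g x = (\<integral>z. ?k z *\<^sub>R g z \<partial>M) - (\<integral>z. ?k z *\<^sub>R g x \<partial>M)"
      using kern_mass[OF x e(1,3)] by (simp add: moll_def)
    also have "\<dots> = (\<integral>z. ?k z *\<^sub>R (g z - g x) \<partial>M)"
      by (subst Bochner_Integration.integral_diff[OF gi gx, symmetric]) (simp add: scaleR_diff_right)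
    finally have eq: "moll \<epsilon> g x - g x = (\<integral>z. ?k z *\<^sub>R (g z - g x) \<partial>M)" .
    have "norm (moll \<epsilon> g x - g x) \<le> (\<integral>z. norm (?k z *\<^sub>R (g z - g x)) \<partial>M)"
      unfolding eq by (rule integral_norm_bound)
    also have "\<dots> \<le> (\<integral>z. ?k z * \<eta> \<partial>M)"
    proof (rule integral_mono)
      show "integrable M (\<lambda>z. norm (?k z *\<^sub>R (g z - g x)))"
        using gi gx by (simp add: scaleR_diff_right del: norm_scaleR)
      show "integrable M (\<lambda>z. ?k z * \<eta>)" using kern_mass(2)[OF x e(1,3)] by simp
      fix z assume "z \<in> space M"
      then have z: "z \<in> U" by simp
      show "norm (?k z *\<^sub>R (g z - g x)) \<le> ?k z * \<eta>"
      proof (cases "norm (z - ctr \<epsilon> x) > \<epsilon> * \<rho> / 2")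
        case True
        then have "?k z = 0" using kern(3)[OF rad[OF e(1)]] by blast
        then show ?thesis by simp
      next
        case False
        have "z - x = (z - ctr \<epsilon> x) + \<epsilon> *\<^sub>R (c - x)" by (simp add: ctr_def algebra_simps)
        then have "norm (z - x) \<le> norm (z - ctr \<epsilon> x) + norm (\<epsilon> *\<^sub>R (c - x))" by (metis norm_triangle_ineq)
        also have "norm (\<epsilon> *\<^sub>R (c - x)) \<le> \<epsilon> * (2 * B)"
          using e B[OF cU] B[OF x] norm_triangle_ineq4[of c x] by simp
        also have "norm (z - ctr \<epsilon> x) \<le> \<epsilon> * \<rho>" using False rad[OF e(1)] by simp
        finally have "norm (z - x) \<le> \<epsilon> * ?R" by (simp add: algebra_simps)
        also have "\<dots> < d" using e(2) R by (simp add: field_simps)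
        finally have "dist (g z) (g x) < \<eta>" using d(2)[of x z] B[OF x] B[OF z] by (simp add: dist_norm)
        then show ?thesis using k0[of "z - ctr \<epsilon> x"] by (simp add: dist_norm mult_left_mono)
      qed
    qed
    also have "\<dots> = \<eta>" using kern_mass[OF x e(1,3)] by simp
    finally show "norm (moll \<epsilon> g x - g x) \<le> \<eta>" .
  qed
qed

definition eps_seq :: "nat \<Rightarrow> real" where "eps_seq n = inverse (real (Suc (Suc n)))"

lemma eps_seq: "0 < eps_seq n" "eps_seq n \<le> 1 / 2" "eps_seq n < 1" "eps_seq \<longlonglongrightarrow> 0"
proof -
  show "0 < eps_seq n" by (simp add: eps_seq_def)
  show "eps_seq n \<le> 1 / 2" by (simp add: eps_seq_def field_simps)
  then show "eps_seq n < 1" by simp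
  have "(\<lambda>n. inverse (real (Suc (Suc n)))) \<longlonglongrightarrow> 0"
    using LIMSEQ_Suc[OF LIMSEQ_inverse_real_of_nat] .
  then show "eps_seq \<longlonglongrightarrow> 0" by (simp add: eps_seq_def[abs_def])
qed

lemma moll_tendsto:
  fixes f :: "plane \<Rightarrow> 'b::euclidean_space"
  assumes f: "L2 M f"
  shows "(\<lambda>n. norm_L2 M (\<lambda>x. moll (eps_seq n) f x - f x)) \<longlonglongrightarrow> 0"
proof (rule LIMSEQ_I)
  fix r :: real assume r: "r > 0"
  define S where "S = sqrt (measure lebesgue U) + 1"
  have S: "S > 0" "sqrt (measure lebesgue U) \<le> S" by (auto simp: S_def add_nonneg_pos)
  obtain g where g: "continuous_on UNIV g" "norm_L2 M (\<lambda>x. f x - g x) < r / 4"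
    using L2_dense_continuous[OF f, of "r / 4"] r by auto
  have gL: "L2 M g" by (rule L2_continuous[OF g(1)])
  have "r / (8 * S) > 0" using r S by simp
  then obtain \<epsilon>0 where e0: "\<epsilon>0 > 0" "\<And>\<epsilon> x. 0 < \<epsilon> \<Longrightarrow> \<epsilon> < \<epsilon>0 \<Longrightarrow> \<epsilon> < 1 \<Longrightarrow> x \<in> U \<Longrightarrow> norm (moll \<epsilon> g x - g x) \<le> r / (8 * S)"
    using moll_uniform[OF g(1)] by blast
  obtain N where N: "\<And>n. n \<ge> N \<Longrightarrow> eps_seq n < \<epsilon>0"
    using order_tendstoD(2)[OF eps_seq(4) e0(1)] by (auto simp: eventually_sequentially)
  show "\<exists>N. \<forall>n\<ge>N. norm (norm_L2 M (\<lambda>x. moll (eps_seq n) f x - f x) - 0) < r"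
  proof (intro exI[of _ N] allI impI)
    fix n assume n: "n \<ge> N"
    let ?e = "eps_seq n"
    note mf = L2_smooth[OF moll_smooth[OF eps_seq(1)[of n] f]] and mg = L2_smooth[OF moll_smooth[OF eps_seq(1)[of n] gL]]
    have md: "moll ?e (\<lambda>x. f x - g x) = (\<lambda>x. moll ?e f x - moll ?e g x)"
      by (rule ext) (rule moll_diff[OF eps_seq(1) f gL])
    have a: "norm_L2 M (\<lambda>x. moll ?e f x - moll ?e g x) \<le> 2 * (r / 4)"
      using moll_bound[OF L2_diff[OF f gL] eps_seq(1,2)[of n]] g(2)
      by (simp add: md)
    have "norm_L2 M (\<lambda>x. moll ?e g x - g x) \<le> r / (8 * S) * sqrt (measure lebesgue U)"
      by (rule norm_L2_bounded) (use L2D(1)[OF L2_diff[OF mg gL]] e0(2)[OF eps_seq(1) N[OF n] eps_seq(3)] r S in auto)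
    also have "\<dots> \<le> r / (8 * S) * S" by (rule mult_left_mono) (use r S in auto)
    also have "\<dots> = r / 8" using S by simp
    finally have b: "norm_L2 M (\<lambda>x. moll ?e g x - g x) \<le> r / 8" .
    have "norm_L2 M (\<lambda>x. moll ?e f x - f x) \<le> norm_L2 M (\<lambda>x. moll ?e f x - moll ?e g x) + norm_L2 M (\<lambda>x. moll ?e g x - f x)"
      by (rule norm_L2_triangle3[OF mf mg f])
    also have "norm_L2 M (\<lambda>x. moll ?e g x - f x) \<le> norm_L2 M (\<lambda>x. moll ?e g x - g x) + norm_L2 M (\<lambda>x. g x - f x)"
      by (rule norm_L2_triangle3[OF mg gL f])
    finally have "norm_L2 M (\<lambda>x. moll ?e f x - f x) < r"
      using a b g(2) r by (simp add: norm_L2_commute[of M g f])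
    then show "norm (norm_L2 M (\<lambda>x. moll ?e f x - f x) - 0) < r" by simp
  qed
qed

lemma fundamental_lemma:
  fixes g :: "plane \<Rightarrow> 'b::euclidean_space"
  assumes g: "L2 M g" and z: "\<And>\<psi>. test_function U \<psi> \<Longrightarrow> (\<integral>x. \<psi> x *\<^sub>R g x \<partial>M) = 0"
  shows "AE x in M. g x = 0"
proof -
  have "moll (eps_seq n) g x = 0" if "x \<in> U" for n x
    unfolding moll_def by (rule z[OF kern_test[OF that eps_seq(1,3)]])
  then have "norm_L2 M (\<lambda>x. moll (eps_seq n) g x - g x) = norm_L2 M g" for n
    by (subst norm_L2_cong[of M _ "\<lambda>x. - g x"]) auto
  then have "norm_L2 M g = 0" using moll_tendsto[OF g] by (simp add: LIMSEQ_const_iff)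
  then show ?thesis by (rule norm_L2_zero_AE[OF g])
qed

end

(* PART 4 *)

context starlike
begin

lemma test_integrable:
  fixes g :: "plane \<Rightarrow> 'b::euclidean_space"
  assumes "test_function U \<psi>" "L2 M g"
  shows "integrable M (\<lambda>x. \<psi> x *\<^sub>R g x)"
proof -
  obtain R where R: "\<forall>x. norm x > R \<longrightarrow> \<psi> x = 0" using test_function_bounded[OF assms(1)] by blast
  have "smooth \<psi>" using assms(1) by (simp add: test_function_def)
  from kernel_integrable[OF idm_lebesgue_on L2_integrable[OF assms(2)] smooth_continuous[OF this] R, of 0]
  show ?thesis by simp
qed

lemma test_function_pdiffs: "test_function V \<psi> \<Longrightarrow> test_function V (pdiffs \<alpha> \<psi>)"
  by (induction \<alpha>) (auto intro: test_function_pdiff)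

lemma weak_deriv_unique:
  fixes f :: "plane \<Rightarrow> 'b::euclidean_space"
  assumes "L2 M g" "L2 M g'" "is_weak_deriv U \<alpha> f g" "is_weak_deriv U \<alpha> f g'"
  shows "AE x in M. g x = g' x"
proof -
  have "AE x in M. g x - g' x = 0"
  proof (rule fundamental_lemma[OF L2_diff[OF assms(1,2)]])
    fix \<psi> assume \<psi>: "test_function U \<psi>"
    have "(-1) ^ length \<alpha> *\<^sub>R (\<integral>x. \<psi> x *\<^sub>R g x \<partial>M) = (-1) ^ length \<alpha> *\<^sub>R (\<integral>x. \<psi> x *\<^sub>R g' x \<partial>M)"
      using assms(3)[unfolded is_weak_deriv_def, rule_format, OF \<psi>]
        assms(4)[unfolded is_weak_deriv_def, rule_format, OF \<psi>] by (rule trans[OF sym])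
    then have "(\<integral>x. \<psi> x *\<^sub>R g x \<partial>M) = (\<integral>x. \<psi> x *\<^sub>R g' x \<partial>M)" by simp
    then show "(\<integral>x. \<psi> x *\<^sub>R (g x - g' x) \<partial>M) = 0"
      using test_integrable[OF \<psi> assms(1)] test_integrable[OF \<psi> assms(2)] by (simp add: scaleR_diff_right)
  qed
  then show ?thesis by simp
qed

lemma weak_deriv_AE:
  fixes f :: "plane \<Rightarrow> 'b::euclidean_space"
  assumes "L2 M g" "is_weak_deriv U \<alpha> f g"
  shows "L2 M (weak_deriv U \<alpha> f)" "is_weak_deriv U \<alpha> f (weak_deriv U \<alpha> f)"
    "AE x in M. weak_deriv U \<alpha> f x = g x"
    "norm_L2 M (weak_deriv U \<alpha> f) = norm_L2 M g"
proof -
  have "\<exists>g. L2 M g \<and> is_weak_deriv U \<alpha> f g" using assms by blast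
  from someI_ex[OF this] show a: "L2 M (weak_deriv U \<alpha> f)" "is_weak_deriv U \<alpha> f (weak_deriv U \<alpha> f)"
    unfolding weak_deriv_def by auto
  show b: "AE x in M. weak_deriv U \<alpha> f x = g x" by (rule weak_deriv_unique[OF a(1) assms(1) a(2) assms(2)])
  show "norm_L2 M (weak_deriv U \<alpha> f) = norm_L2 M g"
    by (rule norm_L2_cong_AE[OF L2D(1)[OF a(1)] L2D(1)[OF assms(1)] b])
qed

lemma sobolev_weak_deriv:
  assumes "f \<in> sobolev m U" "length \<alpha> \<le> m"
  shows "L2 M (weak_deriv U \<alpha> f)" "is_weak_deriv U \<alpha> f (weak_deriv U \<alpha> f)"
proof -
  obtain g where "L2 M g" "is_weak_deriv U \<alpha> f g" using assms unfolding sobolev_def by blast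
  from weak_deriv_AE(1,2)[OF this] show "L2 M (weak_deriv U \<alpha> f)" "is_weak_deriv U \<alpha> f (weak_deriv U \<alpha> f)" .
qed

lemma is_weak_deriv_linear:
  fixes f :: "plane \<Rightarrow> 'b::euclidean_space" and T :: "'b \<Rightarrow> 'c::euclidean_space"
  assumes T: "bounded_linear T" and f: "L2 M f" and g: "L2 M g" and w: "is_weak_deriv U \<alpha> f g"
  shows "is_weak_deriv U \<alpha> (\<lambda>x. T (f x)) (\<lambda>x. T (g x))"
  unfolding is_weak_deriv_def
proof (intro allI impI)
  fix \<psi> assume \<psi>: "test_function U \<psi>"
  interpret T: bounded_linear T by (rule T)
  have "(\<integral>x. pdiffs \<alpha> \<psi> x *\<^sub>R T (f x) \<partial>M) = T (\<integral>x. pdiffs \<alpha> \<psi> x *\<^sub>R f x \<partial>M)"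
    using integral_bounded_linear[OF T test_integrable[OF test_function_pdiffs[OF \<psi>] f], of \<alpha>] by (simp add: T.scaleR)
  also have "\<dots> = (-1) ^ length \<alpha> *\<^sub>R T (\<integral>x. \<psi> x *\<^sub>R g x \<partial>M)"
    using w \<psi> unfolding is_weak_deriv_def by (simp add: T.scaleR)
  also have "T (\<integral>x. \<psi> x *\<^sub>R g x \<partial>M) = (\<integral>x. \<psi> x *\<^sub>R T (g x) \<partial>M)"
    using integral_bounded_linear[OF T test_integrable[OF \<psi> g]] by (simp add: T.scaleR)
  finally show "(\<integral>x. pdiffs \<alpha> \<psi> x *\<^sub>R T (f x) \<partial>M) = (-1) ^ length \<alpha> *\<^sub>R (\<integral>x. \<psi> x *\<^sub>R T (g x) \<partial>M)" .
qed

lemma is_weak_deriv_add: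
  fixes f :: "plane \<Rightarrow> 'b::euclidean_space"
  assumes "L2 M f" "L2 M g" "is_weak_deriv U \<alpha> f g" "L2 M f'" "L2 M g'" "is_weak_deriv U \<alpha> f' g'"
  shows "is_weak_deriv U \<alpha> (\<lambda>x. f x + f' x) (\<lambda>x. g x + g' x)"
  unfolding is_weak_deriv_def
proof (intro allI impI)
  fix \<psi> assume \<psi>: "test_function U \<psi>"
  note ti = test_integrable[OF test_function_pdiffs[OF \<psi>]] test_integrable[OF \<psi>]
  show "(\<integral>x. pdiffs \<alpha> \<psi> x *\<^sub>R (f x + f' x) \<partial>M) = (-1) ^ length \<alpha> *\<^sub>R (\<integral>x. \<psi> x *\<^sub>R (g x + g' x) \<partial>M)"
    using assms \<psi> ti[OF assms(1)] ti[OF assms(2)] ti[OF assms(4)] ti[OF assms(5)]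
    unfolding is_weak_deriv_def by (simp add: scaleR_add_right)
qed

lemma is_weak_deriv_diff:
  fixes f :: "plane \<Rightarrow> 'b::euclidean_space"
  assumes "L2 M f" "L2 M g" "is_weak_deriv U \<alpha> f g" "L2 M f'" "L2 M g'" "is_weak_deriv U \<alpha> f' g'"
  shows "is_weak_deriv U \<alpha> (\<lambda>x. f x - f' x) (\<lambda>x. g x - g' x)"
  using is_weak_deriv_add[OF assms(1-3) L2_minus[OF assms(4)] L2_minus[OF assms(5)]
      is_weak_deriv_linear[OF bounded_linear_minus[OF bounded_linear_ident] assms(4-6)]] by simp

lemma is_weak_deriv_cong:
  assumes "\<And>x. x \<in> U \<Longrightarrow> f x = f' x" "\<And>x. x \<in> U \<Longrightarrow> g x = g' x"
  shows "is_weak_deriv U \<alpha> f g \<longleftrightarrow> is_weak_deriv U \<alpha> f' g'"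
proof -
  have "(\<integral>x. \<psi> x *\<^sub>R f x \<partial>M) = (\<integral>x. \<psi> x *\<^sub>R f' x \<partial>M)" "(\<integral>x. \<psi> x *\<^sub>R g x \<partial>M) = (\<integral>x. \<psi> x *\<^sub>R g' x \<partial>M)" for \<psi> :: "plane \<Rightarrow> real"
    using assms by (auto intro!: Bochner_Integration.integral_cong)
  then show ?thesis unfolding is_weak_deriv_def by simp
qed

lemma smooth_weak_deriv:
  assumes "smooth \<phi>"
  shows "L2 M (weak_deriv U [i] \<phi>)" "norm_L2 M (weak_deriv U [i] \<phi>) = norm_L2 M (pdiff i \<phi>)"
  using weak_deriv_AE[OF L2_smooth[OF smooth_pdiff[OF assms]] smooth_is_weak_deriv[OF U(1) assms]] by auto

text \<open>iterated weak derivatives\<close>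

lemma weak_deriv_iterate:
  fixes f :: "plane \<Rightarrow> 'b::euclidean_space"
  assumes g: "is_weak_deriv U [i] f g" and h: "is_weak_deriv U [i, j] f h"
  shows "is_weak_deriv U [j] g h"
  unfolding is_weak_deriv_def
proof (intro allI impI)
  fix \<psi> assume \<psi>: "test_function U \<psi>"
  have "(\<integral>x. pdiffs [i] (pdiff j \<psi>) x *\<^sub>R f x \<partial>M) = - (\<integral>x. pdiff j \<psi> x *\<^sub>R g x \<partial>M)"
    using g test_function_pdiff[OF \<psi>, of j] unfolding is_weak_deriv_def by simp
  moreover have "(\<integral>x. pdiffs [i, j] \<psi> x *\<^sub>R f x \<partial>M) = (\<integral>x. \<psi> x *\<^sub>R h x \<partial>M)"
    using h \<psi> unfolding is_weak_deriv_def by simp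
  ultimately show "(\<integral>x. pdiffs [j] \<psi> x *\<^sub>R g x \<partial>M) = (- 1) ^ length [j] *\<^sub>R (\<integral>x. \<psi> x *\<^sub>R h x \<partial>M)"
    by (simp add: eq_neg_iff_add_eq_0 neg_eq_iff_add_eq_0 add.commute)
qed

lemma weak_deriv_symmetric:
  assumes "is_weak_deriv U [i, j] f h" shows "is_weak_deriv U [j, i] f h"
proof -
  have "pdiffs [i, j] \<psi> = pdiffs [j, i] \<psi>" if "test_function U \<psi>" for \<psi>
    using that pdiff_commute[of \<psi> i j] unfolding test_function_def by auto
  then show ?thesis using assms unfolding is_weak_deriv_def by (simp del: pdiffs.simps)
qed

lemma sum_length_1: "(\<Sum>\<alpha> | length \<alpha> = 1. F \<alpha>) = (\<Sum>i\<in>UNIV. F [i])" for F :: "2 list \<Rightarrow> real"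
proof -
  have "{\<alpha>::2 list. length \<alpha> = 1} = (\<lambda>i. [i]) ` UNIV" by (auto simp: length_Suc_conv)
  then show ?thesis by (simp add: sum.reindex inj_on_def)
qed

lemma sum_length_2: "(\<Sum>\<alpha> | length \<alpha> = 2. F \<alpha>) = (\<Sum>i\<in>UNIV. \<Sum>j\<in>UNIV. F [i, j])" for F :: "2 list \<Rightarrow> real"
proof -
  have "{\<alpha>::2 list. length \<alpha> = 2} = (\<lambda>(i,j). [i, j]) ` (UNIV \<times> UNIV)"
    by (auto simp: length_Suc_conv numeral_2_eq_2 image_iff)
  then show ?thesis by (simp add: sum.reindex inj_on_def sum.cartesian_product case_prod_unfold)
qed

lemma norm_grad_1: "norm_grad 1 V f = sqrt (\<Sum>i\<in>UNIV. (norm_L2 (lebesgue_on V) (weak_deriv V [i] f))\<^sup>2)"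
  by (simp add: norm_grad_def sum_length_1[of "\<lambda>\<alpha>. (norm_L2 (lebesgue_on V) (weak_deriv V \<alpha> f))\<^sup>2", simplified])

lemma norm_grad_2: "norm_grad 2 V f = sqrt (\<Sum>i\<in>UNIV. \<Sum>j\<in>UNIV. (norm_L2 (lebesgue_on V) (weak_deriv V [i, j] f))\<^sup>2)"
  unfolding norm_grad_def by (subst sum_length_2) simp

lemma sobolev_norm_1: "sobolev_norm 1 V f = norm_L2 (lebesgue_on V) f + norm_grad 1 V f"
  by (simp add: sobolev_norm_def)

lemma sobolevD: "f \<in> sobolev m U \<Longrightarrow> L2 M f" by (simp add: sobolev_def)

lemma weak_deriv_smooth_diff:
  fixes f :: "plane \<Rightarrow> 'b::euclidean_space"
  assumes \<phi>: "smooth \<phi>" and f: "f \<in> sobolev 1 U"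
  shows "norm_L2 M (weak_deriv U [i] (\<lambda>x. \<phi> x - f x)) = norm_L2 M (\<lambda>x. pdiff i \<phi> x - weak_deriv U [i] f x)"
proof (rule weak_deriv_AE(4))
  note w = sobolev_weak_deriv[OF f, of "[i]", simplified]
  show "L2 M (\<lambda>x. pdiff i \<phi> x - weak_deriv U [i] f x)"
    by (intro L2_diff L2_smooth smooth_pdiff \<phi> w)
  show "is_weak_deriv U [i] (\<lambda>x. \<phi> x - f x) (\<lambda>x. pdiff i \<phi> x - weak_deriv U [i] f x)"
    by (rule is_weak_deriv_diff[OF L2_smooth[OF \<phi>] L2_smooth[OF smooth_pdiff[OF \<phi>]] smooth_is_weak_deriv[OF U(1) \<phi>]
          sobolevD[OF f] w])
qed

lemma sobolev_norm_1_diff_tendsto: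
  fixes f :: "plane \<Rightarrow> 'b::euclidean_space"
  assumes \<phi>: "\<And>n. smooth (\<phi> n)" and f: "f \<in> sobolev 1 U"
  shows "(\<lambda>n. sobolev_norm 1 U (\<lambda>x. \<phi> n x - f x)) \<longlonglongrightarrow> 0 \<longleftrightarrow>
    (\<lambda>n. norm_L2 M (\<lambda>x. \<phi> n x - f x)) \<longlonglongrightarrow> 0 \<and>
    (\<forall>i. (\<lambda>n. norm_L2 M (\<lambda>x. pdiff i (\<phi> n) x - weak_deriv U [i] f x)) \<longlonglongrightarrow> 0)" (is "?L \<longleftrightarrow> ?R")
proof
  define a where "a n = norm_L2 M (\<lambda>x. \<phi> n x - f x)" for n
  define b where "b i n = norm_L2 M (\<lambda>x. pdiff i (\<phi> n) x - weak_deriv U [i] f x)" for i n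
  have s: "sobolev_norm 1 U (\<lambda>x. \<phi> n x - f x) = a n + sqrt (\<Sum>i\<in>UNIV. (b i n)\<^sup>2)" for n
    by (simp only: sobolev_norm_1 norm_grad_1 a_def b_def weak_deriv_smooth_diff[OF \<phi> f])
  have a0: "a n \<ge> 0" for n by (simp add: a_def)
  have b0: "b i n \<ge> 0" for i n by (simp add: b_def)
  {
    assume ?L
    then have l: "(\<lambda>n. a n + sqrt (\<Sum>i\<in>UNIV. (b i n)\<^sup>2)) \<longlonglongrightarrow> 0" by (simp only: s)
    have 1: "norm (a n) \<le> a n + sqrt (\<Sum>i\<in>UNIV. (b i n)\<^sup>2)" for n
      using a0 by (simp add: sum_nonneg)
    have 2: "norm (b i n) \<le> a n + sqrt (\<Sum>i\<in>UNIV. (b i n)\<^sup>2)" for n i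
    proof -
      have "b i n = sqrt ((b i n)\<^sup>2)" using b0 by simp
      also have "\<dots> \<le> sqrt (\<Sum>i\<in>UNIV. (b i n)\<^sup>2)"
        by (rule real_sqrt_le_mono, rule member_le_sum[of i UNIV "\<lambda>i. (b i n)\<^sup>2"]) auto
      finally have "b i n \<le> sqrt (\<Sum>i\<in>UNIV. (b i n)\<^sup>2)" .
      then show ?thesis unfolding real_norm_def abs_of_nonneg[OF b0] using a0[of n] by linarith
    qed
    have "a \<longlonglongrightarrow> 0" by (rule Lim_null_comparison[OF _ l]) (use 1 in auto)
    moreover have "b i \<longlonglongrightarrow> 0" for i by (rule Lim_null_comparison[OF _ l]) (use 2 in auto)
    ultimately show ?R by (simp add: a_def[abs_def] b_def[abs_def])
  }
  {
    assume ?R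
    then have "a \<longlonglongrightarrow> 0" "\<And>i. b i \<longlonglongrightarrow> 0" by (auto simp: a_def[abs_def] b_def[abs_def])
    then have "(\<lambda>n. a n + sqrt (\<Sum>i\<in>UNIV. (b i n)\<^sup>2)) \<longlonglongrightarrow> 0 + sqrt (\<Sum>i\<in>(UNIV::2 set). 0\<^sup>2)"
      by (intro tendsto_intros)
    then show ?L unfolding s by simp
  }
qed

lemma sobolev_approx:
  fixes f :: "plane \<Rightarrow> 'b::euclidean_space"
  assumes f: "f \<in> sobolev 1 U"
  obtains \<phi> where "\<And>n. smooth (\<phi> n)" "(\<lambda>n. norm_L2 M (\<lambda>x. \<phi> n x - f x)) \<longlonglongrightarrow> 0"
    "\<And>i. (\<lambda>n. norm_L2 M (\<lambda>x. pdiff i (\<phi> n) x - weak_deriv U [i] f x)) \<longlonglongrightarrow> 0"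
proof (rule that[of "\<lambda>n. moll (eps_seq n) f"])
  have fL: "L2 M f" by (rule sobolevD[OF f])
  show "smooth (moll (eps_seq n) f)" for n by (rule moll_smooth[OF eps_seq(1) fL])
  show "(\<lambda>n. norm_L2 M (\<lambda>x. moll (eps_seq n) f x - f x)) \<longlonglongrightarrow> 0" by (rule moll_tendsto[OF fL])
  fix i
  let ?g = "weak_deriv U [i] f"
  note w = sobolev_weak_deriv[OF f, of "[i]", simplified]
  have b: "norm_L2 M (\<lambda>x. pdiff i (moll (eps_seq n) f) x - ?g x) \<le>
      norm_L2 M (\<lambda>x. moll (eps_seq n) ?g x - ?g x) + eps_seq n * (2 * norm_L2 M ?g)" for n
  proof -
    let ?e = "eps_seq n"
    have mg: "L2 M (moll ?e ?g)" by (rule L2_smooth[OF moll_smooth[OF eps_seq(1) w(1)]])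
    have "norm_L2 M (\<lambda>x. pdiff i (moll ?e f) x - ?g x) = norm_L2 M (\<lambda>x. (moll ?e ?g x - ?g x) + (- ?e) *\<^sub>R moll ?e ?g x)"
      by (rule norm_L2_cong) (simp add: moll_pdiff[OF fL w(2) _ eps_seq(1,3)] algebra_simps)
    also have "\<dots> \<le> norm_L2 M (\<lambda>x. moll ?e ?g x - ?g x) + norm_L2 M (\<lambda>x. (- ?e) *\<^sub>R moll ?e ?g x)"
      by (rule norm_L2_triangle[OF L2_diff[OF mg w(1)] L2_scaleR[OF mg]])
    also have "norm_L2 M (\<lambda>x. (- ?e) *\<^sub>R moll ?e ?g x) = ?e * norm_L2 M (moll ?e ?g)"
      using eps_seq(1)[of n] by (subst norm_L2_scaleR) simp
    also have "\<dots> \<le> ?e * (2 * norm_L2 M ?g)"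
      using moll_bound[OF w(1) eps_seq(1,2)] eps_seq(1)[of n] by (intro mult_left_mono) auto
    finally show ?thesis by simp
  qed
  have "(\<lambda>n. norm_L2 M (\<lambda>x. moll (eps_seq n) ?g x - ?g x) + eps_seq n * (2 * norm_L2 M ?g)) \<longlonglongrightarrow> 0 + 0 * (2 * norm_L2 M ?g)"
    by (intro tendsto_intros moll_tendsto w eps_seq)
  then have l: "(\<lambda>n. norm_L2 M (\<lambda>x. moll (eps_seq n) ?g x - ?g x) + eps_seq n * (2 * norm_L2 M ?g)) \<longlonglongrightarrow> 0" by simp
  show "(\<lambda>n. norm_L2 M (\<lambda>x. pdiff i (moll (eps_seq n) f) x - ?g x)) \<longlonglongrightarrow> 0"
    by (rule Lim_null_comparison[OF _ l]) (use b in auto)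
qed

end

subsection \<open>One-dimensional estimate\<close>

lemma FTC_square_bound:
  fixes g :: "real \<Rightarrow> 'b::euclidean_space"
  assumes ab: "a \<le> b" and g: "\<And>t. (g has_vector_derivative g' t) (at t)" and c: "continuous_on UNIV g'"
  shows "ennreal ((norm (g b - g a))\<^sup>2) \<le> ennreal (b - a) * (\<integral>\<^sup>+t. ennreal ((norm (g' t))\<^sup>2) * indicator {a..b} t \<partial>lborel)"
proof -
  have i: "integrable lborel (\<lambda>t. indicator {a..b} t *\<^sub>R h t)" if "continuous_on UNIV h" for h :: "real \<Rightarrow> 'c::euclidean_space"
    by (intro borel_integrable_compact continuous_on_subset[OF that]) auto
  have "(\<integral>x. indicator {a..b} x *\<^sub>R g' x \<partial>lborel) = g b - g a"
    by (rule integral_FTC_Icc[OF ab]) (auto intro: has_vector_derivative_at_within g continuous_on_subset[OF c])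
  then have "norm (g b - g a) \<le> (\<integral>x. norm (indicator {a..b} x *\<^sub>R g' x) \<partial>lborel)"
    using integral_norm_bound[of lborel "\<lambda>x. indicator {a..b} x *\<^sub>R g' x"] by simp
  also have "\<dots> = (\<integral>x. norm (indicator {a..b} x :: real) * norm (indicator {a..b} x *\<^sub>R g' x) \<partial>lborel)"
    by (intro Bochner_Integration.integral_cong) (auto simp: indicator_def)
  also have "\<dots> \<le> norm_L2 lborel (indicator {a..b} :: real \<Rightarrow> real) * norm_L2 lborel (\<lambda>x. indicator {a..b} x *\<^sub>R g' x)"
  proof (rule L2_Cauchy_Schwarz)
    have [measurable]: "g' \<in> borel_measurable borel" by (rule borel_measurable_continuous_onI[OF c])
    have 1: "(\<lambda>x. (norm (indicator {a..b} x :: real))\<^sup>2) = (\<lambda>x. indicator {a..b} x *\<^sub>R (1::real))" by (auto simp: indicator_def fun_eq_iff)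
    show "L2 lborel (indicator {a..b} :: real \<Rightarrow> real)"
      unfolding L2_def 1
    proof
      show "integrable lborel (\<lambda>x. indicator {a..b} x *\<^sub>R (1::real))" by (rule i) (rule continuous_on_const)
    qed measurable
    have 2: "(\<lambda>x. (norm (indicator {a..b} x *\<^sub>R g' x))\<^sup>2) = (\<lambda>x. indicator {a..b} x *\<^sub>R (norm (g' x))\<^sup>2)" by (auto simp: indicator_def fun_eq_iff)
    show "L2 lborel (\<lambda>x. indicator {a..b} x *\<^sub>R g' x)"
      unfolding L2_def 2
    proof
      show "integrable lborel (\<lambda>x. indicator {a..b} x *\<^sub>R (norm (g' x))\<^sup>2)" by (rule i) (intro continuous_intros c)
    qed measurable
  qed
  finally have "(norm (g b - g a))\<^sup>2 \<le> (norm_L2 lborel (indicator {a..b} :: real \<Rightarrow> real) * norm_L2 lborel (\<lambda>x. indicator {a..b} x *\<^sub>R g' x))\<^sup>2"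
    by (rule power_mono) simp
  also have "\<dots> = (b - a) * (\<integral>x. indicator {a..b} x *\<^sub>R (norm (g' x))\<^sup>2 \<partial>lborel)"
  proof -
    have 1: "(\<lambda>x. (norm (indicator {a..b} x :: real))\<^sup>2) = indicator {a..b}" by (auto simp: indicator_def fun_eq_iff)
    have 2: "(\<lambda>x. (norm (indicator {a..b} x *\<^sub>R g' x))\<^sup>2) = (\<lambda>x. indicator {a..b} x *\<^sub>R (norm (g' x))\<^sup>2)" by (auto simp: indicator_def fun_eq_iff)
    show ?thesis unfolding power_mult_distrib norm_L2_sq 1 2 using ab by simp
  qed
  finally have "ennreal ((norm (g b - g a))\<^sup>2) \<le> ennreal ((b - a) * (\<integral>x. indicator {a..b} x *\<^sub>R (norm (g' x))\<^sup>2 \<partial>lborel))"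
    by (rule ennreal_leI)
  also have "\<dots> = ennreal (b - a) * ennreal (\<integral>x. indicator {a..b} x *\<^sub>R (norm (g' x))\<^sup>2 \<partial>lborel)"
    using ab by (intro ennreal_mult) (auto intro!: integral_nonneg)
  also have "ennreal (\<integral>x. indicator {a..b} x *\<^sub>R (norm (g' x))\<^sup>2 \<partial>lborel) = (\<integral>\<^sup>+x. ennreal (indicator {a..b} x *\<^sub>R (norm (g' x))\<^sup>2) \<partial>lborel)"
    by (rule nn_integral_eq_integral[symmetric]) (rule i, intro continuous_intros c, auto)
  also have "\<dots> = (\<integral>\<^sup>+t. ennreal ((norm (g' t))\<^sup>2) * indicator {a..b} t \<partial>lborel)"
    by (intro nn_integral_cong) (auto simp: indicator_def)
  finally show ?thesis .
qed

definition grad_sq :: "(plane \<Rightarrow> 'b::euclidean_space) \<Rightarrow> plane \<Rightarrow> real" where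
  "grad_sq f x = (\<Sum>i\<in>UNIV. (norm (pdiff i f x))\<^sup>2)"

lemma grad_sq_nonneg [simp]: "grad_sq f x \<ge> 0"
  by (simp add: grad_sq_def sum_nonneg)

lemma grad_sq_continuous: "smooth f \<Longrightarrow> continuous_on S (grad_sq f)"
  unfolding grad_sq_def[abs_def] by (intro continuous_intros smooth_continuous smooth_pdiff)

lemma Cauchy_Schwarz_2: "(a * p + b * q)\<^sup>2 \<le> (a\<^sup>2 + b\<^sup>2) * (p\<^sup>2 + q\<^sup>2)" for a b p q :: real
  using zero_le_power2[of "a * q - b * p"] by (simp add: power2_eq_square algebra_simps)

lemma grad_sq_bound: "(norm (\<Sum>i\<in>UNIV. h $ i *\<^sub>R pdiff i f x))\<^sup>2 \<le> (norm h)\<^sup>2 * grad_sq f x"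
proof -
  have n: "(norm h)\<^sup>2 = (h $ 1)\<^sup>2 + (h $ 2)\<^sup>2"
    by (simp add: norm_vec_def L2_set_def sum_2)
  let ?p = "norm (pdiff 1 f x)" and ?q = "norm (pdiff 2 f x)"
  have "norm (h $ 1 *\<^sub>R pdiff 1 f x + h $ 2 *\<^sub>R pdiff 2 f x) \<le> \<bar>h $ 1\<bar> * ?p + \<bar>h $ 2\<bar> * ?q"
    using norm_triangle_ineq[of "h $ 1 *\<^sub>R pdiff 1 f x" "h $ 2 *\<^sub>R pdiff 2 f x"] by simp
  then have "(norm (h $ 1 *\<^sub>R pdiff 1 f x + h $ 2 *\<^sub>R pdiff 2 f x))\<^sup>2 \<le> (\<bar>h $ 1\<bar> * ?p + \<bar>h $ 2\<bar> * ?q)\<^sup>2"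
    by (rule power_mono) simp
  also have "\<dots> \<le> (\<bar>h $ 1\<bar>\<^sup>2 + \<bar>h $ 2\<bar>\<^sup>2) * (?p\<^sup>2 + ?q\<^sup>2)"
    by (rule Cauchy_Schwarz_2)
  finally show ?thesis by (simp add: n grad_sq_def sum_2)
qed

lemma segment_square_bound:
  fixes f :: "plane \<Rightarrow> 'b::euclidean_space"
  assumes f: "smooth f" and ab: "a \<le> b"
  shows "ennreal ((norm (f (y + b *\<^sub>R d) - f (y + a *\<^sub>R d)))\<^sup>2) \<le>
    ennreal ((b - a) * (norm d)\<^sup>2) * (\<integral>\<^sup>+t. ennreal (grad_sq f (y + t *\<^sub>R d)) * indicator {a..b} t \<partial>lborel)"
proof -
  let ?g' = "\<lambda>t. \<Sum>i\<in>UNIV. d $ i *\<^sub>R pdiff i f (y + t *\<^sub>R d)"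
  have cl: "continuous_on UNIV (\<lambda>t. y + t *\<^sub>R d)" by (intro continuous_intros)
  have "((\<lambda>t. f (y + t *\<^sub>R d)) has_vector_derivative ?g' t) (at t)" for t
  proof -
    have "((\<lambda>t. f (y + t *\<^sub>R d)) has_derivative (\<lambda>h. \<Sum>i\<in>UNIV. (h *\<^sub>R d) $ i *\<^sub>R pdiff i f (y + t *\<^sub>R d))) (at t)"
      by (rule has_derivative_compose[where g=f and f="\<lambda>t. y + t *\<^sub>R d", OF _ has_derivative_pdiff[OF smooth_differentiable[OF f]]])
         (auto intro!: derivative_eq_intros)
    then show ?thesis by (simp add: has_vector_derivative_def scaleR_sum_right)
  qed
  moreover have "continuous_on UNIV ?g'"
    by (intro continuous_intros continuous_on_compose2[OF smooth_continuous[OF smooth_pdiff[OF f], of UNIV] cl]) auto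
  ultimately have "ennreal ((norm (f (y + b *\<^sub>R d) - f (y + a *\<^sub>R d)))\<^sup>2) \<le>
      ennreal (b - a) * (\<integral>\<^sup>+t. ennreal ((norm (?g' t))\<^sup>2) * indicator {a..b} t \<partial>lborel)"
    by (rule FTC_square_bound[OF ab])
  also have "\<dots> \<le> ennreal (b - a) * (\<integral>\<^sup>+t. ennreal ((norm d)\<^sup>2) * (ennreal (grad_sq f (y + t *\<^sub>R d)) * indicator {a..b} t) \<partial>lborel)"
    by (intro mult_left_mono nn_integral_mono)
       (auto simp: indicator_def ennreal_mult[symmetric] intro!: ennreal_leI grad_sq_bound)
  also have "\<dots> = ennreal (b - a) * (ennreal ((norm d)\<^sup>2) * (\<integral>\<^sup>+t. ennreal (grad_sq f (y + t *\<^sub>R d)) * indicator {a..b} t \<partial>lborel))"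
  proof -
    have "(\<lambda>t. grad_sq f (y + t *\<^sub>R d)) \<in> borel_measurable borel"
      by (intro borel_measurable_continuous_onI continuous_on_compose2[OF grad_sq_continuous[OF f, of UNIV] cl]) auto
    then show ?thesis by (subst nn_integral_cmult) auto
  qed
  finally show ?thesis using ab by (simp add: ennreal_mult mult.assoc)
qed

(* PART 5 *)

lemma ennreal_le_double_sum:
  assumes "a \<le> 2 * b + 2 * c" "b \<ge> 0" "c \<ge> 0"
  shows "ennreal a \<le> ennreal 2 * ennreal b + ennreal 2 * ennreal c"
proof -
  have "ennreal a \<le> ennreal (2 * b + 2 * c)" by (rule ennreal_leI[OF assms(1)])
  also have "\<dots> = ennreal 2 * ennreal b + ennreal 2 * ennreal c"
    using assms by (subst ennreal_plus) (auto simp: ennreal_mult)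
  finally show ?thesis .
qed

context starlike
begin

lemma norm_L2_nn_integral:
  fixes g :: "plane \<Rightarrow> 'b::euclidean_space"
  assumes g: "continuous_on UNIV g"
  shows "ennreal ((norm_L2 M g)\<^sup>2) = (\<integral>\<^sup>+x. ennreal ((norm (g x))\<^sup>2) * indicator U x \<partial>lborel)"
proof -
  have [measurable]: "g \<in> borel_measurable borel" by (rule borel_measurable_continuous_onI[OF g])
  have [measurable]: "U \<in> sets borel" using U(1) by simp
  have "ennreal ((norm_L2 M g)\<^sup>2) = (\<integral>\<^sup>+x. ennreal ((norm (g x))\<^sup>2) \<partial>M)"
    unfolding norm_L2_sq
    by (rule nn_integral_eq_integral[symmetric]) (use L2D(2)[OF L2_continuous[OF g]] in auto)
  also have "\<dots> = (\<integral>\<^sup>+x. ennreal ((norm (g x))\<^sup>2) * indicator U x \<partial>lebesgue)"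
    using Usets by (subst nn_integral_restrict_space) auto
  also have "\<dots> = (\<integral>\<^sup>+x. ennreal ((norm (g x))\<^sup>2) * indicator U x \<partial>lborel)"
    by (rule nn_integral_completion)
  finally show ?thesis .
qed

lemma grad_sq_nn_integral:
  assumes f: "smooth f"
  shows "(\<integral>\<^sup>+x. ennreal (grad_sq f x) * indicator U x \<partial>lborel) = ennreal (\<Sum>i\<in>UNIV. (norm_L2 M (pdiff i f))\<^sup>2)"
proof -
  have [measurable]: "U \<in> sets borel" using U(1) by simp
  have [measurable]: "pdiff i f \<in> borel_measurable borel" for i
    by (rule borel_measurable_continuous_onI[OF smooth_continuous[OF smooth_pdiff[OF f]]])
  have "(\<integral>\<^sup>+x. ennreal (grad_sq f x) * indicator U x \<partial>lborel) =
     (\<integral>\<^sup>+x. (\<Sum>i\<in>UNIV. ennreal ((norm (pdiff i f x))\<^sup>2) * indicator U x) \<partial>lborel)"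
    by (intro nn_integral_cong) (simp add: grad_sq_def sum_distrib_right[symmetric] sum_ennreal)
  also have "\<dots> = (\<Sum>i\<in>UNIV. \<integral>\<^sup>+x. ennreal ((norm (pdiff i f x))\<^sup>2) * indicator U x \<partial>lborel)"
    by (rule nn_integral_sum) measurable
  also have "\<dots> = (\<Sum>i\<in>UNIV. ennreal ((norm_L2 M (pdiff i f))\<^sup>2))"
    by (simp add: norm_L2_nn_integral[OF smooth_continuous[OF smooth_pdiff[OF f]]])
  finally show ?thesis by (simp add: sum_ennreal)
qed

lemma midpoint_bound:
  fixes f :: "plane \<Rightarrow> 'b::euclidean_space"
  assumes f: "smooth f" and y: "y \<in> U" and h: "\<And>x y. x \<in> U \<Longrightarrow> y \<in> U \<Longrightarrow> norm (x - y) \<le> h"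
  shows "(\<integral>\<^sup>+x. ennreal ((norm (f x - f ((1/2) *\<^sub>R (x + y))))\<^sup>2) * indicator U x \<partial>lborel) \<le>
    ennreal (h\<^sup>2) * (\<integral>\<^sup>+x. ennreal (grad_sq f x) * indicator U x \<partial>lborel)" (is "_ \<le> _ * ?I")
proof -
  have [measurable]: "U \<in> sets borel" using U(1) by simp
  have [measurable]: "grad_sq f \<in> borel_measurable borel"
    by (rule borel_measurable_continuous_onI[OF grad_sq_continuous[OF f]])
  let ?T = "{1/2..1::real}"
  have h0: "h \<ge> 0" using h[OF y y] by simp
  have pt: "ennreal ((norm (f x - f ((1/2) *\<^sub>R (x + y))))\<^sup>2) * indicator U x \<le>
      ennreal (h\<^sup>2 / 2) * (\<integral>\<^sup>+t. ennreal (grad_sq f (y + t *\<^sub>R (x - y))) * indicator ?T t * indicator U x \<partial>lborel)" for x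
  proof (cases "x \<in> U")
    case True
    have e: "y + 1 *\<^sub>R (x - y) = x" "y + (1/2) *\<^sub>R (x - y) = (1/2) *\<^sub>R (x + y)"
      by (auto simp: vec_eq_iff field_simps)
    have "ennreal ((norm (f x - f ((1/2) *\<^sub>R (x + y))))\<^sup>2) \<le>
       ennreal ((1 - 1/2) * (norm (x - y))\<^sup>2) * (\<integral>\<^sup>+t. ennreal (grad_sq f (y + t *\<^sub>R (x - y))) * indicator ?T t \<partial>lborel)"
      using segment_square_bound[OF f, of "1/2" 1 y "x - y"] unfolding e by simp
    also have "\<dots> \<le> ennreal (h\<^sup>2 / 2) * (\<integral>\<^sup>+t. ennreal (grad_sq f (y + t *\<^sub>R (x - y))) * indicator ?T t \<partial>lborel)"
      using power_mono[OF h[OF True y], of 2] by (intro mult_right_mono ennreal_leI) auto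
    finally show ?thesis using True by simp
  qed simp
  have "(\<integral>\<^sup>+x. ennreal ((norm (f x - f ((1/2) *\<^sub>R (x + y))))\<^sup>2) * indicator U x \<partial>lborel) \<le>
     (\<integral>\<^sup>+x. ennreal (h\<^sup>2 / 2) * (\<integral>\<^sup>+t. ennreal (grad_sq f (y + t *\<^sub>R (x - y))) * indicator ?T t * indicator U x \<partial>lborel) \<partial>lborel)"
    by (rule nn_integral_mono) (rule pt)
  also have "\<dots> = ennreal (h\<^sup>2 / 2) * (\<integral>\<^sup>+x. (\<integral>\<^sup>+t. ennreal (grad_sq f (y + t *\<^sub>R (x - y))) * indicator ?T t * indicator U x \<partial>lborel) \<partial>lborel)"
    by (rule nn_integral_cmult) measurable
  also have "(\<integral>\<^sup>+x. (\<integral>\<^sup>+t. ennreal (grad_sq f (y + t *\<^sub>R (x - y))) * indicator ?T t * indicator U x \<partial>lborel) \<partial>lborel) =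
     (\<integral>\<^sup>+t. (\<integral>\<^sup>+x. ennreal (grad_sq f (y + t *\<^sub>R (x - y))) * indicator ?T t * indicator U x \<partial>lborel) \<partial>lborel)"
    by (rule lborel_pair.Fubini'[symmetric]) measurable
  also have "\<dots> \<le> (\<integral>\<^sup>+t. (ennreal 4 * ?I) * indicator ?T t \<partial>lborel)"
  proof (rule nn_integral_mono)
    fix t :: real
    show "(\<integral>\<^sup>+x. ennreal (grad_sq f (y + t *\<^sub>R (x - y))) * indicator ?T t * indicator U x \<partial>lborel) \<le> (ennreal 4 * ?I) * indicator ?T t"
    proof (cases "t \<in> ?T")
      case True
      have e: "y + t *\<^sub>R (x - y) = (1 - t) *\<^sub>R y + t *\<^sub>R x" for x by (simp add: algebra_simps)
      have "(\<integral>\<^sup>+x. ennreal (grad_sq f (y + t *\<^sub>R (x - y))) * indicator ?T t * indicator U x \<partial>lborel) \<le>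
         (\<integral>\<^sup>+x. ennreal (grad_sq f ((1 - t) *\<^sub>R y + t *\<^sub>R x)) * indicator U ((1 - t) *\<^sub>R y + t *\<^sub>R x) \<partial>lborel)"
        unfolding e
      proof (rule nn_integral_mono)
        fix x
        show "ennreal (grad_sq f ((1 - t) *\<^sub>R y + t *\<^sub>R x)) * indicator ?T t * indicator U x \<le>
          ennreal (grad_sq f ((1 - t) *\<^sub>R y + t *\<^sub>R x)) * indicator U ((1 - t) *\<^sub>R y + t *\<^sub>R x)"
        proof (cases "x \<in> U")
          case xU: True
          have "(1 - t) *\<^sub>R y + t *\<^sub>R x \<in> U" using U(2) y xU True by (intro convexD_alt) auto
          then show ?thesis using True xU by simp
        qed simp
      qed
      also have "\<dots> = ennreal (1 / t\<^sup>2) * ?I"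
        by (rule nn_integral_dilate[where F="\<lambda>x. ennreal (grad_sq f x) * indicator U x"]) (use True in auto)
      also have "\<dots> \<le> ennreal 4 * ?I"
      proof (intro mult_right_mono ennreal_leI)
        have "(1 / 2)\<^sup>2 \<le> t\<^sup>2" using True by (intro power_mono) auto
        then have "1 / t\<^sup>2 \<le> 1 / (1 / 2)\<^sup>2" by (intro divide_left_mono) (use True in \<open>auto simp: power2_eq_square\<close>)
        then show "1 / t\<^sup>2 \<le> 4" by (simp add: power2_eq_square)
      qed simp
      finally have "(\<integral>\<^sup>+x. ennreal (grad_sq f (y + t *\<^sub>R (x - y))) * indicator ?T t * indicator U x \<partial>lborel) \<le> ennreal 4 * ?I" .
      moreover have ind: "indicator ?T t = (1::ennreal)" using True by simp
      ultimately show ?thesis by (simp only: ind mult_1_right)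
    qed simp
  qed
  also have "\<dots> = (ennreal 4 * ?I) * emeasure lborel ?T"
    by (rule nn_integral_cmult_indicator) simp
  also have "\<dots> = ennreal 2 * ?I"
  proof -
    have "ennreal 4 * ennreal (1/2) = ennreal 2" by (subst ennreal_mult[symmetric]) auto
    moreover have "emeasure lborel ?T = ennreal (1/2)" by (subst emeasure_lborel_Icc) auto
    moreover have "(ennreal 4 * ?I) * ennreal (1/2) = (ennreal 4 * ennreal (1/2)) * ?I" by (simp only: mult_ac)
    ultimately show ?thesis by (simp only:)
  qed
  finally have "(\<integral>\<^sup>+x. ennreal ((norm (f x - f ((1/2) *\<^sub>R (x + y))))\<^sup>2) * indicator U x \<partial>lborel) \<le> ennreal (h\<^sup>2 / 2) * (ennreal 2 * ?I)"
    by (simp add: mult_left_mono)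
  also have "\<dots> = (ennreal (h\<^sup>2 / 2) * ennreal 2) * ?I" by (simp only: mult.assoc)
  also have "ennreal (h\<^sup>2 / 2) * ennreal 2 = ennreal (h\<^sup>2)"
    by (subst ennreal_mult[symmetric]) auto
  finally show ?thesis .
qed

lemma pair_bound:
  fixes f :: "plane \<Rightarrow> 'b::euclidean_space"
  assumes f: "smooth f" and h: "\<And>x y. x \<in> U \<Longrightarrow> y \<in> U \<Longrightarrow> norm (x - y) \<le> h"
  shows "(\<integral>\<^sup>+y. (\<integral>\<^sup>+x. ennreal ((norm (f x - f y))\<^sup>2) * indicator U x \<partial>lborel) * indicator U y \<partial>lborel) \<le>
    ennreal 4 * (ennreal (h\<^sup>2) * (\<integral>\<^sup>+x. ennreal (grad_sq f x) * indicator U x \<partial>lborel)) * emeasure lborel U" (is "_ \<le> ennreal 4 * ?J * _")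
proof -
  have [measurable]: "U \<in> sets borel" using U(1) by simp
  have [measurable]: "f \<in> borel_measurable borel"
    by (rule borel_measurable_continuous_onI[OF smooth_continuous[OF f]])
  define H where "H x y = ennreal ((norm (f x - f ((1/2) *\<^sub>R (x + y))))\<^sup>2) * indicator U x * indicator U y" for x y
  have Hm[measurable]: "(\<lambda>p. H (fst p) (snd p)) \<in> borel_measurable (lborel \<Otimes>\<^sub>M lborel)" "(\<lambda>p. H (snd p) (fst p)) \<in> borel_measurable (lborel \<Otimes>\<^sub>M lborel)"
    "(\<lambda>x. H x y) \<in> borel_measurable lborel" "(\<lambda>x. H y x) \<in> borel_measurable lborel" for y
    unfolding H_def by measurable
  have 1: "(\<integral>\<^sup>+y. (\<integral>\<^sup>+x. H x y \<partial>lborel) \<partial>lborel) \<le> ?J * emeasure lborel U"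
  proof -
    have "(\<integral>\<^sup>+x. H x y \<partial>lborel) \<le> ?J * indicator U y" for y
    proof (cases "y \<in> U")
      case True
      then show ?thesis using midpoint_bound[OF f True h] by (simp add: H_def)
    qed (simp add: H_def)
    then have "(\<integral>\<^sup>+y. (\<integral>\<^sup>+x. H x y \<partial>lborel) \<partial>lborel) \<le> (\<integral>\<^sup>+y. ?J * indicator U y \<partial>lborel)"
      by (intro nn_integral_mono) simp
    then show ?thesis by (subst (asm) nn_integral_cmult_indicator) simp_all
  qed
  have 2: "(\<integral>\<^sup>+y. (\<integral>\<^sup>+x. H y x \<partial>lborel) \<partial>lborel) \<le> ?J * emeasure lborel U"
    using 1 by (subst lborel_pair.Fubini') (use Hm in \<open>simp_all add: case_prod_unfold\<close>)
  have pt: "ennreal ((norm (f x - f y))\<^sup>2) * indicator U x * indicator U y \<le> ennreal 2 * H x y + ennreal 2 * H y x" for x y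
  proof (cases "x \<in> U \<and> y \<in> U")
    case True
    let ?m = "(1/2) *\<^sub>R (x + y)"
    have "norm (f x - f y) \<le> norm (f x - f ?m) + norm (f y - f ?m)"
      using norm_triangle_ineq4[of "f x - f ?m" "f y - f ?m"] by simp
    then have "(norm (f x - f y))\<^sup>2 \<le> (norm (f x - f ?m) + norm (f y - f ?m))\<^sup>2" by (rule power_mono) simp
    also have "\<dots> \<le> 2 * (norm (f x - f ?m))\<^sup>2 + 2 * (norm (f y - f ?m))\<^sup>2" by (rule sq_add_le)
    finally have "ennreal ((norm (f x - f y))\<^sup>2) \<le> ennreal 2 * ennreal ((norm (f x - f ?m))\<^sup>2) + ennreal 2 * ennreal ((norm (f y - f ?m))\<^sup>2)"
      by (rule ennreal_le_double_sum) auto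
    then show ?thesis using True by (simp add: H_def add.commute)
  qed auto
  have "(\<integral>\<^sup>+y. (\<integral>\<^sup>+x. ennreal ((norm (f x - f y))\<^sup>2) * indicator U x \<partial>lborel) * indicator U y \<partial>lborel) =
     (\<integral>\<^sup>+y. (\<integral>\<^sup>+x. ennreal ((norm (f x - f y))\<^sup>2) * indicator U x * indicator U y \<partial>lborel) \<partial>lborel)"
    by (intro nn_integral_cong nn_integral_multc[symmetric]) measurable
  also have "\<dots> \<le> (\<integral>\<^sup>+y. (\<integral>\<^sup>+x. ennreal 2 * H x y + ennreal 2 * H y x \<partial>lborel) \<partial>lborel)"
    by (intro nn_integral_mono pt)
  also have "\<dots> = (\<integral>\<^sup>+y. ennreal 2 * (\<integral>\<^sup>+x. H x y \<partial>lborel) + ennreal 2 * (\<integral>\<^sup>+x. H y x \<partial>lborel) \<partial>lborel)"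
    by (intro nn_integral_cong) (simp add: nn_integral_add nn_integral_cmult)
  also have "\<dots> = ennreal 2 * (\<integral>\<^sup>+y. (\<integral>\<^sup>+x. H x y \<partial>lborel) \<partial>lborel) + ennreal 2 * (\<integral>\<^sup>+y. (\<integral>\<^sup>+x. H y x \<partial>lborel) \<partial>lborel)"
  proof -
    have [measurable]: "(\<lambda>y. \<integral>\<^sup>+x. H x y \<partial>lborel) \<in> borel_measurable lborel" "(\<lambda>y. \<integral>\<^sup>+x. H y x \<partial>lborel) \<in> borel_measurable lborel"
      unfolding H_def by measurable
    show ?thesis by (simp add: nn_integral_add nn_integral_cmult)
  qed
  also have "\<dots> \<le> ennreal 2 * (?J * emeasure lborel U) + ennreal 2 * (?J * emeasure lborel U)"
    by (intro add_mono mult_left_mono 1 2) auto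
  also have "\<dots> = (ennreal 2 + ennreal 2) * (?J * emeasure lborel U)" by (simp only: distrib_right)
  also have "ennreal 2 + ennreal 2 = ennreal 4" by (subst ennreal_plus[symmetric]) auto
  finally show ?thesis by (simp only: mult.assoc)
qed

lemma measure_pos: "measure lebesgue U > 0"
proof -
  have "U \<noteq> {}" using \<rho> by auto
  then have "\<not> negligible U" by (rule open_not_negligible[OF U(1)])
  then show ?thesis using lm by (metis measure_nonneg less_eq_real_def negligible_iff_measure)
qed

definition mean :: "(plane \<Rightarrow> 'b::euclidean_space) \<Rightarrow> 'b" where
  "mean f = (1 / measure lebesgue U) *\<^sub>R (\<integral>x. f x \<partial>M)"

lemma integral_const_M: "(\<integral>x. (a::'b::euclidean_space) \<partial>M) = measure lebesgue U *\<^sub>R a"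
  using Usets by (simp add: measure_restrict_space)

lemma L2_const: "L2 M (\<lambda>x. a)"
  by (rule L2_continuous) simp

lemma mean_minimal:
  fixes f :: "plane \<Rightarrow> 'b::euclidean_space"
  assumes f: "L2 M f"
  shows "norm_L2 M (\<lambda>x. f x - mean f) \<le> norm_L2 M (\<lambda>x. f x - a)"
proof (rule power2_le_imp_le)
  let ?m = "mean f"
  note fi = L2_integrable[OF f]
  note fm = L2_diff[OF f L2_const[of ?m]]
  have c: "integrable M (\<lambda>x. b)" for b :: 'b by (rule finite_measure.integrable_const[OF fin])
  have z: "(\<integral>x. (f x - ?m) \<bullet> (?m - a) \<partial>M) = 0"
  proof -
    have "(\<integral>x. (f x - ?m) \<bullet> (?m - a) \<partial>M) = (\<integral>x. f x - ?m \<partial>M) \<bullet> (?m - a)"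
      by (rule integral_inner_left) (use fi c in simp)
    also have "(\<integral>x. f x - ?m \<partial>M) = 0"
      using fi c[of ?m] measure_pos by (simp add: integral_const_M mean_def del: lebesgue_integral_const)
    finally show ?thesis by simp
  qed
  have zi: "integrable M (\<lambda>x. (f x - ?m) \<bullet> (?m - a))"
    by (rule integrable_inner_left) (use fi c in simp)
  have "(norm_L2 M (\<lambda>x. f x - ?m))\<^sup>2 = (\<integral>x. (norm (f x - ?m))\<^sup>2 \<partial>M) + 2 * (\<integral>x. (f x - ?m) \<bullet> (?m - a) \<partial>M)"
    by (simp add: norm_L2_sq z)
  also have "\<dots> = (\<integral>x. (norm (f x - ?m))\<^sup>2 + 2 * ((f x - ?m) \<bullet> (?m - a)) \<partial>M)"
    using zi L2D(2)[OF fm] by simp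
  also have "\<dots> \<le> (\<integral>x. (norm (f x - a))\<^sup>2 \<partial>M)"
  proof (rule integral_mono)
    fix x
    have "(norm (f x - a))\<^sup>2 = (norm (f x - ?m))\<^sup>2 + 2 * ((f x - ?m) \<bullet> (?m - a)) + (norm (?m - a))\<^sup>2"
      unfolding power2_norm_eq_inner by (simp add: algebra_simps inner_commute)
    then show "(norm (f x - ?m))\<^sup>2 + 2 * ((f x - ?m) \<bullet> (?m - a)) \<le> (norm (f x - a))\<^sup>2" by simp
  qed (use zi L2D(2)[OF fm] L2D(2)[OF L2_diff[OF f L2_const[of a]]] in auto)
  finally show "(norm_L2 M (\<lambda>x. f x - mean f))\<^sup>2 \<le> (norm_L2 M (\<lambda>x. f x - a))\<^sup>2" by (simp add: norm_L2_sq)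
qed simp

lemma Poincare_smooth:
  fixes f :: "plane \<Rightarrow> 'b::euclidean_space"
  assumes f: "smooth f" and h: "\<And>x y. x \<in> U \<Longrightarrow> y \<in> U \<Longrightarrow> norm (x - y) \<le> h"
  shows "(norm_L2 M (\<lambda>x. f x - mean f))\<^sup>2 \<le> 4 * h\<^sup>2 * (\<Sum>i\<in>UNIV. (norm_L2 M (pdiff i f))\<^sup>2)"
proof -
  have [measurable]: "U \<in> sets borel" using U(1) by simp
  let ?S = "\<Sum>i\<in>UNIV. (norm_L2 M (pdiff i f))\<^sup>2" and ?n = "(norm_L2 M (\<lambda>x. f x - mean f))\<^sup>2"
  have S0: "?S \<ge> 0" by (simp add: sum_nonneg)
  have eU: "emeasure lborel U = ennreal (measure lebesgue U)"
    using emeasure_eq_measure2[OF lm] Usets by (simp add: emeasure_completion main_part_sets)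
  have "ennreal ?n * emeasure lborel U = (\<integral>\<^sup>+y. ennreal ?n * indicator U y \<partial>lborel)"
    by (rule nn_integral_cmult_indicator[symmetric]) simp
  also have "\<dots> \<le> (\<integral>\<^sup>+y. (\<integral>\<^sup>+x. ennreal ((norm (f x - f y))\<^sup>2) * indicator U x \<partial>lborel) * indicator U y \<partial>lborel)"
  proof (intro nn_integral_mono mult_right_mono)
    fix y
    have "ennreal ?n \<le> ennreal ((norm_L2 M (\<lambda>x. f x - f y))\<^sup>2)"
      by (intro ennreal_leI power_mono mean_minimal L2_smooth f) simp
    also have "\<dots> = (\<integral>\<^sup>+x. ennreal ((norm (f x - f y))\<^sup>2) * indicator U x \<partial>lborel)"
      by (rule norm_L2_nn_integral) (intro continuous_intros smooth_continuous f)
    finally show "ennreal ?n \<le> (\<integral>\<^sup>+x. ennreal ((norm (f x - f y))\<^sup>2) * indicator U x \<partial>lborel)" .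
  qed simp
  also have "\<dots> \<le> ennreal 4 * (ennreal (h\<^sup>2) * ennreal ?S) * emeasure lborel U"
    using pair_bound[OF f h] unfolding grad_sq_nn_integral[OF f] .
  finally have "ennreal (?n * measure lebesgue U) \<le> ennreal (4 * (h\<^sup>2 * ?S) * measure lebesgue U)"
    using S0 by (simp only: eU) (simp add: ennreal_mult)
  then have "?n * measure lebesgue U \<le> 4 * (h\<^sup>2 * ?S) * measure lebesgue U"
    using S0 by (subst (asm) ennreal_le_iff) (auto intro!: mult_nonneg_nonneg)
  then show ?thesis using measure_pos by (simp add: mult.assoc)
qed

lemma Poincare:
  fixes f :: "plane \<Rightarrow> 'b::euclidean_space"
  assumes f: "f \<in> sobolev 1 U" and h: "\<And>x y. x \<in> U \<Longrightarrow> y \<in> U \<Longrightarrow> norm (x - y) \<le> h"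
  shows "(norm_L2 M (\<lambda>x. f x - mean f))\<^sup>2 \<le> 4 * h\<^sup>2 * (\<Sum>i\<in>UNIV. (norm_L2 M (weak_deriv U [i] f))\<^sup>2)"
proof -
  obtain \<phi> where \<phi>: "\<And>n. smooth (\<phi> n)" "(\<lambda>n. norm_L2 M (\<lambda>x. \<phi> n x - f x)) \<longlonglongrightarrow> 0"
    "\<And>i. (\<lambda>n. norm_L2 M (\<lambda>x. pdiff i (\<phi> n) x - weak_deriv U [i] f x)) \<longlonglongrightarrow> 0"
    using sobolev_approx[OF f] by blast
  note fL = sobolevD[OF f] and w = sobolev_weak_deriv(1)[OF f, of "[i]" for i, simplified]
  let ?B = "\<lambda>n. 4 * h\<^sup>2 * (\<Sum>i\<in>UNIV. (norm_L2 M (pdiff i (\<phi> n)))\<^sup>2)"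
  have le: "norm_L2 M (\<lambda>x. f x - mean f) \<le> norm_L2 M (\<lambda>x. \<phi> n x - f x) + sqrt (?B n)" for n
  proof -
    have "norm_L2 M (\<lambda>x. f x - mean f) \<le> norm_L2 M (\<lambda>x. f x - mean (\<phi> n))" by (rule mean_minimal[OF fL])
    also have "\<dots> \<le> norm_L2 M (\<lambda>x. f x - \<phi> n x) + norm_L2 M (\<lambda>x. \<phi> n x - mean (\<phi> n))"
      by (rule norm_L2_triangle3[OF fL L2_smooth[OF \<phi>(1)] L2_const])
    also have "norm_L2 M (\<lambda>x. \<phi> n x - mean (\<phi> n)) \<le> sqrt (?B n)"
      by (rule real_le_rsqrt[OF Poincare_smooth[OF \<phi>(1) h]])
    finally show ?thesis by (simp add: norm_L2_commute[of M f])
  qed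
  have "(\<lambda>n. norm_L2 M (\<lambda>x. \<phi> n x - f x) + sqrt (?B n)) \<longlonglongrightarrow> 0 + sqrt (4 * h\<^sup>2 * (\<Sum>i\<in>UNIV. (norm_L2 M (weak_deriv U [i] f))\<^sup>2))"
    by (intro tendsto_intros \<phi>(2) norm_L2_tendsto[OF _ w \<phi>(3)] L2_smooth smooth_pdiff \<phi>(1))
  from LIMSEQ_le_const[OF this, of "norm_L2 M (\<lambda>x. f x - mean f)"] le
  have "norm_L2 M (\<lambda>x. f x - mean f) \<le> sqrt (4 * h\<^sup>2 * (\<Sum>i\<in>UNIV. (norm_L2 M (weak_deriv U [i] f))\<^sup>2))" by auto
  then have "(norm_L2 M (\<lambda>x. f x - mean f))\<^sup>2 \<le> (sqrt (4 * h\<^sup>2 * (\<Sum>i\<in>UNIV. (norm_L2 M (weak_deriv U [i] f))\<^sup>2)))\<^sup>2"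
    by (rule power_mono) simp
  then show ?thesis by (simp add: sum_nonneg)
qed

end

subsection \<open>Riesz-Fischer\<close>

lemma (in finite_measure) L1_le_norm_L2:
  assumes f: "L2 M f"
  shows "integrable M f" "(\<integral>x. norm (f x) \<partial>M) \<le> norm_L2 M f * sqrt (measure M (space M))"
proof -
  have 1: "L2 M (\<lambda>x. 1::real)" by (simp add: L2_def)
  have i: "integrable M (\<lambda>x. norm (f x))" using L2_mult_integrable[OF f 1] by simp
  then show "integrable M f" using L2D(1)[OF f] by (simp add: integrable_norm_iff)
  show "(\<integral>x. norm (f x) \<partial>M) \<le> norm_L2 M f * sqrt (measure M (space M))"
    using L2_Cauchy_Schwarz[OF f 1] by (simp add: norm_L2_def)
qed

lemma (in finite_measure) L2_complete:
  fixes \<phi> :: "nat \<Rightarrow> 'a \<Rightarrow> 'b::euclidean_space"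
  assumes L: "\<And>n. L2 M (\<phi> n)"
    and C: "\<And>\<eta>. \<eta> > 0 \<Longrightarrow> \<exists>N. \<forall>m\<ge>N. \<forall>n\<ge>N. norm_L2 M (\<lambda>x. \<phi> m x - \<phi> n x) < \<eta>"
  obtains w where "L2 M w" "(\<lambda>n. norm_L2 M (\<lambda>x. \<phi> n x - w x)) \<longlonglongrightarrow> 0"
proof -
  have "\<exists>N. \<forall>m\<ge>N. \<forall>n\<ge>N. norm_L2 M (\<lambda>x. \<phi> m x - \<phi> n x) < (1/2) ^ k" for k :: nat
    by (rule C) simp
  then obtain N where N: "\<And>k m n. m \<ge> N k \<Longrightarrow> n \<ge> N k \<Longrightarrow> norm_L2 M (\<lambda>x. \<phi> m x - \<phi> n x) < (1/2) ^ k"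
    by metis
  define r where "r k = (\<Sum>j\<le>k. N j) + k" for k
  have rN: "r k \<ge> N k" "r (Suc k) \<ge> N k" "r k \<ge> k" for k
  proof -
    have "N k \<le> (\<Sum>j\<le>k. N j)" by (rule member_le_sum) auto
    then show "r k \<ge> N k" "r (Suc k) \<ge> N k" "r k \<ge> k" by (auto simp: r_def)
  qed
  define S where "S = sqrt (measure M (space M))"
  have S0: "S \<ge> 0" by (simp add: S_def)
  define d where "d k x = norm (\<phi> (r (Suc k)) x - \<phi> (r k) x)" for k x
  have dL: "L2 M (\<lambda>x. \<phi> (r (Suc k)) x - \<phi> (r k) x)" for k by (intro L2_diff L)
  have dm[measurable]: "d k \<in> borel_measurable M" for k
    unfolding d_def[abs_def] using L2D(1)[OF dL[of k]] by simp
  have di: "(\<integral>\<^sup>+x. ennreal (d k x) \<partial>M) \<le> ennreal ((1/2) ^ k * S)" for k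
  proof -
    have "(\<integral>\<^sup>+x. ennreal (d k x) \<partial>M) = ennreal (\<integral>x. d k x \<partial>M)"
      unfolding d_def by (rule nn_integral_eq_integral) (use L1_le_norm_L2(1)[OF dL] in auto)
    also have "\<dots> \<le> ennreal ((1/2) ^ k * S)"
    proof (rule ennreal_leI)
      have "(\<integral>x. d k x \<partial>M) \<le> norm_L2 M (\<lambda>x. \<phi> (r (Suc k)) x - \<phi> (r k) x) * S"
        using L1_le_norm_L2(2)[OF dL] by (simp add: d_def S_def)
      also have "\<dots> \<le> (1/2) ^ k * S"
        by (rule mult_right_mono[OF less_imp_le[OF N[OF rN(2) rN(1)]] S0])
      finally show "(\<integral>x. d k x \<partial>M) \<le> (1/2) ^ k * S" .
    qed
    finally show ?thesis .
  qed
  have "(\<integral>\<^sup>+x. (\<Sum>k. ennreal (d k x)) \<partial>M) = (\<Sum>k. \<integral>\<^sup>+x. ennreal (d k x) \<partial>M)"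
    by (rule nn_integral_suminf) measurable
  also have "\<dots> \<le> (\<Sum>k. ennreal ((1/2) ^ k * S))"
    by (intro suminf_le di) auto
  also have "\<dots> = ennreal (\<Sum>k. (1/2) ^ k * S)"
    by (rule suminf_ennreal2) (use S0 in \<open>auto intro!: summable_mult2 summable_geometric\<close>)
  also have "\<dots> < top" by simp
  finally have "(\<integral>\<^sup>+x. (\<Sum>k. ennreal (d k x)) \<partial>M) \<noteq> \<infinity>" by simp
  then have "AE x in M. (\<Sum>k. ennreal (d k x)) \<noteq> \<infinity>"
    by (intro nn_integral_PInf_AE) measurable
  then have conv: "AE x in M. convergent (\<lambda>k. \<phi> (r k) x)"
  proof (rule eventually_mono)
    fix x assume "(\<Sum>k. ennreal (d k x)) \<noteq> \<infinity>"
    then have "summable (\<lambda>k. norm (\<phi> (r (Suc k)) x - \<phi> (r k) x))"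
      by (intro summable_suminf_not_top) (auto simp: d_def)
    then have "summable (\<lambda>k. \<phi> (r (Suc k)) x - \<phi> (r k) x)" by (rule summable_norm_cancel)
    then have "convergent (\<lambda>n. \<Sum>k<n. \<phi> (r (Suc k)) x - \<phi> (r k) x)" by (simp add: summable_iff_convergent)
    then have "convergent (\<lambda>n. \<phi> (r n) x - \<phi> (r 0) x)" by (subst (asm) sum_lessThan_telescope)
    then show "convergent (\<lambda>k. \<phi> (r k) x)" using convergent_diff_const_right_iff by blast
  qed
  define w where "w x = lim (\<lambda>k. \<phi> (r k) x)" for x
  have wm[measurable]: "w \<in> borel_measurable M"
    unfolding w_def[abs_def] by (rule borel_measurable_lim_metric) (rule L2D(1)[OF L])
  have lim: "AE x in M. (\<lambda>k. \<phi> (r k) x) \<longlonglongrightarrow> w x"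
    using conv by (rule eventually_mono) (simp add: w_def convergent_LIMSEQ_iff)
  have key: "(\<integral>\<^sup>+x. ennreal ((norm (\<phi> n x - w x))\<^sup>2) \<partial>M) \<le> ennreal (\<eta>\<^sup>2)"
    if \<eta>: "\<eta> > 0" and K: "\<forall>m\<ge>K. \<forall>n\<ge>K. norm_L2 M (\<lambda>x. \<phi> m x - \<phi> n x) < \<eta>" and n: "n \<ge> K" for n K \<eta>
  proof -
    have pm: "\<phi> m \<in> borel_measurable M" for m by (rule L2D(1)[OF L])
    have "(\<integral>\<^sup>+x. ennreal ((norm (\<phi> n x - w x))\<^sup>2) \<partial>M) = (\<integral>\<^sup>+x. liminf (\<lambda>k. ennreal ((norm (\<phi> n x - \<phi> (r k) x))\<^sup>2)) \<partial>M)"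
    proof (rule nn_integral_cong_AE)
      show "AE x in M. ennreal ((norm (\<phi> n x - w x))\<^sup>2) = liminf (\<lambda>k. ennreal ((norm (\<phi> n x - \<phi> (r k) x))\<^sup>2))"
        using lim
      proof (rule eventually_mono)
        fix x assume "(\<lambda>k. \<phi> (r k) x) \<longlonglongrightarrow> w x"
        then have "(\<lambda>k. ennreal ((norm (\<phi> n x - \<phi> (r k) x))\<^sup>2)) \<longlonglongrightarrow> ennreal ((norm (\<phi> n x - w x))\<^sup>2)"
          by (intro tendsto_intros)
        then show "ennreal ((norm (\<phi> n x - w x))\<^sup>2) = liminf (\<lambda>k. ennreal ((norm (\<phi> n x - \<phi> (r k) x))\<^sup>2))"
          using lim_imp_Liminf[OF sequentially_bot] by metis
      qed
    qed
    also have "\<dots> \<le> liminf (\<lambda>k. \<integral>\<^sup>+x. ennreal ((norm (\<phi> n x - \<phi> (r k) x))\<^sup>2) \<partial>M)"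
      by (rule nn_integral_liminf) (use pm in measurable)
    also have "\<dots> \<le> ennreal (\<eta>\<^sup>2)"
    proof (rule Liminf_le)
      show "\<forall>\<^sub>F k in sequentially. (\<integral>\<^sup>+x. ennreal ((norm (\<phi> n x - \<phi> (r k) x))\<^sup>2) \<partial>M) \<le> ennreal (\<eta>\<^sup>2)"
      proof (rule eventually_sequentiallyI[of K])
        fix k assume "k \<ge> K"
        then have rk: "r k \<ge> K" using rN(3)[of k] by simp
        have "(\<integral>\<^sup>+x. ennreal ((norm (\<phi> n x - \<phi> (r k) x))\<^sup>2) \<partial>M) = ennreal ((norm_L2 M (\<lambda>x. \<phi> n x - \<phi> (r k) x))\<^sup>2)"
          unfolding norm_L2_sq by (rule nn_integral_eq_integral) (use L2D(2)[OF L2_diff[OF L L]] in auto)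
        also have "\<dots> \<le> ennreal (\<eta>\<^sup>2)"
          using K[rule_format, OF n rk] by (intro ennreal_leI power_mono) auto
        finally show "(\<integral>\<^sup>+x. ennreal ((norm (\<phi> n x - \<phi> (r k) x))\<^sup>2) \<partial>M) \<le> ennreal (\<eta>\<^sup>2)" .
      qed
    qed simp
    finally show ?thesis .
  qed
  have diffL: "L2 M (\<lambda>x. \<phi> n x - w x)" if "\<eta> > 0" "\<forall>m\<ge>K. \<forall>n\<ge>K. norm_L2 M (\<lambda>x. \<phi> m x - \<phi> n x) < \<eta>" "n \<ge> K" for n K \<eta>
    unfolding L2_def
  proof
    show m: "(\<lambda>x. \<phi> n x - w x) \<in> borel_measurable M" using L2D(1)[OF L[of n]] by simp
    show "integrable M (\<lambda>x. (norm (\<phi> n x - w x))\<^sup>2)"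
    proof (rule integrableI_bounded)
      show "(\<lambda>x. (norm (\<phi> n x - w x))\<^sup>2) \<in> borel_measurable M" using m by simp
      have "(\<integral>\<^sup>+ x. ennreal (norm ((norm (\<phi> n x - w x))\<^sup>2)) \<partial>M) \<le> ennreal (\<eta>\<^sup>2)" using key[OF that] by simp
      also have "\<dots> < \<infinity>" by simp
      finally show "(\<integral>\<^sup>+ x. ennreal (norm ((norm (\<phi> n x - w x))\<^sup>2)) \<partial>M) < \<infinity>" .
    qed
  qed
  obtain K1 where K1: "\<forall>m\<ge>K1. \<forall>n\<ge>K1. norm_L2 M (\<lambda>x. \<phi> m x - \<phi> n x) < 1" using C[of 1] by auto
  have wL: "L2 M w"
    using L2_diff[OF L[of K1] diffL[OF _ K1 order_refl]] by simp
  have "(\<lambda>n. norm_L2 M (\<lambda>x. \<phi> n x - w x)) \<longlonglongrightarrow> 0"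
  proof (rule LIMSEQ_I)
    fix e :: real assume e: "e > 0"
    then have e2: "e / 2 > 0" by simp
    obtain K where K: "\<forall>m\<ge>K. \<forall>n\<ge>K. norm_L2 M (\<lambda>x. \<phi> m x - \<phi> n x) < e / 2" using C[OF e2] by auto
    have "norm (norm_L2 M (\<lambda>x. \<phi> n x - w x) - 0) < e" if n: "n \<ge> K" for n
    proof -
      have "ennreal ((norm_L2 M (\<lambda>x. \<phi> n x - w x))\<^sup>2) = (\<integral>\<^sup>+x. ennreal ((norm (\<phi> n x - w x))\<^sup>2) \<partial>M)"
        unfolding norm_L2_sq by (rule nn_integral_eq_integral[symmetric]) (use L2D(2)[OF L2_diff[OF L wL]] in auto)
      also have "\<dots> \<le> ennreal ((e / 2)\<^sup>2)" by (rule key[OF e2 K n])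
      finally have "(norm_L2 M (\<lambda>x. \<phi> n x - w x))\<^sup>2 \<le> (e / 2)\<^sup>2" by (subst (asm) ennreal_le_iff) auto
      then have "norm_L2 M (\<lambda>x. \<phi> n x - w x) \<le> e / 2" by (rule power2_le_imp_le) (use e in simp)
      then show ?thesis using e by simp
    qed
    then show "\<exists>N. \<forall>n\<ge>N. norm (norm_L2 M (\<lambda>x. \<phi> n x - w x) - 0) < e" by blast
  qed
  then show thesis using that[OF wL] by blast
qed

(* PART 6 *)

definition wedge :: "plane \<Rightarrow> plane \<Rightarrow> real" where
  "wedge p q = p $ 1 * q $ 2 - p $ 2 * q $ 1"

lemma Basis_plane: "(Basis :: plane set) = {axis 1 1, axis 2 1}"
  unfolding Basis_vec_def by (auto simp: UNIV_2)

lemma axis_12: "axis 1 (1::real) $ (1::2) = 1" "axis 1 (1::real) $ (2::2) = 0"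
  "axis 2 (1::real) $ (1::2) = 0" "axis 2 (1::real) $ (2::2) = 1"
  by (auto simp: axis_def)

lemma prod_Basis_plane: "(\<Prod>b\<in>Basis. (x::plane) \<bullet> b) = x $ 1 * x $ 2"
proof -
  have "axis 1 (1::real) \<noteq> (axis 2 1 :: plane)" by (simp add: axis_eq_axis)
  then show ?thesis unfolding Basis_plane by (simp add: inner_axis)
qed

lemma wedge_axis: "wedge (axis 1 1) q = q $ 2" "wedge (axis 2 1) q = - q $ 1"
  "wedge q (axis 1 1) = - q $ 2" "wedge q (axis 2 1) = q $ 1"
  by (simp_all add: wedge_def axis_12)

lemma wedge_linear: "wedge (x + y) q = wedge x q + wedge y q" "wedge q (x + y) = wedge q x + wedge q y"
  "wedge (c *\<^sub>R x) q = c * wedge x q" "wedge q (c *\<^sub>R x) = c * wedge q x" "wedge x x = 0"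
  "wedge (x - y) q = wedge x q - wedge y q" "wedge q (x - y) = wedge q x - wedge q y"
  by (simp_all add: wedge_def algebra_simps)

lemma wedge_expand: "wedge y q *\<^sub>R p + wedge p y *\<^sub>R q = wedge p q *\<^sub>R y"
  by (simp add: vec_eq_iff forall_2 wedge_def algebra_simps)

lemma lborel_plane_product:
  "(lborel :: plane measure) = distr (lborel \<Otimes>\<^sub>M lborel) borel (\<lambda>p. fst p *\<^sub>R axis 1 1 + snd p *\<^sub>R axis 2 1)"
proof (rule lborel_eqI)
  fix l u :: plane assume le: "\<And>b. b \<in> Basis \<Longrightarrow> l \<bullet> b \<le> u \<bullet> b"
  have le': "l $ 1 \<le> u $ 1" "l $ 2 \<le> u $ 2"
    using le[of "axis 1 1"] le[of "axis 2 1"] by (auto simp: Basis_plane inner_axis)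
  let ?f = "\<lambda>p::real\<times>real. fst p *\<^sub>R axis 1 (1::real) + snd p *\<^sub>R axis (2::2) 1"
  have "emeasure (distr (lborel \<Otimes>\<^sub>M lborel) borel ?f) (box l u) =
      emeasure (lborel \<Otimes>\<^sub>M lborel) (?f -` box l u \<inter> space (lborel \<Otimes>\<^sub>M lborel))"
    by (rule emeasure_distr) measurable
  also have "?f -` box l u \<inter> space (lborel \<Otimes>\<^sub>M lborel) = {l $ 1 <..< u $ 1} \<times> {l $ 2 <..< u $ 2}"
    by (auto simp: mem_box_cart axis_def space_pair_measure forall_2)
  also have "emeasure (lborel \<Otimes>\<^sub>M lborel) ({l $ 1 <..< u $ 1} \<times> {l $ 2 <..< u $ 2}) = ennreal (u $ 1 - l $ 1) * ennreal (u $ 2 - l $ 2)"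
    using le' by (subst lborel.emeasure_pair_measure_Times) auto
  also have "\<dots> = ennreal (\<Prod>b\<in>Basis. (u - l) \<bullet> b)"
    using le' unfolding prod_Basis_plane by (simp add: ennreal_mult)
  finally show "emeasure (distr (lborel \<Otimes>\<^sub>M lborel) borel ?f) (box l u) = ennreal (\<Prod>b\<in>Basis. (u - l) \<bullet> b)" .
qed simp

lemma nn_integral_plane_product:
  assumes [measurable]: "F \<in> borel_measurable borel"
  shows "(\<integral>\<^sup>+x. F x \<partial>(lborel :: plane measure)) = (\<integral>\<^sup>+t. (\<integral>\<^sup>+u. F (t *\<^sub>R axis 1 1 + u *\<^sub>R axis 2 1) \<partial>lborel) \<partial>lborel)"
proof -
  have "(\<integral>\<^sup>+x. F x \<partial>(lborel :: plane measure)) = (\<integral>\<^sup>+p. F (fst p *\<^sub>R axis 1 1 + snd p *\<^sub>R axis 2 1) \<partial>(lborel \<Otimes>\<^sub>M lborel))"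
    by (subst lborel_plane_product, rule nn_integral_distr) measurable
  also have "\<dots> = (\<integral>\<^sup>+t. (\<integral>\<^sup>+u. F (t *\<^sub>R axis 1 1 + u *\<^sub>R axis 2 1) \<partial>lborel) \<partial>lborel)"
    by (subst lborel.nn_integral_fst[symmetric]) (auto simp: measurable_split_conv)
  finally show ?thesis .
qed

lemma lborel_linear_plane:
  assumes D: "wedge p q \<noteq> 0"
  shows "(lborel :: plane measure) = density (distr lborel borel (\<lambda>x::plane. x $ 1 *\<^sub>R p + x $ 2 *\<^sub>R q)) (\<lambda>_. ennreal \<bar>wedge p q\<bar>)"
proof (rule lborel_eqI)
  fix l u :: plane assume le: "\<And>b. b \<in> Basis \<Longrightarrow> l \<bullet> b \<le> u \<bullet> b"
  let ?D = "wedge p q"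
  let ?A = "\<lambda>x::plane. x $ 1 *\<^sub>R p + x $ 2 *\<^sub>R q"
  let ?B = "\<lambda>y::plane. (wedge y q / ?D) *\<^sub>R axis 1 (1::real) + (wedge p y / ?D) *\<^sub>R axis (2::2) 1"
  have AB: "?A (?B y) = y" for y
  proof -
    have "?A (?B y) = (1 / ?D) *\<^sub>R (wedge y q *\<^sub>R p + wedge p y *\<^sub>R q)" by (simp add: axis_12 scaleR_add_right)
    then show ?thesis using D by (simp add: wedge_expand)
  qed
  have BA: "?B (?A x) = x" for x
    using D by (simp add: vec_eq_iff forall_2 axis_12 wedge_linear)
  have lin: "linear ?B"
    by (rule linearI) (auto simp: wedge_linear add_divide_distrib algebra_simps)
  have det: "\<bar>det (matrix ?B)\<bar> = 1 / \<bar>?D\<bar>"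
  proof -
    have "det (matrix ?B) = (q $ 2 / ?D) * (p $ 1 / ?D) - ((- q $ 1) / ?D) * ((- p $ 2) / ?D)"
      by (simp add: det_2 matrix_def axis_12 wedge_axis)
    also have "\<dots> = (p $ 1 * q $ 2 - p $ 2 * q $ 1) / (?D * ?D)" by (simp add: diff_divide_distrib mult.commute)
    also have "\<dots> = 1 / ?D" using D by (simp add: wedge_def[of p q, symmetric])
    finally show ?thesis by simp
  qed
  have pre: "?A -` box l u = ?B ` box l u"
  proof (intro equalityI subsetI)
    fix x assume "x \<in> ?A -` box l u"
    then show "x \<in> ?B ` box l u" using BA[of x] by (intro image_eqI[of _ _ "?A x"]) auto
  next
    fix x assume "x \<in> ?B ` box l u" then show "x \<in> ?A -` box l u" using AB by auto
  qed
  have mA: "?A \<in> borel_measurable borel"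
    by (intro borel_measurable_continuous_onI continuous_intros)
  then have bs: "?A -` box l u \<in> sets borel" using measurable_sets[of ?A borel borel "box l u"] by simp
  have mB: "measure lebesgue (?B ` box l u) = 1 / \<bar>?D\<bar> * measure lebesgue (box l u)"
    using measure_linear_image[OF lin, of "box l u"] det by simp
  have lmB: "?B ` box l u \<in> lmeasurable" by (rule measurable_linear_image[OF lin]) simp
  have "emeasure (density (distr lborel borel ?A) (\<lambda>_. ennreal \<bar>?D\<bar>)) (box l u) = ennreal \<bar>?D\<bar> * emeasure (distr lborel borel ?A) (box l u)"
    by (subst emeasure_density) (auto simp: nn_integral_cmult_indicator)
  also have "emeasure (distr lborel borel ?A) (box l u) = emeasure lborel (?A -` box l u)"
    using mA by (subst emeasure_distr) auto
  also have "\<dots> = emeasure lebesgue (?B ` box l u)"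
    using bs unfolding pre by (simp add: emeasure_completion main_part_sets)
  also have "\<dots> = ennreal (1 / \<bar>?D\<bar> * measure lebesgue (box l u))"
    using emeasure_eq_measure2[OF lmB] mB by simp
  also have "ennreal \<bar>?D\<bar> * ennreal (1 / \<bar>?D\<bar> * measure lebesgue (box l u)) = ennreal (measure lebesgue (box l u))"
    using D by (subst ennreal_mult[symmetric]) auto
  also have "measure lebesgue (box l u) = (\<Prod>b\<in>Basis. (u - l) \<bullet> b)"
    using le by (simp add: measure_completion measure_lborel_box_eq)
  finally show "emeasure (density (distr lborel borel ?A) (\<lambda>_. ennreal \<bar>?D\<bar>)) (box l u) = ennreal (\<Prod>b\<in>Basis. (u - l) \<bullet> b)" .
qed simp

lemma nn_integral_parallelogram:
  assumes F[measurable]: "F \<in> borel_measurable borel" and D: "wedge p q \<noteq> 0"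
  shows "(\<integral>\<^sup>+t. (\<integral>\<^sup>+u. F (a + t *\<^sub>R p + u *\<^sub>R q) \<partial>lborel) \<partial>lborel) = ennreal (1 / \<bar>wedge p q\<bar>) * (\<integral>\<^sup>+x. F x \<partial>lborel)"
proof -
  let ?A = "\<lambda>x::plane. x $ 1 *\<^sub>R p + x $ 2 *\<^sub>R q"
  have mA[measurable]: "?A \<in> borel_measurable borel"
    by (intro borel_measurable_continuous_onI continuous_intros)
  have mFA: "(\<lambda>x. F (a + ?A x)) \<in> borel_measurable borel"
    by (rule measurable_compose[OF _ F]) (use mA in measurable)
  have "(\<integral>\<^sup>+x. F x \<partial>lborel) = (\<integral>\<^sup>+x. F (a + 1 *\<^sub>R x) \<partial>lborel)"
    using nn_integral_dilate[OF F, of 1 a] by simp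
  also have "\<dots> = (\<integral>\<^sup>+x. F (a + x) \<partial>density (distr lborel borel ?A) (\<lambda>_. ennreal \<bar>wedge p q\<bar>))"
    using lborel_linear_plane[OF D] by simp
  also have "\<dots> = (\<integral>\<^sup>+x. ennreal \<bar>wedge p q\<bar> * F (a + x) \<partial>distr lborel borel ?A)"
    by (rule nn_integral_density) measurable
  also have "\<dots> = (\<integral>\<^sup>+x. ennreal \<bar>wedge p q\<bar> * F (a + ?A x) \<partial>lborel)"
    using mA by (intro nn_integral_distr) auto
  also have "\<dots> = ennreal \<bar>wedge p q\<bar> * (\<integral>\<^sup>+x. F (a + ?A x) \<partial>lborel)"
    using mFA by (intro nn_integral_cmult) simp
  also have "(\<integral>\<^sup>+x. F (a + ?A x) \<partial>lborel) = (\<integral>\<^sup>+t. (\<integral>\<^sup>+u. F (a + t *\<^sub>R p + u *\<^sub>R q) \<partial>lborel) \<partial>lborel)"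
    by (subst nn_integral_plane_product[OF mFA]) (simp add: axis_12 add.assoc)
  finally have "ennreal (1 / \<bar>wedge p q\<bar>) * (\<integral>\<^sup>+x. F x \<partial>lborel) =
    (ennreal (1 / \<bar>wedge p q\<bar>) * ennreal \<bar>wedge p q\<bar>) * (\<integral>\<^sup>+t. (\<integral>\<^sup>+u. F (a + t *\<^sub>R p + u *\<^sub>R q) \<partial>lborel) \<partial>lborel)"
    by (simp only: mult.assoc)
  also have "ennreal (1 / \<bar>wedge p q\<bar>) * ennreal \<bar>wedge p q\<bar> = 1"
    using D by (subst ennreal_mult[symmetric]) auto
  finally show ?thesis by simp
qed

lemma ennreal_combination:
  assumes "x \<ge> 0" "y \<ge> 0" "c \<ge> 0" "X \<ge> 0" "Y \<ge> 0"
  shows "ennreal x * (ennreal c * ennreal X) + ennreal y * (ennreal c * ennreal Y) = ennreal (x * (c * X) + y * (c * Y))"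
  using assms by (simp add: ennreal_mult[symmetric] ennreal_plus[symmetric] del: ennreal_plus)

lemma (in starlike) half_trace:
  fixes f :: "plane \<Rightarrow> 'b::euclidean_space"
  assumes f: "smooth f" and D: "wedge p q \<noteq> 0" and h: "norm q \<le> h"
    and in_U: "\<And>t u. 0 < t \<Longrightarrow> t < 1/2 \<Longrightarrow> 0 < u \<Longrightarrow> u < 1/2 \<Longrightarrow> a + t *\<^sub>R p + u *\<^sub>R q \<in> U"
  shows "(\<integral>\<^sup>+t. ennreal ((norm (f (a + t *\<^sub>R p)))\<^sup>2) * indicator {0<..<1/2} t \<partial>lborel) \<le>
    ennreal ((4 * (norm_L2 M f)\<^sup>2 + h\<^sup>2 * (\<Sum>i\<in>UNIV. (norm_L2 M (pdiff i f))\<^sup>2)) / \<bar>wedge p q\<bar>)"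
proof -
  have h0: "h \<ge> 0" using h norm_ge_zero order_trans by blast
  have [measurable]: "U \<in> sets borel" using U(1) by simp
  have [measurable]: "f \<in> borel_measurable borel"
    by (rule borel_measurable_continuous_onI[OF smooth_continuous[OF f]])
  have [measurable]: "grad_sq f \<in> borel_measurable borel"
    by (rule borel_measurable_continuous_onI[OF grad_sq_continuous[OF f]])
  let ?J = "{0<..<1/2::real}"
  let ?n = "\<lambda>x. ennreal ((norm (f x))\<^sup>2)" and ?g = "\<lambda>x. ennreal (grad_sq f x)"
  let ?G = "\<lambda>t. \<integral>\<^sup>+u. ?g (a + t *\<^sub>R p + u *\<^sub>R q) * indicator ?J u \<partial>lborel"
  let ?N = "\<lambda>t. \<integral>\<^sup>+u. ?n (a + t *\<^sub>R p + u *\<^sub>R q) * indicator ?J u \<partial>lborel"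
  have pt: "?n (a + t *\<^sub>R p) \<le> ennreal 4 * ?N t + ennreal (h\<^sup>2) * ?G t" for t
  proof -
    have 1: "?n (a + t *\<^sub>R p) \<le> ennreal 2 * ?n (a + t *\<^sub>R p + u *\<^sub>R q) + ennreal (h\<^sup>2) * ?G t" if u: "u \<in> ?J" for u
    proof -
      let ?y = "a + t *\<^sub>R p"
      let ?d = "norm (f (?y + u *\<^sub>R q) - f (?y + 0 *\<^sub>R q))"
      have "norm (f ?y) \<le> norm (f (?y + u *\<^sub>R q)) + ?d"
        using norm_triangle_ineq4[of "f (?y + u *\<^sub>R q)" "f (?y + u *\<^sub>R q) - f ?y"] by simp
      then have "(norm (f ?y))\<^sup>2 \<le> (norm (f (?y + u *\<^sub>R q)) + ?d)\<^sup>2" by (rule power_mono) simp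
      also have "\<dots> \<le> 2 * (norm (f (?y + u *\<^sub>R q)))\<^sup>2 + 2 * ?d\<^sup>2" by (rule sq_add_le)
      finally have a: "?n ?y \<le> ennreal 2 * ?n (?y + u *\<^sub>R q) + ennreal 2 * ennreal (?d\<^sup>2)"
        by (rule ennreal_le_double_sum) auto
      have "ennreal (?d\<^sup>2) \<le> ennreal ((u - 0) * (norm q)\<^sup>2) * (\<integral>\<^sup>+s. ?g (?y + s *\<^sub>R q) * indicator {0..u} s \<partial>lborel)"
        by (rule segment_square_bound[OF f]) (use u in simp)
      also have "\<dots> \<le> ennreal (h\<^sup>2 / 2) * ?G t"
      proof (rule mult_mono)
        have "u * (norm q)\<^sup>2 \<le> (1/2) * h\<^sup>2" using u h h0 by (intro mult_mono power_mono) auto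
        then show "ennreal ((u - 0) * (norm q)\<^sup>2) \<le> ennreal (h\<^sup>2 / 2)" by (intro ennreal_leI) simp
        show "(\<integral>\<^sup>+s. ?g (?y + s *\<^sub>R q) * indicator {0..u} s \<partial>lborel) \<le> ?G t"
        proof (rule nn_integral_mono_AE)
          show "AE s in lborel. ?g (?y + s *\<^sub>R q) * indicator {0..u} s \<le> ?g (?y + s *\<^sub>R q) * indicator ?J s"
            using AE_lborel_singleton[of 0]
            by (rule eventually_mono) (use u in \<open>auto simp: indicator_def\<close>)
        qed
      qed auto
      finally have "ennreal 2 * ennreal (?d\<^sup>2) \<le> ennreal 2 * (ennreal (h\<^sup>2 / 2) * ?G t)" by (rule mult_left_mono) simp
      also have "\<dots> = (ennreal 2 * ennreal (h\<^sup>2 / 2)) * ?G t" by (simp only: mult.assoc)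
      also have "ennreal 2 * ennreal (h\<^sup>2 / 2) = ennreal (h\<^sup>2)" by (subst ennreal_mult[symmetric]) auto
      finally show ?thesis using a by (meson add_left_mono order_trans)
    qed
    have eJ: "emeasure lborel ?J = ennreal (1/2)" by (subst emeasure_lborel_Ioo) auto
    have "?n (a + t *\<^sub>R p) * ennreal (1/2) = (\<integral>\<^sup>+u. ?n (a + t *\<^sub>R p) * indicator ?J u \<partial>lborel)"
      by (subst nn_integral_cmult_indicator) (auto simp: eJ)
    also have "\<dots> \<le> (\<integral>\<^sup>+u. ennreal 2 * (?n (a + t *\<^sub>R p + u *\<^sub>R q) * indicator ?J u) + (ennreal (h\<^sup>2) * ?G t) * indicator ?J u \<partial>lborel)"
    proof (rule nn_integral_mono)
      fix u show "?n (a + t *\<^sub>R p) * indicator ?J u \<le> ennreal 2 * (?n (a + t *\<^sub>R p + u *\<^sub>R q) * indicator ?J u) + (ennreal (h\<^sup>2) * ?G t) * indicator ?J u"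
      proof (cases "u \<in> ?J")
        case True
        then have i: "indicator ?J u = (1::ennreal)" by simp
        show ?thesis unfolding i mult_1_right by (rule 1[OF True])
      next
        case False
        then have i: "indicator ?J u = (0::ennreal)" by (simp add: indicator_def)
        show ?thesis unfolding i by simp
      qed
    qed
    also have "\<dots> = ennreal 2 * ?N t + (ennreal (h\<^sup>2) * ?G t) * ennreal (1/2)"
      by (subst nn_integral_add) (auto simp: nn_integral_cmult nn_integral_cmult_indicator eJ)
    finally have "?n (a + t *\<^sub>R p) * ennreal (1/2) * ennreal 2 \<le> (ennreal 2 * ?N t + (ennreal (h\<^sup>2) * ?G t) * ennreal (1/2)) * ennreal 2"
      by (rule mult_right_mono) simp
    moreover have "ennreal (1/2) * ennreal 2 = 1" "ennreal 2 * ennreal 2 = ennreal 4"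
      by (subst ennreal_mult[symmetric]; simp)+
    moreover have "(ennreal 2 * ?N t + (ennreal (h\<^sup>2) * ?G t) * ennreal (1/2)) * ennreal 2 =
       (ennreal 2 * ennreal 2) * ?N t + (ennreal (h\<^sup>2) * ?G t) * (ennreal (1/2) * ennreal 2)"
    proof -
      have "(x * a + (b * c) * y) * x = (x * x) * a + (b * c) * (y * x)" for a b c x y :: ennreal
        by (simp add: distrib_left distrib_right mult_ac)
      then show ?thesis by blast
    qed
    ultimately show ?thesis by (simp only: mult.assoc mult_1_right)
  qed
  have par: "(\<integral>\<^sup>+t. (\<integral>\<^sup>+u. F (a + t *\<^sub>R p + u *\<^sub>R q) * indicator ?J u \<partial>lborel) * indicator ?J t \<partial>lborel) \<le>
     ennreal (1 / \<bar>wedge p q\<bar>) * (\<integral>\<^sup>+x. F x * indicator U x \<partial>lborel)" if F: "F \<in> borel_measurable borel" for F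
  proof -
    have "(\<integral>\<^sup>+t. (\<integral>\<^sup>+u. F (a + t *\<^sub>R p + u *\<^sub>R q) * indicator ?J u \<partial>lborel) * indicator ?J t \<partial>lborel) \<le>
       (\<integral>\<^sup>+t. (\<integral>\<^sup>+u. F (a + t *\<^sub>R p + u *\<^sub>R q) * indicator U (a + t *\<^sub>R p + u *\<^sub>R q) \<partial>lborel) \<partial>lborel)"
    proof (rule nn_integral_mono)
      fix t
      show "(\<integral>\<^sup>+u. F (a + t *\<^sub>R p + u *\<^sub>R q) * indicator ?J u \<partial>lborel) * indicator ?J t \<le>
         (\<integral>\<^sup>+u. F (a + t *\<^sub>R p + u *\<^sub>R q) * indicator U (a + t *\<^sub>R p + u *\<^sub>R q) \<partial>lborel)"
      proof (cases "t \<in> ?J")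
        case True
        then have i: "indicator ?J t = (1::ennreal)" by simp
        show ?thesis unfolding i mult_1_right
        proof (rule nn_integral_mono)
          fix u show "F (a + t *\<^sub>R p + u *\<^sub>R q) * indicator ?J u \<le> F (a + t *\<^sub>R p + u *\<^sub>R q) * indicator U (a + t *\<^sub>R p + u *\<^sub>R q)"
            using in_U[of t u] True by (auto simp: indicator_def)
        qed
      next
        case False
        then have i: "indicator ?J t = (0::ennreal)" by (simp add: indicator_def)
        show ?thesis unfolding i by simp
      qed
    qed
    also have "\<dots> = ennreal (1 / \<bar>wedge p q\<bar>) * (\<integral>\<^sup>+x. F x * indicator U x \<partial>lborel)"
      by (rule nn_integral_parallelogram[OF _ D]) (use F in measurable)
    finally show ?thesis .
  qed
  let ?S = "\<Sum>i\<in>UNIV. (norm_L2 M (pdiff i f))\<^sup>2"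
  have S0: "?S \<ge> 0" by (simp add: sum_nonneg)
  have "(\<integral>\<^sup>+t. ?n (a + t *\<^sub>R p) * indicator ?J t \<partial>lborel) \<le> (\<integral>\<^sup>+t. ennreal 4 * (?N t * indicator ?J t) + ennreal (h\<^sup>2) * (?G t * indicator ?J t) \<partial>lborel)"
  proof (rule nn_integral_mono)
    fix t
    have "?n (a + t *\<^sub>R p) * indicator ?J t \<le> (ennreal 4 * ?N t + ennreal (h\<^sup>2) * ?G t) * indicator ?J t"
      by (rule mult_right_mono[OF pt]) simp
    then show "?n (a + t *\<^sub>R p) * indicator ?J t \<le> ennreal 4 * (?N t * indicator ?J t) + ennreal (h\<^sup>2) * (?G t * indicator ?J t)"
      by (simp only: distrib_right mult.assoc)
  qed
  also have "\<dots> = ennreal 4 * (\<integral>\<^sup>+t. ?N t * indicator ?J t \<partial>lborel) + ennreal (h\<^sup>2) * (\<integral>\<^sup>+t. ?G t * indicator ?J t \<partial>lborel)"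
    by (subst nn_integral_add) (auto simp: nn_integral_cmult)
  also have "\<dots> \<le> ennreal 4 * (ennreal (1 / \<bar>wedge p q\<bar>) * (\<integral>\<^sup>+x. ?n x * indicator U x \<partial>lborel)) +
      ennreal (h\<^sup>2) * (ennreal (1 / \<bar>wedge p q\<bar>) * (\<integral>\<^sup>+x. ?g x * indicator U x \<partial>lborel))"
    by (intro add_mono mult_left_mono par) auto
  also have "\<dots> = ennreal 4 * (ennreal (1 / \<bar>wedge p q\<bar>) * ennreal ((norm_L2 M f)\<^sup>2)) + ennreal (h\<^sup>2) * (ennreal (1 / \<bar>wedge p q\<bar>) * ennreal ?S)"
    by (simp only: norm_L2_nn_integral[OF smooth_continuous[OF f]] grad_sq_nn_integral[OF f])
  also have "\<dots> = ennreal (4 * (1 / \<bar>wedge p q\<bar> * (norm_L2 M f)\<^sup>2) + h\<^sup>2 * (1 / \<bar>wedge p q\<bar> * ?S))"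
    by (rule ennreal_combination) (use S0 in auto)
  also have "4 * (1 / \<bar>wedge p q\<bar> * (norm_L2 M f)\<^sup>2) + h\<^sup>2 * (1 / \<bar>wedge p q\<bar> * ?S) = (4 * (norm_L2 M f)\<^sup>2 + h\<^sup>2 * ?S) / \<bar>wedge p q\<bar>"
    by (simp add: add_divide_distrib)
  finally show ?thesis .
qed

(* PART 7 *)

lemma edge_ends_cases:
  assumes "e = closed_segment a b"
  shows "edge_ends e = (a, b) \<or> edge_ends e = (b, a)"
proof -
  have "closed_segment (fst (edge_ends e)) (snd (edge_ends e)) = e"
    unfolding edge_ends_def by (rule someI[of _ "(a, b)"]) (simp add: assms)
  then have "{fst (edge_ends e), snd (edge_ends e)} = {a, b}"
    by (simp add: assms closed_segment_eq)
  then show ?thesis by (auto simp: doubleton_eq_iff prod_eq_iff)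
qed

lemma diameter_closed_segment_plane: "diameter (closed_segment a b :: plane set) = norm (b - a)"
proof (rule antisym)
  show "diameter (closed_segment a b) \<le> norm (b - a)"
  proof (rule diameter_le)
    fix x y assume "x \<in> closed_segment a b" "y \<in> closed_segment a b"
    then obtain s t where st: "0 \<le> s" "s \<le> 1" "x = (1 - s) *\<^sub>R a + s *\<^sub>R b" "0 \<le> t" "t \<le> 1" "y = (1 - t) *\<^sub>R a + t *\<^sub>R b"
      unfolding in_segment by auto
    have "x - y = (s - t) *\<^sub>R (b - a)" unfolding st by (simp add: algebra_simps)
    then have "norm (x - y) = \<bar>s - t\<bar> * norm (b - a)" by simp
    also have "\<dots> \<le> 1 * norm (b - a)" using st by (intro mult_right_mono) auto
    finally show "norm (x - y) \<le> norm (b - a)" by simp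
  qed simp
  show "norm (b - a) \<le> diameter (closed_segment a b)"
    using diameter_bounded_bound[OF compact_imp_bounded[OF compact_segment], of b a b a] by (simp add: dist_norm)
qed

locale edge =
  fixes e :: "plane set" and a b :: plane
  assumes e: "e = closed_segment a b" and ab: "a \<noteq> b"
begin

abbreviation "p0 \<equiv> fst (edge_ends e)"
abbreviation "p1 \<equiv> snd (edge_ends e)"
abbreviation "tt \<equiv> tangent e"
abbreviation "E \<equiv> edge_measure e"
abbreviation "len \<equiv> norm (b - a)"

lemma len: "len > 0" "diameter e = len" "norm (p1 - p0) = len" "len \<noteq> 0"
  using edge_ends_cases[OF e] ab by (auto simp: e diameter_closed_segment_plane norm_minus_commute)

lemma ends: "closed_segment p0 p1 = e"
  using edge_ends_cases[OF e] by (auto simp: e closed_segment_commute)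

lemma tangent: "norm tt = 1" "p1 = p0 + len *\<^sub>R tt" "tt \<bullet> tt = 1" "p1 - p0 = len *\<^sub>R tt"
proof -
  have t: "tt = (p1 - p0) /\<^sub>R len" by (simp add: tangent_def sgn_div_norm len(3))
  show n: "norm tt = 1" unfolding t using len by simp
  show "p1 = p0 + len *\<^sub>R tt" unfolding t using len by simp
  show "tt \<bullet> tt = 1" using n by (simp add: norm_eq_1)
  show "p1 - p0 = len *\<^sub>R tt" unfolding t using len by simp
qed

lemma param_in_edge: "s \<in> {0..len} \<Longrightarrow> p0 + s *\<^sub>R tt \<in> e"
proof -
  assume s: "s \<in> {0..len}"
  have "p0 + s *\<^sub>R tt = (1 - s / len) *\<^sub>R p0 + (s / len) *\<^sub>R p1"
    by (subst tangent(2)) (use len(4) in \<open>simp add: algebra_simps\<close>)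
  moreover have "0 \<le> s / len" "s / len \<le> 1" using s len(1) by auto
  ultimately have "p0 + s *\<^sub>R tt \<in> closed_segment p0 p1" unfolding in_segment by blast
  then show ?thesis using ends by simp
qed

lemma edge_param: "x \<in> e \<Longrightarrow> \<exists>s\<in>{0..len}. x = p0 + s *\<^sub>R tt"
proof -
  assume "x \<in> e"
  then have "x \<in> closed_segment p0 p1" using ends by simp
  then obtain u where u: "0 \<le> u" "u \<le> 1" "x = (1 - u) *\<^sub>R p0 + u *\<^sub>R p1" unfolding in_segment by blast
  have "x = p0 + (u * len) *\<^sub>R tt" unfolding u(3) by (subst tangent(2)) (simp add: algebra_simps)
  moreover have "u * len \<in> {0..len}" using u len by (auto intro: mult_left_le_one_le)
  ultimately show ?thesis by blast
qed

lemma space_edge: "space E = e" by (simp add: edge_measure_def space_restrict_space)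

lemma sets_edge: "sets E = sets (restrict_space borel e)" by (simp add: edge_measure_def)

lemma idm_edge: "(\<lambda>x. x) \<in> measurable E borel"
  by (subst measurable_cong_sets[OF sets_edge refl]) (rule measurable_restrict_space1, simp)

lemma measurable_edge: "F \<in> measurable borel N \<Longrightarrow> F \<in> measurable E N"
  by (rule measurable_compose[OF idm_edge])

lemma param_measurable: "(\<lambda>s. p0 + s *\<^sub>R tt) \<in> measurable (restrict_space lborel {0..len}) (restrict_space borel e)"
proof (rule measurable_restrict_space2)
  show "(\<lambda>s. p0 + s *\<^sub>R tt) \<in> space (restrict_space lborel {0..len}) \<rightarrow> e"
    using param_in_edge by (auto simp: space_restrict_space)
  show "(\<lambda>s. p0 + s *\<^sub>R tt) \<in> borel_measurable (restrict_space lborel {0..len})"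
    by (intro measurable_restrict_space1) measurable
qed

lemma nn_integral_edge_arclength:
  assumes F: "F \<in> borel_measurable E"
  shows "(\<integral>\<^sup>+x. F x \<partial>E) = (\<integral>\<^sup>+s. F (p0 + s *\<^sub>R tt) * indicator {0..len} s \<partial>lborel)"
proof -
  have F': "F \<in> borel_measurable (restrict_space borel e)"
    using F by (simp add: measurable_cong_sets[OF sets_edge refl])
  have "(\<integral>\<^sup>+x. F x \<partial>E) = (\<integral>\<^sup>+s. F (p0 + s *\<^sub>R tt) \<partial>restrict_space lborel {0..len})"
    unfolding edge_measure_def len(2)
    by (rule nn_integral_distr[OF param_measurable]) (use F' in simp)
  also have "\<dots> = (\<integral>\<^sup>+s. F (p0 + s *\<^sub>R tt) * indicator {0..len} s \<partial>lborel)"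
    by (rule nn_integral_restrict_space) simp
  finally show ?thesis .
qed

lemma emeasure_edge: "emeasure E (space E) = ennreal len"
proof -
  have "emeasure E (space E) = (\<integral>\<^sup>+x. 1 \<partial>E)" by simp
  also have "\<dots> = (\<integral>\<^sup>+s. 1 * indicator {0..len} s \<partial>lborel)" by (rule nn_integral_edge_arclength) simp
  also have "\<dots> = ennreal len" using len by simp
  finally show ?thesis .
qed

lemma fin_edge: "finite_measure E"
  by (rule finite_measureI) (simp add: emeasure_edge)

lemma measure_edge: "measure E (space E) = len"
  using emeasure_edge len by (simp add: measure_def)

lemma nn_integral_edge:
  assumes F: "F \<in> borel_measurable borel"
  shows "(\<integral>\<^sup>+x. F x \<partial>E) = ennreal len * (\<integral>\<^sup>+s. F (a + s *\<^sub>R (b - a)) * indicator {0..1} s \<partial>lborel)"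
proof -
  have Fp: "(\<lambda>s. F (y + s *\<^sub>R z)) \<in> borel_measurable borel" for y z
    by (rule measurable_compose[OF _ F]) measurable
  have "(\<integral>\<^sup>+x. F x \<partial>E) = (\<integral>\<^sup>+s. F (p0 + s *\<^sub>R tt) * indicator {0..len} s \<partial>lborel)"
    by (rule nn_integral_edge_arclength[OF measurable_edge[OF F]])
  also have "\<dots> = ennreal \<bar>len\<bar> * (\<integral>\<^sup>+s. F (p0 + (0 + len * s) *\<^sub>R tt) * indicator {0..len} (0 + len * s) \<partial>lborel)"
    by (rule nn_integral_real_affine) (use Fp len in auto)
  also have "(\<integral>\<^sup>+s. F (p0 + (0 + len * s) *\<^sub>R tt) * indicator {0..len} (0 + len * s) \<partial>lborel) = (\<integral>\<^sup>+s. F (p0 + s *\<^sub>R (p1 - p0)) * indicator {0..1} s \<partial>lborel)"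
  proof (rule nn_integral_cong)
    fix s
    have "p0 + (0 + len * s) *\<^sub>R tt = p0 + s *\<^sub>R (p1 - p0)" by (simp add: tangent(4))
    moreover have "indicator {0..len} (0 + len * s) = (indicator {0..1} s :: ennreal)"
      using len by (auto simp: indicator_def zero_le_mult_iff)
    ultimately show "F (p0 + (0 + len * s) *\<^sub>R tt) * indicator {0..len} (0 + len * s) = F (p0 + s *\<^sub>R (p1 - p0)) * indicator {0..1} s" by simp
  qed
  also have "\<dots> = (\<integral>\<^sup>+s. F (a + s *\<^sub>R (b - a)) * indicator {0..1} s \<partial>lborel)"
  proof (cases "edge_ends e = (a, b)")
    case False
    then have eq: "edge_ends e = (b, a)" using edge_ends_cases[OF e] by blast
    have "(\<integral>\<^sup>+s. F (p0 + s *\<^sub>R (p1 - p0)) * indicator {0..1} s \<partial>lborel) = ennreal \<bar>-1\<bar> * (\<integral>\<^sup>+s. F (p0 + (1 + (-1) * s) *\<^sub>R (p1 - p0)) * indicator {0..1} (1 + (-1) * s) \<partial>lborel)"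
      by (rule nn_integral_real_affine) (use Fp in auto)
    also have "\<dots> = (\<integral>\<^sup>+s. F (a + s *\<^sub>R (b - a)) * indicator {0..1} s \<partial>lborel)"
      unfolding eq by (auto intro!: nn_integral_cong simp: indicator_def algebra_simps)
    finally show ?thesis .
  qed simp
  finally show ?thesis by simp
qed

lemma L2_edge_bounded:
  fixes g :: "plane \<Rightarrow> 'b::euclidean_space"
  assumes "g \<in> borel_measurable E" "\<And>x. x \<in> e \<Longrightarrow> norm (g x) \<le> B"
  shows "L2 E g"
  unfolding L2_def
proof
  show "integrable E (\<lambda>x. (norm (g x))\<^sup>2)"
  proof (rule Bochner_Integration.integrable_bound[of E "\<lambda>x. B\<^sup>2"])
    show "AE x in E. norm ((norm (g x))\<^sup>2) \<le> norm (B\<^sup>2)"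
      by (rule AE_I2) (use assms(2) space_edge in \<open>auto intro!: power_mono\<close>)
  qed (use assms finite_measure.integrable_const[OF fin_edge] in auto)
qed (rule assms)

lemma compact_edge: "compact e" unfolding e by simp

lemma L2_edge_continuous:
  fixes g :: "plane \<Rightarrow> 'b::euclidean_space"
  assumes "continuous_on UNIV g" shows "L2 E g"
proof -
  have "bounded (g ` e)"
    by (intro compact_imp_bounded compact_continuous_image continuous_on_subset[OF assms] compact_edge) auto
  then obtain B where B: "\<forall>x\<in>e. norm (g x) \<le> B" unfolding bounded_iff by auto
  show ?thesis
    by (rule L2_edge_bounded[of _ B]) (use B measurable_edge[OF borel_measurable_continuous_onI[OF assms]] in auto)
qed

subsection \<open>Projection\<close>

definition nn :: plane where "nn = vector [- tt $ 2, tt $ 1]"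

lemma frame: "v \<bullet> w = (v \<bullet> tt) * (w \<bullet> tt) + (v \<bullet> nn) * (w \<bullet> nn)"
proof -
  have 1: "(tt $ 1)\<^sup>2 + (tt $ 2)\<^sup>2 = 1"
    using tangent(3) by (simp add: inner_vec_def sum_2 power2_eq_square)
  have "(v \<bullet> tt) * (w \<bullet> tt) + (v \<bullet> nn) * (w \<bullet> nn) = (v $ 1 * w $ 1 + v $ 2 * w $ 2) * ((tt $ 1)\<^sup>2 + (tt $ 2)\<^sup>2)"
    by (simp add: inner_vec_def sum_2 nn_def vector_2 power2_eq_square algebra_simps)
  then show ?thesis using 1 by (simp add: inner_vec_def sum_2)
qed

lemma nn: "nn \<bullet> nn = 1" "nn \<bullet> tt = 0" "tt \<bullet> nn = 0"
  using tangent(3) by (simp_all add: inner_vec_def sum_2 nn_def vector_2)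

lemma P1_minus_cont:
  assumes "q \<in> P1_minus e"
  obtains q' where "continuous_on UNIV q'" "\<And>x. x \<in> e \<Longrightarrow> q x = q' x"
proof -
  have "\<forall>i. \<exists>c d. \<forall>x\<in>e. q x $ i = c + d \<bullet> x" using assms unfolding P1_minus_def P1_def by auto
  then obtain c d where cd: "\<And>i x. x \<in> e \<Longrightarrow> q x $ i = c i + d i \<bullet> x" by metis
  show thesis
  proof (rule that[of "\<lambda>x. \<chi> i. c i + d i \<bullet> x"])
    show "continuous_on UNIV (\<lambda>x. \<chi> i. c i + d i \<bullet> x)" by (intro continuous_intros)
    show "q x = (\<chi> i. c i + d i \<bullet> x)" if "x \<in> e" for x using cd[OF that] by (simp add: vec_eq_iff)
  qed
qed

lemma P1_minus_L2: "q \<in> P1_minus e \<Longrightarrow> L2 E q"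
  by (erule P1_minus_cont) (subst L2_cong, auto simp: space_edge intro: L2_edge_continuous)

lemma P1_minus_diff:
  assumes "q \<in> P1_minus e" "r \<in> P1_minus e" shows "(\<lambda>x. q x - r x) \<in> P1_minus e"
proof -
  have "(\<lambda>x. (q x - r x) $ i) \<in> P1 e" for i
  proof -
    obtain c d c' d' where "\<forall>x\<in>e. q x $ i = c + d \<bullet> x" "\<forall>x\<in>e. r x $ i = c' + d' \<bullet> x"
      using assms unfolding P1_minus_def P1_def by blast
    then have "\<forall>x\<in>e. (q x - r x) $ i = (c - c') + (d - d') \<bullet> x" by (simp add: inner_diff_left)
    then show ?thesis unfolding P1_def by blast
  qed
  moreover have "(\<lambda>x. (q x - r x) \<bullet> tt) \<in> RM_edge e"
  proof -
    obtain c c' where "\<forall>x\<in>e. q x \<bullet> tt = c" "\<forall>x\<in>e. r x \<bullet> tt = c'"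
      using assms unfolding P1_minus_def RM_edge_def by blast
    then have "\<forall>x\<in>e. (q x - r x) \<bullet> tt = c - c'" by (simp add: inner_diff_left)
    then show ?thesis unfolding RM_edge_def by blast
  qed
  ultimately show ?thesis unfolding P1_minus_def by blast
qed

lemma P1_minus_frame:
  assumes "q \<in> P1_minus e"
  obtains c1 c2 d where "\<And>x. x \<in> e \<Longrightarrow> q x \<bullet> tt = c1" "\<And>x. x \<in> e \<Longrightarrow> q x \<bullet> nn = c2 + d * ((x - p0) \<bullet> tt)"
proof -
  obtain c1 where c1: "\<forall>x\<in>e. q x \<bullet> tt = c1" using assms unfolding P1_minus_def RM_edge_def by blast
  have "\<forall>i. \<exists>c d. \<forall>x\<in>e. q x $ i = c + d \<bullet> x" using assms unfolding P1_minus_def P1_def by auto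
  then obtain c d where cd: "\<And>i x. x \<in> e \<Longrightarrow> q x $ i = c i + d i \<bullet> x" by metis
  let ?w = "nn $ 1 *\<^sub>R d 1 + nn $ 2 *\<^sub>R d 2"
  have "q x \<bullet> nn = (nn $ 1 * c 1 + nn $ 2 * c 2 + ?w \<bullet> p0) + (?w \<bullet> tt) * ((x - p0) \<bullet> tt)" if x: "x \<in> e" for x
  proof -
    obtain s where s: "x = p0 + s *\<^sub>R tt" using edge_param[OF x] by blast
    have "q x \<bullet> nn = nn $ 1 * (c 1 + d 1 \<bullet> x) + nn $ 2 * (c 2 + d 2 \<bullet> x)"
      using cd[OF x] by (simp add: inner_vec_def sum_2[where 'a=real] mult.commute)
    also have "\<dots> = nn $ 1 * c 1 + nn $ 2 * c 2 + ?w \<bullet> x" by (simp add: inner_add_left algebra_simps)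
    also have "?w \<bullet> x = ?w \<bullet> p0 + (?w \<bullet> tt) * s" unfolding s by (simp add: inner_add_right mult.commute)
    also have "s = (x - p0) \<bullet> tt" unfolding s by (simp add: tangent(3))
    finally show ?thesis by simp
  qed
  then show thesis using that c1 by blast
qed

lemma edge_proj_exists:
  assumes f: "L2 E f"
  shows "\<exists>p. p \<in> P1_minus e \<and> (\<forall>q\<in>P1_minus e. (\<integral>x. (f x - p x) \<bullet> q x \<partial>E) = 0)"
proof -
  interpret E: finite_measure E by (rule fin_edge)
  have cont: "L2 E g" if "continuous_on UNIV g" for g :: "plane \<Rightarrow> real" by (rule L2_edge_continuous[OF that])
  have mi: "integrable E (\<lambda>x. g x * h x)" if "L2 E g" "L2 E h" for g h :: "plane \<Rightarrow> real"
  proof (rule Bochner_Integration.integrable_bound[OF L2_mult_integrable[OF that]])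
    show "(\<lambda>x. g x * h x) \<in> borel_measurable E" using L2D(1)[OF that(1)] L2D(1)[OF that(2)] by measurable
    show "AE x in E. norm (g x * h x) \<le> norm (norm (g x) * norm (h x))" by (simp add: abs_mult)
  qed
  define \<sigma>0 where "\<sigma>0 x = (x - p0) \<bullet> tt" for x
  define m where "m = (\<integral>x. \<sigma>0 x \<partial>E) / len"
  define \<sigma> where "\<sigma> x = \<sigma>0 x - m" for x
  have \<sigma>0L: "L2 E \<sigma>0" unfolding \<sigma>0_def[abs_def] by (intro cont continuous_intros)
  have \<sigma>L: "L2 E \<sigma>" unfolding \<sigma>_def[abs_def] \<sigma>0_def by (intro cont continuous_intros)
  have oneL: "L2 E (\<lambda>x. 1::real)" by (intro cont continuous_intros)
  have i\<sigma>: "integrable E \<sigma>" using mi[OF \<sigma>L oneL] by simp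
  have i\<sigma>0: "integrable E \<sigma>0" using mi[OF \<sigma>0L oneL] by simp
  have z: "(\<integral>x. \<sigma> x \<partial>E) = 0"
    using i\<sigma>0 len by (simp add: \<sigma>_def m_def measure_edge)
  have ftL: "L2 E (\<lambda>x. f x \<bullet> tt)" and fnL: "L2 E (\<lambda>x. f x \<bullet> nn)"
    by (intro L2_linear[OF _ f] bounded_linear_inner_left)+
  have ift: "integrable E (\<lambda>x. f x \<bullet> tt)" and ifn: "integrable E (\<lambda>x. f x \<bullet> nn)"
    using mi[OF ftL oneL] mi[OF fnL oneL] by simp_all
  define \<kappa> where "\<kappa> = (\<integral>x. \<sigma> x * \<sigma> x \<partial>E)"
  define \<mu> where "\<mu> = (\<integral>x. (f x \<bullet> nn) * \<sigma> x \<partial>E)"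
  define \<alpha> where "\<alpha> = (\<integral>x. f x \<bullet> tt \<partial>E) / len"
  define \<beta> where "\<beta> = (\<integral>x. f x \<bullet> nn \<partial>E) / len"
  define g where "g = \<mu> / \<kappa>"
  have gk: "g * \<kappa> = \<mu>"
  proof (cases "\<kappa> = 0")
    case True
    have "(norm_L2 E \<sigma>)\<^sup>2 = \<kappa>" by (simp only: norm_L2_sq \<kappa>_def real_norm_def power2_abs power2_eq_square[symmetric])
    then have "AE x in E. \<sigma> x = 0" using True by (intro norm_L2_zero_AE[OF \<sigma>L]) simp
    then have "AE x in E. (f x \<bullet> nn) * \<sigma> x = 0" by (rule eventually_mono) simp
    then have "\<mu> = 0" unfolding \<mu>_def by (rule integral_eq_zero_AE)
    then show ?thesis using True by simp
  qed (simp add: g_def)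
  define p where "p x = \<alpha> *\<^sub>R tt + (\<beta> + g * \<sigma> x) *\<^sub>R nn" for x
  have pt: "p x \<bullet> tt = \<alpha>" "p x \<bullet> nn = \<beta> + g * \<sigma> x" for x
    by (simp_all add: p_def inner_add_left tangent(3) nn)
  have pP: "p \<in> P1_minus e"
  proof -
    have "(\<lambda>x. p x $ i) \<in> P1 e" for i
    proof -
      have "p x $ i = (\<alpha> * tt $ i + (\<beta> - g * m - g * (p0 \<bullet> tt)) * nn $ i) + ((g * nn $ i) *\<^sub>R tt) \<bullet> x" for x
        by (simp add: p_def \<sigma>_def \<sigma>0_def inner_diff_left inner_commute algebra_simps)
      then show ?thesis unfolding P1_def by blast
    qed
    moreover have "(\<lambda>x. p x \<bullet> tt) \<in> RM_edge e" unfolding RM_edge_def pt by auto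
    ultimately show ?thesis unfolding P1_minus_def by blast
  qed
  have "(\<integral>x. (f x - p x) \<bullet> q x \<partial>E) = 0" if q: "q \<in> P1_minus e" for q
  proof -
    obtain c1 c2 d where q: "\<And>x. x \<in> e \<Longrightarrow> q x \<bullet> tt = c1" "\<And>x. x \<in> e \<Longrightarrow> q x \<bullet> nn = c2 + d * ((x - p0) \<bullet> tt)"
      using P1_minus_frame[OF q] by blast
    let ?c = "c2 + d * m"
    have "(\<integral>x. (f x - p x) \<bullet> q x \<partial>E) = (\<integral>x. c1 * (f x \<bullet> tt) - c1 * \<alpha> + (?c * (f x \<bullet> nn) - ?c * \<beta> - ?c * g * \<sigma> x
        + d * ((f x \<bullet> nn) * \<sigma> x) - d * \<beta> * \<sigma> x - d * g * (\<sigma> x * \<sigma> x)) \<partial>E)"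
    proof (rule Bochner_Integration.integral_cong[OF refl])
      fix x assume "x \<in> space E"
      then have x: "x \<in> e" by (simp add: space_edge)
      have qn: "q x \<bullet> nn = ?c + d * \<sigma> x" using q(2)[OF x] by (simp add: \<sigma>_def \<sigma>0_def algebra_simps)
      have "(f x - p x) \<bullet> q x = (f x \<bullet> tt - \<alpha>) * c1 + (f x \<bullet> nn - (\<beta> + g * \<sigma> x)) * (?c + d * \<sigma> x)"
        by (subst frame) (simp only: inner_diff_left pt q(1)[OF x] qn)
      then show "(f x - p x) \<bullet> q x = c1 * (f x \<bullet> tt) - c1 * \<alpha> + (?c * (f x \<bullet> nn) - ?c * \<beta> - ?c * g * \<sigma> x
        + d * ((f x \<bullet> nn) * \<sigma> x) - d * \<beta> * \<sigma> x - d * g * (\<sigma> x * \<sigma> x))" by (simp add: algebra_simps)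
    qed
    also have "\<dots> = c1 * (\<integral>x. f x \<bullet> tt \<partial>E) - c1 * \<alpha> * len + (?c * (\<integral>x. f x \<bullet> nn \<partial>E) - ?c * \<beta> * len - ?c * g * (\<integral>x. \<sigma> x \<partial>E)
        + d * \<mu> - d * \<beta> * (\<integral>x. \<sigma> x \<partial>E) - d * g * \<kappa>)"
      unfolding \<mu>_def \<kappa>_def
      using ift ifn i\<sigma> mi[OF fnL \<sigma>L] mi[OF \<sigma>L \<sigma>L] by (simp add: measure_edge)
    also have "\<dots> = 0"
      using len gk by (simp add: z \<alpha>_def \<beta>_def mult.assoc)
    finally show ?thesis .
  qed
  then show ?thesis using pP by blast
qed

lemma edge_proj:
  assumes f: "L2 E f"
  shows "edge_proj e f \<in> P1_minus e" "\<And>q. q \<in> P1_minus e \<Longrightarrow> (\<integral>x. (f x - edge_proj e f x) \<bullet> q x \<partial>E) = 0"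
  using someI_ex[OF edge_proj_exists[OF f]] unfolding edge_proj_def by auto

lemma edge_proj_nonexpansive:
  assumes f: "L2 E f" and r: "r \<in> P1_minus e"
  shows "norm_L2 E (\<lambda>x. edge_proj e f x - r x) \<le> norm_L2 E (\<lambda>x. f x - r x)"
proof (rule power2_le_imp_le)
  let ?p = "edge_proj e f"
  note pL = P1_minus_L2[OF edge_proj(1)[OF f]] and rL = P1_minus_L2[OF r]
  let ?a = "\<lambda>x. f x - ?p x" and ?b = "\<lambda>x. ?p x - r x"
  note aL = L2_diff[OF f pL] and bL = L2_diff[OF pL rL] and fr = L2_diff[OF f rL]
  have z: "(\<integral>x. ?a x \<bullet> ?b x \<partial>E) = 0"
    by (rule edge_proj(2)[OF f P1_minus_diff[OF edge_proj(1)[OF f] r]])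
  have ii: "integrable E (\<lambda>x. ?a x \<bullet> ?b x)"
  proof (rule Bochner_Integration.integrable_bound[OF L2_mult_integrable[OF aL bL]])
    show "(\<lambda>x. ?a x \<bullet> ?b x) \<in> borel_measurable E"
      using L2D(1)[OF aL] L2D(1)[OF bL] by measurable
    show "AE x in E. norm (?a x \<bullet> ?b x) \<le> norm (norm (?a x) * norm (?b x))"
      by (auto intro!: AE_I2 simp: Cauchy_Schwarz_ineq2)
  qed
  have "(norm_L2 E ?b)\<^sup>2 = (\<integral>x. (norm (?b x))\<^sup>2 \<partial>E) + 2 * (\<integral>x. ?a x \<bullet> ?b x \<partial>E)" by (simp add: norm_L2_sq z)
  also have "\<dots> = (\<integral>x. (norm (?b x))\<^sup>2 + 2 * (?a x \<bullet> ?b x) \<partial>E)" using ii L2D(2)[OF bL] by simp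
  also have "\<dots> \<le> (\<integral>x. (norm (f x - r x))\<^sup>2 \<partial>E)"
  proof (rule integral_mono)
    fix x
    have "(norm (f x - r x))\<^sup>2 = (norm (?a x))\<^sup>2 + 2 * (?a x \<bullet> ?b x) + (norm (?b x))\<^sup>2"
      unfolding power2_norm_eq_inner by (simp add: algebra_simps inner_commute)
    then show "(norm (?b x))\<^sup>2 + 2 * (?a x \<bullet> ?b x) \<le> (norm (f x - r x))\<^sup>2" by simp
  qed (use ii L2D(2)[OF bL] L2D(2)[OF fr] in auto)
  finally show "(norm_L2 E ?b)\<^sup>2 \<le> (norm_L2 E (\<lambda>x. f x - r x))\<^sup>2" by (simp add: norm_L2_sq)
qed simp

end

text \<open>A triangle interior together with one of its edges\<close>

locale triangle_edge = starlike U c \<rho> + edge e a b for U c \<rho> e a b +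
  fixes d :: plane and h :: real
  assumes half1: "\<And>t u. 0 < t \<Longrightarrow> t < 1/2 \<Longrightarrow> 0 < u \<Longrightarrow> u < 1/2 \<Longrightarrow> a + t *\<^sub>R (b - a) + u *\<^sub>R (d - a) \<in> U"
    and half2: "\<And>t u. 0 < t \<Longrightarrow> t < 1/2 \<Longrightarrow> 0 < u \<Longrightarrow> u < 1/2 \<Longrightarrow> b + t *\<^sub>R (a - b) + u *\<^sub>R (d - b) \<in> U"
    and D: "wedge (b - a) (d - a) \<noteq> 0" and h: "norm (d - a) \<le> h" "norm (d - b) \<le> h"
begin

abbreviation "DD \<equiv> \<bar>wedge (b - a) (d - a)\<bar>"

lemma wedge_swap: "\<bar>wedge (a - b) (d - b)\<bar> = DD" "wedge (a - b) (d - b) \<noteq> 0"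
proof -
  have "wedge (a - b) (d - b) = - wedge (b - a) (d - a)" by (simp add: wedge_def algebra_simps)
  then show "\<bar>wedge (a - b) (d - b)\<bar> = DD" "wedge (a - b) (d - b) \<noteq> 0" using D by auto
qed

definition trc :: real where "trc = 2 * len / DD"

lemma trc_pos: "trc > 0" using len D by (simp add: trc_def)

lemma trace_smooth:
  fixes f :: "plane \<Rightarrow> 'b::euclidean_space"
  assumes f: "smooth f"
  shows "(norm_L2 E f)\<^sup>2 \<le> trc * (4 * (norm_L2 M f)\<^sup>2 + h\<^sup>2 * (\<Sum>i\<in>UNIV. (norm_L2 M (pdiff i f))\<^sup>2))"
proof -
  let ?J = "{0<..<1/2::real}"
  let ?X = "4 * (norm_L2 M f)\<^sup>2 + h\<^sup>2 * (\<Sum>i\<in>UNIV. (norm_L2 M (pdiff i f))\<^sup>2)"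
  let ?n = "\<lambda>x. ennreal ((norm (f x))\<^sup>2)"
  have X0: "?X \<ge> 0" by (simp add: sum_nonneg)
  have fc: "continuous_on UNIV f" by (rule smooth_continuous[OF f])
  have [measurable]: "f \<in> borel_measurable borel" by (rule borel_measurable_continuous_onI[OF fc])
  have 1: "(\<integral>\<^sup>+t. ?n (a + t *\<^sub>R (b - a)) * indicator ?J t \<partial>lborel) \<le> ennreal (?X / DD)"
    by (rule half_trace[OF f D h(1) half1])
  have 2: "(\<integral>\<^sup>+t. ?n (b + t *\<^sub>R (a - b)) * indicator ?J t \<partial>lborel) \<le> ennreal (?X / DD)"
    using half_trace[OF f wedge_swap(2) h(2) half2] unfolding wedge_swap .
  have r: "(\<integral>\<^sup>+t. ?n (b + t *\<^sub>R (a - b)) * indicator ?J t \<partial>lborel) = (\<integral>\<^sup>+t. ?n (a + t *\<^sub>R (b - a)) * indicator ?J (1 - t) \<partial>lborel)"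
  proof -
    have "(\<integral>\<^sup>+t. ?n (b + t *\<^sub>R (a - b)) * indicator ?J t \<partial>lborel) = ennreal \<bar>-1\<bar> * (\<integral>\<^sup>+t. ?n (b + (1 + (-1) * t) *\<^sub>R (a - b)) * indicator ?J (1 + (-1) * t) \<partial>lborel)"
      by (rule nn_integral_real_affine) auto
    also have "\<dots> = (\<integral>\<^sup>+t. ?n (a + t *\<^sub>R (b - a)) * indicator ?J (1 - t) \<partial>lborel)"
    proof -
      have "b + (1 + (-1) * t) *\<^sub>R (a - b) = a + t *\<^sub>R (b - a)" for t by (simp add: algebra_simps)
      then show ?thesis by simp
    qed
    finally show ?thesis .
  qed
  have "ennreal ((norm_L2 E f)\<^sup>2) = (\<integral>\<^sup>+x. ?n x \<partial>E)"
    unfolding norm_L2_sq by (rule nn_integral_eq_integral[symmetric]) (use L2D(2)[OF L2_edge_continuous[OF fc]] in auto)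
  also have "\<dots> = ennreal len * (\<integral>\<^sup>+t. ?n (a + t *\<^sub>R (b - a)) * indicator {0..1} t \<partial>lborel)"
    by (rule nn_integral_edge) measurable
  also have "\<dots> \<le> ennreal len * (\<integral>\<^sup>+t. ?n (a + t *\<^sub>R (b - a)) * indicator ?J t + ?n (a + t *\<^sub>R (b - a)) * indicator ?J (1 - t) \<partial>lborel)"
  proof (intro mult_left_mono nn_integral_mono_AE)
    have "AE t in lborel. t \<noteq> 0 \<and> t \<noteq> 1/2 \<and> t \<noteq> (1::real)"
      using AE_lborel_singleton[of "0::real"] AE_lborel_singleton[of "1/2::real"] AE_lborel_singleton[of "1::real"] by eventually_elim simp
    then show "AE t in lborel. ?n (a + t *\<^sub>R (b - a)) * indicator {0..1} t \<le> ?n (a + t *\<^sub>R (b - a)) * indicator ?J t + ?n (a + t *\<^sub>R (b - a)) * indicator ?J (1 - t)"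
      by (rule eventually_mono) (auto simp: indicator_def)
  qed simp
  also have "(\<integral>\<^sup>+t. ?n (a + t *\<^sub>R (b - a)) * indicator ?J t + ?n (a + t *\<^sub>R (b - a)) * indicator ?J (1 - t) \<partial>lborel) =
      (\<integral>\<^sup>+t. ?n (a + t *\<^sub>R (b - a)) * indicator ?J t \<partial>lborel) + (\<integral>\<^sup>+t. ?n (a + t *\<^sub>R (b - a)) * indicator ?J (1 - t) \<partial>lborel)"
    by (rule nn_integral_add) measurable
  also have "ennreal len * \<dots> \<le> ennreal len * (ennreal (?X / DD) + ennreal (?X / DD))"
    by (intro mult_left_mono add_mono 1 2[unfolded r]) simp
  also have "\<dots> = ennreal (len * (?X / DD + ?X / DD))"
  proof -
    have "ennreal l * (ennreal Y + ennreal Y) = ennreal (l * (Y + Y))" if "l \<ge> 0" "Y \<ge> 0" for l Y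
      using that by (simp add: ennreal_mult ennreal_plus[symmetric] del: ennreal_plus)
    then show ?thesis using X0 len by simp
  qed
  also have "len * (?X / DD + ?X / DD) = trc * ?X" by (simp add: trc_def)
  finally show ?thesis using X0 trc_pos by (subst (asm) ennreal_le_iff) auto
qed

lemma trace_limit:
  fixes v :: "plane \<Rightarrow> 'b::euclidean_space"
  assumes v: "v \<in> sobolev 1 U" and w: "L2 E w" and \<phi>: "\<And>n. smooth (\<phi> n)"
    and l1: "(\<lambda>n. norm_L2 M (\<lambda>x. \<phi> n x - v x)) \<longlonglongrightarrow> 0"
    and l2: "\<And>i. (\<lambda>n. norm_L2 M (\<lambda>x. pdiff i (\<phi> n) x - weak_deriv U [i] v x)) \<longlonglongrightarrow> 0"
    and l3: "(\<lambda>n. norm_L2 E (\<lambda>x. \<phi> n x - w x)) \<longlonglongrightarrow> 0"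
    and r: "smooth r"
  shows "(norm_L2 E (\<lambda>x. w x - r x))\<^sup>2 \<le> trc * (4 * (norm_L2 M (\<lambda>x. v x - r x))\<^sup>2 +
    h\<^sup>2 * (\<Sum>i\<in>UNIV. (norm_L2 M (\<lambda>x. weak_deriv U [i] v x - pdiff i r x))\<^sup>2))"
proof -
  note wd = sobolev_weak_deriv(1)[OF v, of "[i]" for i, simplified]
  have EL: "L2 E g" if "smooth g" for g :: "plane \<Rightarrow> 'b" by (rule L2_edge_continuous[OF smooth_continuous[OF that]])
  have le: "(norm_L2 E (\<lambda>x. \<phi> n x - r x))\<^sup>2 \<le> trc * (4 * (norm_L2 M (\<lambda>x. \<phi> n x - r x))\<^sup>2 +
    h\<^sup>2 * (\<Sum>i\<in>UNIV. (norm_L2 M (\<lambda>x. pdiff i (\<phi> n) x - pdiff i r x))\<^sup>2))" for n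
  proof -
    have "pdiff i (\<lambda>x. \<phi> n x - r x) = (\<lambda>x. pdiff i (\<phi> n) x - pdiff i r x)" for i
      by (intro ext pdiff_diff smooth_differentiable \<phi> r)
    then show ?thesis using trace_smooth[OF smooth_diff[OF \<phi>[of n] r]] by simp
  qed
  have a: "(\<lambda>n. norm_L2 E (\<lambda>x. \<phi> n x - r x)) \<longlonglongrightarrow> norm_L2 E (\<lambda>x. w x - r x)"
    by (rule norm_L2_tendsto) (use l3 L2_diff[OF EL[OF \<phi>] EL[OF r]] L2_diff[OF w EL[OF r]] in auto)
  have b: "(\<lambda>n. norm_L2 M (\<lambda>x. \<phi> n x - r x)) \<longlonglongrightarrow> norm_L2 M (\<lambda>x. v x - r x)"
    by (rule norm_L2_tendsto) (use l1 L2_diff[OF L2_smooth[OF \<phi>] L2_smooth[OF r]] L2_diff[OF sobolevD[OF v] L2_smooth[OF r]] in auto)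
  have c': "(\<lambda>n. norm_L2 M (\<lambda>x. pdiff i (\<phi> n) x - pdiff i r x)) \<longlonglongrightarrow> norm_L2 M (\<lambda>x. weak_deriv U [i] v x - pdiff i r x)" for i
    by (rule norm_L2_tendsto) (use l2[of i] L2_diff[OF L2_smooth[OF smooth_pdiff[OF \<phi>]] L2_smooth[OF smooth_pdiff[OF r]]] L2_diff[OF wd L2_smooth[OF smooth_pdiff[OF r]]] in auto)
  show ?thesis
    by (rule LIMSEQ_le[OF tendsto_power[OF a] tendsto_mult[OF tendsto_const tendsto_add[OF tendsto_mult[OF tendsto_const tendsto_power[OF b]]
        tendsto_mult[OF tendsto_const tendsto_sum[OF tendsto_power[OF c']]]]]]) (use le in auto)
qed

lemma trace_exists:
  fixes v :: "plane \<Rightarrow> 'b::euclidean_space"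
  assumes v: "v \<in> sobolev 1 U" and K: "interior K = U"
  shows "\<exists>w. is_trace K e v w"
proof -
  obtain \<phi> where \<phi>: "\<And>n. smooth (\<phi> n)" and l1: "(\<lambda>n. norm_L2 M (\<lambda>x. \<phi> n x - v x)) \<longlonglongrightarrow> 0"
    and l2: "\<And>i. (\<lambda>n. norm_L2 M (\<lambda>x. pdiff i (\<phi> n) x - weak_deriv U [i] v x)) \<longlonglongrightarrow> 0"
    using sobolev_approx[OF v] by blast
  note wd = sobolev_weak_deriv(1)[OF v, of "[i]" for i, simplified]
  interpret E: finite_measure E by (rule fin_edge)
  define B where "B n = sqrt (trc * (4 * (norm_L2 M (\<lambda>x. \<phi> n x - v x))\<^sup>2 +
    h\<^sup>2 * (\<Sum>i\<in>UNIV. (norm_L2 M (\<lambda>x. pdiff i (\<phi> n) x - weak_deriv U [i] v x))\<^sup>2)) * 2)" for n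
  have B0: "B \<longlonglongrightarrow> sqrt (trc * (4 * 0\<^sup>2 + h\<^sup>2 * (\<Sum>i\<in>(UNIV::2 set). 0\<^sup>2)) * 2)"
    unfolding B_def[abs_def] by (intro tendsto_intros l1 l2)
  then have B0: "B \<longlonglongrightarrow> 0" by simp
  have EL: "L2 E g" if "smooth g" for g :: "plane \<Rightarrow> 'b" by (rule L2_edge_continuous[OF smooth_continuous[OF that]])
  have le: "norm_L2 E (\<lambda>x. \<phi> m x - \<phi> n x) \<le> B m + B n" for m n
  proof -
    let ?a = "\<lambda>n. norm_L2 M (\<lambda>x. \<phi> n x - v x)" and ?b = "\<lambda>i n. norm_L2 M (\<lambda>x. pdiff i (\<phi> n) x - weak_deriv U [i] v x)"
    let ?Q = "\<lambda>n. trc * (4 * (?a n)\<^sup>2 + h\<^sup>2 * (\<Sum>i\<in>UNIV. (?b i n)\<^sup>2)) * 2"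
    have Q0: "?Q n \<ge> 0" for n using trc_pos by (simp add: sum_nonneg)
    have pe: "pdiff i (\<lambda>x. \<phi> m x - \<phi> n x) = (\<lambda>x. pdiff i (\<phi> m) x - pdiff i (\<phi> n) x)" for i
      by (intro ext pdiff_diff smooth_differentiable \<phi>)
    have s: "x\<^sup>2 \<le> 2 * y\<^sup>2 + 2 * z\<^sup>2" if "x \<le> y + z" "0 \<le> x" for x y z :: real
      by (rule order_trans[OF power_mono[OF that] sq_add_le])
    have 1: "(norm_L2 M (\<lambda>x. \<phi> m x - \<phi> n x))\<^sup>2 \<le> 2 * (?a m)\<^sup>2 + 2 * (?a n)\<^sup>2"
      by (rule s) (use norm_L2_triangle3[OF L2_smooth[OF \<phi>[of m]] sobolevD[OF v] L2_smooth[OF \<phi>[of n]]] in \<open>simp_all add: norm_L2_commute[of M v]\<close>)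
    have 2: "(norm_L2 M (\<lambda>x. pdiff i (\<phi> m) x - pdiff i (\<phi> n) x))\<^sup>2 \<le> 2 * (?b i m)\<^sup>2 + 2 * (?b i n)\<^sup>2" for i
      by (rule s) (use norm_L2_triangle3[OF L2_smooth[OF smooth_pdiff[OF \<phi>[of m], of i]] wd[of i] L2_smooth[OF smooth_pdiff[OF \<phi>[of n], of i]]] in \<open>simp_all add: norm_L2_commute[of M "weak_deriv U [i] v"]\<close>)
    have "(norm_L2 E (\<lambda>x. \<phi> m x - \<phi> n x))\<^sup>2 \<le> trc * (4 * (norm_L2 M (\<lambda>x. \<phi> m x - \<phi> n x))\<^sup>2 +
        h\<^sup>2 * (\<Sum>i\<in>UNIV. (norm_L2 M (\<lambda>x. pdiff i (\<phi> m) x - pdiff i (\<phi> n) x))\<^sup>2))"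
      using trace_smooth[OF smooth_diff[OF \<phi>[of m] \<phi>[of n]]] unfolding pe .
    also have "\<dots> \<le> trc * (4 * (2 * (?a m)\<^sup>2 + 2 * (?a n)\<^sup>2) + h\<^sup>2 * (\<Sum>i\<in>UNIV. 2 * (?b i m)\<^sup>2 + 2 * (?b i n)\<^sup>2))"
      using trc_pos by (intro mult_left_mono add_mono sum_mono 1 2) auto
    also have "\<dots> = ?Q m + ?Q n" by (simp add: sum.distrib sum_distrib_left[symmetric] algebra_simps)
    also have "\<dots> \<le> (B m + B n)\<^sup>2"
      using Q0[of m] Q0[of n] unfolding B_def by (simp add: power2_sum)
    finally show ?thesis by (rule power2_le_imp_le) (use Q0 in \<open>simp add: B_def\<close>)
  qed
  obtain w where w: "L2 E w" "(\<lambda>n. norm_L2 E (\<lambda>x. \<phi> n x - w x)) \<longlonglongrightarrow> 0"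
  proof (rule E.L2_complete[of \<phi>])
    show "L2 E (\<phi> n)" for n by (rule EL[OF \<phi>])
    fix \<eta> :: real assume \<eta>: "\<eta> > 0"
    obtain N where N: "\<And>n. n \<ge> N \<Longrightarrow> B n < \<eta> / 2"
      using order_tendstoD(2)[OF B0, of "\<eta> / 2"] \<eta> by (auto simp: eventually_sequentially)
    have "norm_L2 E (\<lambda>x. \<phi> m x - \<phi> n x) < \<eta>" if "m \<ge> N" "n \<ge> N" for m n
      using le[of m n] N[OF that(1)] N[OF that(2)] by simp
    then show "\<exists>N. \<forall>m\<ge>N. \<forall>n\<ge>N. norm_L2 E (\<lambda>x. \<phi> m x - \<phi> n x) < \<eta>" by blast
  qed
  have "(\<lambda>n. sobolev_norm 1 (interior K) (\<lambda>x. \<phi> n x - v x)) \<longlonglongrightarrow> 0"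
    unfolding K using sobolev_norm_1_diff_tendsto[where \<phi>=\<phi>, OF \<phi> v] l1 l2 by blast
  then have "is_trace K e v w" unfolding is_trace_def using w \<phi> by blast
  then show ?thesis by blast
qed

lemma trace_inequality:
  fixes v :: "plane \<Rightarrow> 'b::euclidean_space"
  assumes v: "v \<in> sobolev 1 U" and K: "interior K = U" and r: "smooth r"
  shows "L2 E (edge_trace K e v)"
    "(norm_L2 E (\<lambda>x. edge_trace K e v x - r x))\<^sup>2 \<le> trc * (4 * (norm_L2 M (\<lambda>x. v x - r x))\<^sup>2 +
    h\<^sup>2 * (\<Sum>i\<in>UNIV. (norm_L2 M (\<lambda>x. weak_deriv U [i] v x - pdiff i r x))\<^sup>2))"
proof -
  have t: "is_trace K e v (edge_trace K e v)"
    using someI_ex[OF trace_exists[OF v K]] unfolding edge_trace_def .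
  then show w: "L2 E (edge_trace K e v)" unfolding is_trace_def by blast
  obtain \<phi> where \<phi>: "\<And>n. smooth (\<phi> n)" "(\<lambda>n. sobolev_norm 1 U (\<lambda>x. \<phi> n x - v x)) \<longlonglongrightarrow> 0"
    "(\<lambda>n. norm_L2 E (\<lambda>x. \<phi> n x - edge_trace K e v x)) \<longlonglongrightarrow> 0"
    using t unfolding is_trace_def K by blast
  have l: "(\<lambda>n. norm_L2 M (\<lambda>x. \<phi> n x - v x)) \<longlonglongrightarrow> 0"
    "\<And>i. (\<lambda>n. norm_L2 M (\<lambda>x. pdiff i (\<phi> n) x - weak_deriv U [i] v x)) \<longlonglongrightarrow> 0"
    using sobolev_norm_1_diff_tendsto[where \<phi>=\<phi>, OF \<phi>(1) v] \<phi>(2) by blast+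
  show "(norm_L2 E (\<lambda>x. edge_trace K e v x - r x))\<^sup>2 \<le> trc * (4 * (norm_L2 M (\<lambda>x. v x - r x))\<^sup>2 +
    h\<^sup>2 * (\<Sum>i\<in>UNIV. (norm_L2 M (\<lambda>x. weak_deriv U [i] v x - pdiff i r x))\<^sup>2))"
    by (rule trace_limit[OF v w \<phi>(1) l \<phi>(3) r])
qed

end

(* PART 8 *)

lemma wedge_bound: "\<bar>wedge x y\<bar> \<le> norm x * norm y"
proof -
  have "(wedge x y)\<^sup>2 \<le> (norm x * norm y)\<^sup>2"
    using Cauchy_Schwarz_2[of "x $ 1" "y $ 2" "- x $ 2" "y $ 1"]
    by (simp add: wedge_def norm_vec_def L2_set_def sum_2 power_mult_distrib add.commute)
  then show ?thesis by (metis abs_le_square_iff abs_of_nonneg mult_nonneg_nonneg norm_ge_zero)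
qed

lemma wedge_anti: "wedge x y = - wedge y x"
  by (simp add: wedge_def)

lemma wedge_zero_collinear:
  assumes "wedge x y = 0" shows "collinear {0, x, y}"
proof (cases "x = 0")
  case False
  then obtain i where i: "x $ i \<noteq> 0" by (auto simp: vec_eq_iff)
  have "y = (y $ i / x $ i) *\<^sub>R x"
    using assms i exhaust_2[of i] by (auto simp: vec_eq_iff forall_2 wedge_def field_simps)
  then show ?thesis unfolding collinear_lemma by blast
qed (simp add: collinear_lemma)

locale tri =
  fixes a b c :: plane
  assumes pos: "wedge (b - a) (c - a) > 0" and indep: "\<not> affine_dependent {a, b, c}"
begin

abbreviation "K \<equiv> convex hull {a, b, c}"
abbreviation "D \<equiv> wedge (b - a) (c - a)"
definition "la x = wedge (c - b) (x - b)"
definition "lb x = wedge (a - c) (x - c)"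
definition "lc x = wedge (b - a) (x - a)"

lemma rot: "tri b c a"
proof
  have "wedge (c - b) (a - b) = D" by (simp add: wedge_def algebra_simps)
  then show "wedge (c - b) (a - b) > 0" using pos by simp
  have "{b, c, a} = {a, b, c}" by auto
  then show "\<not> affine_dependent {b, c, a}" using indep by simp
qed

lemma distinct: "a \<noteq> b" "b \<noteq> c" "a \<noteq> c"
  using pos by (auto simp: wedge_def)

lemma l_sum: "la x + lb x + lc x = D"
  by (simp add: la_def lb_def lc_def wedge_def algebra_simps)

lemma l_expand: "D *\<^sub>R x = la x *\<^sub>R a + lb x *\<^sub>R b + lc x *\<^sub>R c"
  by (simp add: vec_eq_iff forall_2 la_def lb_def lc_def wedge_def algebra_simps)

lemma l_comb:
  assumes "u + v + w = 1"
  shows "la (u *\<^sub>R a + v *\<^sub>R b + w *\<^sub>R c) = u * D" "lb (u *\<^sub>R a + v *\<^sub>R b + w *\<^sub>R c) = v * D"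
    "lc (u *\<^sub>R a + v *\<^sub>R b + w *\<^sub>R c) = w * D"
proof -
  have u: "u = 1 - v - w" using assms by simp
  show "la (u *\<^sub>R a + v *\<^sub>R b + w *\<^sub>R c) = u * D" "lb (u *\<^sub>R a + v *\<^sub>R b + w *\<^sub>R c) = v * D"
    "lc (u *\<^sub>R a + v *\<^sub>R b + w *\<^sub>R c) = w * D"
    unfolding u by (simp_all add: la_def lb_def lc_def wedge_def algebra_simps)
qed

lemma mem: "x \<in> K \<longleftrightarrow> 0 \<le> la x \<and> 0 \<le> lb x \<and> 0 \<le> lc x"
proof
  assume "x \<in> K"
  then obtain u v w where uvw: "0 \<le> u" "0 \<le> v" "0 \<le> w" "u + v + w = 1" "x = u *\<^sub>R a + v *\<^sub>R b + w *\<^sub>R c"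
    unfolding convex_hull_3 by auto
  then show "0 \<le> la x \<and> 0 \<le> lb x \<and> 0 \<le> lc x" using l_comb[OF uvw(4)] pos by simp
next
  assume l: "0 \<le> la x \<and> 0 \<le> lb x \<and> 0 \<le> lc x"
  have "x = (1 / D) *\<^sub>R (D *\<^sub>R x)" using pos by simp
  also have "\<dots> = (la x / D) *\<^sub>R a + (lb x / D) *\<^sub>R b + (lc x / D) *\<^sub>R c" unfolding l_expand by (simp add: scaleR_add_right)
  finally have "x = (la x / D) *\<^sub>R a + (lb x / D) *\<^sub>R b + (lc x / D) *\<^sub>R c" .
  moreover have "la x / D + lb x / D + lc x / D = 1" using l_sum[of x] pos by (simp add: add_divide_distrib[symmetric])
  moreover have "0 \<le> la x / D" "0 \<le> lb x / D" "0 \<le> lc x / D" using l pos by auto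
  ultimately show "x \<in> K" unfolding convex_hull_3 by blast
qed

lemma l_cont: "continuous_on UNIV la" "continuous_on UNIV lb" "continuous_on UNIV lc"
  unfolding la_def[abs_def] lb_def[abs_def] lc_def[abs_def] wedge_def by (intro continuous_intros)+

lemma open_l: "open {y. la y > 0 \<and> lb y > 0}" "open {y. la y > 0 \<and> lb y > 0 \<and> lc y > 0}"
proof -
  have 1: "open {y. la y > 0}" "open {y. lb y > 0}" "open {y. lc y > 0}"
    by (intro open_Collect_less continuous_on_const l_cont)+
  have "{y. la y > 0 \<and> lb y > 0} = {y. la y > 0} \<inter> {y. lb y > 0}" by auto
  then show "open {y. la y > 0 \<and> lb y > 0}" using 1 by auto
  have "{y. la y > 0 \<and> lb y > 0 \<and> lc y > 0} = {y. la y > 0} \<inter> {y. lb y > 0} \<inter> {y. lc y > 0}" by auto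
  then show "open {y. la y > 0 \<and> lb y > 0 \<and> lc y > 0}" using 1 by auto
qed

lemma mem_interior: "x \<in> interior K \<longleftrightarrow> 0 < la x \<and> 0 < lb x \<and> 0 < lc x"
proof
  assume "0 < la x \<and> 0 < lb x \<and> 0 < lc x"
  then show "x \<in> interior K"
    by (intro interiorI[OF open_l(2)]) (auto simp: mem)
next
  assume x: "x \<in> interior K"
  then obtain e where e: "e > 0" "ball x e \<subseteq> K" unfolding mem_interior by blast
  have step: "0 < l x" if l: "\<And>y s v. l (x + s *\<^sub>R v) = l x + s * m v" and lK: "\<And>y. y \<in> K \<Longrightarrow> 0 \<le> l y" and v: "m v < 0"
    for l :: "plane \<Rightarrow> real" and m v
  proof -
    have nv: "norm v + 1 > 0" by (simp add: add_nonneg_pos)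
    define s where "s = e / (2 * (norm v + 1))"
    have s: "s > 0" using e nv by (simp add: s_def)
    have "s * norm v < e" unfolding s_def using e(1) nv by (simp add: field_simps) (smt (verit) norm_ge_zero mult_pos_pos mult_nonneg_nonneg)
    then have "x + s *\<^sub>R v \<in> ball x e" using s by (simp add: dist_norm)
    then have "0 \<le> l (x + s *\<^sub>R v)" using e(2) lK by blast
    also have "l (x + s *\<^sub>R v) = l x + s * m v" by (rule l)
    finally show "0 < l x" using mult_pos_neg[OF s v] by linarith
  qed
  have "0 < la x"
    by (rule step[of la "wedge (c - b)" "b - a"]) (use pos mem in \<open>auto simp: la_def wedge_def algebra_simps\<close>)
  moreover have "0 < lb x"
    by (rule step[of lb "wedge (a - c)" "c - b"]) (use pos mem in \<open>auto simp: lb_def wedge_def algebra_simps\<close>)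
  moreover have "0 < lc x"
    by (rule step[of lc "wedge (b - a)" "a - c"]) (use pos mem in \<open>auto simp: lc_def wedge_def algebra_simps\<close>)
  ultimately show "0 < la x \<and> 0 < lb x \<and> 0 < lc x" by blast
qed

lemma edge_of_iff: "e edge_of K \<longleftrightarrow> e \<in> {closed_segment a b, closed_segment b c, closed_segment c a}"
proof
  assume "e edge_of K"
  then have f: "e face_of K" and d: "aff_dim e = 1" by (auto simp: edge_of_def)
  obtain C where C: "C \<subseteq> {a, b, c}" "e = convex hull C"
    using f face_of_convex_hull_affine_independent[OF indep] by blast
  have "\<not> affine_dependent C" using affine_independent_subset[OF indep C(1)] .
  from aff_dim_affine_independent[OF this] have "aff_dim C = int (card C) - 1" by simp
  then have "card C = 2" using d C(2) by (simp add: aff_dim_convex_hull)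
  then obtain x y where xy: "C = {x, y}" "x \<noteq> y" unfolding card_2_iff by blast
  then have "e = closed_segment x y" using C(2) by (simp add: segment_convex_hull)
  moreover have "x \<in> {a, b, c}" "y \<in> {a, b, c}" using C(1) xy by auto
  ultimately show "e \<in> {closed_segment a b, closed_segment b c, closed_segment c a}"
    using xy(2) by (auto simp: closed_segment_commute)
next
  have *: "closed_segment x y edge_of K" if "x \<in> {a, b, c}" "y \<in> {a, b, c}" "x \<noteq> y" for x y
  proof -
    have s: "{x, y} \<subseteq> {a, b, c}" using that by auto
    have e: "closed_segment x y = convex hull {x, y}" by (simp add: segment_convex_hull)
    have "closed_segment x y face_of K"
      unfolding face_of_convex_hull_affine_independent[OF indep] e using s by blast
    moreover have "aff_dim (closed_segment x y) = 1"
      unfolding e using that(3) by (simp add: aff_dim_convex_hull aff_dim_2)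
    ultimately show ?thesis by (simp add: edge_of_def)
  qed
  assume "e \<in> {closed_segment a b, closed_segment b c, closed_segment c a}"
  then show "e edge_of K" using *[of a b] *[of b c] *[of c a] distinct by auto
qed

lemma edges_distinct: "closed_segment a b \<noteq> closed_segment b c" "closed_segment b c \<noteq> closed_segment c a"
  "closed_segment a b \<noteq> closed_segment c a"
  using distinct by (auto simp: closed_segment_eq doubleton_eq_iff)

lemma vertex_iff: "p \<in> {a, b, c} \<longleftrightarrow> {p} face_of K"
  using extreme_point_of_convex_hull_affine_independent[OF indep, of p] by (simp add: face_of_singleton)

lemma seg_ab: "x \<in> closed_segment a b \<longleftrightarrow> x \<in> K \<and> lc x = 0"
proof
  assume "x \<in> closed_segment a b"
  then obtain u where u: "0 \<le> u" "u \<le> 1" "x = (1 - u) *\<^sub>R a + u *\<^sub>R b" unfolding in_segment by auto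
  have x: "x = (1 - u) *\<^sub>R a + u *\<^sub>R b + 0 *\<^sub>R c" using u by simp
  show "x \<in> K \<and> lc x = 0"
    unfolding mem using l_comb[of "1 - u" u 0, folded x] u pos by simp
next
  assume x: "x \<in> K \<and> lc x = 0"
  then obtain u v w where uvw: "0 \<le> u" "0 \<le> v" "0 \<le> w" "u + v + w = 1" "x = u *\<^sub>R a + v *\<^sub>R b + w *\<^sub>R c"
    unfolding convex_hull_3 by auto
  have "w = 0" using l_comb(3)[OF uvw(4)] x uvw(5) pos by simp
  then have "u = 1 - v" "x = u *\<^sub>R a + v *\<^sub>R b" using uvw by auto
  then show "x \<in> closed_segment a b" unfolding in_segment using uvw by (intro exI[of _ v]) auto
qed

lemma vertices_values: "la a = D" "lb a = 0" "lc a = 0" "la b = 0" "lb b = D" "lc b = 0" "la c = 0" "lb c = 0" "lc c = D"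
  by (simp_all add: la_def lb_def lc_def wedge_def algebra_simps)

lemma near_open_segment:
  assumes x: "x = (1 - s) *\<^sub>R a + s *\<^sub>R b" and s: "0 < s" "s < 1"
  obtains \<delta> where "\<delta> > 0" "\<And>y. dist x y < \<delta> \<Longrightarrow> 0 < la y \<and> 0 < lb y"
proof -
  have x': "x = (1 - s) *\<^sub>R a + s *\<^sub>R b + 0 *\<^sub>R c" using x by simp
  have "x \<in> {y. la y > 0 \<and> lb y > 0}" using l_comb[of "1 - s" s 0, folded x'] s pos by simp
  then obtain d where "d > 0" "ball x d \<subseteq> {y. la y > 0 \<and> lb y > 0}"
    using open_l(1) open_contains_ball by blast
  then show thesis using that[of d] by (auto simp: subset_iff)
qed

lemma centroid_interior: "(1/3) *\<^sub>R a + (1/3) *\<^sub>R b + (1/3) *\<^sub>R c \<in> interior K"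
  unfolding mem_interior using l_comb[of "1/3" "1/3" "1/3"] pos by simp

lemma compact_K: "compact K" by (simp add: finite_imp_compact_convex_hull)

lemma starlike_interior: "\<exists>z \<rho>. starlike (interior K) z \<rho>"
proof -
  obtain \<rho> where \<rho>: "\<rho> > 0" "ball ((1/3) *\<^sub>R a + (1/3) *\<^sub>R b + (1/3) *\<^sub>R c) \<rho> \<subseteq> interior K"
    using centroid_interior open_contains_ball open_interior by blast
  have "starlike (interior K) ((1/3) *\<^sub>R a + (1/3) *\<^sub>R b + (1/3) *\<^sub>R c) \<rho>"
    by standard (use \<rho> compact_K in \<open>auto intro: convex_interior bounded_interior compact_imp_bounded\<close>)
  then show ?thesis by blast
qed

lemma half_in: "0 < t \<Longrightarrow> t < 1/2 \<Longrightarrow> 0 < u \<Longrightarrow> u < 1/2 \<Longrightarrow> a + t *\<^sub>R (b - a) + u *\<^sub>R (c - a) \<in> interior K"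
  "0 < t \<Longrightarrow> t < 1/2 \<Longrightarrow> 0 < u \<Longrightarrow> u < 1/2 \<Longrightarrow> b + t *\<^sub>R (a - b) + u *\<^sub>R (c - b) \<in> interior K"
proof -
  assume tu: "0 < t" "t < 1/2" "0 < u" "u < 1/2"
  have e: "a + t *\<^sub>R (b - a) + u *\<^sub>R (c - a) = (1 - t - u) *\<^sub>R a + t *\<^sub>R b + u *\<^sub>R c"
    "b + t *\<^sub>R (a - b) + u *\<^sub>R (c - b) = t *\<^sub>R a + (1 - t - u) *\<^sub>R b + u *\<^sub>R c" by (auto simp: algebra_simps)
  have p: "t * D > 0" "u * D > 0" "(1 - t - u) * D > 0" using tu pos by auto
  show "a + t *\<^sub>R (b - a) + u *\<^sub>R (c - a) \<in> interior K"
    unfolding e mem_interior using l_comb[of "1 - t - u" t u] p by simp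
  show "b + t *\<^sub>R (a - b) + u *\<^sub>R (c - b) \<in> interior K"
    unfolding e mem_interior using l_comb[of t "1 - t - u" u] p by simp
qed

lemma area: "measure lebesgue K = D / 2"
proof -
  have "measure lebesgue K = measure lborel K"
    using compact_K by (simp add: borel_compact)
  also have "\<dots> = D / 2"
    using pos by (subst content_triangle) (simp add: wedge_def algebra_simps abs_minus_commute)
  finally show ?thesis .
qed

lemma closure_interior_K: "closure (interior K) = K"
proof -
  have "interior K \<noteq> {}" using centroid_interior by blast
  then have "closure (interior K) = closure K" by (intro convex_closure_interior) auto
  then show ?thesis using compact_K by (simp add: compact_imp_closed)
qed

lemma diam: "norm (x - y) \<le> diameter K" if "x \<in> K" "y \<in> K"
  using diameter_bounded_bound[OF compact_imp_bounded[OF compact_K] that] by (simp add: dist_norm)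

lemma vertices_in: "a \<in> K" "b \<in> K" "c \<in> K" by (auto intro: hull_inc)

lemma D_le: "D \<le> norm (b - a) * diameter K" "D \<le> (diameter K)\<^sup>2" "diameter K > 0"
proof -
  have "D \<le> norm (b - a) * norm (c - a)" using wedge_bound[of "b - a" "c - a"] pos by simp
  also have "\<dots> \<le> norm (b - a) * diameter K" by (intro mult_left_mono diam vertices_in) simp
  finally show 1: "D \<le> norm (b - a) * diameter K" .
  also have "\<dots> \<le> diameter K * diameter K" 
    by (intro mult_right_mono diam vertices_in) (use diam[OF vertices_in(1,1)] in simp)
  finally show "D \<le> (diameter K)\<^sup>2" by (simp add: power2_eq_square)
  show "diameter K > 0" using diam[OF vertices_in(1,2)] distinct(1) by (smt (verit) norm_le_zero_iff right_minus_eq norm_minus_commute)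
qed

end

lemma simplex_2_tri:
  assumes "2 simplex K" obtains a b c where "K = convex hull {a, b, c}" "tri a b c"
proof -
  obtain C where C: "\<not> affine_dependent C" "int (card C) = 2 + 1" "K = convex hull C"
    using assms unfolding simplex_def by blast
  then have "card C = 3" by simp
  then obtain a b c where abc: "C = {a, b, c}" "a \<noteq> b" "a \<noteq> c" "b \<noteq> c" unfolding card_3_iff by blast
  have "wedge (b - a) (c - a) \<noteq> 0"
  proof
    assume "wedge (b - a) (c - a) = 0"
    then have "collinear {0, b - a, c - a}" by (rule wedge_zero_collinear)
    then have "collinear {b, a, c}" using collinear_3[of b a c] by simp
    then have "collinear {a, b, c}" by (simp add: insert_commute)
    then show False using C(1) abc by (simp add: collinear_3_eq_affine_dependent)
  qed
  then consider "wedge (b - a) (c - a) > 0" | "wedge (c - a) (b - a) > 0" using wedge_anti[of "b - a" "c - a"] by linarith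
  then show thesis
  proof cases
    case 1
    then have "tri a b c" using C(1) abc by unfold_locales auto
    then show thesis using that C(3) abc by blast
  next
    case 2
    have e: "C = {a, c, b}" using abc by auto
    have "tri a c b" using C(1) e 2 by unfold_locales auto
    then show thesis using that C(3) e by blast
  qed
qed

(* PART 9 *)

locale mesh =
  fixes \<T> :: "plane set set"
  assumes tr: "triangulation \<T>" and s2: "\<And>K. K \<in> \<T> \<Longrightarrow> 2 simplex K"
begin

lemma fin: "finite \<T>" using tr by (simp add: triangulation_def)

lemma inter_face: "K \<in> \<T> \<Longrightarrow> K' \<in> \<T> \<Longrightarrow> (K \<inter> K') face_of K"
  using tr by (simp add: triangulation_def)

definition vs :: "plane set \<Rightarrow> plane \<times> plane \<times> plane" where
  "vs K = (SOME p. K = convex hull {fst p, fst (snd p), snd (snd p)} \<and> tri (fst p) (fst (snd p)) (snd (snd p)))"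

definition "vA K = fst (vs K)"
definition "vB K = fst (snd (vs K))"
definition "vC K = snd (snd (vs K))"

lemma vs: assumes "K \<in> \<T>" shows "K = convex hull {vA K, vB K, vC K}" "tri (vA K) (vB K) (vC K)"
proof -
  obtain a b c where "K = convex hull {a, b, c}" "tri a b c" using simplex_2_tri[OF s2[OF assms]] by blast
  then have "\<exists>p. K = convex hull {fst p, fst (snd p), snd (snd p)} \<and> tri (fst p) (fst (snd p)) (snd (snd p))"
    by (intro exI[of _ "(a, b, c)"]) simp
  from someI_ex[OF this] show "K = convex hull {vA K, vB K, vC K}" "tri (vA K) (vB K) (vC K)"
    unfolding vA_def vB_def vC_def vs_def by auto
qed

definition verts :: "plane set \<Rightarrow> plane set" where "verts K = {vA K, vB K, vC K}"

lemma hull: "K \<in> \<T> \<Longrightarrow> convex hull {vA K, vB K, vC K} = K" using vs(1) by simp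

definition DK :: "plane set \<Rightarrow> real" where "DK K = wedge (vB K - vA K) (vC K - vA K)"

lemma DK_pos: "K \<in> \<T> \<Longrightarrow> DK K > 0" using vs(2) unfolding DK_def tri_def by blast

definition dedges :: "plane set \<Rightarrow> (plane \<times> plane) set" where
  "dedges K = {(vA K, vB K), (vB K, vC K), (vC K, vA K)}"

text \<open>Every directed edge is the first one after a rotation of the vertices.\<close>

lemma dedge_tri:
  assumes "K \<in> \<T>" "(p, q) \<in> dedges K"
  obtains r where "tri p q r" "K = convex hull {p, q, r}" "verts K = {p, q, r}" "wedge (q - p) (r - p) = DK K"
    "(q, r) \<in> dedges K" "(r, p) \<in> dedges K"
proof -
  note t = vs(2)[OF assms(1)]
  have r1: "tri (vB K) (vC K) (vA K)" by (rule tri.rot[OF t])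
  have r2: "tri (vC K) (vA K) (vB K)" by (rule tri.rot[OF r1])
  have h: "convex hull {vB K, vC K, vA K} = K" "convex hull {vC K, vA K, vB K} = K"
    using hull[OF assms(1)] by (simp_all add: insert_commute)
  have d: "wedge (vC K - vB K) (vA K - vB K) = DK K" "wedge (vA K - vC K) (vB K - vC K) = DK K"
    by (simp_all add: DK_def wedge_def algebra_simps)
  have v: "verts K = {vB K, vC K, vA K}" "verts K = {vC K, vA K, vB K}" by (auto simp: verts_def)
  consider "p = vA K" "q = vB K" | "p = vB K" "q = vC K" | "p = vC K" "q = vA K" using assms(2) unfolding dedges_def by auto
  then show thesis
  proof cases
    case 1 then show thesis using that[of "vC K"] t hull[OF assms(1)] by (simp add: verts_def DK_def dedges_def)
  next
    case 2 then show thesis using that[of "vA K"] r1 h d v by (simp add: dedges_def)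
  next
    case 3 then show thesis using that[of "vB K"] r2 h d v by (simp add: dedges_def)
  qed
qed

lemma edge_dedge:
  assumes "K \<in> \<T>"
  shows "e edge_of K \<longleftrightarrow> (\<exists>p q. (p, q) \<in> dedges K \<and> e = closed_segment p q)"
  using tri.edge_of_iff[OF vs(2)[OF assms], of e] unfolding hull[OF assms] dedges_def by auto

lemma mem_verts_iff: "K \<in> \<T> \<Longrightarrow> p \<in> verts K \<longleftrightarrow> {p} face_of K"
  using tri.vertex_iff[OF vs(2), of K p] hull[of K] unfolding verts_def by metis

lemma verts_subset: "K \<in> \<T> \<Longrightarrow> p \<in> verts K \<Longrightarrow> p \<in> K"
  using tri.vertices_in[OF vs(2), of K] hull[of K] unfolding verts_def by auto

lemma finite_verts: "finite (verts K)" by (simp add: verts_def)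

lemma vertex_shared:
  assumes "K \<in> \<T>" "K' \<in> \<T>" "p \<in> verts K" "p \<in> K'" shows "p \<in> verts K'"
proof -
  have "{p} face_of K" using assms mem_verts_iff by blast
  moreover have "{p} \<subseteq> K \<inter> K'" using assms verts_subset by blast
  ultimately have "{p} face_of (K \<inter> K')" by (rule face_of_subset) auto
  moreover have "(K \<inter> K') face_of K'" using inter_face[OF assms(2,1)] by (simp add: Int_commute)
  ultimately have "{p} face_of K'" by (rule face_of_trans)
  then show ?thesis using assms mem_verts_iff by blast
qed

lemma K_convex_compact: "K \<in> \<T> \<Longrightarrow> convex K" "K \<in> \<T> \<Longrightarrow> compact K" "K \<in> \<T> \<Longrightarrow> closed K"
  "K \<in> \<T> \<Longrightarrow> closure (interior K) = K"
proof -
  assume K: "K \<in> \<T>"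
  note h = hull[OF K]
  show "convex K" using convex_convex_hull[of "{vA K, vB K, vC K}"] unfolding h .
  show "compact K" using tri.compact_K[OF vs(2)[OF K]] unfolding h .
  then show "closed K" by (rule compact_imp_closed)
  show "closure (interior K) = K" using tri.closure_interior_K[OF vs(2)[OF K]] unfolding h .
qed

lemma interior_disjoint:
  assumes "K \<in> \<T>" "K' \<in> \<T>" "K \<noteq> K'" shows "interior K \<inter> K' = {}"
proof (rule ccontr)
  assume ne: "interior K \<inter> K' \<noteq> {}"
  have sub: "K \<subseteq> K'" if "K \<in> \<T>" "K' \<in> \<T>" "interior K \<inter> K' \<noteq> {}" for K K'
  proof -
    have "rel_interior K = interior K"
      using that(3) by (intro rel_interior_nonempty_interior) auto
    then have "(K \<inter> K') \<inter> rel_interior K \<noteq> {}" using that(3) interior_subset by blast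
    then have "K \<inter> K' = K" using face_of_disjoint_rel_interior[OF inter_face[OF that(1,2)]] by blast
    then show ?thesis by blast
  qed
  have s1: "K \<subseteq> K'" by (rule sub[OF assms(1,2) ne])
  then have "interior K \<subseteq> interior K'" by (rule interior_mono)
  then have "interior K' \<inter> K \<noteq> {}" using ne interior_subset by blast
  then have "K' \<subseteq> K" by (rule sub[OF assms(2,1)])
  then show False using s1 assms(3) by blast
qed

lemma negligible_inter:
  assumes "K \<in> \<T>" "K' \<in> \<T>" "K \<noteq> K'" shows "negligible (K \<inter> K')"
proof -
  have "K \<inter> K' \<subseteq> frontier K"
    using interior_disjoint[OF assms] K_convex_compact(3)[OF assms(1)] by (auto simp: frontier_def)
  then show ?thesis
    using negligible_convex_frontier[OF K_convex_compact(1)[OF assms(1)]] negligible_subset by blast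
qed

text \<open>Two triangles cannot lie on the same side of a common edge.\<close>

lemma same_side:
  assumes "K \<in> \<T>" "K' \<in> \<T>" "(p, q) \<in> dedges K" "(p, q) \<in> dedges K'" shows "K = K'"
proof (rule ccontr)
  assume ne: "K \<noteq> K'"
  obtain r where r: "tri p q r" "K = convex hull {p, q, r}" using dedge_tri[OF assms(1,3)] by metis
  obtain r' where r': "tri p q r'" "K' = convex hull {p, q, r'}" using dedge_tri[OF assms(2,4)] by metis
  interpret t: tri p q r by (rule r(1))
  interpret t': tri p q r' by (rule r'(1))
  define x where "x = (1 - 1/2) *\<^sub>R p + (1/2) *\<^sub>R q"
  obtain d where d: "d > 0" "\<And>y. dist x y < d \<Longrightarrow> 0 < t.la y \<and> 0 < t.lb y"
    using t.near_open_segment[OF x_def] by auto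
  obtain d' where d': "d' > 0" "\<And>y. dist x y < d' \<Longrightarrow> 0 < t'.la y \<and> 0 < t'.lb y"
    using t'.near_open_segment[OF x_def] by auto
  have nr: "norm (r - p) + 1 > 0" by (simp add: add_nonneg_pos)
  define s where "s = min d d' / (2 * (norm (r - p) + 1))"
  have s: "s > 0" using d(1) d'(1) nr by (simp add: s_def)
  let ?y = "x + s *\<^sub>R (r - p)"
  have "s * norm (r - p) < min d d'"
  proof -
    have "norm (r - p) < 2 * (norm (r - p) + 1)" using nr by simp
    then have "s * norm (r - p) < s * (2 * (norm (r - p) + 1))" using s by (rule mult_strict_left_mono)
    also have "\<dots> = min d d'" using nr by (simp add: s_def)
    finally show ?thesis .
  qed
  then have "dist x ?y < min d d'" using s by (simp add: dist_norm)
  then have l: "0 < t.la ?y" "0 < t.lb ?y" "0 < t'.la ?y" "0 < t'.lb ?y" using d(2)[of ?y] d'(2)[of ?y] by auto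
  have "t.lc ?y = s * wedge (q - p) (r - p)"
  proof -
    have "?y - p = (1/2) *\<^sub>R (q - p) + s *\<^sub>R (r - p)" by (simp add: x_def vec_eq_iff field_simps)
    then show ?thesis unfolding t.lc_def by (simp only: wedge_linear mult_zero_right add_0_left)
  qed
  then have lc: "0 < t.lc ?y" using s t.pos by simp
  then have "0 < t'.lc ?y" by (simp add: t.lc_def t'.lc_def)
  then have "?y \<in> interior K" "?y \<in> interior K'"
    using l lc t.mem_interior t'.mem_interior r(2) r'(2) by auto
  then show False using interior_disjoint[OF assms(1,2) ne] interior_subset by blast
qed

lemma dedge_distinct: "K \<in> \<T> \<Longrightarrow> (p, q) \<in> dedges K \<Longrightarrow> p \<noteq> q"
  using tri.distinct[OF vs(2), of K] unfolding dedges_def by auto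

lemma not_both: "K \<in> \<T> \<Longrightarrow> (p, q) \<in> dedges K \<Longrightarrow> (q, p) \<notin> dedges K"
  using tri.distinct[OF vs(2), of K] unfolding dedges_def by auto

lemma edge_dir:
  assumes "K \<in> \<T>" "closed_segment p q edge_of K" shows "(p, q) \<in> dedges K \<or> (q, p) \<in> dedges K"
proof -
  obtain p' q' where "(p', q') \<in> dedges K" "closed_segment p q = closed_segment p' q'" using assms edge_dedge by blast
  then show ?thesis by (auto simp: closed_segment_eq doubleton_eq_iff)
qed

lemma opposite_dir:
  assumes "K \<in> \<T>" "K' \<in> \<T>" "K \<noteq> K'" "closed_segment p q edge_of K'" "(p, q) \<in> dedges K"
  shows "(q, p) \<in> dedges K'"
  using edge_dir[OF assms(2,4)] same_side[OF assms(1,2,5)] assms(3) by blast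

lemma at_most_two:
  assumes "K \<in> \<T>" "K' \<in> \<T>" "K'' \<in> \<T>" "K \<noteq> K'" "K \<noteq> K''" "e edge_of K" "e edge_of K'" "e edge_of K''"
  shows "K' = K''"
proof -
  obtain p q where pq: "(p, q) \<in> dedges K" "e = closed_segment p q" using edge_dedge assms by blast
  have "(q, p) \<in> dedges K'" by (rule opposite_dir[OF assms(1,2,4) _ pq(1)]) (use assms(7) pq(2) in simp)
  moreover have "(q, p) \<in> dedges K''" by (rule opposite_dir[OF assms(1,3,5) _ pq(1)]) (use assms(8) pq(2) in simp)
  ultimately show ?thesis by (rule same_side[OF assms(2,3)])
qed

lemma interior_union:
  assumes "K \<in> \<T>" "K' \<in> \<T>" "K \<noteq> K'" "(p, q) \<in> dedges K" "closed_segment p q edge_of K'"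
    and x: "x \<in> closed_segment p q" "x \<noteq> p" "x \<noteq> q"
  shows "x \<in> interior (K \<union> K')"
proof -
  have d': "(q, p) \<in> dedges K'" by (rule opposite_dir[OF assms(1-3,5,4)])
  obtain r where r: "tri p q r" "K = convex hull {p, q, r}" using dedge_tri[OF assms(1,4)] by metis
  obtain r' where r': "tri q p r'" "K' = convex hull {q, p, r'}" using dedge_tri[OF assms(2) d'] by metis
  interpret t: tri p q r by (rule r(1))
  interpret t': tri q p r' by (rule r'(1))
  obtain s where s: "0 \<le> s" "s \<le> 1" "x = (1 - s) *\<^sub>R p + s *\<^sub>R q" using x(1) unfolding in_segment by auto
  have s': "s \<noteq> 0" "s \<noteq> 1" using s(3) x(2,3) by auto
  then have st: "0 < s" "s < 1" using s by auto
  have x2: "x = (1 - (1 - s)) *\<^sub>R q + (1 - s) *\<^sub>R p" using s(3) by (simp add: algebra_simps)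
  obtain d where d: "d > 0" "\<And>y. dist x y < d \<Longrightarrow> 0 < t.la y \<and> 0 < t.lb y"
    using t.near_open_segment[OF s(3) st] by auto
  obtain d' where d': "d' > 0" "\<And>y. dist x y < d' \<Longrightarrow> 0 < t'.la y \<and> 0 < t'.lb y"
    using t'.near_open_segment[OF x2] st by auto
  have sub: "ball x (min d d') \<subseteq> K \<union> K'"
  proof
    fix y assume "y \<in> ball x (min d d')"
    then have l: "0 < t.la y" "0 < t.lb y" "0 < t'.la y" "0 < t'.lb y" using d(2)[of y] d'(2)[of y] by auto
    have "t'.lc y = - t.lc y" by (simp add: t.lc_def t'.lc_def wedge_def algebra_simps)
    then have "0 \<le> t.lc y \<or> 0 \<le> t'.lc y" by linarith
    then show "y \<in> K \<union> K'" using l t.mem t'.mem r(2) r'(2) by (auto simp: less_imp_le)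
  qed
  have "x \<in> ball x (min d d')" using d(1) d'(1) by simp
  then show ?thesis by (rule subsetD[OF interior_maximal[OF sub open_ball]])
qed

definition star :: "plane \<Rightarrow> plane set set" where "star p = {K \<in> \<T>. p \<in> verts K}"

lemma star_sub: "star p \<subseteq> \<T>" "finite (star p)" using fin by (auto simp: star_def)

definition boundary_edge :: "plane set \<Rightarrow> bool" where
  "boundary_edge e \<longleftrightarrow> (\<exists>K\<in>\<T>. e edge_of K \<and> (\<forall>K'\<in>\<T>. e edge_of K' \<longrightarrow> K' = K))"

lemma vertex_dedges:
  assumes "K \<in> \<T>" "p \<in> verts K"
  obtains q r where "(p, q) \<in> dedges K" "(r, p) \<in> dedges K" "(q, r) \<in> dedges K" "verts K = {p, q, r}" "tri p q r" "K = convex hull {p, q, r}"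
proof -
  have "\<exists>q. (p, q) \<in> dedges K" using assms unfolding verts_def dedges_def by auto
  then obtain q where q: "(p, q) \<in> dedges K" by blast
  show thesis by (rule dedge_tri[OF assms(1) q]) (rule that[OF q])
qed

lemma finite_dedges: "finite (dedges K)" by (simp add: dedges_def)

text \<open>Connectivity of the star of an interior vertex\<close>

lemma star_connected:
  assumes A: "A \<subseteq> star p" "A \<noteq> {}"
    and clos: "\<And>K e. K \<in> A \<Longrightarrow> e edge_of K \<Longrightarrow> p \<in> e \<Longrightarrow> \<exists>K'\<in>A. K' \<noteq> K \<and> e edge_of K'"
  shows "A = star p"
proof -
  have AT: "K \<in> \<T>" "p \<in> verts K" if "K \<in> A" for K using A(1) that by (auto simp: star_def)
  have finA: "finite A" using A(1) star_sub finite_subset by blast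
  define S where "S = (\<Union>K\<in>A. \<Union>d \<in> {d \<in> dedges K. p \<notin> closed_segment (fst d) (snd d)}. closed_segment (fst d) (snd d))"
  have "closed S" unfolding S_def
    by (intro closed_UN finA finite_subset[OF _ finite_dedges] ballI closed_segment) auto
  then have "open (- S)" by (simp add: open_Compl)
  moreover have "p \<in> - S" by (auto simp: S_def)
  ultimately obtain \<rho> where "\<rho> > 0" and sub: "ball p \<rho> \<subseteq> - S"
    using open_contains_ball by blast
  moreover have "closed_segment q r \<subseteq> S" if "K \<in> A" "(q, r) \<in> dedges K" "p \<notin> closed_segment q r" for K q r
    unfolding S_def using that by force
  ultimately have "\<exists>\<rho>>0. \<forall>K q r. K \<in> A \<longrightarrow> (q, r) \<in> dedges K \<longrightarrow> p \<notin> closed_segment q r \<longrightarrow> closed_segment q r \<inter> ball p \<rho> = {}"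
    by (intro exI[of _ \<rho>]) blast
  then obtain \<rho> where \<rho>: "\<rho> > 0" "\<And>K q r. K \<in> A \<Longrightarrow> (q, r) \<in> dedges K \<Longrightarrow> p \<notin> closed_segment q r \<Longrightarrow> closed_segment q r \<inter> ball p \<rho> = {}"
    by blast
  let ?B = "ball p \<rho> - {p}"
  have "connected ?B" by (rule connected_punctured_ball) simp
  have cl: "closed (\<Union>A)" using finA K_convex_compact(3) AT by (intro closed_Union) auto
  have key: "x \<in> interior (\<Union>A)" if x: "x \<in> \<Union>A" "x \<in> ?B" for x
  proof -
    obtain K where K: "K \<in> A" "x \<in> K" using x(1) by blast
    obtain q r where qr: "(p, q) \<in> dedges K" "(r, p) \<in> dedges K" "tri p q r" "K = convex hull {p, q, r}" "verts K = {p, q, r}"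
      and qr_edge: "(q, r) \<in> dedges K"
      using vertex_dedges[OF AT[OF K(1)]] by metis
    interpret t: tri p q r by (rule qr(3))
    have on: "x \<in> interior (\<Union>A)" if d: "(u, v) \<in> dedges K" "x \<in> closed_segment u v" "p \<in> {u, v}" for u v
    proof -
      have e: "closed_segment u v edge_of K" using edge_dedge[OF AT(1)[OF K(1)]] d(1) by blast
      have pe: "p \<in> closed_segment u v" using d(3) by auto
      obtain K' where K': "K' \<in> A" "K' \<noteq> K" "closed_segment u v edge_of K'" using clos[OF K(1) e pe] by blast
      have "x \<noteq> p" using x(2) by auto
      have other: "w \<notin> ?B" if "w \<in> {u, v}" "w \<noteq> p" for w
      proof -
        have "w \<in> closed_segment q r"
        proof -
          obtain r' where "verts K = {u, v, r'}" using dedge_tri[OF AT(1)[OF K(1)] d(1)] by metis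
          then have "{u, v} \<subseteq> {p, q, r}" using qr(5) by auto
          then have "w = q \<or> w = r" using that by auto
          then show ?thesis by auto
        qed
        moreover note qr_edge
        moreover have "p \<notin> closed_segment q r"
          using tri.seg_ab[OF t.rot, of p] tri.vertices_values(9)[OF t.rot] tri.pos[OF t.rot] by auto
        ultimately show ?thesis using \<rho>(2)[OF K(1), of q r] by blast
      qed
      have "x \<noteq> u" "x \<noteq> v" using other[of u] other[of v] x(2) d(3) by auto
      then have "x \<in> interior (K \<union> K')"
        using interior_union[OF AT(1)[OF K(1)] AT(1)[OF K'(1)] K'(2)[symmetric] d(1) K'(3) d(2)] by blast
      moreover have "K \<union> K' \<subseteq> \<Union>A" using K(1) K'(1) by blast
      ultimately show ?thesis using interior_mono by blast
    qed
    have xl: "0 \<le> t.la x" "0 \<le> t.lb x" "0 \<le> t.lc x" using K(2) qr(4) t.mem by auto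
    have xK: "x \<in> convex hull {p, q, r}" using K(2) qr(4) by simp
    have np: "p \<notin> closed_segment q r"
      using tri.seg_ab[OF t.rot, of p] tri.vertices_values(9)[OF t.rot] tri.pos[OF t.rot] by auto
    consider "t.lc x = 0" | "t.lb x = 0" | "t.la x = 0" | "0 < t.la x \<and> 0 < t.lb x \<and> 0 < t.lc x" using xl by linarith
    then show ?thesis
    proof cases
      case 1
      then have "x \<in> closed_segment p q" using t.seg_ab xK by blast
      then show ?thesis using on[OF qr(1)] by auto
    next
      case 2
      have "tri r p q" by (rule tri.rot[OF t.rot])
      moreover have "{r, p, q} = {p, q, r}" by auto
      moreover have "wedge (p - r) (x - r) = 0" using 2 by (simp add: t.lb_def)
      ultimately have "x \<in> closed_segment r p" using tri.seg_ab[of r p q x] xK by (simp add: tri.lc_def)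
      then show ?thesis using on[OF qr(2)] by auto
    next
      case 3
      have "{q, r, p} = {p, q, r}" by auto
      moreover have "wedge (r - q) (x - q) = 0" using 3 by (simp add: t.la_def)
      ultimately have "x \<in> closed_segment q r" using tri.seg_ab[OF t.rot, of x] xK by (simp add: tri.lc_def[OF t.rot])
      then show ?thesis using \<rho>(2)[OF K(1) qr_edge np] x(2) by blast
    next
      case 4
      then have "x \<in> interior K" using t.mem_interior qr(4) by simp
      then show ?thesis using K(1) interior_mono[of K "\<Union>A"] by blast
    qed
  qed
  have near: "\<exists>x. x \<in> interior K \<and> x \<in> ?B" if "K \<in> \<T>" "p \<in> verts K" for K
  proof -
    have "p \<in> closure (interior K)" using K_convex_compact(4)[OF that(1)] verts_subset[OF that] by simp
    then obtain x where x: "x \<in> interior K" "dist x p < \<rho>" using \<rho>(1) closure_approachable by blast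
    have "p \<notin> interior K"
    proof
      assume "p \<in> interior K"
      moreover have "{p} face_of K" using mem_verts_iff that by blast
      moreover have "K \<noteq> {p}" using \<open>p \<in> interior K\<close> by (metis interior_singleton empty_iff)
      ultimately show False using face_of_disjoint_interior[of "{p}" K] by auto
    qed
    then show ?thesis using x by (intro exI[of _ x]) (auto simp: dist_commute)
  qed
  have "openin (top_of_set ?B) (\<Union>A \<inter> ?B)"
  proof -
    have "\<Union>A \<inter> ?B = ?B \<inter> interior (\<Union>A)" using key interior_subset by blast
    then show ?thesis by (simp add: openin_open_Int)
  qed
  moreover have "closedin (top_of_set ?B) (\<Union>A \<inter> ?B)"
    using closedin_closed_Int[OF cl, of ?B] by (simp add: Int_commute)
  ultimately have "\<Union>A \<inter> ?B = {} \<or> \<Union>A \<inter> ?B = ?B"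
    using \<open>connected ?B\<close> unfolding connected_clopen by blast
  moreover have "\<Union>A \<inter> ?B \<noteq> {}"
  proof -
    obtain K where K: "K \<in> A" using A(2) by blast
    obtain x where "x \<in> interior K" "x \<in> ?B" using near[OF AT[OF K]] by blast
    then show ?thesis using K interior_subset[of K] by blast
  qed
  ultimately have cover: "?B \<subseteq> \<Union>A" by blast
  have "star p \<subseteq> A"
  proof
    fix K assume "K \<in> star p"
    then have K: "K \<in> \<T>" "p \<in> verts K" by (auto simp: star_def)
    obtain x where x: "x \<in> interior K" "x \<in> ?B" using near[OF K] by blast
    then obtain K' where K': "K' \<in> A" "x \<in> K'" using cover by blast
    have "K = K'" using interior_disjoint[OF K(1) AT(1)[OF K'(1)]] x K' by blast
    then show "K \<in> A" using K' by simp
  qed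
  then show ?thesis using A(1) by blast
qed

end

(* PART 10 *)

definition JJ :: "plane \<Rightarrow> plane" where "JJ x = vector [- x $ 2, x $ 1]"

lemma JJ_nth: "JJ x $ 1 = - x $ 2" "JJ x $ 2 = x $ 1"
  by (simp_all add: JJ_def vector_2)

lemma JJ: "wedge (JJ x) (JJ y) = wedge x y" "norm (JJ x) = norm x" "JJ (x - y) = JJ x - JJ y"
  by (simp_all add: wedge_def JJ_nth norm_vec_def L2_set_def sum_2 vec_eq_iff forall_2 algebra_simps)

lemma triangle_area_abs: "measure lebesgue (convex hull {a, b, c}) = \<bar>wedge (b - a) (c - a)\<bar> / 2" for a b c :: plane
proof -
  have "compact (convex hull {a, b, c})" by (simp add: finite_imp_compact_convex_hull)
  then have "measure lebesgue (convex hull {a, b, c}) = measure lborel (convex hull {a, b, c})"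
    by (simp add: borel_compact)
  also have "\<dots> = \<bar>wedge (b - a) (c - a)\<bar> / 2"
    by (subst content_triangle) (simp add: wedge_def algebra_simps abs_minus_commute)
  finally show ?thesis .
qed

lemma triangle_determinant_bound:
  assumes \<kappa>: "\<kappa> > 0" and D: "wedge u v > 0" and h: "norm u \<le> h" "norm v \<le> h" "\<kappa> * h\<^sup>2 \<le> wedge u v"
    and Z: "norm za \<le> Z" "norm zb \<le> Z" "norm zc \<le> Z"
    and w: "wb - wa = \<beta> *\<^sub>R JJ u + (zb - za)" "wc - wa = \<beta> *\<^sub>R JJ v + (zc - za)"
  shows "wedge u v * \<beta>\<^sup>2 \<le> 2 * wedge (wb - wa) (wc - wa) + 2 * (8 / \<kappa> + 4) * Z\<^sup>2"
proof -
  let ?x = "zb - za" and ?y = "zc - za"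
  have Z0: "Z \<ge> 0" and h0: "h \<ge> 0" using Z(1) h(1) norm_ge_zero order_trans by blast+
  have xy: "norm ?x \<le> 2 * Z" "norm ?y \<le> 2 * Z"
    using norm_triangle_ineq4[of zb za] norm_triangle_ineq4[of zc za] Z by linarith+
  have X: "wedge (wb - wa) (wc - wa) = wedge u v * \<beta>\<^sup>2 + \<beta> * (wedge (JJ u) ?y + wedge ?x (JJ v)) + wedge ?x ?y"
    unfolding w by (simp only: wedge_linear(1,2,3,4) JJ(1)) (simp add: power2_eq_square algebra_simps)
  have 1: "\<bar>wedge (JJ u) ?y\<bar> \<le> h * (2 * Z)"
    using wedge_bound[of "JJ u" ?y] mult_mono[OF h(1) xy(2)] h0 by (simp add: JJ(2))
  have 2: "\<bar>wedge ?x (JJ v)\<bar> \<le> h * (2 * Z)"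
    using wedge_bound[of ?x "JJ v"] mult_mono[OF xy(1) h(2)] Z0 by (simp add: JJ(2) mult.commute)
  have "\<bar>wedge (JJ u) ?y + wedge ?x (JJ v)\<bar> \<le> 4 * h * Z" using 1 2 by linarith
  then have "\<bar>\<beta>\<bar> * \<bar>wedge (JJ u) ?y + wedge ?x (JJ v)\<bar> \<le> \<bar>\<beta>\<bar> * (4 * h * Z)" by (rule mult_left_mono) simp
  then have 3: "- (\<bar>\<beta>\<bar> * (4 * h * Z)) \<le> \<beta> * (wedge (JJ u) ?y + wedge ?x (JJ v))"
    by (simp add: abs_mult[symmetric] abs_le_iff)
  have 4: "- (4 * Z\<^sup>2) \<le> wedge ?x ?y"
    using wedge_bound[of ?x ?y] mult_mono[OF xy] Z0 by (simp add: power2_eq_square abs_le_iff)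
  have "0 \<le> (\<kappa> * h * \<bar>\<beta>\<bar> - 4 * Z)\<^sup>2 / (2 * \<kappa>)" using \<kappa> by simp
  also have "\<dots> = \<kappa> * h\<^sup>2 * \<beta>\<^sup>2 / 2 - \<bar>\<beta>\<bar> * (4 * h * Z) + 8 / \<kappa> * Z\<^sup>2"
    using \<kappa> by (simp add: power2_diff power_mult_distrib field_simps power2_eq_square)
  also have "\<kappa> * h\<^sup>2 * \<beta>\<^sup>2 / 2 \<le> wedge u v * \<beta>\<^sup>2 / 2" using h(3) by (simp add: mult_right_mono)
  finally have 5: "\<bar>\<beta>\<bar> * (4 * h * Z) \<le> wedge u v * \<beta>\<^sup>2 / 2 + 8 / \<kappa> * Z\<^sup>2" by simp
  have "2 * (8 / \<kappa> + 4) * Z\<^sup>2 = 2 * (8 / \<kappa> * Z\<^sup>2) + 8 * Z\<^sup>2" by (simp add: algebra_simps)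
  then show ?thesis using X 3 4 5 by linarith
qed

locale shape_mesh = mesh +
  fixes \<kappa> :: real
  assumes \<kappa>: "\<kappa> > 0" and shape: "\<And>K. K \<in> \<T> \<Longrightarrow> \<kappa> * (diameter K)\<^sup>2 \<le> DK K"
begin

lemma diam_pos: "K \<in> \<T> \<Longrightarrow> diameter K > 0"
  using tri.D_le(3)[OF vs(2)] hull by metis

lemma norm_le_diam: "K \<in> \<T> \<Longrightarrow> x \<in> K \<Longrightarrow> y \<in> K \<Longrightarrow> norm (x - y) \<le> diameter K"
  using tri.diam[OF vs(2)] hull by metis

lemma card_star: "real (card (star p)) \<le> 8 / \<kappa>"
proof (cases "star p = {}")
  case True then show ?thesis using \<kappa> by simp
next
  case False
  define \<rho> where "\<rho> = Min (diameter ` star p)"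
  have sT: "K \<in> \<T>" "p \<in> verts K" if "K \<in> star p" for K using that by (auto simp: star_def)
  have fs: "finite (diameter ` star p)" using star_sub(2) by simp
  have \<rho>: "\<rho> > 0" unfolding \<rho>_def using fs False diam_pos sT by (subst Min_gr_iff) auto
  have \<rho>le: "\<rho> \<le> diameter K" if "K \<in> star p" for K unfolding \<rho>_def using fs that by simp
  have "\<exists>S. S \<in> lmeasurable \<and> S \<subseteq> K \<and> S \<subseteq> cbox (p - \<rho> *\<^sub>R 1) (p + \<rho> *\<^sub>R 1) \<and> measure lebesgue S \<ge> \<kappa> * \<rho>\<^sup>2 / 2" if K: "K \<in> star p" for K
  proof -
    obtain q r where qr: "(p, q) \<in> dedges K" "tri p q r" "K = convex hull {p, q, r}"
      using vertex_dedges[OF sT[OF K]] by metis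
    obtain r' where r': "K = convex hull {p, q, r'}" "wedge (q - p) (r' - p) = DK K"
      using dedge_tri[OF sT(1)[OF K] qr(1)] by metis
    define t where "t = \<rho> / diameter K"
    have t: "0 < t" "t \<le> 1" using \<rho> \<rho>le[OF K] diam_pos[OF sT(1)[OF K]] by (auto simp: t_def)
    let ?q = "p + t *\<^sub>R (q - p)" and ?r = "p + t *\<^sub>R (r' - p)"
    let ?S = "convex hull {p, ?q, ?r}"
    have in_K: "p \<in> K" "q \<in> K" "r' \<in> K" unfolding r'(1) by (auto intro: hull_inc)
    have cv: "p + t *\<^sub>R (x - p) \<in> K \<inter> cbox (p - \<rho> *\<^sub>R 1) (p + \<rho> *\<^sub>R 1)" if "x \<in> K" for x
    proof -
      have "p + t *\<^sub>R (x - p) = (1 - t) *\<^sub>R p + t *\<^sub>R x" by (simp add: algebra_simps)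
      then have 1: "p + t *\<^sub>R (x - p) \<in> K" using K_convex_compact(1)[OF sT(1)[OF K]] in_K(1) that t by (auto intro: convexD_alt)
      have "\<bar>t * (x $ i - p $ i)\<bar> \<le> \<rho>" for i
      proof -
        have "\<bar>t * (x $ i - p $ i)\<bar> = t * \<bar>(x - p) $ i\<bar>" using t by (simp add: abs_mult)
        also have "\<dots> \<le> t * diameter K"
          using t component_le_norm_cart[of "x - p" i] norm_le_diam[OF sT(1)[OF K] that in_K(1)] by (intro mult_left_mono) auto
        also have "\<dots> = \<rho>" using diam_pos[OF sT(1)[OF K]] by (simp add: t_def)
        finally show ?thesis .
      qed
      then have "p + t *\<^sub>R (x - p) \<in> cbox (p - \<rho> *\<^sub>R 1) (p + \<rho> *\<^sub>R 1)"
        by (auto simp: mem_box_cart abs_le_iff) (smt (verit))+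
      then show ?thesis using 1 by blast
    qed
    have "{p, ?q, ?r} \<subseteq> K \<inter> cbox (p - \<rho> *\<^sub>R 1) (p + \<rho> *\<^sub>R 1)"
      using cv[OF in_K(1)] cv[OF in_K(2)] cv[OF in_K(3)] by auto
    then have "?S \<subseteq> K \<inter> cbox (p - \<rho> *\<^sub>R 1) (p + \<rho> *\<^sub>R 1)"
      by (rule hull_minimal) (intro convex_Int K_convex_compact sT[OF K] convex_box)
    moreover have "?S \<in> lmeasurable" by (intro lmeasurable_compact) (simp add: finite_imp_compact_convex_hull)
    moreover have "measure lebesgue ?S \<ge> \<kappa> * \<rho>\<^sup>2 / 2"
    proof -
      have "measure lebesgue ?S = t\<^sup>2 * DK K / 2"
        using DK_pos[OF sT(1)[OF K]] by (simp add: triangle_area_abs wedge_linear(3,4) r'(2) abs_mult power2_eq_square)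
      moreover have "\<kappa> * \<rho>\<^sup>2 = t\<^sup>2 * (\<kappa> * (diameter K)\<^sup>2)" using diam_pos[OF sT(1)[OF K]] by (simp add: t_def power_divide)
      moreover have "t\<^sup>2 * (\<kappa> * (diameter K)\<^sup>2) \<le> t\<^sup>2 * DK K" using shape[OF sT(1)[OF K]] by (intro mult_left_mono) auto
      ultimately show ?thesis by linarith
    qed
    ultimately show ?thesis by blast
  qed
  then obtain S where S: "\<And>K. K \<in> star p \<Longrightarrow> S K \<in> lmeasurable \<and> S K \<subseteq> K \<and> S K \<subseteq> cbox (p - \<rho> *\<^sub>R 1) (p + \<rho> *\<^sub>R 1) \<and> measure lebesgue (S K) \<ge> \<kappa> * \<rho>\<^sup>2 / 2"
    by metis
  have "real (card (star p)) * (\<kappa> * \<rho>\<^sup>2 / 2) = (\<Sum>K\<in>star p. \<kappa> * \<rho>\<^sup>2 / 2)" by simp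
  also have "\<dots> \<le> (\<Sum>K\<in>star p. measure lebesgue (S K))" by (intro sum_mono) (use S in auto)
  also have "\<dots> = measure lebesgue (\<Union>(S ` star p))"
  proof (rule measure_negligible_finite_Union_image[symmetric])
    show "pairwise (\<lambda>x y. negligible (S x \<inter> S y)) (star p)"
    proof (rule pairwiseI)
      fix K K' assume KK: "K \<in> star p" "K' \<in> star p" "K \<noteq> K'"
      have "S K \<inter> S K' \<subseteq> K \<inter> K'" using S KK by blast
      then show "negligible (S K \<inter> S K')" using negligible_inter[OF sT(1)[OF KK(1)] sT(1)[OF KK(2)] KK(3)] negligible_subset by blast
    qed
  qed (use star_sub S in auto)
  also have "\<dots> \<le> measure lebesgue (cbox (p - \<rho> *\<^sub>R 1) (p + \<rho> *\<^sub>R 1))"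
    by (rule measure_mono_fmeasurable) (use S star_sub(2) in \<open>auto intro!: sets.finite_UN fmeasurableD\<close>)
  also have "\<dots> = (2 * \<rho>)\<^sup>2"
    using \<rho> by (subst measure_completion, simp, subst measure_lborel_cbox_eq, subst prod_Basis_plane)
      (auto simp: Basis_plane inner_axis power2_eq_square)
  finally have "real (card (star p)) * (\<kappa> * \<rho>\<^sup>2 / 2) \<le> 4 * \<rho>\<^sup>2" by (simp add: power_mult_distrib)
  then have "(real (card (star p)) * \<kappa> / 8) * (4 * \<rho>\<^sup>2) \<le> 1 * (4 * \<rho>\<^sup>2)" by (simp add: algebra_simps)
  then have "real (card (star p)) * \<kappa> / 8 \<le> 1" using \<rho> by (subst (asm) mult_le_cancel_right) auto
  then show ?thesis using \<kappa> by (simp add: field_simps)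
qed

definition adj :: "plane \<Rightarrow> (plane set \<times> plane set) set" where
  "adj p = {(K, K'). K \<in> star p \<and> K' \<in> star p \<and> K \<noteq> K' \<and> (\<exists>e. p \<in> e \<and> e edge_of K \<and> e edge_of K')}"

definition bd_vertex :: "plane \<Rightarrow> bool" where
  "bd_vertex p \<longleftrightarrow> (\<exists>e. boundary_edge e \<and> p \<in> e)"

definition vval :: "(plane set \<Rightarrow> plane \<Rightarrow> plane) \<Rightarrow> plane \<Rightarrow> plane" where
  "vval r p = (if bd_vertex p then 0 else r (SOME K. K \<in> star p) p)"

lemma star_vertex_bound:
  fixes r :: "plane set \<Rightarrow> plane \<Rightarrow> plane"
  assumes m: "m \<ge> 0"
    and j: "\<And>K K'. (K, K') \<in> adj p \<Longrightarrow> norm (r K p - r K' p) \<le> m"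
    and b: "\<And>K e. K \<in> star p \<Longrightarrow> boundary_edge e \<Longrightarrow> e edge_of K \<Longrightarrow> p \<in> e \<Longrightarrow> norm (r K p) \<le> m"
    and K: "K \<in> star p"
  shows "norm (vval r p - r K p) \<le> ((8 / \<kappa>)\<^sup>2 + 1) * m"
proof -
  let ?R = "adj p"
  have Rsub: "?R \<subseteq> star p \<times> star p" by (auto simp: adj_def)
  have finR: "finite ?R" using finite_subset[OF Rsub] star_sub(2) by blast
  have "card ?R \<le> card (star p \<times> star p)" by (rule card_mono[OF _ Rsub]) (use star_sub(2) in simp)
  then have "card ?R \<le> (card (star p))\<^sup>2" by (simp add: card_cartesian_product power2_eq_square)
  then have 1: "real (card ?R) \<le> (real (card (star p)))\<^sup>2" unfolding of_nat_power[symmetric] of_nat_le_iff .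
  have 2: "(real (card (star p)))\<^sup>2 \<le> (8 / \<kappa>)\<^sup>2" by (rule power_mono[OF card_star]) simp
  have cR: "real (card ?R) \<le> (8 / \<kappa>)\<^sup>2" by (rule order_trans[OF 1 2])
  have path: "norm (r K1 p - r K2 p) \<le> (8 / \<kappa>)\<^sup>2 * m" if K12: "(K1, K2) \<in> ?R\<^sup>*" for K1 K2
  proof -
    obtain n where n: "n \<le> card ?R" "(K1, K2) \<in> ?R ^^ n"
      using subsetD[OF equalityD1[OF rtrancl_finite_eq_relpow[OF finR]] K12] by blast
    have "(K1, K2) \<in> ?R ^^ n \<Longrightarrow> norm (r K1 p - r K2 p) \<le> real n * m" for n K2
    proof (induction n arbitrary: K2)
      case (Suc n)
      then obtain K3 where K3: "(K1, K3) \<in> ?R ^^ n" "(K3, K2) \<in> ?R" by auto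
      have "norm (r K1 p - r K2 p) \<le> norm (r K1 p - r K3 p) + norm (r K3 p - r K2 p)"
        using norm_triangle_ineq[of "r K1 p - r K3 p" "r K3 p - r K2 p"] by simp
      then show ?case using Suc.IH[OF K3(1)] j[OF K3(2)] by (simp add: distrib_right)
    qed simp
    from this[OF n(2)] have "norm (r K1 p - r K2 p) \<le> real n * m" .
    also have "\<dots> \<le> (8 / \<kappa>)\<^sup>2 * m" using n(1) cR m by (intro mult_right_mono) linarith+
    finally show ?thesis .
  qed
  have comp: "{K'. (K1, K') \<in> ?R\<^sup>*} = star p"
    if K1: "K1 \<in> star p" and nb: "\<And>K' e. (K1, K') \<in> ?R\<^sup>* \<Longrightarrow> e edge_of K' \<Longrightarrow> p \<in> e \<Longrightarrow> \<not> boundary_edge e" for K1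
  proof (rule star_connected)
    show "{K'. (K1, K') \<in> ?R\<^sup>*} \<subseteq> star p"
    proof
      fix K' assume "K' \<in> {K'. (K1, K') \<in> ?R\<^sup>*}"
      then have "(K1, K') \<in> ?R\<^sup>*" by simp
      then show "K' \<in> star p" by (induction rule: rtrancl_induct) (use K1 Rsub in auto)
    qed
    then have sub: "K' \<in> star p" if "(K1, K') \<in> ?R\<^sup>*" for K' using that by blast
    show "{K'. (K1, K') \<in> ?R\<^sup>*} \<noteq> {}" by auto
    fix K' e assume K': "K' \<in> {K'. (K1, K') \<in> ?R\<^sup>*}" and e: "e edge_of K'" "p \<in> e"
    have K'T: "K' \<in> \<T>" "p \<in> verts K'" using sub K' by (auto simp: star_def)
    obtain K'' where K'': "K'' \<in> \<T>" "e edge_of K''" "K'' \<noteq> K'"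
      using nb[of K' e] K' e K'T(1) unfolding boundary_edge_def by blast
    have "p \<in> K''" using edge_of_imp_subset[OF K''(2)] e(2) by blast
    then have "K'' \<in> star p" using vertex_shared[OF K'T(1) K''(1) K'T(2)] K''(1) by (simp add: star_def)
    moreover have "K' \<in> star p" using sub K' by blast
    ultimately have st: "(K', K'') \<in> ?R" unfolding adj_def using K''(2,3) e by blast
    have "(K1, K'') \<in> ?R\<^sup>*" by (rule rtrancl_into_rtrancl[OF _ st]) (use K' in simp)
    then show "\<exists>K''\<in>{K'. (K1, K') \<in> ?R\<^sup>*}. K'' \<noteq> K' \<and> e edge_of K''" using K'' by blast
  qed
  show ?thesis
  proof (cases "bd_vertex p")
    case True
    have "\<exists>K' e. (K, K') \<in> ?R\<^sup>* \<and> e edge_of K' \<and> p \<in> e \<and> boundary_edge e"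
    proof (rule ccontr)
      assume n: "\<not> ?thesis"
      then have c: "{K'. (K, K') \<in> ?R\<^sup>*} = star p" by (intro comp[OF K]) blast
      obtain e where e: "boundary_edge e" "p \<in> e" using True unfolding bd_vertex_def by blast
      obtain K1 where K1: "K1 \<in> \<T>" "e edge_of K1" using e(1) unfolding boundary_edge_def by blast
      have "p \<in> K1" using edge_of_imp_subset[OF K1(2)] e(2) by blast
      then have "K1 \<in> star p" using vertex_shared[of K K1 p] K K1(1) by (auto simp: star_def)
      then have "(K, K1) \<in> ?R\<^sup>*" using c by blast
      then show False using n K1(2) e by blast
    qed
    then obtain K' e where K': "(K, K') \<in> ?R\<^sup>*" "e edge_of K'" "p \<in> e" "boundary_edge e" by blast
    have "K' \<in> star p" using K'(1) by (induction rule: rtrancl_induct) (use K Rsub in auto)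
    from b[OF this K'(4,2,3)] have "norm (r K' p) \<le> m" .
    moreover have "norm (r K p) \<le> norm (r K p - r K' p) + norm (r K' p)" using norm_triangle_ineq[of "r K p - r K' p" "r K' p"] by simp
    ultimately show ?thesis using path[OF K'(1)] True by (simp add: vval_def distrib_right)
  next
    case False
    define K0 where "K0 = (SOME K. K \<in> star p)"
    have K0: "K0 \<in> star p" unfolding K0_def using K by (rule someI)
    have "{K'. (K0, K') \<in> ?R\<^sup>*} = star p" by (rule comp[OF K0]) (use False in \<open>auto simp: bd_vertex_def\<close>)
    then have "(K0, K) \<in> ?R\<^sup>*" using K by blast
    then have "norm (r K0 p - r K p) \<le> (8 / \<kappa>)\<^sup>2 * m" by (rule path)
    then show ?thesis using False m by (simp add: vval_def K0_def[symmetric] distrib_right)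
  qed
qed

lemma finite_edges: "finite (edges \<T>)"
proof -
  have "edges \<T> \<subseteq> (\<Union>K\<in>\<T>. (\<lambda>d. closed_segment (fst d) (snd d)) ` dedges K)"
  proof
    fix e assume "e \<in> edges \<T>"
    then obtain K where K: "K \<in> \<T>" "e edge_of K" unfolding edges_def by blast
    then obtain p q where pq: "(p, q) \<in> dedges K" "e = closed_segment p q" using edge_dedge by blast
    have "e \<in> (\<lambda>d. closed_segment (fst d) (snd d)) ` dedges K" using pq by (intro image_eqI[of _ _ "(p, q)"]) auto
    then show "e \<in> (\<Union>K\<in>\<T>. (\<lambda>d. closed_segment (fst d) (snd d)) ` dedges K)" using K(1) by blast
  qed
  then show ?thesis by (rule finite_subset) (intro finite_UN_I fin finite_imageI finite_dedges)
qed

lemma sum_determinants_zero: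
  assumes w: "\<And>p. bd_vertex p \<Longrightarrow> w p = 0"
  shows "(\<Sum>K\<in>\<T>. \<Sum>d\<in>dedges K. wedge (w (fst d)) (w (snd d))) = 0"
proof -
  let ?f = "\<lambda>d. wedge (w (fst d)) (w (snd d))"
  let ?E = "\<Union>K\<in>\<T>. dedges K"
  let ?E' = "{d \<in> ?E. prod.swap d \<in> ?E}"
  have fE: "finite ?E" using fin finite_dedges by blast
  have "(\<Sum>K\<in>\<T>. \<Sum>d\<in>dedges K. ?f d) = sum ?f ?E"
  proof (rule sum.UNION_disjoint[symmetric, OF fin])
    show "\<forall>K\<in>\<T>. finite (dedges K)" using finite_dedges by blast
    show "\<forall>K\<in>\<T>. \<forall>K'\<in>\<T>. K \<noteq> K' \<longrightarrow> dedges K \<inter> dedges K' = {}"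
      using same_side by (metis disjoint_iff surj_pair)
  qed
  also have "\<dots> = sum ?f ?E'"
  proof (rule sum.mono_neutral_right[OF fE])
    show "\<forall>d\<in>?E - ?E'. ?f d = 0"
    proof
      fix d assume "d \<in> ?E - ?E'"
      then obtain K p q where d: "d = (p, q)" "K \<in> \<T>" "(p, q) \<in> dedges K" "(q, p) \<notin> ?E" by (cases d) auto
      have "closed_segment p q edge_of K" using edge_dedge d by blast
      moreover have "K' = K" if "K' \<in> \<T>" "closed_segment p q edge_of K'" for K'
        using opposite_dir[OF d(2) that(1) _ that(2) d(3)] d(4) that(1) by blast
      ultimately have "boundary_edge (closed_segment p q)" unfolding boundary_edge_def using d(2) by blast
      then have "bd_vertex p" unfolding bd_vertex_def by auto
      then show "?f d = 0" using w d(1) by (simp add: wedge_def)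
    qed
  qed auto
  also have "\<dots> = sum (\<lambda>d. - ?f d) ?E'"
    by (rule sum.reindex_bij_witness[of _ prod.swap prod.swap]) (auto simp: wedge_def)
  also have "\<dots> = - sum ?f ?E'" by (rule sum_negf)
  finally have a: "(\<Sum>K\<in>\<T>. \<Sum>d\<in>dedges K. ?f d) = - sum ?f ?E'" .
  have "sum ?f ?E' = sum (\<lambda>d. - ?f d) ?E'"
    by (rule sum.reindex_bij_witness[of _ prod.swap prod.swap]) (auto simp: wedge_def)
  then have "sum ?f ?E' = 0" by (simp add: sum_negf)
  then show ?thesis using a by simp
qed

lemma sum_dedges:
  assumes "K \<in> \<T>"
  shows "(\<Sum>d\<in>dedges K. wedge (w (fst d)) (w (snd d))) = wedge (w (vB K) - w (vA K)) (w (vC K) - w (vA K))"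
  using tri.distinct[OF vs(2)[OF assms]] unfolding dedges_def
  by (simp add: wedge_def algebra_simps)

lemma incidence_bound:
  assumes "e \<in> edges \<T>"
  shows "(\<Sum>K\<in>\<T>. real (card {p \<in> verts K. p \<in> e})) \<le> 2 * (8 / \<kappa>)"
proof -
  obtain K0 u v where K0: "K0 \<in> \<T>" "(u, v) \<in> dedges K0" "e = closed_segment u v"
    using assms edge_dedge unfolding edges_def by blast
  obtain r where r: "tri u v r" "K0 = convex hull {u, v, r}" "verts K0 = {u, v, r}" using dedge_tri[OF K0(1,2)] by metis
  interpret t: tri u v r by (rule r(1))
  have sub: "{p \<in> verts K. p \<in> e} \<subseteq> {u, v}" if "K \<in> \<T>" for K
  proof
    fix p assume p: "p \<in> {p \<in> verts K. p \<in> e}"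
    then have "p \<in> K0" using t.seg_ab r(2) K0(3) by auto
    then have "p \<in> verts K0" using vertex_shared[OF that K0(1)] p by blast
    moreover have "r \<notin> e" using t.seg_ab[of r] t.vertices_values(9) t.pos K0(3) by auto
    ultimately show "p \<in> {u, v}" using r(3) p by auto
  qed
  have "(\<Sum>K\<in>\<T>. real (card {p \<in> verts K. p \<in> e})) \<le> (\<Sum>K\<in>\<T>. (if u \<in> verts K then 1 else 0) + (if v \<in> verts K then 1 else 0))"
  proof (rule sum_mono)
    fix K assume K: "K \<in> \<T>"
    have "card {p \<in> verts K. p \<in> e} \<le> card ((if u \<in> verts K then {u} else {}) \<union> (if v \<in> verts K then {v} else {}))"
      by (rule card_mono) (use sub[OF K] in \<open>auto split: if_splits\<close>)
    also have "\<dots> \<le> card (if u \<in> verts K then {u} else {}) + card (if v \<in> verts K then {v} else {})" by (rule card_Un_le)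
    finally show "real (card {p \<in> verts K. p \<in> e}) \<le> (if u \<in> verts K then 1 else 0) + (if v \<in> verts K then 1 else 0)"
      by (auto split: if_splits)
  qed
  also have "\<dots> = real (card (star u)) + real (card (star v))"
    using fin by (simp add: sum.distrib sum.inter_filter[symmetric] star_def)
  also have "\<dots> \<le> 2 * (8 / \<kappa>)" using card_star[of u] card_star[of v] by linarith
  finally show ?thesis .
qed

theorem rigid_motion_Korn:
  fixes \<alpha> :: "plane set \<Rightarrow> plane" and \<beta> \<delta> :: "plane set \<Rightarrow> real"
  defines "r \<equiv> \<lambda>K x. \<alpha> K + \<beta> K *\<^sub>R JJ x"
  assumes \<delta>: "\<And>e. \<delta> e \<ge> 0"
    and jmp: "\<And>K K' e p. K \<in> \<T> \<Longrightarrow> K' \<in> \<T> \<Longrightarrow> K \<noteq> K' \<Longrightarrow> e edge_of K \<Longrightarrow> e edge_of K' \<Longrightarrow> p \<in> verts K \<Longrightarrow> p \<in> e \<Longrightarrow> norm (r K p - r K' p) \<le> \<delta> e"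
    and bdr: "\<And>K e p. K \<in> \<T> \<Longrightarrow> boundary_edge e \<Longrightarrow> e edge_of K \<Longrightarrow> p \<in> verts K \<Longrightarrow> p \<in> e \<Longrightarrow> norm (r K p) \<le> \<delta> e"
  shows "(\<Sum>K\<in>\<T>. DK K * (\<beta> K)\<^sup>2) \<le> 2 * (8 / \<kappa> + 4) * (((8 / \<kappa>)\<^sup>2 + 1)\<^sup>2 * (2 * (8 / \<kappa>))) * (\<Sum>e\<in>edges \<T>. (\<delta> e)\<^sup>2)"
proof -
  let ?N1 = "(8 / \<kappa>)\<^sup>2 + 1"
  define w where "w = vval r"
  define m where "m p = sqrt (\<Sum>e | e \<in> edges \<T> \<and> p \<in> e. (\<delta> e)\<^sup>2)" for p
  have fe: "finite {e. e \<in> edges \<T> \<and> p \<in> e}" for p using finite_edges by simp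
  have m0: "m p \<ge> 0" for p by (simp add: m_def sum_nonneg)
  have \<delta>m: "\<delta> e \<le> m p" if "e \<in> edges \<T>" "p \<in> e" for e p
  proof -
    have "\<delta> e = sqrt ((\<delta> e)\<^sup>2)" using \<delta> by simp
    also have "\<dots> \<le> m p" unfolding m_def
      by (rule real_sqrt_le_mono, rule member_le_sum[of e _ "\<lambda>e. (\<delta> e)\<^sup>2"]) (use that fe in auto)
    finally show ?thesis .
  qed
  have wb: "norm (w p - r K p) \<le> ?N1 * m p" if K: "K \<in> \<T>" "p \<in> verts K" for K p
    unfolding w_def
  proof (rule star_vertex_bound[OF m0])
    show "K \<in> star p" using K by (simp add: star_def)
  next
    fix K K' assume "(K, K') \<in> adj p"
    then obtain e where e: "K \<in> \<T>" "K' \<in> \<T>" "K \<noteq> K'" "p \<in> verts K" "p \<in> e" "e edge_of K" "e edge_of K'"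
      unfolding adj_def star_def by blast
    have "e \<in> edges \<T>" using e unfolding edges_def by blast
    then show "norm (r K p - r K' p) \<le> m p" using jmp[OF e(1,2,3,6,7,4,5)] \<delta>m[of e p] e(5) by linarith
  next
    fix K e assume e: "K \<in> star p" "boundary_edge e" "e edge_of K" "p \<in> e"
    then have K: "K \<in> \<T>" "p \<in> verts K" by (auto simp: star_def)
    have "e \<in> edges \<T>" using e K unfolding edges_def by blast
    then show "norm (r K p) \<le> m p" using bdr[OF K(1) e(2,3) K(2) e(4)] \<delta>m[of e p] e(4) by linarith
  qed
  have wz: "w p = 0" if "bd_vertex p" for p using that by (simp add: w_def vval_def)
  define Z2 where "Z2 K = (\<Sum>p\<in>verts K. (?N1 * m p)\<^sup>2)" for K
  have loc: "DK K * (\<beta> K)\<^sup>2 \<le> 2 * (\<Sum>d\<in>dedges K. wedge (w (fst d)) (w (snd d))) + 2 * (8 / \<kappa> + 4) * Z2 K" if K: "K \<in> \<T>" for K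
  proof -
    have Z0: "Z2 K \<ge> 0" by (simp add: Z2_def sum_nonneg)
    have z: "norm (w p - r K p) \<le> sqrt (Z2 K)" if p: "p \<in> verts K" for p
    proof -
      have "norm (w p - r K p) \<le> ?N1 * m p" by (rule wb[OF K p])
      also have "\<dots> = sqrt ((?N1 * m p)\<^sup>2)" using m0[of p] by simp
      also have "\<dots> \<le> sqrt (Z2 K)" unfolding Z2_def
        by (rule real_sqrt_le_mono, rule member_le_sum[of p _ "\<lambda>p. (?N1 * m p)\<^sup>2"]) (use p finite_verts in auto)
      finally show ?thesis .
    qed
    have v: "vA K \<in> verts K" "vB K \<in> verts K" "vC K \<in> verts K" by (auto simp: verts_def)
    note vK = verts_subset[OF K v(1)] verts_subset[OF K v(2)] verts_subset[OF K v(3)]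
    have "wedge (vB K - vA K) (vC K - vA K) * (\<beta> K)\<^sup>2 \<le> 2 * wedge (w (vB K) - w (vA K)) (w (vC K) - w (vA K)) + 2 * (8 / \<kappa> + 4) * (sqrt (Z2 K))\<^sup>2"
    proof (rule triangle_determinant_bound[OF \<kappa>])
      show "0 < wedge (vB K - vA K) (vC K - vA K)" using DK_pos[OF K] by (simp add: DK_def)
      show "norm (vB K - vA K) \<le> diameter K" "norm (vC K - vA K) \<le> diameter K" using norm_le_diam[OF K] vK by auto
      show "\<kappa> * (diameter K)\<^sup>2 \<le> wedge (vB K - vA K) (vC K - vA K)" using shape[OF K] by (simp add: DK_def)
      show "norm (w (vA K) - r K (vA K)) \<le> sqrt (Z2 K)" "norm (w (vB K) - r K (vB K)) \<le> sqrt (Z2 K)" "norm (w (vC K) - r K (vC K)) \<le> sqrt (Z2 K)"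
        using z v by auto
      show "w (vB K) - w (vA K) = \<beta> K *\<^sub>R JJ (vB K - vA K) + (w (vB K) - r K (vB K) - (w (vA K) - r K (vA K)))"
        "w (vC K) - w (vA K) = \<beta> K *\<^sub>R JJ (vC K - vA K) + (w (vC K) - r K (vC K) - (w (vA K) - r K (vA K)))"
        by (simp_all add: r_def JJ(3) algebra_simps)
    qed
    then show ?thesis using Z0 by (simp add: DK_def sum_dedges[OF K])
  qed
  have "(\<Sum>K\<in>\<T>. DK K * (\<beta> K)\<^sup>2) \<le> (\<Sum>K\<in>\<T>. 2 * (\<Sum>d\<in>dedges K. wedge (w (fst d)) (w (snd d))) + 2 * (8 / \<kappa> + 4) * Z2 K)"
    by (rule sum_mono[OF loc])
  also have "\<dots> = 2 * (\<Sum>K\<in>\<T>. \<Sum>d\<in>dedges K. wedge (w (fst d)) (w (snd d))) + 2 * (8 / \<kappa> + 4) * (\<Sum>K\<in>\<T>. Z2 K)"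
    by (simp only: sum.distrib sum_distrib_left)
  also have "\<dots> = 2 * (8 / \<kappa> + 4) * (\<Sum>K\<in>\<T>. Z2 K)"
  proof -
    have "(\<Sum>K\<in>\<T>. \<Sum>d\<in>dedges K. wedge (w (fst d)) (w (snd d))) = 0"
      by (rule sum_determinants_zero) (rule wz)
    then show ?thesis by simp
  qed
  finally have step: "(\<Sum>K\<in>\<T>. DK K * (\<beta> K)\<^sup>2) \<le> 2 * (8 / \<kappa> + 4) * (\<Sum>K\<in>\<T>. Z2 K)" .
  have Zb: "(\<Sum>K\<in>\<T>. Z2 K) \<le> ?N1\<^sup>2 * (2 * (8 / \<kappa>)) * (\<Sum>e\<in>edges \<T>. (\<delta> e)\<^sup>2)"
  proof -
    have q: "(\<Sum>K\<in>\<T>. Z2 K) = ?N1\<^sup>2 * (\<Sum>K\<in>\<T>. \<Sum>p\<in>verts K. (m p)\<^sup>2)"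
      by (simp add: Z2_def power_mult_distrib sum_distrib_left)
    have "(\<Sum>K\<in>\<T>. \<Sum>p\<in>verts K. (m p)\<^sup>2) = (\<Sum>K\<in>\<T>. \<Sum>p\<in>verts K. \<Sum>e\<in>edges \<T>. if p \<in> e then (\<delta> e)\<^sup>2 else 0)"
      by (simp add: m_def sum_nonneg sum.inter_filter[OF finite_edges, symmetric])
    also have "\<dots> = (\<Sum>K\<in>\<T>. \<Sum>e\<in>edges \<T>. \<Sum>p\<in>verts K. if p \<in> e then (\<delta> e)\<^sup>2 else 0)"
      by (intro sum.cong refl sum.swap)
    also have "\<dots> = (\<Sum>e\<in>edges \<T>. \<Sum>K\<in>\<T>. \<Sum>p\<in>verts K. if p \<in> e then (\<delta> e)\<^sup>2 else 0)"
      by (rule sum.swap)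
    also have "\<dots> = (\<Sum>e\<in>edges \<T>. (\<Sum>K\<in>\<T>. real (card {p \<in> verts K. p \<in> e})) * (\<delta> e)\<^sup>2)"
      by (simp add: sum.inter_filter[OF finite_verts, symmetric] sum_distrib_right)
    also have "\<dots> \<le> (\<Sum>e\<in>edges \<T>. 2 * (8 / \<kappa>) * (\<delta> e)\<^sup>2)"
      by (intro sum_mono mult_right_mono incidence_bound) auto
    also have "\<dots> = 2 * (8 / \<kappa>) * (\<Sum>e\<in>edges \<T>. (\<delta> e)\<^sup>2)" by (rule sum_distrib_left[symmetric])
    finally have "?N1\<^sup>2 * (\<Sum>K\<in>\<T>. \<Sum>p\<in>verts K. (m p)\<^sup>2) \<le> ?N1\<^sup>2 * (2 * (8 / \<kappa>) * (\<Sum>e\<in>edges \<T>. (\<delta> e)\<^sup>2))"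
      by (rule mult_left_mono) simp
    with q show ?thesis by (simp only: mult.assoc)
  qed
  have "2 * (8 / \<kappa> + 4) * (\<Sum>K\<in>\<T>. Z2 K) \<le> 2 * (8 / \<kappa> + 4) * (?N1\<^sup>2 * (2 * (8 / \<kappa>)) * (\<Sum>e\<in>edges \<T>. (\<delta> e)\<^sup>2))"
    by (rule mult_left_mono[OF Zb]) (use \<kappa> in auto)
  with step show ?thesis by (simp only: mult.assoc)
qed

end

(* PART 11 *)

definition sym_grad :: "plane set \<Rightarrow> (plane \<Rightarrow> plane) \<Rightarrow> plane \<Rightarrow> real^2^2" where
  "sym_grad V v x = (\<chi> i j. (weak_deriv V [j] v x $ i + weak_deriv V [i] v x $ j) / 2)"

lemma norm_L2_sq_le_integral:
  assumes "L2 M f" "integrable M F" "AE x in M. (norm (f x))\<^sup>2 \<le> F x"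
  shows "(norm_L2 M f)\<^sup>2 \<le> (\<integral>x. F x \<partial>M)"
  unfolding norm_L2_sq by (rule integral_mono_AE) (use L2D(2)[OF assms(1)] assms in auto)

lemma norm_sq_vec2: "(norm x)\<^sup>2 = (norm (x $ 1))\<^sup>2 + (norm (x $ 2))\<^sup>2" for x :: "('a::real_normed_vector)^2"
  by (simp add: norm_vec_def L2_set_def sum_2)

lemma square_bound_aux:
  fixes y m s a b c d r :: real
  assumes "0 \<le> y" "y \<le> s + m" "m \<le> d + c" "c \<le> (d + r) / 2" "r \<le> a + b" "d \<le> a + b"
  shows "y\<^sup>2 \<le> 2 * s\<^sup>2 + 16 * (a\<^sup>2 + b\<^sup>2)"
proof -
  have q: "y \<le> s + 2 * (a + b)" using assms by argo
  have "y\<^sup>2 \<le> (s + 2 * (a + b))\<^sup>2" by (rule power_mono[OF q assms(1)])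
  also have "\<dots> \<le> 2 * s\<^sup>2 + 2 * (2 * (a + b))\<^sup>2" by (rule sq_add_le)
  also have "\<dots> = 2 * s\<^sup>2 + 8 * (a + b)\<^sup>2" by (simp add: power2_eq_square algebra_simps)
  also have "\<dots> \<le> 2 * s\<^sup>2 + 16 * (a\<^sup>2 + b\<^sup>2)" using sq_add_le[of a b] by (simp add: algebra_simps)
  finally show ?thesis .
qed

lemma JJ_linear: "bounded_linear JJ"
  by (intro linear_conv_bounded_linear[THEN iffD1] linearI) (simp_all add: vec_eq_iff forall_2 JJ_nth)

lemma rigid_smooth: "smooth (\<lambda>x. \<alpha> + \<beta> *\<^sub>R JJ x)"
  by (intro smooth_add smooth_const smooth_scaleR smooth_id_linear JJ_linear)

lemma rigid_pdiff: "pdiff i (\<lambda>x. \<alpha> + \<beta> *\<^sub>R JJ x) x = \<beta> *\<^sub>R JJ (axis i 1)"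
proof (rule pdiff_eqI)
  show "((\<lambda>x. \<alpha> + \<beta> *\<^sub>R JJ x) has_derivative (\<lambda>h. \<beta> *\<^sub>R JJ h)) (at x)"
    by (rule has_derivative_add[of "\<lambda>_. \<alpha>" "\<lambda>_. 0", simplified])
      (intro bounded_linear.has_derivative[OF bounded_linear_scaleR_right] bounded_linear.has_derivative[OF JJ_linear] has_derivative_ident)
qed

context starlike
begin

lemma sobolev_1I:
  assumes "L2 M f" "\<And>i. L2 M (g i)" "\<And>i. is_weak_deriv U [i] f (g i)"
  shows "f \<in> sobolev 1 U"
  unfolding sobolev_def
proof (intro CollectI conjI allI impI)
  fix \<alpha> :: "2 list" assume "length \<alpha> \<le> 1"
  then consider "\<alpha> = []" | i where "\<alpha> = [i]" by (cases \<alpha>) auto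
  then show "\<exists>g. L2 M g \<and> is_weak_deriv U \<alpha> f g"
  proof cases
    case 1 then show ?thesis using assms(1) by (intro exI[of _ f]) (simp add: is_weak_deriv_def)
  next
    case 2 then show ?thesis using assms(2,3) by blast
  qed
qed (rule assms(1))

lemma sobolev_mono: "f \<in> sobolev m U \<Longrightarrow> n \<le> m \<Longrightarrow> f \<in> sobolev n U"
  unfolding sobolev_def by auto

lemma weak_deriv_of_gradient:
  assumes v: "v \<in> sobolev 2 U"
  shows "weak_deriv U [j] v \<in> sobolev 1 U"
    "norm_L2 M (weak_deriv U [i] (weak_deriv U [j] v)) = norm_L2 M (weak_deriv U [j, i] v)"
    "L2 M (weak_deriv U [j, i] v)" "is_weak_deriv U [i] (weak_deriv U [j] v) (weak_deriv U [j, i] v)"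
proof -
  have g: "L2 M (weak_deriv U [j] v)" "is_weak_deriv U [j] v (weak_deriv U [j] v)" for j
    using sobolev_weak_deriv[OF v, of "[j]"] by auto
  have h: "L2 M (weak_deriv U [j, i] v)" "is_weak_deriv U [j, i] v (weak_deriv U [j, i] v)" for i j
    using sobolev_weak_deriv[OF v, of "[j, i]"] by auto
  have w: "is_weak_deriv U [i] (weak_deriv U [j] v) (weak_deriv U [j, i] v)" for i j
    by (rule weak_deriv_iterate[OF g(2) h(2)])
  show "weak_deriv U [j] v \<in> sobolev 1 U" by (rule sobolev_1I[OF g(1) h(1) w])
  show "norm_L2 M (weak_deriv U [i] (weak_deriv U [j] v)) = norm_L2 M (weak_deriv U [j, i] v)"
    by (rule weak_deriv_AE(4)[OF h(1) w])
  show "L2 M (weak_deriv U [j, i] v)" "is_weak_deriv U [i] (weak_deriv U [j] v) (weak_deriv U [j, i] v)" by (rule h w)+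
qed

lemma sym_grad_L2:
  assumes v: "v \<in> sobolev 1 U"
  shows "L2 M (sym_grad U v)"
proof -
  let ?g = "\<lambda>j. weak_deriv U [j] v"
  have g: "L2 M (?g j)" for j using sobolev_weak_deriv(1)[OF v, of "[j]"] by simp
  have T: "bounded_linear (\<lambda>w. \<chi> i j. ((if j = l then w $ i else 0) + (if i = l then w $ j else 0)) / 2 :: real^2^2)" for l :: 2
    by (intro linear_conv_bounded_linear[THEN iffD1] linearI) (auto simp: vec_eq_iff algebra_simps add_divide_distrib)
  have "L2 M (\<lambda>x. (\<chi> i j. ((if j = 1 then ?g 1 x $ i else 0) + (if i = 1 then ?g 1 x $ j else 0)) / 2 :: real^2^2)
      + (\<chi> i j. ((if j = 2 then ?g 2 x $ i else 0) + (if i = 2 then ?g 2 x $ j else 0)) / 2))"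
    by (intro L2_add L2_linear[OF T g])
  moreover have "sym_grad U v = (\<lambda>x. (\<chi> i j. ((if j = 1 then ?g 1 x $ i else 0) + (if i = 1 then ?g 1 x $ j else 0)) / 2 :: real^2^2)
      + (\<chi> i j. ((if j = 2 then ?g 2 x $ i else 0) + (if i = 2 then ?g 2 x $ j else 0)) / 2))"
    by (rule ext) (simp add: sym_grad_def vec_eq_iff forall_2)
  ultimately show ?thesis by simp
qed

lemma sym_grad_weak_deriv:
  assumes v: "v \<in> sobolev 2 U"
  shows "L2 M (\<lambda>x. \<chi> i j. (weak_deriv U [j, k] v x $ i + weak_deriv U [i, k] v x $ j) / 2 :: real^2^2)"
    "is_weak_deriv U [k] (sym_grad U v) (\<lambda>x. \<chi> i j. (weak_deriv U [j, k] v x $ i + weak_deriv U [i, k] v x $ j) / 2)"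
proof -
  let ?g = "\<lambda>j. weak_deriv U [j] v" and ?h = "\<lambda>j. weak_deriv U [j, k] v"
  let ?T = "\<lambda>l w. \<chi> i j. ((if j = l then w $ i else 0) + (if i = l then w $ j else 0)) / 2 :: real^2^2"
  have g: "L2 M (?g j)" for j using sobolev_weak_deriv(1)[OF v, of "[j]"] by simp
  note h = weak_deriv_of_gradient(3,4)[OF v]
  have T: "bounded_linear (?T l)" for l :: 2
    by (intro linear_conv_bounded_linear[THEN iffD1] linearI) (auto simp: vec_eq_iff algebra_simps add_divide_distrib)
  have e1: "sym_grad U v = (\<lambda>x. ?T 1 (?g 1 x) + ?T 2 (?g 2 x))"
    by (rule ext) (simp add: sym_grad_def vec_eq_iff forall_2)
  have e2: "(\<lambda>x. \<chi> i j. (?h j x $ i + ?h i x $ j) / 2 :: real^2^2) = (\<lambda>x. ?T 1 (?h 1 x) + ?T 2 (?h 2 x))"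
    by (rule ext) (simp add: vec_eq_iff forall_2)
  show "L2 M (\<lambda>x. \<chi> i j. (?h j x $ i + ?h i x $ j) / 2 :: real^2^2)"
    unfolding e2 by (intro L2_add L2_linear[OF T h(1)])
  show "is_weak_deriv U [k] (sym_grad U v) (\<lambda>x. \<chi> i j. (?h j x $ i + ?h i x $ j) / 2)"
    unfolding e1 e2 by (intro is_weak_deriv_add L2_linear[OF T g] L2_linear[OF T h(1)] is_weak_deriv_linear[OF T g h(1) h(2)])
qed

lemma second_derivatives_bound:
  assumes v: "v \<in> sobolev 2 U"
  shows "(norm_grad 2 U v)\<^sup>2 \<le> 72 * (norm_grad 1 U (sym_grad U v))\<^sup>2"
proof -
  let ?H = "\<lambda>i j. weak_deriv U [i, j] v" and ?G = "\<lambda>k. weak_deriv U [k] (sym_grad U v)"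
  note h = weak_deriv_of_gradient(3,4)[OF v]
  note G = sym_grad_weak_deriv[OF v]
  have GL: "L2 M (?G k)" for k by (rule weak_deriv_AE(1)[OF G])
  have GAE: "AE x in M. ?G k x = (\<chi> i j. (?H j k x $ i + ?H i k x $ j) / 2)" for k
    by (rule weak_deriv_AE(3)[OF G])
  have "is_weak_deriv U [j, i] v (?H i j)" for i j
    using sobolev_weak_deriv(2)[OF v, of "[i, j]"] by (simp add: weak_deriv_symmetric)
  then have sAE: "AE x in M. ?H i j x = ?H j i x" for i j
    using weak_deriv_unique[OF h(1)[of i j] h(1)[of j i], of "[j, i]" v] sobolev_weak_deriv(2)[OF v, of "[j, i]"] by simp
  have b: "(norm_L2 M (?H i j))\<^sup>2 \<le> 18 * (\<Sum>k\<in>UNIV. (norm_L2 M (?G k))\<^sup>2)" for i j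
  proof -
    have "AE x in M. (norm (?H i j x))\<^sup>2 \<le> 18 * ((norm (?G 1 x))\<^sup>2 + (norm (?G 2 x))\<^sup>2)"
      using GAE[of 1] GAE[of 2] sAE[of 1 2] sAE[of i j]
    proof eventually_elim
      case (elim x)
      have Gk: "?G k x = (\<chi> i j. (?H j k x $ i + ?H i k x $ j) / 2)" for k
        using elim(1,2) exhaust_2[of k] by auto
      have Hs: "?H i j x = ?H j i x" for i j using elim(3) exhaust_2[of i] exhaust_2[of j] by auto
      define s where "s = sqrt ((norm (?G 1 x))\<^sup>2 + (norm (?G 2 x))\<^sup>2)"
      have Gs: "\<bar>?G k x $ i $ j\<bar> \<le> s" for k i j
      proof -
        have "norm (?G k x $ i $ j) \<le> norm (?G k x $ i)" by (rule Finite_Cartesian_Product.norm_nth_le)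
        also have "\<dots> \<le> norm (?G k x)" by (rule Finite_Cartesian_Product.norm_nth_le)
        also have "\<dots> \<le> s" unfolding s_def by (rule real_le_rsqrt) (use exhaust_2[of k] in auto)
        finally show ?thesis by simp
      qed
      have c: "\<bar>?H i j x $ k\<bar> \<le> 3 * s" for k
      proof -
        have "?H i j x $ k = ?G i x $ j $ k + ?G j x $ i $ k - ?G k x $ i $ j"
          unfolding Gk using Hs[of k i] Hs[of k j] Hs[of i j] by (simp add: field_simps)
        then show ?thesis using Gs[of i j k] Gs[of j i k] Gs[of k i j] by linarith
      qed
      have s0: "0 \<le> s" by (simp add: s_def)
      have "(norm (?H i j x))\<^sup>2 = \<bar>?H i j x $ 1\<bar>\<^sup>2 + \<bar>?H i j x $ 2\<bar>\<^sup>2" by (simp add: norm_sq_vec2)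
      also have "\<dots> \<le> (3 * s)\<^sup>2 + (3 * s)\<^sup>2" by (intro add_mono power_mono c) auto
      also have "\<dots> = 18 * ((norm (?G 1 x))\<^sup>2 + (norm (?G 2 x))\<^sup>2)" by (simp add: s_def power_mult_distrib)
      finally show ?case .
    qed
    then have "(norm_L2 M (?H i j))\<^sup>2 \<le> (\<integral>x. 18 * ((norm (?G 1 x))\<^sup>2 + (norm (?G 2 x))\<^sup>2) \<partial>M)"
      by (rule norm_L2_sq_le_integral[OF h(1), rotated]) (use L2D(2)[OF GL] in auto)
    also have "\<dots> = 18 * (\<Sum>k\<in>UNIV. (norm_L2 M (?G k))\<^sup>2)" using L2D(2)[OF GL] by (simp add: norm_L2_sq sum_2)
    finally show ?thesis .
  qed
  have "(norm_grad 2 U v)\<^sup>2 = (\<Sum>i\<in>UNIV. \<Sum>j\<in>UNIV. (norm_L2 M (?H i j))\<^sup>2)"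
    by (simp add: norm_grad_2 sum_nonneg)
  also have "\<dots> \<le> (\<Sum>i\<in>(UNIV :: 2 set). \<Sum>j\<in>(UNIV :: 2 set). 18 * (\<Sum>k\<in>UNIV. (norm_L2 M (?G k))\<^sup>2))"
    by (intro sum_mono b)
  also have "\<dots> = 72 * (norm_grad 1 U (sym_grad U v))\<^sup>2" unfolding norm_grad_1 by (simp add: sum_nonneg)
  finally show ?thesis .
qed

lemma rigid_motion_approximation:
  assumes v: "v \<in> sobolev 2 U" and h: "\<And>x y. x \<in> U \<Longrightarrow> y \<in> U \<Longrightarrow> norm (x - y) \<le> h"
  shows "\<exists>\<alpha> \<beta>. (norm_L2 M (\<lambda>x. v x - (\<alpha> + \<beta> *\<^sub>R JJ x)))\<^sup>2 \<le>
        4 * h\<^sup>2 * (2 * (norm_L2 M (sym_grad U v))\<^sup>2 + 128 * h\<^sup>2 * (norm_grad 2 U v)\<^sup>2) \<and>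
      (\<Sum>i\<in>UNIV. (norm_L2 M (\<lambda>x. weak_deriv U [i] v x - \<beta> *\<^sub>R JJ (axis i 1)))\<^sup>2) \<le>
        2 * (norm_L2 M (sym_grad U v))\<^sup>2 + 128 * h\<^sup>2 * (norm_grad 2 U v)\<^sup>2"
proof -
  have v1: "v \<in> sobolev 1 U" by (rule sobolev_mono[OF v]) simp
  let ?g = "\<lambda>j. weak_deriv U [j] v" and ?H = "\<lambda>i j. weak_deriv U [i, j] v"
  let ?R = "2 * (norm_L2 M (sym_grad U v))\<^sup>2 + 128 * h\<^sup>2 * (norm_grad 2 U v)\<^sup>2"
  define A where "A j = mean (?g j)" for j
  define \<beta> where "\<beta> = (A 1 $ 2 - A 2 $ 1) / 2"
  define J where "J i = \<beta> *\<^sub>R JJ (axis i 1)" for i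
  note gs = weak_deriv_of_gradient[OF v]
  have g: "L2 M (?g j)" for j using sobolev_weak_deriv(1)[OF v, of "[j]"] by simp
  have dL: "L2 M (\<lambda>x. ?g j x - A j)" for j by (intro L2_diff g L2_const)
  note eL = sym_grad_L2[OF v1]
  have D: "(norm_L2 M (\<lambda>x. ?g j x - A j))\<^sup>2 \<le> 4 * h\<^sup>2 * (\<Sum>i\<in>UNIV. (norm_L2 M (?H j i))\<^sup>2)" for j
    using Poincare[OF gs(1)[of j] h] unfolding A_def gs(2) .
  have S: "(norm_L2 M (\<lambda>x. ?g 1 x - A 1))\<^sup>2 + (norm_L2 M (\<lambda>x. ?g 2 x - A 2))\<^sup>2 \<le> 4 * h\<^sup>2 * (norm_grad 2 U v)\<^sup>2"
    using D[of 1] D[of 2] by (simp add: norm_grad_2 sum_nonneg sum_2 algebra_simps)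
  let ?F = "\<lambda>x. \<lambda>i. 2 * (norm (sym_grad U v x $ i))\<^sup>2 + 16 * ((norm (?g 1 x - A 1))\<^sup>2 + (norm (?g 2 x - A 2))\<^sup>2)"
  have pt: "(norm (?g i x - J i))\<^sup>2 \<le> ?F x i" for i x
  proof -
    let ?d = "\<lambda>j. ?g j x - A j"
    define c where "c = (\<chi> k. (?d i $ k + ?d k $ i) / 2)"
    have dk: "norm (?d k) \<le> norm (?d 1) + norm (?d 2)" for k using exhaust_2[of k] by auto
    define r where "r = (\<chi> k. ?d k $ i)"
    have "norm r \<le> (\<Sum>k\<in>UNIV. \<bar>r $ k\<bar>)" by (rule norm_le_l1_cart)
    also have "\<dots> \<le> (\<Sum>k\<in>UNIV. norm (?d k))"
      by (rule sum_mono) (simp add: r_def component_le_norm_cart del: vector_minus_component)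
    finally have r: "norm r \<le> norm (?d 1) + norm (?d 2)" by (simp add: sum_2)
    have "c = (1/2) *\<^sub>R (?d i + r)" by (simp add: c_def r_def vec_eq_iff)
    then have c: "norm c \<le> (norm (?d i) + norm r) / 2" using norm_triangle_ineq[of "?d i" r] by simp
    have "?g i x - J i = sym_grad U v x $ i + (?d i - c)"
    proof -
      have "A i - J i = (\<chi> k. (A i $ k + A k $ i) / 2)"
        using exhaust_2[of i] by (auto simp: vec_eq_iff forall_2 J_def \<beta>_def JJ_nth axis_def field_simps)
      moreover have "sym_grad U v x $ i - c = (\<chi> k. (A i $ k + A k $ i) / 2)"
        by (simp add: sym_grad_def c_def vec_eq_iff field_simps)
      ultimately have "A i - J i = sym_grad U v x $ i - c" by simp
      then show ?thesis by (simp add: algebra_simps)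
    qed
    note eq = this
    have "norm (?g i x - J i) \<le> norm (sym_grad U v x $ i) + norm (?d i - c)" unfolding eq by (rule norm_triangle_ineq)
    then show ?thesis by (rule square_bound_aux[OF norm_ge_zero _ norm_triangle_ineq4 c r dk])
  qed
  have rowL: "L2 M (\<lambda>x. sym_grad U v x $ i)" for i by (rule L2_linear[OF bounded_linear_vec_nth eL])
  have gJ: "L2 M (\<lambda>x. ?g i x - J i)" for i by (intro L2_diff g L2_const)
  have Fi: "integrable M (\<lambda>x. ?F x i)" for i using L2D(2)[OF rowL[of i]] L2D(2)[OF dL] by simp
  have FL: "(norm_L2 M (\<lambda>x. ?g i x - J i))\<^sup>2 \<le> (\<integral>x. ?F x i \<partial>M)" for i
    by (rule norm_L2_sq_le_integral[OF gJ Fi], rule AE_I2, rule pt)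
  have "(\<Sum>i\<in>UNIV. (norm_L2 M (\<lambda>x. ?g i x - J i))\<^sup>2) \<le> (\<integral>x. ?F x 1 \<partial>M) + (\<integral>x. ?F x 2 \<partial>M)"
    using FL[of 1] FL[of 2] by (simp add: sum_2)
  also have "\<dots> = (\<integral>x. 2 * (norm (sym_grad U v x))\<^sup>2 + 32 * ((norm (?g 1 x - A 1))\<^sup>2 + (norm (?g 2 x - A 2))\<^sup>2) \<partial>M)"
    by (subst Bochner_Integration.integral_add[symmetric, OF Fi Fi]) (simp add: norm_sq_vec2[of "sym_grad U v _"] algebra_simps)
  also have "\<dots> = 2 * (norm_L2 M (sym_grad U v))\<^sup>2 + 32 * ((norm_L2 M (\<lambda>x. ?g 1 x - A 1))\<^sup>2 + (norm_L2 M (\<lambda>x. ?g 2 x - A 2))\<^sup>2)"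
    using L2D(2)[OF eL] L2D(2)[OF dL] by (simp add: norm_L2_sq)
  also have "\<dots> \<le> ?R" using S by simp
  finally have G: "(\<Sum>i\<in>UNIV. (norm_L2 M (\<lambda>x. ?g i x - J i))\<^sup>2) \<le> ?R" .
  define f where "f = (\<lambda>x. v x - \<beta> *\<^sub>R JJ x)"
  have sJ: "smooth (\<lambda>x. \<beta> *\<^sub>R JJ x)" using rigid_smooth[of 0 \<beta>] by simp
  have pJ: "pdiff i (\<lambda>x. \<beta> *\<^sub>R JJ x) = (\<lambda>x. J i)" for i
    using rigid_pdiff[of i 0 \<beta>] by (auto simp: J_def)
  have fL: "L2 M f" unfolding f_def by (intro L2_diff L2_smooth sJ sobolevD[OF v])
  have fw: "is_weak_deriv U [i] f (\<lambda>x. ?g i x - J i)" for i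
    unfolding f_def
    by (rule is_weak_deriv_diff[OF sobolevD[OF v] g _ L2_smooth[OF sJ] L2_const])
      (use sobolev_weak_deriv(2)[OF v1, of "[i]"] smooth_is_weak_deriv[OF U(1) sJ, of i] in \<open>simp_all add: pJ\<close>)
  have fs: "f \<in> sobolev 1 U" by (rule sobolev_1I[OF fL gJ fw])
  have "(norm_L2 M (\<lambda>x. f x - mean f))\<^sup>2 \<le> 4 * h\<^sup>2 * (\<Sum>i\<in>UNIV. (norm_L2 M (weak_deriv U [i] f))\<^sup>2)"
    by (rule Poincare[OF fs h])
  also have "(\<Sum>i\<in>UNIV. (norm_L2 M (weak_deriv U [i] f))\<^sup>2) = (\<Sum>i\<in>UNIV. (norm_L2 M (\<lambda>x. ?g i x - J i))\<^sup>2)"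
    by (simp add: weak_deriv_AE(4)[OF gJ fw])
  also have "4 * h\<^sup>2 * \<dots> \<le> 4 * h\<^sup>2 * ?R" by (rule mult_left_mono[OF G]) simp
  finally have "(norm_L2 M (\<lambda>x. v x - (mean f + \<beta> *\<^sub>R JJ x)))\<^sup>2 \<le> 4 * h\<^sup>2 * ?R"
    by (simp add: f_def algebra_simps)
  then show ?thesis using G unfolding J_def by blast
qed

end

(* PART 12 *)

context edge
begin

lemma rigid_P1_minus: "(\<lambda>x. \<alpha> + \<beta> *\<^sub>R JJ x) \<in> P1_minus e"
proof -
  have "(\<lambda>x. (\<alpha> + \<beta> *\<^sub>R JJ x) $ i) \<in> P1 e" for i
  proof -
    have "\<exists>d. \<forall>x. (\<alpha> + \<beta> *\<^sub>R JJ x) $ i = \<alpha> $ i + d \<bullet> x"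
    proof (cases "i = 1")
      case True
      then show ?thesis by (intro exI[of _ "axis 2 (- \<beta>)"]) (simp add: JJ_nth inner_axis')
    next
      case False
      then have "i = 2" using exhaust_2 by blast
      then show ?thesis by (intro exI[of _ "axis 1 \<beta>"]) (simp add: JJ_nth inner_axis')
    qed
    then show ?thesis unfolding P1_def by blast
  qed
  moreover have "(\<lambda>x. (\<alpha> + \<beta> *\<^sub>R JJ x) \<bullet> tt) \<in> RM_edge e"
  proof -
    have "(\<alpha> + \<beta> *\<^sub>R JJ x) \<bullet> tt = (\<alpha> + \<beta> *\<^sub>R JJ p0) \<bullet> tt" if "x \<in> e" for x
      using edge_param[OF that] by (auto simp: inner_vec_def sum_2 JJ_nth algebra_simps)
    then show ?thesis unfolding RM_edge_def by blast
  qed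
  ultimately show ?thesis unfolding P1_minus_def by blast
qed

lemma P1_minus_endpoint_bound:
  assumes q: "q \<in> P1_minus e" and x: "x \<in> {a, b}"
  shows "(norm (q x))\<^sup>2 \<le> 4 * inverse len * (norm_L2 E q)\<^sup>2"
proof -
  have "\<forall>i. \<exists>c d. \<forall>x\<in>e. q x $ i = c + d \<bullet> x" using q unfolding P1_minus_def P1_def by auto
  then obtain c d where cd: "\<And>i x. x \<in> e \<Longrightarrow> q x $ i = c i + d i \<bullet> x" by metis
  define Q where "Q x = (\<chi> i. c i + d i \<bullet> x)" for x
  have Qq: "q x = Q x" if "x \<in> e" for x using cd[OF that] by (simp add: Q_def vec_eq_iff)
  have Qc: "continuous_on UNIV Q" unfolding Q_def by (intro continuous_intros)
  have [measurable]: "Q \<in> borel_measurable borel" by (rule borel_measurable_continuous_onI[OF Qc])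
  have Qs: "Q (a + s *\<^sub>R (b - a)) = Q a + s *\<^sub>R (Q b - Q a)" for s
    by (simp add: Q_def vec_eq_iff inner_add_right inner_diff_right algebra_simps)
  define u w where "u = Q a" and "w = Q b - Q a"
  have "ennreal ((norm_L2 E q)\<^sup>2) = ennreal ((norm_L2 E Q)\<^sup>2)"
    using norm_L2_cong[of E q Q] Qq by (simp add: space_edge)
  also have "\<dots> = (\<integral>\<^sup>+x. ennreal ((norm (Q x))\<^sup>2) \<partial>E)"
    unfolding norm_L2_sq
    by (rule nn_integral_eq_integral[symmetric]) (use L2D(2)[OF L2_edge_continuous[OF Qc]] in auto)
  also have "\<dots> = ennreal len * (\<integral>\<^sup>+s. ennreal ((norm (Q (a + s *\<^sub>R (b - a))))\<^sup>2) * indicator {0..1} s \<partial>lborel)"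
    by (rule nn_integral_edge) measurable
  also have "(\<integral>\<^sup>+s. ennreal ((norm (Q (a + s *\<^sub>R (b - a))))\<^sup>2) * indicator {0..1} s \<partial>lborel)
     = (\<integral>\<^sup>+s. ennreal ((norm (u + s *\<^sub>R w))\<^sup>2) * indicator {0..1} s \<partial>lborel)"
    unfolding Qs u_def w_def ..
  also have "\<dots> = ennreal ((1 * (u \<bullet> u) + 1\<^sup>2 * (u \<bullet> w) + 1 ^ 3 / 3 * (w \<bullet> w)) - (0 * (u \<bullet> u) + 0\<^sup>2 * (u \<bullet> w) + 0 ^ 3 / 3 * (w \<bullet> w)))"
  proof (rule nn_integral_FTC_Icc[where F = "\<lambda>s. s * (u \<bullet> u) + s\<^sup>2 * (u \<bullet> w) + s ^ 3 / 3 * (w \<bullet> w)"])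
    fix s :: real assume "s \<in> {0..1}"
    have "(norm (u + s *\<^sub>R w))\<^sup>2 = u \<bullet> u + 2 * s * (u \<bullet> w) + s\<^sup>2 * (w \<bullet> w)"
      unfolding power2_norm_eq_inner by (simp add: inner_add_left inner_add_right inner_commute power2_eq_square algebra_simps)
    moreover have "((\<lambda>s. s * (u \<bullet> u) + s\<^sup>2 * (u \<bullet> w) + s ^ 3 / 3 * (w \<bullet> w)) has_real_derivative u \<bullet> u + 2 * s * (u \<bullet> w) + s\<^sup>2 * (w \<bullet> w)) (at s)"
      by (auto intro!: derivative_eq_intros simp: power2_eq_square field_simps)
    ultimately show "((\<lambda>s. s * (u \<bullet> u) + s\<^sup>2 * (u \<bullet> w) + s ^ 3 / 3 * (w \<bullet> w)) has_real_derivative (norm (u + s *\<^sub>R w))\<^sup>2) (at s)"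
      by simp
  qed auto
  also have "\<dots> = ennreal (u \<bullet> u + u \<bullet> w + w \<bullet> w / 3)" by simp
  finally have I: "ennreal ((norm_L2 E q)\<^sup>2) = ennreal len * ennreal (u \<bullet> u + u \<bullet> w + w \<bullet> w / 3)" .
  have low: "(norm (q x))\<^sup>2 / 4 \<le> u \<bullet> u + u \<bullet> w + w \<bullet> w / 3"
  proof -
    have "0 \<le> (norm (3 *\<^sub>R u + 2 *\<^sub>R w))\<^sup>2" "0 \<le> (norm (3 *\<^sub>R u + w))\<^sup>2" by auto
    then have "u \<bullet> u / 4 \<le> u \<bullet> u + u \<bullet> w + w \<bullet> w / 3" "(u + w) \<bullet> (u + w) / 4 \<le> u \<bullet> u + u \<bullet> w + w \<bullet> w / 3"
      unfolding power2_norm_eq_inner by (simp_all add: inner_add_left inner_add_right inner_commute algebra_simps)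
    moreover have "q x = u \<or> q x = u + w" using x Qq[of a] Qq[of b] unfolding u_def w_def e by auto
    ultimately show ?thesis unfolding power2_norm_eq_inner by auto
  qed
  have "0 \<le> u \<bullet> u + u \<bullet> w + w \<bullet> w / 3" using low zero_le_power2[of "norm (q x)"] by linarith
  then have "(norm_L2 E q)\<^sup>2 = len * (u \<bullet> u + u \<bullet> w + w \<bullet> w / 3)"
    using I by (simp add: ennreal_mult[symmetric])
  then have "inverse len * (norm_L2 E q)\<^sup>2 = u \<bullet> u + u \<bullet> w + w \<bullet> w / 3" using len by simp
  then show ?thesis using low by simp
qed

end

context mesh
begin

lemma mesh_starlike:
  assumes "K \<in> \<T>" obtains z \<rho> where "starlike (interior K) z \<rho>"
  using tri.starlike_interior[OF vs(2)[OF assms]] hull[OF assms] by metis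

lemma mesh_area: "K \<in> \<T> \<Longrightarrow> measure lebesgue K = DK K / 2"
  using tri.area[OF vs(2)] hull by (simp add: DK_def)

lemma card_edges: assumes "K \<in> \<T>" shows "finite {e. e edge_of K}" "card {e. e edge_of K} \<le> 3"
proof -
  have *: "{e. e edge_of K} = (\<lambda>d. closed_segment (fst d) (snd d)) ` dedges K"
    using edge_dedge[OF assms] by force
  show "finite {e. e edge_of K}" unfolding * by (intro finite_imageI finite_dedges)
  have "card (dedges K) \<le> 3" unfolding dedges_def by (intro card_insert_le_m1) auto
  then show "card {e. e edge_of K} \<le> 3" unfolding * using card_image_le[OF finite_dedges] order_trans by blast
qed

end

context shape_mesh
begin

lemma projected_trace_bound:
  assumes K: "K \<in> \<T>" and e: "f edge_of K" and v: "v \<in> sobolev 1 (interior K)"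
    and r: "(norm_L2 (lebesgue_on (interior K)) (\<lambda>x. v x - (\<alpha> + \<beta> *\<^sub>R JJ x)))\<^sup>2 \<le> 4 * (diameter K)\<^sup>2 * S"
    and g: "(\<Sum>i\<in>UNIV. (norm_L2 (lebesgue_on (interior K)) (\<lambda>x. weak_deriv (interior K) [i] v x - \<beta> *\<^sub>R JJ (axis i 1)))\<^sup>2) \<le> S"
  shows "inverse (diameter f) * (norm_L2 (edge_measure f) (\<lambda>x. edge_proj f (edge_trace K f v) x - (\<alpha> + \<beta> *\<^sub>R JJ x)))\<^sup>2 \<le> 34 / \<kappa> * S"
    "L2 (edge_measure f) (edge_proj f (edge_trace K f v))"
proof -
  let ?h = "diameter K"
  obtain p q where pq: "(p, q) \<in> dedges K" "f = closed_segment p q" using edge_dedge[OF K] e by blast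
  obtain d where d: "tri p q d" "K = convex hull {p, q, d}" "wedge (q - p) (d - p) = DK K" using dedge_tri[OF K pq(1)] by metis
  obtain z \<rho> where z: "starlike (interior K) z \<rho>" using mesh_starlike[OF K] .
  interpret t: tri p q d by (rule d(1))
  interpret triangle_edge "interior K" z \<rho> f p q d ?h
  proof (intro triangle_edge.intro triangle_edge_axioms.intro z edge.intro)
    show "wedge (q - p) (d - p) \<noteq> 0" using t.pos by simp
    show "norm (d - p) \<le> ?h" "norm (d - q) \<le> ?h"
      by (rule norm_le_diam[OF K]; use t.vertices_in d(2) in simp)+
  qed (use pq(2) t.distinct t.half_in d(2) in auto)
  have S0: "S \<ge> 0" using g by (rule order_trans[rotated]) (simp add: sum_nonneg)
  have pd: "pdiff i (\<lambda>x. \<alpha> + \<beta> *\<^sub>R JJ x) = (\<lambda>x. \<beta> *\<^sub>R JJ (axis i 1))" for i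
    by (rule ext) (rule rigid_pdiff)
  note tr = trace_inequality[OF v refl rigid_smooth[of \<alpha> \<beta>], unfolded pd]
  have "(norm_L2 E (\<lambda>x. edge_proj f (edge_trace K f v) x - (\<alpha> + \<beta> *\<^sub>R JJ x)))\<^sup>2
      \<le> (norm_L2 E (\<lambda>x. edge_trace K f v x - (\<alpha> + \<beta> *\<^sub>R JJ x)))\<^sup>2"
    by (intro power_mono edge_proj_nonexpansive tr(1) rigid_P1_minus) simp
  also have "\<dots> \<le> trc * (4 * (4 * ?h\<^sup>2 * S) + ?h\<^sup>2 * S)"
    by (rule order_trans[OF tr(2)]) (intro mult_left_mono add_mono r g, use trc_pos in auto)
  also have "\<dots> = len * (34 * ?h\<^sup>2 / DK K * S)" using DK_pos[OF K] by (simp add: trc_def d(3) field_simps)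
  also have "\<dots> \<le> len * (34 / \<kappa> * S)"
  proof (intro mult_left_mono mult_right_mono S0)
    show "34 * ?h\<^sup>2 / DK K \<le> 34 / \<kappa>" using shape[OF K] DK_pos[OF K] \<kappa> by (simp add: field_simps)
  qed simp
  finally have "inverse len * (norm_L2 E (\<lambda>x. edge_proj f (edge_trace K f v) x - (\<alpha> + \<beta> *\<^sub>R JJ x)))\<^sup>2 \<le> inverse len * (len * (34 / \<kappa> * S))"
    by (rule mult_left_mono) simp
  moreover have "inverse len * (len * (34 / \<kappa> * S)) = 34 / \<kappa> * S" using len(4) by (simp only: mult.assoc[symmetric]) simp
  ultimately show "inverse (diameter f) * (norm_L2 E (\<lambda>x. edge_proj f (edge_trace K f v) x - (\<alpha> + \<beta> *\<^sub>R JJ x)))\<^sup>2 \<le> 34 / \<kappa> * S"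
    by (simp only: len(2))
  show "L2 E (edge_proj f (edge_trace K f v))" by (rule P1_minus_L2[OF edge_proj(1)[OF tr(1)]])
qed

lemma jump_interior_edge:
  assumes "K \<in> \<T>" "K' \<in> \<T>" "K \<noteq> K'" "f edge_of K" "f edge_of K'"
  shows "norm_L2 M (jump \<T> f F) = norm_L2 M (\<lambda>x. F K x - F K' x)"
proof -
  define p where "p = (SOME p. fst p \<in> \<T> \<and> snd p \<in> \<T> \<and> fst p \<noteq> snd p \<and> f edge_of fst p \<and> f edge_of snd p)"
  have p: "fst p \<in> \<T> \<and> snd p \<in> \<T> \<and> fst p \<noteq> snd p \<and> f edge_of fst p \<and> f edge_of snd p"
    unfolding p_def by (rule someI[of _ "(K, K')"]) (use assms in auto)
  have nu: "\<not> (\<exists>!K. K \<in> \<T> \<and> f edge_of K)" using assms by blast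
  have j: "jump \<T> f F = (\<lambda>x. F (fst p) x - F (snd p) x)" unfolding jump_def p_def Let_def by (rule if_not_P[OF nu])
  have "fst p = K \<and> snd p = K' \<or> fst p = K' \<and> snd p = K"
    using p assms at_most_two by metis
  then show ?thesis
  proof
    assume "fst p = K' \<and> snd p = K"
    then show ?thesis unfolding j using norm_L2_commute[of M "F K'" "F K"] by simp
  qed (simp add: j)
qed

lemma jump_boundary_edge:
  assumes "K \<in> \<T>" "f edge_of K" "boundary_edge f"
  shows "jump \<T> f F = F K"
proof -
  have u: "\<exists>!K. K \<in> \<T> \<and> f edge_of K" using assms unfolding boundary_edge_def by blast
  then have "(THE K. K \<in> \<T> \<and> f edge_of K) = K" by (rule the1_equality) (use assms in auto)
  then show ?thesis using u unfolding jump_def by simp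
qed

end

(* PART 13 *)

lemma sum_three_sq: "(x + y + z)\<^sup>2 \<le> 3 * (x\<^sup>2 + y\<^sup>2 + z\<^sup>2)" for x y z :: real
proof -
  have "0 \<le> (x - y)\<^sup>2 + (y - z)\<^sup>2 + (x - z)\<^sup>2" by simp
  then show ?thesis by (simp add: power2_eq_square algebra_simps)
qed

context shape_mesh
begin

definition local_energy :: "(plane \<Rightarrow> plane) \<Rightarrow> plane set \<Rightarrow> real" where
  "local_energy v K = 2 * (norm_L2 (lebesgue_on (interior K)) (sym_grad (interior K) v))\<^sup>2
     + 128 * (diameter K)\<^sup>2 * (norm_grad 2 (interior K) v)\<^sup>2"

definition jump_energy :: "(plane \<Rightarrow> plane) \<Rightarrow> real" where
  "jump_energy v = (\<Sum>e\<in>edges \<T>. inverse (diameter e) * (norm_L2 (edge_measure e) (jump_proj \<T> e v))\<^sup>2)"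

lemma local_energy_nonneg: "local_energy v K \<ge> 0" by (simp add: local_energy_def)

lemma sum_edges_energy:
  "(\<Sum>e\<in>edges \<T>. \<Sum>K\<in>{K \<in> \<T>. e edge_of K}. local_energy v K) \<le> 3 * (\<Sum>K\<in>\<T>. local_energy v K)"
proof -
  have "(\<Sum>e\<in>edges \<T>. \<Sum>K\<in>{K \<in> \<T>. e edge_of K}. local_energy v K)
      = (\<Sum>e\<in>edges \<T>. \<Sum>K\<in>\<T>. if e edge_of K then local_energy v K else 0)"
    using fin by (simp add: sum.inter_filter)
  also have "\<dots> = (\<Sum>K\<in>\<T>. \<Sum>e\<in>edges \<T>. if e edge_of K then local_energy v K else 0)" by (rule sum.swap)
  also have "\<dots> = (\<Sum>K\<in>\<T>. real (card {e \<in> edges \<T>. e edge_of K}) * local_energy v K)"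
    using finite_edges by (simp add: sum.inter_filter[symmetric])
  also have "\<dots> \<le> (\<Sum>K\<in>\<T>. 3 * local_energy v K)"
  proof (intro sum_mono mult_right_mono local_energy_nonneg)
    fix K assume "K \<in> \<T>"
    then have "card {e \<in> edges \<T>. e edge_of K} \<le> card {e. e edge_of K}" by (intro card_mono card_edges(1)) auto
    then have "card {e \<in> edges \<T>. e edge_of K} \<le> 3" using card_edges(2)[OF \<open>K \<in> \<T>\<close>] by linarith
    then show "real (card {e \<in> edges \<T>. e edge_of K}) \<le> 3" by simp
  qed
  also have "\<dots> = 3 * (\<Sum>K\<in>\<T>. local_energy v K)" by (simp add: sum_distrib_left)
  finally show ?thesis .
qed

theorem broken_gradient_bound:
  assumes v: "\<And>K. K \<in> \<T> \<Longrightarrow> v \<in> sobolev 2 (interior K)"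
  shows "(broken_norm_grad 1 \<T> v)\<^sup>2 \<le> 2 * (\<Sum>K\<in>\<T>. local_energy v K)
     + 2 * (2 * (8 / \<kappa> + 4) * (((8 / \<kappa>)\<^sup>2 + 1)\<^sup>2 * (2 * (8 / \<kappa>))))
       * (12 * (jump_energy v + 102 / \<kappa> * (\<Sum>K\<in>\<T>. local_energy v K)))"
proof -
  let ?S = "local_energy v" and ?M = "\<lambda>K. lebesgue_on (interior K)"
  let ?g = "\<lambda>K i. weak_deriv (interior K) [i] v"
  define P where "P K \<alpha> \<beta> \<longleftrightarrow> (norm_L2 (?M K) (\<lambda>x. v x - (\<alpha> + \<beta> *\<^sub>R JJ x)))\<^sup>2 \<le> 4 * (diameter K)\<^sup>2 * ?S K \<and>
      (\<Sum>i\<in>UNIV. (norm_L2 (?M K) (\<lambda>x. ?g K i x - \<beta> *\<^sub>R JJ (axis i 1)))\<^sup>2) \<le> ?S K" for K \<alpha> \<beta>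
  have "\<exists>p. P K (fst p) (snd p)" if K: "K \<in> \<T>" for K
  proof -
    obtain z \<rho> where z: "starlike (interior K) z \<rho>" using mesh_starlike[OF K] .
    have d: "norm (x - y) \<le> diameter K" if "x \<in> interior K" "y \<in> interior K" for x y
      by (rule norm_le_diam[OF K]; use that interior_subset in blast)
    have "\<exists>\<alpha> \<beta>. P K \<alpha> \<beta>"
      unfolding P_def local_energy_def by (rule starlike.rigid_motion_approximation[OF z v[OF K] d])
    then show ?thesis by auto
  qed
  then have "\<exists>m. \<forall>K\<in>\<T>. P K (fst (m K)) (snd (m K))" by (intro bchoice) blast
  then obtain m where m: "\<forall>K\<in>\<T>. P K (fst (m K)) (snd (m K))" by blast
  define \<alpha> \<beta> where "\<alpha> K = fst (m K)" and "\<beta> K = snd (m K)" for K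
  have PK: "P K (\<alpha> K) (\<beta> K)" if "K \<in> \<T>" for K using m that unfolding \<alpha>_def \<beta>_def by blast
  have r: "(norm_L2 (?M K) (\<lambda>x. v x - (\<alpha> K + \<beta> K *\<^sub>R JJ x)))\<^sup>2 \<le> 4 * (diameter K)\<^sup>2 * ?S K"
    and g: "(\<Sum>i\<in>UNIV. (norm_L2 (?M K) (\<lambda>x. ?g K i x - \<beta> K *\<^sub>R JJ (axis i 1)))\<^sup>2) \<le> ?S K" if "K \<in> \<T>" for K
    using PK[OF that] unfolding P_def by blast+
  have v1: "v \<in> sobolev 1 (interior K)" if "K \<in> \<T>" for K using v[OF that] unfolding sobolev_def by auto
  define rr where "rr K x = \<alpha> K + \<beta> K *\<^sub>R JJ x" for K x
  define q where "q K e = edge_proj e (edge_trace K e v)" for K e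
  note pt = projected_trace_bound[OF _ _ v1 r g, folded rr_def q_def]
  define T where "T e = inverse (diameter e) * (norm_L2 (edge_measure e) (jump_proj \<T> e v))\<^sup>2
     + 34 / \<kappa> * (\<Sum>K\<in>{K \<in> \<T>. e edge_of K}. ?S K)" for e
  define \<delta> where "\<delta> e = sqrt (12 * \<bar>T e\<bar>)" for e
  have T0: "T e \<ge> 0" if "e \<in> edges \<T>" for e
  proof -
    obtain K where "K \<in> \<T>" "e edge_of K" using \<open>e \<in> edges \<T>\<close> unfolding edges_def by blast
    then obtain p q where "e = closed_segment p q" using edge_dedge by blast
    then have "diameter e \<ge> 0" by (simp add: diameter_closed_segment_plane)
    then show ?thesis unfolding T_def using \<kappa> by (intro add_nonneg_nonneg mult_nonneg_nonneg sum_nonneg local_energy_nonneg) auto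
  qed
  have ed: "\<exists>a b. edge e a b \<and> {p \<in> verts K. p \<in> e} \<subseteq> {a, b}" if K: "K \<in> \<T>" "e edge_of K" for K e
  proof -
    obtain a b where ab: "(a, b) \<in> dedges K" "e = closed_segment a b" using edge_dedge[OF K(1)] K(2) by blast
    obtain c where c: "tri a b c" "verts K = {a, b, c}" using dedge_tri[OF K(1) ab(1)] by metis
    interpret t: tri a b c by (rule c(1))
    have "edge e a b" by (rule edge.intro) (use ab(2) t.distinct in auto)
    moreover have "c \<notin> e" using t.seg_ab[of c] t.vertices_values(9) t.pos ab(2) by auto
    ultimately show ?thesis using c(2) by (intro exI[of _ a] exI[of _ b]) auto
  qed
  have jmp: "norm (rr K p - rr K' p) \<le> \<delta> e"
    if K: "K \<in> \<T>" "K' \<in> \<T>" "K \<noteq> K'" "e edge_of K" "e edge_of K'" "p \<in> verts K" "p \<in> e" for K K' e p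
  proof -
    obtain a b where en: "edge e a b" "p \<in> {a, b}" using ed[OF K(1,4)] K(6,7) by blast
    interpret edge e a b by (rule en(1))
    have rP: "rr K \<in> P1_minus e" for K unfolding rr_def by (rule rigid_P1_minus)
    note b = pt[OF K(1,4,1,1,1)] pt[OF K(2,5,2,2,2)]
    have L: "L2 E (rr K)" for K by (rule P1_minus_L2[OF rP])
    let ?x = "norm_L2 E (\<lambda>x. q K e x - rr K x)" and ?y = "norm_L2 E (\<lambda>x. q K e x - q K' e x)" and ?z = "norm_L2 E (\<lambda>x. q K' e x - rr K' x)"
    have "norm_L2 E (\<lambda>x. rr K x - rr K' x) \<le> ?x + ?y + ?z"
      using norm_L2_triangle3[OF L[of K] b(2) L[of K']] norm_L2_triangle3[OF b(2) b(4) L[of K']] norm_L2_commute[of E "rr K" "q K e"] by linarith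
    then have "(norm_L2 E (\<lambda>x. rr K x - rr K' x))\<^sup>2 \<le> (?x + ?y + ?z)\<^sup>2" by (rule power_mono) simp
    also have "\<dots> \<le> 3 * (?x\<^sup>2 + ?y\<^sup>2 + ?z\<^sup>2)" by (rule sum_three_sq)
    finally have "4 * inverse len * (norm_L2 E (\<lambda>x. rr K x - rr K' x))\<^sup>2 \<le> 4 * inverse len * (3 * (?x\<^sup>2 + ?y\<^sup>2 + ?z\<^sup>2))"
      by (rule mult_left_mono) simp
    also have "\<dots> = 12 * (inverse len * ?x\<^sup>2 + inverse len * ?y\<^sup>2 + inverse len * ?z\<^sup>2)" by (simp add: algebra_simps)
    also have "\<dots> \<le> 12 * (34 / \<kappa> * ?S K + inverse len * ?y\<^sup>2 + 34 / \<kappa> * ?S K')"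
      by (intro mult_left_mono add_mono order_refl) (use b(1,3) in \<open>simp_all only: len(2)\<close>, simp)
    also have "\<dots> = 12 * T e"
    proof -
      have "{K \<in> \<T>. e edge_of K} = {K, K'}" using K(1-5) at_most_two by blast
      then have "(\<Sum>K\<in>{K \<in> \<T>. e edge_of K}. ?S K) = ?S K + ?S K'" using K(3) by (simp only:) simp
      moreover have "norm_L2 E (jump_proj \<T> e v) = ?y"
        unfolding jump_proj_def using jump_interior_edge[OF K(1-5)] by (simp add: q_def)
      ultimately have "T e = inverse len * ?y\<^sup>2 + 34 / \<kappa> * (?S K + ?S K')" by (simp only: T_def len(2))
      then show ?thesis by (simp only: distrib_left add.assoc add.commute add.left_commute)
    qed
    finally have "4 * inverse len * (norm_L2 E (\<lambda>x. rr K x - rr K' x))\<^sup>2 \<le> 12 * T e" .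
    with P1_minus_endpoint_bound[OF P1_minus_diff[OF rP rP] en(2)] have "(norm (rr K p - rr K' p))\<^sup>2 \<le> 12 * T e"
      by (rule order_trans)
    also have "\<dots> \<le> 12 * \<bar>T e\<bar>" by simp
    finally show ?thesis unfolding \<delta>_def by (rule real_le_rsqrt)
  qed
  have bdr: "norm (rr K p) \<le> \<delta> e"
    if K: "K \<in> \<T>" "boundary_edge e" "e edge_of K" "p \<in> verts K" "p \<in> e" for K e p
  proof -
    obtain a b where en: "edge e a b" "p \<in> {a, b}" using ed[OF K(1,3)] K(4,5) by blast
    interpret edge e a b by (rule en(1))
    have rP: "rr K \<in> P1_minus e" unfolding rr_def by (rule rigid_P1_minus)
    note b = pt[OF K(1,3,1,1,1)]
    let ?x = "norm_L2 E (\<lambda>x. q K e x - rr K x)" and ?y = "norm_L2 E (q K e)"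
    have "norm_L2 E (rr K) \<le> ?x + ?y"
      using norm_L2_triangle_diff[OF P1_minus_L2[OF rP] b(2)] norm_L2_commute[of E "rr K" "q K e"] by linarith
    then have "(norm_L2 E (rr K))\<^sup>2 \<le> (?x + ?y + 0)\<^sup>2" by (intro power_mono) auto
    also have "\<dots> \<le> 3 * (?x\<^sup>2 + ?y\<^sup>2 + 0\<^sup>2)" by (rule sum_three_sq)
    finally have "4 * inverse len * (norm_L2 E (rr K))\<^sup>2 \<le> 4 * inverse len * (3 * (?x\<^sup>2 + ?y\<^sup>2 + 0\<^sup>2))"
      by (rule mult_left_mono) simp
    also have "\<dots> = 12 * (inverse len * ?x\<^sup>2 + inverse len * ?y\<^sup>2)" by (simp add: algebra_simps)
    also have "\<dots> \<le> 12 * (34 / \<kappa> * ?S K + inverse len * ?y\<^sup>2)"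
      by (intro mult_left_mono add_mono order_refl) (use b(1) in \<open>simp_all only: len(2)\<close>, simp)
    also have "\<dots> = 12 * T e"
    proof -
      have "{K \<in> \<T>. e edge_of K} = {K}" using K(1-3) unfolding boundary_edge_def by blast
      then have "(\<Sum>K\<in>{K \<in> \<T>. e edge_of K}. ?S K) = ?S K" by (simp only:) simp
      moreover have "norm_L2 E (jump_proj \<T> e v) = ?y"
        unfolding jump_proj_def by (simp only: jump_boundary_edge[OF K(1,3,2)] q_def)
      ultimately have "T e = inverse len * ?y\<^sup>2 + 34 / \<kappa> * ?S K" by (simp only: T_def len(2))
      then show ?thesis by (simp only: distrib_left add.assoc add.commute add.left_commute)
    qed
    finally have "4 * inverse len * (norm_L2 E (rr K))\<^sup>2 \<le> 12 * T e" .
    with P1_minus_endpoint_bound[OF rP en(2)] have "(norm (rr K p))\<^sup>2 \<le> 12 * T e"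
      by (rule order_trans)
    also have "\<dots> \<le> 12 * \<bar>T e\<bar>" by simp
    finally show ?thesis unfolding \<delta>_def by (rule real_le_rsqrt)
  qed
  let ?C = "2 * (8 / \<kappa> + 4) * (((8 / \<kappa>)\<^sup>2 + 1)\<^sup>2 * (2 * (8 / \<kappa>)))"
  have C0: "?C \<ge> 0" using \<kappa> by simp
  have "(\<Sum>K\<in>\<T>. DK K * (\<beta> K)\<^sup>2) \<le> ?C * (\<Sum>e\<in>edges \<T>. (\<delta> e)\<^sup>2)"
  proof (rule rigid_motion_Korn[of \<delta> \<alpha> \<beta>, folded rr_def])
    show "\<delta> e \<ge> 0" for e by (simp add: \<delta>_def)
  qed (fact jmp bdr)+
  also have "(\<Sum>e\<in>edges \<T>. (\<delta> e)\<^sup>2) = 12 * (jump_energy v + 34 / \<kappa> * (\<Sum>e\<in>edges \<T>. \<Sum>K\<in>{K \<in> \<T>. e edge_of K}. ?S K))"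
  proof -
    have "(\<Sum>e\<in>edges \<T>. (\<delta> e)\<^sup>2) = (\<Sum>e\<in>edges \<T>. 12 * T e)"
      by (rule sum.cong[OF refl]) (simp add: \<delta>_def T0)
    also have "\<dots> = 12 * (\<Sum>e\<in>edges \<T>. T e)" by (simp only: sum_distrib_left)
    also have "(\<Sum>e\<in>edges \<T>. T e) = jump_energy v + 34 / \<kappa> * (\<Sum>e\<in>edges \<T>. \<Sum>K\<in>{K \<in> \<T>. e edge_of K}. ?S K)"
      by (simp only: T_def jump_energy_def sum.distrib sum_distrib_left)
    finally show ?thesis .
  qed
  also have "?C * \<dots> \<le> ?C * (12 * (jump_energy v + 34 / \<kappa> * (3 * (\<Sum>K\<in>\<T>. ?S K))))"
    by (intro mult_left_mono add_mono order_refl sum_edges_energy C0) (use \<kappa> in auto)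
  finally have B: "(\<Sum>K\<in>\<T>. DK K * (\<beta> K)\<^sup>2) \<le> ?C * (12 * (jump_energy v + 102 / \<kappa> * (\<Sum>K\<in>\<T>. ?S K)))"
    by simp
  have loc: "(norm_grad 1 (interior K) v)\<^sup>2 \<le> 2 * ?S K + 2 * (DK K * (\<beta> K)\<^sup>2)" if K: "K \<in> \<T>" for K
  proof -
    obtain z \<rho> where z: "starlike (interior K) z \<rho>" using mesh_starlike[OF K] .
    interpret starlike "interior K" z \<rho> by (rule z)
    have area: "measure lebesgue (interior K) \<le> DK K / 2"
    proof -
      have "measure lebesgue (interior K) \<le> measure lebesgue K"
        by (rule measure_mono_fmeasurable[OF interior_subset]) (use Usets K_convex_compact(2)[OF K] in \<open>auto intro: lmeasurable_compact\<close>)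
      then show ?thesis using mesh_area[OF K] by simp
    qed
    have c: "(norm_L2 M (\<lambda>x. \<beta> K *\<^sub>R JJ (axis i 1)))\<^sup>2 \<le> (\<beta> K)\<^sup>2 * (DK K / 2)" for i :: 2
    proof -
      have "(norm_L2 M (\<lambda>x. \<beta> K *\<^sub>R JJ (axis i 1)))\<^sup>2 = (\<beta> K)\<^sup>2 * measure lebesgue (interior K)"
        using integral_const_M[of "(\<beta> K)\<^sup>2"] by (simp add: norm_L2_sq JJ(2) power_mult_distrib)
      also have "\<dots> \<le> (\<beta> K)\<^sup>2 * (DK K / 2)" by (rule mult_left_mono[OF area]) simp
      finally show ?thesis .
    qed
    have gi: "(norm_L2 M (?g K i))\<^sup>2 \<le> 2 * (norm_L2 M (\<lambda>x. ?g K i x - \<beta> K *\<^sub>R JJ (axis i 1)))\<^sup>2 + 2 * ((\<beta> K)\<^sup>2 * (DK K / 2))" for i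
    proof -
      have gL: "L2 M (?g K i)" using sobolev_weak_deriv(1)[OF v1[OF K], of "[i]"] by simp
      have "(norm_L2 M (?g K i))\<^sup>2 \<le> (norm_L2 M (\<lambda>x. ?g K i x - \<beta> K *\<^sub>R JJ (axis i 1)) + norm_L2 M (\<lambda>x. \<beta> K *\<^sub>R JJ (axis i 1)))\<^sup>2"
        by (rule power_mono[OF norm_L2_triangle_diff[OF gL L2_const]]) simp
      also have "\<dots> \<le> 2 * (norm_L2 M (\<lambda>x. ?g K i x - \<beta> K *\<^sub>R JJ (axis i 1)))\<^sup>2 + 2 * (norm_L2 M (\<lambda>x. \<beta> K *\<^sub>R JJ (axis i 1)))\<^sup>2"
        by (rule sq_add_le)
      finally show ?thesis using c[of i] by linarith
    qed
    have "(norm_grad 1 (interior K) v)\<^sup>2 = (\<Sum>i\<in>UNIV. (norm_L2 M (?g K i))\<^sup>2)"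
      unfolding norm_grad_1 by (simp add: sum_nonneg)
    also have "\<dots> \<le> (\<Sum>i\<in>UNIV. 2 * (norm_L2 M (\<lambda>x. ?g K i x - \<beta> K *\<^sub>R JJ (axis i 1)))\<^sup>2 + 2 * ((\<beta> K)\<^sup>2 * (DK K / 2)))"
      by (rule sum_mono) (rule gi)
    also have "\<dots> = 2 * (\<Sum>i\<in>UNIV. (norm_L2 M (\<lambda>x. ?g K i x - \<beta> K *\<^sub>R JJ (axis i 1)))\<^sup>2) + 2 * (DK K * (\<beta> K)\<^sup>2)"
      by (simp add: sum_2)
    finally show ?thesis using g[OF K] by linarith
  qed
  have "(broken_norm_grad 1 \<T> v)\<^sup>2 = (\<Sum>K\<in>\<T>. (norm_grad 1 (interior K) v)\<^sup>2)"
    by (simp add: broken_norm_grad_def sum_nonneg)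
  also have "\<dots> \<le> (\<Sum>K\<in>\<T>. 2 * ?S K + 2 * (DK K * (\<beta> K)\<^sup>2))" by (rule sum_mono) (rule loc)
  also have "\<dots> = 2 * (\<Sum>K\<in>\<T>. ?S K) + 2 * (\<Sum>K\<in>\<T>. DK K * (\<beta> K)\<^sup>2)" by (simp add: sum.distrib sum_distrib_left)
  also have "\<dots> \<le> 2 * (\<Sum>K\<in>\<T>. ?S K) + 2 * (?C * (12 * (jump_energy v + 102 / \<kappa> * (\<Sum>K\<in>\<T>. ?S K))))"
    using B by (intro add_left_mono mult_left_mono) auto
  finally show ?thesis by (simp only: mult.assoc)
qed

end

(* PART 14 *)

lemma inscribed_ball:
  assumes K: "compact K" "interior K \<noteq> {}" and c: "c < inball_diameter K"
  obtains x r where "ball x r \<subseteq> K" "c < diameter (ball x r)" 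
proof -
  have "{diameter (ball x r) | x r. ball x r \<subseteq> K} \<noteq> {}" 
    using ball_empty[of 0] by (auto intro!: exI[of _ "0::real"])
  from less_cSupD[OF this] c show thesis using that unfolding inball_diameter_def by blast
qed

lemma inball_diameter_pos:
  assumes "compact K" "interior K \<noteq> {}" shows "inball_diameter K > 0"
proof -
  obtain x r where r: "r > 0" "ball x r \<subseteq> K"
    using assms(2) by (metis ex_in_conv mem_interior)
  have "bdd_above {diameter (ball x r) | x r. ball x r \<subseteq> K}"
  proof (rule bdd_aboveI)
    fix y assume "y \<in> {diameter (ball x r) | x r. ball x r \<subseteq> K}"
    then obtain x r where y: "y = diameter (ball x r)" "ball x r \<subseteq> K" by blast
    show "y \<le> diameter K"
      unfolding y(1) by (rule diameter_subset[OF y(2) compact_imp_bounded[OF assms(1)]])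
  qed
  then have "diameter (ball x r) \<le> inball_diameter K"
    unfolding inball_diameter_def by (rule cSup_upper[rotated]) (use r in blast)
  then show ?thesis using r(1) by (simp add: diameter_ball)
qed

lemma shape_regular_area:
  assumes K: "2 simplex K" and reg: "diameter K / inball_diameter K \<le> \<gamma>"
  shows "\<gamma> > 0" "(1 / (8 * \<gamma>\<^sup>2)) * (diameter K)\<^sup>2 \<le> 2 * measure lebesgue K"
proof -
  obtain a b c where abc: "K = convex hull {a, b, c}" "tri a b c" using simplex_2_tri[OF K] .
  interpret tri a b c by (rule abc(2))
  have cK: "compact K" using compact_K abc(1) by simp
  have iK: "interior K \<noteq> {}" using centroid_interior abc(1) by blast
  have h: "diameter K > 0" using D_le(3) abc(1) by simp
  note p = inball_diameter_pos[OF cK iK]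
  have "0 < diameter K / inball_diameter K" using h p by simp
  then show \<gamma>: "\<gamma> > 0" using reg by linarith
  have "diameter K \<le> \<gamma> * inball_diameter K" using reg p by (simp add: field_simps)
  then have "diameter K / (2 * \<gamma>) < inball_diameter K" using \<gamma> h p by (simp add: field_simps)
  then obtain x r where r: "ball x r \<subseteq> K" "diameter K / (2 * \<gamma>) < diameter (ball x r)"
    using inscribed_ball[OF cK iK] by blast
  have hp: "diameter K / (2 * \<gamma>) > 0" using \<gamma> h by simp
  then have r2: "diameter K / (2 * \<gamma>) < 2 * r" "r > 0" using r(2) by (auto simp: diameter_ball split: if_splits)
  have "(diameter K / (2 * \<gamma>))\<^sup>2 \<le> (2 * r)\<^sup>2" by (rule power_mono) (use r2 hp in auto)
  then have 1: "(1 / (8 * \<gamma>\<^sup>2)) * (diameter K)\<^sup>2 \<le> 2 * r\<^sup>2" by (simp add: power_divide power_mult_distrib)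
  have "r\<^sup>2 * 1 \<le> r\<^sup>2 * pi" by (rule mult_left_mono) (use pi_gt3 in auto)
  also have "r\<^sup>2 * pi = measure lebesgue (ball x r)"
    using circle_area[of r x] r2(2) by simp
  also have "\<dots> \<le> measure lebesgue K"
    by (rule measure_mono_fmeasurable[OF r(1)]) (use cK in \<open>auto intro: lmeasurable_compact\<close>)
  finally show "(1 / (8 * \<gamma>\<^sup>2)) * (diameter K)\<^sup>2 \<le> 2 * measure lebesgue K" using 1 by linarith
qed

lemma shape_regular_mesh:
  assumes T: "triangulation_of \<Omega> \<T>" and reg: "shape_regular \<gamma> \<T>" and ne: "\<Omega> \<noteq> {}"
  shows "shape_mesh \<T> (1 / (8 * \<gamma>\<^sup>2))"
proof -
  interpret mesh \<T> by unfold_locales (use T in \<open>auto simp: triangulation_of_def\<close>)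
  have "\<Union>\<T> \<noteq> {}" using T ne by (simp add: triangulation_of_def)
  then obtain K0 where K0: "K0 \<in> \<T>" by blast
  have r: "diameter K / inball_diameter K \<le> \<gamma>" if "K \<in> \<T>" for K using reg that by (simp add: shape_regular_def)
  show ?thesis
  proof unfold_locales
    show "0 < 1 / (8 * \<gamma>\<^sup>2)" using shape_regular_area(1)[OF s2[OF K0] r[OF K0]] by simp
    show "1 / (8 * \<gamma>\<^sup>2) * (diameter K)\<^sup>2 \<le> DK K" if "K \<in> \<T>" for K
      using shape_regular_area(2)[OF s2[OF that] r[OF that]] mesh_area[OF that] by simp
  qed
qed

context mesh
begin

lemma broken_deriv_interior:
  assumes K: "K \<in> \<T>" and x: "x \<in> interior K"
  shows "broken_deriv \<T> \<alpha> v x = weak_deriv (interior K) \<alpha> v x"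
proof -
  have "broken_deriv \<T> \<alpha> v x = (\<Sum>K'\<in>\<T>. if K' = K then weak_deriv (interior K) \<alpha> v x else 0)"
    unfolding broken_deriv_def
  proof (rule sum.cong[OF refl])
    fix K' assume K': "K' \<in> \<T>"
    have "x \<notin> interior K'" if "K' \<noteq> K"
      using interior_disjoint[OF K K'] that x interior_subset by blast
    then show "indicator (interior K') x *\<^sub>R weak_deriv (interior K') \<alpha> v x = (if K' = K then weak_deriv (interior K) \<alpha> v x else 0)"
      using x by auto
  qed
  then show ?thesis using K fin by simp
qed

lemma eps_h_interior: "K \<in> \<T> \<Longrightarrow> x \<in> interior K \<Longrightarrow> eps_h \<T> v x = sym_grad (interior K) v x"
  by (simp add: eps_h_def sym_grad_def broken_deriv_interior)

lemma eps_h_outside: "(\<And>K. K \<in> \<T> \<Longrightarrow> x \<notin> interior K) \<Longrightarrow> eps_h \<T> v x = 0"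
  by (simp add: eps_h_def broken_deriv_def vec_eq_iff)

lemma norm_grad_eps_h:
  assumes K: "K \<in> \<T>"
  shows "norm_grad 1 (interior K) (eps_h \<T> v) = norm_grad 1 (interior K) (sym_grad (interior K) v)"
proof -
  obtain z \<rho> where z: "starlike (interior K) z \<rho>" using mesh_starlike[OF K] .
  interpret starlike "interior K" z \<rho> by (rule z)
  have "is_weak_deriv (interior K) \<alpha> (eps_h \<T> v) g = is_weak_deriv (interior K) \<alpha> (sym_grad (interior K) v) g" for \<alpha> g
    by (rule is_weak_deriv_cong) (simp_all add: eps_h_interior[OF K])
  then have "weak_deriv (interior K) \<alpha> (eps_h \<T> v) = weak_deriv (interior K) \<alpha> (sym_grad (interior K) v)" for \<alpha>
    by (simp add: weak_deriv_def)
  then show ?thesis by (simp add: norm_grad_def)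
qed

lemma norm_eps_h:
  assumes v: "\<And>K. K \<in> \<T> \<Longrightarrow> v \<in> sobolev 1 (interior K)"
    and \<Omega>: "open \<Omega>" "\<And>K. K \<in> \<T> \<Longrightarrow> interior K \<subseteq> \<Omega>"
  shows "(norm_L2 (lebesgue_on \<Omega>) (eps_h \<T> v))\<^sup>2
    = (\<Sum>K\<in>\<T>. (norm_L2 (lebesgue_on (interior K)) (sym_grad (interior K) v))\<^sup>2)"
proof -
  let ?s = "\<lambda>K. sym_grad (interior K) v"
  let ?F = "\<lambda>K x. indicator (interior K) x *\<^sub>R (norm (?s K x))\<^sup>2"
  have L: "interior K \<inter> space lebesgue \<in> sets lebesgue" "\<Omega> \<inter> space lebesgue \<in> sets lebesgue" for K :: "plane set"
    using \<Omega>(1) by (auto intro: sets_completionI_sets)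
  have int: "integrable lebesgue (?F K)" if K: "K \<in> \<T>" for K
  proof -
    obtain z \<rho> where z: "starlike (interior K) z \<rho>" using mesh_starlike[OF K] .
    interpret starlike "interior K" z \<rho> by (rule z)
    show ?thesis using L2D(2)[OF sym_grad_L2[OF v[OF K]]] by (subst (asm) integrable_restrict_space[OF L(1)])
  qed
  have pt: "indicator \<Omega> x *\<^sub>R (norm (eps_h \<T> v x))\<^sup>2 = (\<Sum>K\<in>\<T>. ?F K x)" for x
  proof (cases "\<exists>K\<in>\<T>. x \<in> interior K")
    case True
    then obtain K where K: "K \<in> \<T>" "x \<in> interior K" by blast
    have "(\<Sum>K\<in>\<T>. ?F K x) = (\<Sum>K'\<in>\<T>. if K' = K then (norm (?s K x))\<^sup>2 else 0)"
    proof (rule sum.cong[OF refl])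
      fix K' assume K': "K' \<in> \<T>"
      have "x \<notin> interior K'" if "K' \<noteq> K"
        using interior_disjoint[OF K(1) K'] that K(2) interior_subset by blast
      then show "?F K' x = (if K' = K then (norm (?s K x))\<^sup>2 else 0)" using K(2) by auto
    qed
    also have "\<dots> = (norm (?s K x))\<^sup>2" using K(1) fin by simp
    finally show ?thesis using eps_h_interior[OF K] \<Omega>(2)[OF K(1)] K(2) by auto
  next
    case False
    then have "(\<Sum>K\<in>\<T>. ?F K x) = 0" by (intro sum.neutral) auto
    then show ?thesis using False eps_h_outside[of x v] by auto
  qed
  have "(norm_L2 (lebesgue_on \<Omega>) (eps_h \<T> v))\<^sup>2 = (\<integral>x. indicator \<Omega> x *\<^sub>R (norm (eps_h \<T> v x))\<^sup>2 \<partial>lebesgue)"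
    unfolding norm_L2_sq by (rule integral_restrict_space[OF L(2)])
  also have "\<dots> = (\<integral>x. (\<Sum>K\<in>\<T>. ?F K x) \<partial>lebesgue)" by (simp only: pt)
  also have "\<dots> = (\<Sum>K\<in>\<T>. \<integral>x. ?F K x \<partial>lebesgue)" by (rule Bochner_Integration.integral_sum) (rule int)
  also have "\<dots> = (\<Sum>K\<in>\<T>. (norm_L2 (lebesgue_on (interior K)) (?s K))\<^sup>2)"
    unfolding norm_L2_sq by (intro sum.cong refl integral_restrict_space[OF L(1), symmetric])
  finally show ?thesis .
qed

end

theorem theorem3p1:
  fixes \<Omega> :: "(real^2) set" and \<gamma> :: real
  assumes "polygonal_domain \<Omega>"
  shows "\<exists>C>0. \<forall>\<T>. triangulation_of \<Omega> \<T> \<and> shape_regular \<gamma> \<T> \<longrightarrow>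
           (\<forall>v :: real^2 \<Rightarrow> real^2. v \<in> broken_sobolev 2 \<Omega> \<T> \<longrightarrow>
              (broken_norm 2 \<Omega> \<T> v)\<^sup>2 \<le>
                C * ((broken_norm_grad 1 \<T> (eps_h \<T> v))\<^sup>2
                     + (norm_L2 (lebesgue_on \<Omega>) (eps_h \<T> v))\<^sup>2
                     + (norm_L2 (lebesgue_on \<Omega>) v)\<^sup>2
                     + (\<Sum>e\<in>edges \<T>. inverse (diameter e)
                          * (norm_L2 (edge_measure e) (jump_proj \<T> e v))\<^sup>2)))"
proof -
  have \<Omega>: "open \<Omega>" "\<Omega> \<noteq> {}" "bounded \<Omega>" "interior (closure \<Omega>) = \<Omega>"
    using assms unfolding polygonal_domain_def by auto
  define \<kappa> where "\<kappa> = 1 / (8 * \<gamma>\<^sup>2)"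
  define d where "d = diameter (closure \<Omega>)"
  define Ck where "Ck = 2 * (8 / \<kappa> + 4) * (((8 / \<kappa>)\<^sup>2 + 1)\<^sup>2 * (2 * (8 / \<kappa>)))"
  define c1 where "c1 = 2 + 2 * Ck * (12 * (102 / \<kappa>))"
  define c2 where "c2 = 2 + 9216 * d\<^sup>2"
  define C where "C = 3 + 3 * (c1 * c2) + 72 * Ck + 216"
  have \<kappa>0: "\<kappa> \<ge> 0" by (simp add: \<kappa>_def)
  have Ck0: "Ck \<ge> 0" unfolding Ck_def using \<kappa>0 by simp
  have c1: "c1 \<ge> 0" unfolding c1_def using \<kappa>0 Ck0 by simp
  have c2: "c2 \<ge> 0" unfolding c2_def by simp
  have C: "C > 0" using mult_nonneg_nonneg[OF c1 c2] Ck0 unfolding C_def by linarith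
  show ?thesis
  proof (intro exI[of _ C] conjI allI impI)
    show "C > 0" by (rule C)
  next
    fix \<T> and v :: "real^2 \<Rightarrow> real^2"
    assume T': "triangulation_of \<Omega> \<T> \<and> shape_regular \<gamma> \<T>" and v: "v \<in> broken_sobolev 2 \<Omega> \<T>"
    note T = conjunct1[OF T'] and reg = conjunct2[OF T']
    interpret shape_mesh \<T> \<kappa> unfolding \<kappa>_def by (rule shape_regular_mesh[OF T reg \<Omega>(2)])
    have U: "\<Union>\<T> = closure \<Omega>" using T by (simp add: triangulation_of_def)
    have v2: "v \<in> sobolev 2 (interior K)" if "K \<in> \<T>" for K using v that by (simp add: broken_sobolev_def)
    have v1: "v \<in> sobolev 1 (interior K)" if "K \<in> \<T>" for K using v2[OF that] unfolding sobolev_def by auto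
    have iK: "interior K \<subseteq> \<Omega>" if "K \<in> \<T>" for K
      using interior_mono[of K "closure \<Omega>"] U that \<Omega>(4) by auto
    have dK: "(diameter K)\<^sup>2 \<le> d\<^sup>2" if "K \<in> \<T>" for K
      unfolding d_def by (intro power_mono diameter_subset) (use U that \<Omega>(3) diam_pos[OF that] in \<open>auto simp: less_imp_le\<close>)
    define V E G J N where "V = (norm_L2 (lebesgue_on \<Omega>) v)\<^sup>2" and "E = (norm_L2 (lebesgue_on \<Omega>) (eps_h \<T> v))\<^sup>2"
      and "G = (broken_norm_grad 1 \<T> (eps_h \<T> v))\<^sup>2" and "J = jump_energy v" and "N = (broken_norm_grad 2 \<T> v)\<^sup>2"
    let ?S = "\<Sum>K\<in>\<T>. local_energy v K"
    have J0: "J \<ge> 0"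
    proof -
      have "inverse (diameter e) \<ge> 0" if ee: "e \<in> edges \<T>" for e
      proof -
        obtain K where "K \<in> \<T>" "e edge_of K" using ee unfolding edges_def by blast
        then obtain p q where "e = closed_segment p q" using edge_dedge by blast
        then show ?thesis by (simp add: diameter_closed_segment_plane)
      qed
      then show ?thesis unfolding J_def jump_energy_def by (intro sum_nonneg mult_nonneg_nonneg) auto
    qed
    have pos: "V \<ge> 0" "E \<ge> 0" "G \<ge> 0" by (simp_all add: V_def E_def G_def)
    have Nsum: "N = (\<Sum>K\<in>\<T>. (norm_grad 2 (interior K) v)\<^sup>2)"
      by (simp add: N_def broken_norm_grad_def sum_nonneg)
    have NG: "N \<le> 72 * G"
    proof -
      have "N \<le> (\<Sum>K\<in>\<T>. 72 * (norm_grad 1 (interior K) (eps_h \<T> v))\<^sup>2)"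
        unfolding Nsum
      proof (rule sum_mono)
        fix K assume K: "K \<in> \<T>"
        obtain z \<rho> where z: "starlike (interior K) z \<rho>" using mesh_starlike[OF K] .
        show "(norm_grad 2 (interior K) v)\<^sup>2 \<le> 72 * (norm_grad 1 (interior K) (eps_h \<T> v))\<^sup>2"
          unfolding norm_grad_eps_h[OF K] by (rule starlike.second_derivatives_bound[OF z v2[OF K]])
      qed
      also have "\<dots> = 72 * G" by (simp add: G_def broken_norm_grad_def sum_nonneg sum_distrib_left)
      finally show ?thesis .
    qed
    have "?S \<le> (\<Sum>K\<in>\<T>. 2 * (norm_L2 (lebesgue_on (interior K)) (sym_grad (interior K) v))\<^sup>2 + 128 * d\<^sup>2 * (norm_grad 2 (interior K) v)\<^sup>2)"
      unfolding local_energy_def by (intro sum_mono add_left_mono mult_right_mono mult_left_mono dK) auto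
    also have "\<dots> = 2 * E + 128 * d\<^sup>2 * N"
      using norm_eps_h[OF v1 \<Omega>(1) iK] by (simp add: E_def Nsum sum.distrib sum_distrib_left)
    also have "\<dots> \<le> 2 * E + 128 * d\<^sup>2 * (72 * G)" by (intro add_left_mono mult_left_mono NG) simp
    also have "\<dots> \<le> c2 * (E + G)" using pos by (simp add: c2_def algebra_simps)
    finally have S: "?S \<le> c2 * (E + G)" .
    have "(broken_norm_grad 1 \<T> v)\<^sup>2 \<le> 2 * ?S + 2 * Ck * (12 * (J + 102 / \<kappa> * ?S))"
      using broken_gradient_bound[OF v2] unfolding Ck_def J_def .
    also have "\<dots> = c1 * ?S + 24 * Ck * J" by (simp add: c1_def algebra_simps)
    also have "\<dots> \<le> c1 * (c2 * (E + G)) + 24 * Ck * J" by (intro add_right_mono mult_left_mono S c1)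
    finally have B1: "(broken_norm_grad 1 \<T> v)\<^sup>2 \<le> c1 * c2 * (E + G) + 24 * Ck * J" by (simp only: mult.assoc)
    have "broken_norm 2 \<Omega> \<T> v = norm_L2 (lebesgue_on \<Omega>) v + broken_norm_grad 1 \<T> v + broken_norm_grad 2 \<T> v"
      by (simp add: broken_norm_def numeral_2_eq_2)
    then have "(broken_norm 2 \<Omega> \<T> v)\<^sup>2 \<le> 3 * (V + (broken_norm_grad 1 \<T> v)\<^sup>2 + N)"
      using sum_three_sq unfolding V_def N_def by metis
    also have "\<dots> \<le> 3 * (V + (c1 * c2 * (E + G) + 24 * Ck * J) + 72 * G)"
      by (intro mult_left_mono add_mono order_refl B1 NG) simp
    also have "\<dots> = 3 * V + 3 * (c1 * c2) * (E + G) + 72 * Ck * J + 216 * G" by (simp add: algebra_simps)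
    also have "\<dots> \<le> C * (G + E + V + J)"
    proof -
      have "C * (G + E + V + J) - (3 * V + 3 * (c1 * c2) * (E + G) + 72 * Ck * J + 216 * G)
        = (3 * (c1 * c2) + 72 * Ck + 216) * V + (3 + 72 * Ck + 216) * E + (3 + 72 * Ck) * G + (3 + 3 * (c1 * c2) + 216) * J"
        by (simp add: C_def algebra_simps)
      also have "\<dots> \<ge> 0"
        by (intro add_nonneg_nonneg mult_nonneg_nonneg pos J0) (use c1 c2 Ck0 in auto)
      finally show ?thesis by simp
    qed
    finally show "(broken_norm 2 \<Omega> \<T> v)\<^sup>2 \<le> C * ((broken_norm_grad 1 \<T> (eps_h \<T> v))\<^sup>2
         + (norm_L2 (lebesgue_on \<Omega>) (eps_h \<T> v))\<^sup>2 + (norm_L2 (lebesgue_on \<Omega>) v)\<^sup>2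
         + (\<Sum>e\<in>edges \<T>. inverse (diameter e) * (norm_L2 (edge_measure e) (jump_proj \<T> e v))\<^sup>2))"
      unfolding G_def E_def V_def J_def jump_energy_def .
  qed
qed

end
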